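(* Let $S$ be a compact Hausdorff space, let $X$ be a lattice normed space over a Dedekind complete vector lattice $E$, let $\tilde X$ be the norm completion of $X$, and let $W$ be a nonempty subset of $C_{uo}(S,X)$. If the set $\mu(W)$ of all multipliers of $W$ separates the points of $\Sigma$, then for every $f\in C_{uo}(S,X)$ the following are equivalent: (1) $W$ approximates $f$ in $C_{uo}(S,X)$, i.e. $\inf\{\|f-g\|: g\in W\}=0$ in $E$; (2) for every $\sigma\in\Sigma$ the set $W(\sigma):=\{g(\sigma)\in\tilde X: g\in W\}$ approximates $f(\sigma)$ in $\tilde X$, i.e. $\inf\{\|f(\sigma)-x\|_{\tilde X}: x\in W(\sigma)\}=0$ in $E$.
   Context: **Lattices.** Vector lattices are real and Archimedean. $E$ is a Dedekind complete vector lattice, $\mathbb B=\mathbb P(E)$ is the complete Boolean algebra of its band projections, $\Lambda=\mathrm{Orth}(E)$ is the Dedekind complete $f$-algebra (under composition) of orthomorphisms of $E$, with unit $I=I_E$. Elements of $\mathbb B$ act on $\Lambda$ by multiplication. A partition of unity in $\mathbb B$ is a family of pairwise disjoint elements with supremum $I$. **Lattice normed spaces.** A lattice normed space (LNS) over $E$ is a real or complex vector space $X$ with a map $\|\cdot\|:X\to E_+$ (an $E$-valued norm) such that $\|x\|=0$ implies $x=0$, $\|\lambda x\|=|\lambda|\|x\|$ for scalars $\lambda$, and $\|x+y\|\le\|x\|+\|y\|$. It is always assumed that $\{\|x\|:x\in X\}^{\perp\perp}=E$. A net $(x_\alpha)$ norm $o$-converges to $x$ if $\|x-x_\alpha\|$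 order converges to $0$ in $E$; $X$ is norm $o$-complete if every net $(x_\alpha)$ for which $(x_\alpha-x_\beta)_{(\alpha,\beta)}$ norm $o$-converges to $0$ is norm $o$-convergent in $X$. $X$ is decomposable if $\|x\|=e_1+e_2$ with $e_1,e_2\in E_+$ implies $x=x_1+x_2$ with $\|x_k\|=e_k$ for some $x_1,x_2\in X$. A Banach–Kantorovich space over $E$ is a decomposable norm $o$-complete LNS. The norm completion $\tilde X$ of an LNS $X$ over $E$ is a Banach–Kantorovich space over $E$ containing $X$ isometrically and such that every decomposable norm complete subspace of $\tilde X$ including $X$ equals $\tilde X$; it is unique up to linear isometry. Each $\pi\in\mathbb B$ acts on $\tilde X$ as a linear projection with $\|\pi x+\pi^\perp y\|=\pi\|x\|+\pi^\perp\|y\|$, and this action extends to a faithful $\Lambda$-module structure on $\tilde X$ with $\|\lambda x\|=|\lambda|\,\|x\|$. **The space $C_{uo}$.** $S$ carries its unique compatible uniformity $\mathcal U$. For an LNS $X$, $C_{uo}(S,X)$ is the vector space of uniformly order continuous $f:S\to X$, i.e. norm bounded $f$ (there is $e\in E$ with $\|f(s)\|\le e$ for all $s$) with $\inf_{U\in\mathcal U}\sup\{\|f(s)-f(t)\|:(s,t)\in U\}=0$. It has the $E$-valued norm $\|f\|=\sup_{s\in S}\|f(s)\|$. $C_{uo}(S,\Lambda)$ is defined in the same way, with $\Lambda$ viewed as an LNS over itself with norm $|\cdot|$; it has pointwise multiplication and order. For $\varphi\in C_{uo}(S,\Lambda)$ and $f\in C_{uo}(S,X)$, $(\varphi f)(s)=\varphi(s)f(s)$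 (computed in $\tilde X$). **The set $\Sigma$.** Let $\varepsilon^c:C_{uo}(S,\Lambda)\to\Lambda$, $\varepsilon^c(\varphi)=\sup_{s\in S}\varphi(s)$, and let $\partial\varepsilon^c$ be the convex set of linear operators $T:C_{uo}(S,\Lambda)\to\Lambda$ with $T\varphi\le\varepsilon^c(\varphi)$ for all $\varphi$. $\Sigma$ is the set of extreme points of $\partial\varepsilon^c$; equivalently, the set of all lattice homomorphisms $\sigma:C_{uo}(S,\Lambda)\to\Lambda$ with $\sigma(\bar\lambda)=\lambda$ for every $\lambda\in\Lambda$, where $\bar\lambda$ is the constant function $s\mapsto\lambda$. A pure state is an operator $\sum_{s\in S}\pi_s\delta_s:\varphi\mapsto o\text{-}\sum_s\pi_s\varphi(s)$ with $(\pi_s)_{s\in S}$ a partition of unity in $\mathbb B$. Every $\sigma\in\Sigma$ is a pointwise $r$-limit (relatively uniform limit) of a net of pure states. **Values $f(\sigma)$.** Each $f\in C_{uo}(S,X)$ extends canonically to a map $\Sigma\to\tilde X$, $\sigma\mapsto f(\sigma)$: for a pure state $\sigma=\sum_s\pi_s\delta_s$, $f(\sigma)=\sum_s\pi_sf(s)$, i.e. the unique element of $\tilde X$ with $\pi_sf(\sigma)=\pi_sf(s)$ for all $s$; for general $\sigma$, $f(\sigma)=\lim_\alpha f(\sigma_\alpha)$ (norm $o$-limit in $\tilde X$) for any net $(\sigma_\alpha)$ of pure states that $r$-converges pointwise to $\sigma$. **Multipliers and separation.** A multiplier of $W\subset C_{uo}(S,X)$ is a $\varphi\in C_{uo}(S,\Lambda)$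 with $0\le\varphi(s)\le I$ for all $s\in S$ and $\varphi f+(I-\varphi)g\in W$ for all $f,g\in W$; $\mu(W)$ is the set of all multipliers. A set $\mathcal F\subset C_{uo}(S,\Lambda)$ separates the points of $\Sigma$ if for all $\sigma,\tau\in\Sigma$ and $b\in\mathbb B$: whenever $b\sigma(\varphi)=b\tau(\varphi)$ for all $\varphi\in\mathcal F$, then $b\sigma=b\tau$. *)

theory Defs
  imports "HOL-Analysis.Analysis" "HOL-Library.Lattice_Algebras"
begin

section \<open>Dedekind complete vector lattices\<close>

class dedekind_complete_vector_lattice =
  ordered_real_vector + conditionally_complete_lattice + lattice_ab_group_add_abs

instance real :: dedekind_complete_vector_lattice ..

definition vl_disjoint :: "'e::dedekind_complete_vector_lattice \<Rightarrow> 'e \<Rightarrow> bool"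
  where "vl_disjoint x y \<longleftrightarrow> inf \<bar>x\<bar> \<bar>y\<bar> = 0"

definition disjoint_complement :: "'e::dedekind_complete_vector_lattice set \<Rightarrow> 'e set"
  where "disjoint_complement A = {x. \<forall>a\<in>A. vl_disjoint x a}"

section \<open>Orthomorphisms\<close>

definition order_bounded_map :: "('e::dedekind_complete_vector_lattice \<Rightarrow> 'e) \<Rightarrow> bool"
  where "order_bounded_map T \<longleftrightarrow> (\<forall>a b. \<exists>c d. T ` {a..b} \<subseteq> {c..d})"

definition band_preserving :: "('e::dedekind_complete_vector_lattice \<Rightarrow> 'e) \<Rightarrow> bool"
  where "band_preserving T \<longleftrightarrow> (\<forall>x y. vl_disjoint x y \<longrightarrow> vl_disjoint (T x) y)"

definition orthomorphism :: "('e::dedekind_complete_vector_lattice \<Rightarrow> 'e) \<Rightarrow> bool"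
  where "orthomorphism T \<longleftrightarrow> linear T \<and> order_bounded_map T \<and> band_preserving T"

lemma orthomorphism_linear: "orthomorphism T \<Longrightarrow> linear T"
  by (simp add: orthomorphism_def)

lemma vl_disjoint_dominated:
  assumes "vl_disjoint x z" "\<bar>y\<bar> \<le> \<bar>x\<bar>" shows "vl_disjoint y z"
proof -
  have "inf \<bar>y\<bar> \<bar>z\<bar> \<le> 0"
    using inf_mono[OF assms(2) order_refl[of "\<bar>z\<bar>"]] assms(1) by (simp only: vl_disjoint_def)
  moreover have "0 \<le> inf \<bar>y\<bar> \<bar>z\<bar>" by simp
  ultimately show ?thesis unfolding vl_disjoint_def by (rule antisym)
qed

lemma inf_add_le:
  fixes a b c :: "'e::lattice_ab_group_add"
  assumes "0 \<le> a" "0 \<le> b" "0 \<le> c"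
  shows "inf (a + b) c \<le> inf a c + inf b c"
proof -
  have 1: "inf (a + b) c \<le> a + b" by simp
  have 2: "inf (a + b) c \<le> c" by simp
  have a: "inf (a + b) c \<le> a + c" using 2 assms(1) by (simp add: add_increasing)
  have b: "inf (a + b) c \<le> c + b" using 2 assms(2) by (simp add: add_increasing2)
  have c: "inf (a + b) c \<le> c + c" using 2 assms(3) by (simp add: add_increasing)
  have "inf a c + inf b c = inf (inf (a + b) (a + c)) (inf (c + b) (c + c))"
    by (simp add: add_inf_distrib_left add_inf_distrib_right inf_aci)
  then show ?thesis using 1 a b c by simp
qed

lemma vl_disjoint_add:
  assumes "vl_disjoint x z" "vl_disjoint y z" shows "vl_disjoint (x + y) z"
proof -
  have "inf \<bar>x + y\<bar> \<bar>z\<bar> \<le> inf (\<bar>x\<bar> + \<bar>y\<bar>) \<bar>z\<bar>"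
    by (simp add: le_infI1 abs_triangle_ineq)
  also have "\<dots> \<le> inf \<bar>x\<bar> \<bar>z\<bar> + inf \<bar>y\<bar> \<bar>z\<bar>" by (rule inf_add_le) simp_all
  finally have "inf \<bar>x + y\<bar> \<bar>z\<bar> \<le> 0" using assms by (simp add: vl_disjoint_def)
  moreover have "0 \<le> inf \<bar>x + y\<bar> \<bar>z\<bar>" by simp
  ultimately show ?thesis by (simp add: vl_disjoint_def)
qed

lemma vl_disjoint_minus: "vl_disjoint (- x) z \<longleftrightarrow> vl_disjoint x z"
  by (simp add: vl_disjoint_def)

lemma vl_disjoint_diff: "vl_disjoint x z \<Longrightarrow> vl_disjoint y z \<Longrightarrow> vl_disjoint (x - y) z"
  using vl_disjoint_add[of x z "- y"] by (simp add: vl_disjoint_minus)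

lemma vl_disjoint_zero: "vl_disjoint 0 z"
  by (simp add: vl_disjoint_def inf_absorb1)

lemma vl_scaleR_inf:
  fixes x y :: "'e::dedekind_complete_vector_lattice"
  assumes "0 < c" shows "c *\<^sub>R inf x y = inf (c *\<^sub>R x) (c *\<^sub>R y)"
proof (rule antisym)
  show "c *\<^sub>R inf x y \<le> inf (c *\<^sub>R x) (c *\<^sub>R y)"
    using assms by (simp add: scaleR_left_mono)
  have i: "0 \<le> inverse c" using assms by simp
  have "inverse c *\<^sub>R inf (c *\<^sub>R x) (c *\<^sub>R y) \<le> inverse c *\<^sub>R (c *\<^sub>R x)"
    by (rule scaleR_left_mono[OF _ i]) simp
  moreover have "inverse c *\<^sub>R inf (c *\<^sub>R x) (c *\<^sub>R y) \<le> inverse c *\<^sub>R (c *\<^sub>R y)"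
    by (rule scaleR_left_mono[OF _ i]) simp
  ultimately have "inverse c *\<^sub>R inf (c *\<^sub>R x) (c *\<^sub>R y) \<le> inf x y"
    using assms by simp
  then have "c *\<^sub>R (inverse c *\<^sub>R inf (c *\<^sub>R x) (c *\<^sub>R y)) \<le> c *\<^sub>R inf x y"
    using assms by (simp only: scaleR_left_mono less_imp_le)
  then show "inf (c *\<^sub>R x) (c *\<^sub>R y) \<le> c *\<^sub>R inf x y" using assms by simp
qed

lemma vl_nprt_scaleR:
  fixes x :: "'e::dedekind_complete_vector_lattice"
  assumes "0 \<le> c" shows "nprt (c *\<^sub>R x) = c *\<^sub>R nprt x"
  using assms vl_scaleR_inf[of c x 0] by (cases "c = 0") (auto simp: nprt_def)

lemma vl_pprt_scaleR:
  fixes x :: "'e::dedekind_complete_vector_lattice"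
  assumes "0 \<le> c" shows "pprt (c *\<^sub>R x) = c *\<^sub>R pprt x"
  using vl_nprt_scaleR[OF assms, of "- x"] by (simp add: nprt_neg)

lemma vl_abs_scaleR:
  fixes x :: "'e::dedekind_complete_vector_lattice"
  shows "\<bar>c *\<^sub>R x\<bar> = \<bar>c\<bar> *\<^sub>R \<bar>x\<bar>"
proof -
  have *: "\<bar>c *\<^sub>R x\<bar> = c *\<^sub>R \<bar>x\<bar>" if "0 \<le> c" for c
    using that by (simp add: abs_prts vl_pprt_scaleR vl_nprt_scaleR scaleR_diff_right)
  show ?thesis
  proof (cases "0 \<le> c")
    case True then show ?thesis using * by simp
  next
    case False
    then have "\<bar>(- c) *\<^sub>R x\<bar> = (- c) *\<^sub>R \<bar>x\<bar>" using *[of "- c"] by simp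
    then show ?thesis using False by simp
  qed
qed

lemma vl_disjoint_scaleR:
  assumes "vl_disjoint x z" shows "vl_disjoint (c *\<^sub>R x) z"
proof -
  obtain n :: nat where n: "\<bar>c\<bar> \<le> real n" using real_arch_simple by blast
  have m: "vl_disjoint (real n *\<^sub>R x) z" for n :: nat
    by (induction n) (simp_all add: vl_disjoint_zero scaleR_add_left vl_disjoint_add assms)
  show ?thesis
    by (rule vl_disjoint_dominated[OF m[of n]]) (simp add: vl_abs_scaleR scaleR_right_mono n)
qed

lemma order_bounded_map_iff:
  "order_bounded_map T \<longleftrightarrow> (\<forall>a b. \<exists>c d. \<forall>x. a \<le> x \<and> x \<le> b \<longrightarrow> c \<le> T x \<and> T x \<le> d)"
  unfolding order_bounded_map_def image_subset_iff Ball_def atLeastAtMost_iff by (rule refl)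

lemma order_bounded_mapD:
  assumes "order_bounded_map T"
  shows "\<exists>c d. (\<forall>x. a \<le> x \<longrightarrow> x \<le> b \<longrightarrow> c \<le> T x) \<and> (\<forall>x. a \<le> x \<longrightarrow> x \<le> b \<longrightarrow> T x \<le> d)"
  using assms unfolding order_bounded_map_iff by blast

lemma order_bounded_mapI:
  assumes "\<And>a b. \<exists>c d. \<forall>x. a \<le> x \<and> x \<le> b \<longrightarrow> c \<le> T x \<and> T x \<le> d"
  shows "order_bounded_map T"
  using assms unfolding order_bounded_map_iff by blast

lemma order_bounded_map_dominated:
  assumes T: "order_bounded_map T" and P: "linear P" and le: "\<And>x. 0 \<le> x \<Longrightarrow> T x \<le> P x"
  shows "order_bounded_map P"
proof (rule order_bounded_mapI)
  fix a b
  obtain c d where c: "\<And>x. 0 \<le> x \<Longrightarrow> x \<le> b - a \<Longrightarrow> c \<le> T x"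
    and "\<And>x. 0 \<le> x \<Longrightarrow> x \<le> b - a \<Longrightarrow> T x \<le> d"
    using order_bounded_mapD[OF T, of "0" "b - a"] by blast
  have c': "c \<le> P x" if "0 \<le> x" "x \<le> b - a" for x
    using c[OF that] le[OF that(1)] by (rule order_trans)
  have "P a + c \<le> P x \<and> P x \<le> P b - c" if "a \<le> x \<and> x \<le> b" for x
    using c'[of "x - a"] c'[of "b - x"] that P by (simp add: linear_diff algebra_simps)
  then show "\<exists>c d. \<forall>x. a \<le> x \<and> x \<le> b \<longrightarrow> c \<le> P x \<and> P x \<le> d" by blast
qed

lemma orthomorphismI:
  assumes "linear T" "\<And>a b. \<exists>c d. \<forall>x. a \<le> x \<and> x \<le> b \<longrightarrow> c \<le> T x \<and> T x \<le> d"
    "\<And>x y. vl_disjoint x y \<Longrightarrow> vl_disjoint (T x) y"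
  shows "orthomorphism T"
  using assms order_bounded_mapI[OF assms(2)] by (simp add: orthomorphism_def band_preserving_def)

lemma orthomorphism_order_bounded: "orthomorphism T \<Longrightarrow> order_bounded_map T"
  by (simp add: orthomorphism_def)

lemma orthomorphism_disjoint: "orthomorphism T \<Longrightarrow> vl_disjoint x y \<Longrightarrow> vl_disjoint (T x) y"
  by (simp add: orthomorphism_def band_preserving_def)

lemma orthomorphism_zero: "orthomorphism (\<lambda>x. 0)"
  by (rule orthomorphismI) (auto simp: linear_zero vl_disjoint_zero)

lemma orthomorphism_id: "orthomorphism (\<lambda>x. x)"
  using linear_id by (intro orthomorphismI) (auto simp: id_def)

lemma orthomorphism_add:
  assumes S: "orthomorphism S" and T: "orthomorphism T"
  shows "orthomorphism (\<lambda>x. S x + T x)"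
proof (rule orthomorphismI)
  fix a b
  obtain c d where 1: "\<And>x. a \<le> x \<Longrightarrow> x \<le> b \<Longrightarrow> c \<le> S x" "\<And>x. a \<le> x \<Longrightarrow> x \<le> b \<Longrightarrow> S x \<le> d"
    using order_bounded_mapD[OF orthomorphism_order_bounded[OF S], of "a" "b"] by blast
  obtain c' d' where 2: "\<And>x. a \<le> x \<Longrightarrow> x \<le> b \<Longrightarrow> c' \<le> T x" "\<And>x. a \<le> x \<Longrightarrow> x \<le> b \<Longrightarrow> T x \<le> d'"
    using order_bounded_mapD[OF orthomorphism_order_bounded[OF T], of "a" "b"] by blast
  show "\<exists>c d. \<forall>x. a \<le> x \<and> x \<le> b \<longrightarrow> c \<le> S x + T x \<and> S x + T x \<le> d"
    by (intro exI[of _ "c + c'"] exI[of _ "d + d'"] allI impI conjI add_mono) (auto intro: 1 2)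
qed (auto intro: assms linear_compose_add orthomorphism_linear vl_disjoint_add orthomorphism_disjoint)

lemma orthomorphism_uminus:
  assumes T: "orthomorphism T" shows "orthomorphism (\<lambda>x. - T x)"
proof (rule orthomorphismI)
  fix a b
  obtain c d where 1: "\<And>x. a \<le> x \<Longrightarrow> x \<le> b \<Longrightarrow> c \<le> T x" "\<And>x. a \<le> x \<Longrightarrow> x \<le> b \<Longrightarrow> T x \<le> d"
    using order_bounded_mapD[OF orthomorphism_order_bounded[OF T], of "a" "b"] by blast
  show "\<exists>c d. \<forall>x. a \<le> x \<and> x \<le> b \<longrightarrow> c \<le> - T x \<and> - T x \<le> d"
    by (intro exI[of _ "- d"] exI[of _ "- c"]) (auto intro: 1)
qed (auto intro: assms linear_compose_neg orthomorphism_linear orthomorphism_disjoint simp: vl_disjoint_minus)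

lemma orthomorphism_diff:
  "orthomorphism S \<Longrightarrow> orthomorphism T \<Longrightarrow> orthomorphism (\<lambda>x. S x - T x)"
  using orthomorphism_add[OF _ orthomorphism_uminus, of S T] by simp

lemma orthomorphism_scaleR:
  assumes T: "orthomorphism T" shows "orthomorphism (\<lambda>x. r *\<^sub>R T x)"
proof -
  have pos: "orthomorphism (\<lambda>x. r *\<^sub>R T x)" if "0 \<le> r" for r
  proof (rule orthomorphismI)
    fix a b
    obtain c d where 1: "\<And>x. a \<le> x \<Longrightarrow> x \<le> b \<Longrightarrow> c \<le> T x" "\<And>x. a \<le> x \<Longrightarrow> x \<le> b \<Longrightarrow> T x \<le> d"
      using order_bounded_mapD[OF orthomorphism_order_bounded[OF T], of "a" "b"] by blast
    show "\<exists>c d. \<forall>x. a \<le> x \<and> x \<le> b \<longrightarrow> c \<le> r *\<^sub>R T x \<and> r *\<^sub>R T x \<le> d"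
      by (intro exI[of _ "r *\<^sub>R c"] exI[of _ "r *\<^sub>R d"]) (auto intro!: 1 scaleR_left_mono that)
  qed (auto intro: assms linear_compose_scale_right orthomorphism_linear orthomorphism_disjoint
        vl_disjoint_scaleR)
  show ?thesis
    using pos[of r] orthomorphism_uminus[OF pos[of "- r"]] by (cases "0 \<le> r") auto
qed

lemma orthomorphism_compose:
  assumes S: "orthomorphism S" and T: "orthomorphism T"
  shows "orthomorphism (\<lambda>x. S (T x))"
proof (rule orthomorphismI)
  fix a b
  obtain c d where 1: "\<And>x. a \<le> x \<Longrightarrow> x \<le> b \<Longrightarrow> c \<le> T x" "\<And>x. a \<le> x \<Longrightarrow> x \<le> b \<Longrightarrow> T x \<le> d"
    using order_bounded_mapD[OF orthomorphism_order_bounded[OF T], of "a" "b"] by blast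
  obtain c' d' where 2: "\<And>x. c \<le> x \<Longrightarrow> x \<le> d \<Longrightarrow> c' \<le> S x" "\<And>x. c \<le> x \<Longrightarrow> x \<le> d \<Longrightarrow> S x \<le> d'"
    using order_bounded_mapD[OF orthomorphism_order_bounded[OF S], of "c" "d"] by blast
  show "\<exists>c d. \<forall>x. a \<le> x \<and> x \<le> b \<longrightarrow> c \<le> S (T x) \<and> S (T x) \<le> d"
    by (intro exI[of _ c'] exI[of _ d']) (auto intro!: 1 2)
next
  show "linear (\<lambda>x. S (T x))"
    using linear_compose[OF orthomorphism_linear[OF T] orthomorphism_linear[OF S]] by (simp add: o_def)
qed (auto intro: assms orthomorphism_disjoint)

lemma linear_prts:
  fixes T :: "'e::dedekind_complete_vector_lattice \<Rightarrow> 'e"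
  assumes "linear T" shows "T x = T (pprt x) - T (- nprt x)"
proof -
  have "T x = T (pprt x + nprt x)" by (simp only: prts[symmetric])
  then show ?thesis using assms by (simp add: linear_add linear_neg)
qed

lemma linear_eq_on_cone:
  fixes S T :: "'e::dedekind_complete_vector_lattice \<Rightarrow> 'e"
  assumes "linear S" "linear T" "\<And>x. 0 \<le> x \<Longrightarrow> S x = T x"
  shows "S = T"
proof
  fix x
  show "S x = T x"
    using linear_prts[OF assms(1), of x] linear_prts[OF assms(2), of x]
      assms(3)[of "pprt x"] assms(3)[of "- nprt x"] by simp
qed

text \<open>Extension of an additive, positively homogeneous map from the positive cone.\<close>

definition cone_ext :: "('e::dedekind_complete_vector_lattice \<Rightarrow> 'e) \<Rightarrow> 'e \<Rightarrow> 'e"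
  where "cone_ext R x = R (pprt x) - R (- nprt x)"

lemma cone_ext:
  fixes R :: "'e::dedekind_complete_vector_lattice \<Rightarrow> 'e"
  assumes add: "\<And>x y. 0 \<le> x \<Longrightarrow> 0 \<le> y \<Longrightarrow> R (x + y) = R x + R y"
    and scale: "\<And>c x. 0 < c \<Longrightarrow> 0 \<le> x \<Longrightarrow> R (c *\<^sub>R x) \<le> c *\<^sub>R R x"
  shows "linear (cone_ext R)" and "0 \<le> x \<Longrightarrow> cone_ext R x = R x"
proof -
  have z: "R 0 = 0" using add[of 0 0] by simp
  have sc: "R (c *\<^sub>R x) = c *\<^sub>R R x" if "0 \<le> c" "0 \<le> x" for c x
  proof (cases "c = 0")
    case True then show ?thesis by (simp add: z)
  next
    case False
    then have c: "0 < c" using that by simp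
    have "R (inverse c *\<^sub>R (c *\<^sub>R x)) \<le> inverse c *\<^sub>R R (c *\<^sub>R x)"
      using c that by (intro scale) (auto simp: scaleR_nonneg_nonneg)
    then have "R x \<le> inverse c *\<^sub>R R (c *\<^sub>R x)" using c by simp
    then have "c *\<^sub>R R x \<le> c *\<^sub>R (inverse c *\<^sub>R R (c *\<^sub>R x))"
      using c by (simp only: scaleR_left_mono less_imp_le)
    then show ?thesis using c scale[OF c that(2)] by simp
  qed
  have key: "cone_ext R (u - v) = R u - R v" if "0 \<le> u" "0 \<le> v" for u v
  proof -
    have "pprt (u - v) + nprt (u - v) = u - v" by (rule prts[symmetric])
    then have "pprt (u - v) + v = u + (- nprt (u - v))" by (simp add: algebra_simps)
    then have "R (pprt (u - v) + v) = R (u + (- nprt (u - v)))" by simp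
    then have "R (pprt (u - v)) + R v = R u + R (- nprt (u - v))"
      using that add[of "pprt (u - v)" v] add[of u "- nprt (u - v)"] by simp
    then show ?thesis by (simp add: cone_ext_def algebra_simps)
  qed
  show "0 \<le> x \<Longrightarrow> cone_ext R x = R x" using key[of x 0] z by simp
  have split: "x = pprt x - (- nprt x)" for x :: 'e using prts[of x] by simp
  show "linear (cone_ext R)"
  proof (rule linearI)
    fix x y :: 'e
    have "x + y = (pprt x + nprt x) + (pprt y + nprt y)" by (simp only: prts[symmetric])
    also have "\<dots> = (pprt x + pprt y) - (- nprt x + - nprt y)" by (simp add: algebra_simps)
    finally have eq: "x + y = (pprt x + pprt y) - (- nprt x + - nprt y)" .
    have "cone_ext R (x + y) = R (pprt x + pprt y) - R (- nprt x + - nprt y)"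
      unfolding eq by (rule key; rule add_nonneg_nonneg) simp_all
    then show "cone_ext R (x + y) = cone_ext R x + cone_ext R y"
      using add[of "pprt x" "pprt y"] add[of "- nprt x" "- nprt y"]
      by (simp add: cone_ext_def)
  next
    fix c :: real and x :: 'e
    show "cone_ext R (c *\<^sub>R x) = c *\<^sub>R cone_ext R x"
    proof (cases "0 \<le> c")
      case True
      then show ?thesis
        using sc[OF True, of "- nprt x"] sc[OF True, of "pprt x"]
        by (simp add: cone_ext_def vl_pprt_scaleR vl_nprt_scaleR scaleR_diff_right)
    next
      case False
      then have c: "0 \<le> - c" by simp
      have "c *\<^sub>R x = c *\<^sub>R (pprt x + nprt x)" by (simp only: prts[symmetric])
      also have "\<dots> = (- c) *\<^sub>R (- nprt x) - (- c) *\<^sub>R pprt x" by (simp add: algebra_simps)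
      finally have eq: "c *\<^sub>R x = (- c) *\<^sub>R (- nprt x) - (- c) *\<^sub>R pprt x" .
      have "cone_ext R (c *\<^sub>R x) = R ((- c) *\<^sub>R (- nprt x)) - R ((- c) *\<^sub>R pprt x)"
        unfolding eq by (rule key; rule scaleR_nonneg_nonneg[OF c]) simp_all
      then show ?thesis
        using sc[OF c, of "- nprt x"] sc[OF c, of "pprt x"]
        by (simp add: cone_ext_def algebra_simps)
    qed
  qed
qed

text \<open>The positive part of an orthomorphism, by the Riesz--Kantorovich formula.\<close>

definition rk_pos :: "('e::dedekind_complete_vector_lattice \<Rightarrow> 'e) \<Rightarrow> 'e \<Rightarrow> 'e"
  where "rk_pos D = cone_ext (\<lambda>x. Sup (D ` {0..x}))"

lemma riesz_decomp:
  fixes u x y :: "'e::lattice_ab_group_add"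
  assumes "0 \<le> u" "u \<le> x + y" "0 \<le> x" "0 \<le> y"
  shows "\<exists>v w. u = v + w \<and> 0 \<le> v \<and> v \<le> x \<and> 0 \<le> w \<and> w \<le> y"
proof (intro exI conjI)
  show "u = inf u x + (u - inf u x)" by (simp only: add_diff_cancel_left' add_diff_eq)
  show "0 \<le> inf u x" "inf u x \<le> x" using assms by auto
  have "u - inf u x = u + sup (- u) (- x)" by (rule diff_inf_eq_sup)
  also have "\<dots> = sup 0 (u - x)" by (simp add: add_sup_distrib_left)
  finally have eq: "u - inf u x = sup 0 (u - x)" .
  then show "0 \<le> u - inf u x" by simp
  show "u - inf u x \<le> y" unfolding eq using assms by (simp add: algebra_simps)
qed

lemma rk_pos:
  assumes D: "orthomorphism D"
  shows "orthomorphism (rk_pos D)"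
    and "0 \<le> x \<Longrightarrow> 0 \<le> rk_pos D x"
    and "0 \<le> x \<Longrightarrow> D x \<le> rk_pos D x"
    and "(\<And>x. 0 \<le> x \<Longrightarrow> 0 \<le> T x \<and> D x \<le> T x) \<Longrightarrow> linear T \<Longrightarrow> 0 \<le> x \<Longrightarrow> rk_pos D x \<le> T x"
proof -
  define R where "R x = Sup (D ` {0..x})" for x
  have lin: "linear D" using D by (rule orthomorphism_linear)
  have bdd: "bdd_above (D ` {0..x})" for x
  proof -
    obtain c d where "\<And>u. 0 \<le> u \<Longrightarrow> u \<le> x \<Longrightarrow> c \<le> D u" "\<And>u. 0 \<le> u \<Longrightarrow> u \<le> x \<Longrightarrow> D u \<le> d"
      using order_bounded_mapD[OF orthomorphism_order_bounded[OF D], of "0" "x"] by blast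
    then show ?thesis by (intro bdd_aboveI[of _ d]) auto
  qed
  have up: "D u \<le> R x" if "0 \<le> u" "u \<le> x" for u x
    unfolding R_def by (rule cSup_upper[OF imageI bdd]) (simp add: that)
  have least: "R x \<le> z" if x: "0 \<le> x" and z: "\<And>u. 0 \<le> u \<Longrightarrow> u \<le> x \<Longrightarrow> D u \<le> z" for x z
    unfolding R_def
  proof (rule cSup_least)
    show "D ` {0..x} \<noteq> {}" using x by simp
    fix y assume "y \<in> D ` {0..x}"
    then obtain u where "y = D u" "0 \<le> u" "u \<le> x" by auto
    then show "y \<le> z" using z by simp
  qed
  have radd: "R (x + y) = R x + R y" if xy: "0 \<le> x" "0 \<le> y" for x y
  proof (rule antisym)
    show "R (x + y) \<le> R x + R y"
    proof (rule least)
      fix u assume u: "0 \<le> u" "u \<le> x + y"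
      then obtain v w where "u = v + w" "0 \<le> v" "v \<le> x" "0 \<le> w" "w \<le> y"
        using riesz_decomp[OF u xy] by blast
      then show "D u \<le> R x + R y" using lin up[of v x] up[of w y] by (simp add: linear_add add_mono)
    qed (use xy in simp)
    have "R x \<le> R (x + y) - R y"
    proof (rule least[OF that(1)])
      fix u assume u: "0 \<le> u" "u \<le> x"
      have "R y \<le> R (x + y) - D u"
      proof (rule least[OF that(2)])
        fix v assume v: "0 \<le> v" "v \<le> y"
        have "D (u + v) \<le> R (x + y)"
          by (rule up[OF add_nonneg_nonneg[OF u(1) v(1)] add_mono[OF u(2) v(2)]])
        then show "D v \<le> R (x + y) - D u" using lin by (simp add: linear_add algebra_simps)
      qed
      then show "D u \<le> R (x + y) - R y" by (simp add: algebra_simps)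
    qed
    then show "R x + R y \<le> R (x + y)" by (simp add: algebra_simps)
  qed
  have rsc: "R (c *\<^sub>R x) \<le> c *\<^sub>R R x" if "0 < c" "0 \<le> x" for c x
  proof (rule least)
    show "0 \<le> c *\<^sub>R x" using that by (simp add: scaleR_nonneg_nonneg)
    fix u assume u: "0 \<le> u" "u \<le> c *\<^sub>R x"
    have i: "0 \<le> inverse c" using that by simp
    have "inverse c *\<^sub>R u \<le> inverse c *\<^sub>R (c *\<^sub>R x)" by (rule scaleR_left_mono[OF u(2) i])
    then have "D (inverse c *\<^sub>R u) \<le> R x"
      using that u i by (intro up) (auto simp: scaleR_nonneg_nonneg)
    then have "c *\<^sub>R (inverse c *\<^sub>R D u) \<le> c *\<^sub>R R x"
      using lin that by (simp only: linear_scale scaleR_left_mono less_imp_le)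
    then show "D u \<le> c *\<^sub>R R x" using that by simp
  qed
  have eq: "rk_pos D = cone_ext R" by (simp add: rk_pos_def R_def[abs_def])
  have lin': "linear (rk_pos D)" unfolding eq by (rule cone_ext(1)[OF radd rsc])
  have on: "rk_pos D x = R x" if "0 \<le> x" for x
    unfolding eq by (rule cone_ext(2)[OF radd rsc that])
  show pos: "0 \<le> rk_pos D x" if "0 \<le> x" for x
    using up[of 0 x] that lin by (simp add: on linear_0)
  show ge: "D x \<le> rk_pos D x" if "0 \<le> x" for x
    using up[of x x] that by (simp add: on)
  show "rk_pos D x \<le> T x" if T: "\<And>x. 0 \<le> x \<Longrightarrow> 0 \<le> T x \<and> D x \<le> T x" "linear T" "0 \<le> x" for x T
  proof -
    have "R x \<le> T x"
    proof (rule least[OF T(3)])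
      fix u assume u: "0 \<le> u" "u \<le> x"
      have "D u \<le> T u" using T u by blast
      also have "T u \<le> T x" using T(1)[of "x - u"] T(2) u by (simp add: linear_diff)
      finally show "D u \<le> T x" .
    qed
    then show ?thesis using T by (simp add: on)
  qed
  have bpos: "vl_disjoint (R x) y" if x: "0 \<le> x" and xy: "vl_disjoint x y" for x y
  proof -
    have R0: "0 \<le> R x" using pos[OF x] on[OF x] by simp
    define w where "w = inf (R x) \<bar>y\<bar>"
    have w0: "0 \<le> w" using R0 by (simp add: w_def)
    have "R x \<le> R x - w"
    proof (rule least[OF x])
      fix u assume u: "0 \<le> u" "u \<le> x"
      have "vl_disjoint u y" using xy by (rule vl_disjoint_dominated) (use u x in simp)
      then have du: "vl_disjoint (D u) y" by (rule orthomorphism_disjoint[OF D])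
      have "pprt (D u) \<le> \<bar>D u\<bar>" by (simp add: abs_prts)
      then have "inf (pprt (D u)) \<bar>y\<bar> \<le> 0"
        using inf_mono[OF _ order_refl[of "\<bar>y\<bar>"], of "pprt (D u)" "\<bar>D u\<bar>"] du
        by (simp only: vl_disjoint_def)
      moreover have "inf (pprt (D u)) w \<le> inf (pprt (D u)) \<bar>y\<bar>"
        by (simp add: w_def le_infI2)
      ultimately have "inf (pprt (D u)) w \<le> 0" by (meson order_trans)
      then have "inf (pprt (D u)) w = 0" using w0 by (simp add: antisym)
      then have "pprt (D u) + w = sup (pprt (D u)) w"
        using add_eq_inf_sup[of "pprt (D u)" w] by simp
      also have "\<dots> \<le> R x" using up[OF u] R0 by (simp add: pprt_def w_def)
      finally have "pprt (D u) \<le> R x - w" by (simp add: algebra_simps)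
      then show "D u \<le> R x - w" by (simp add: pprt_def)
    qed
    then have "w = 0" using w0 by (simp add: antisym)
    then show ?thesis using R0 by (simp add: vl_disjoint_def w_def)
  qed
  have "vl_disjoint (rk_pos D x) y" if "vl_disjoint x y" for x y
  proof -
    have "vl_disjoint (pprt x) y" "vl_disjoint (- nprt x) y"
      by (rule vl_disjoint_dominated[OF that], simp add: abs_prts)+
    then have "vl_disjoint (R (pprt x) - R (- nprt x)) y"
      by (intro vl_disjoint_diff bpos) auto
    then show ?thesis by (simp add: eq cone_ext_def)
  qed
  then have "band_preserving (rk_pos D)" by (simp add: band_preserving_def)
  moreover have "order_bounded_map (rk_pos D)"
    by (rule order_bounded_map_dominated[OF orthomorphism_order_bounded[OF D] lin' ge])
  ultimately show "orthomorphism (rk_pos D)" using lin' by (simp add: orthomorphism_def)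
qed

lemma orthomorphism_sandwich:
  assumes S: "orthomorphism S" and T: "orthomorphism T" and L: "linear L"
    and "\<And>x. 0 \<le> x \<Longrightarrow> S x \<le> L x" "\<And>x. 0 \<le> x \<Longrightarrow> L x \<le> T x"
  shows "orthomorphism L"
proof -
  have TS: "orthomorphism (\<lambda>x. T x - S x)" by (rule orthomorphism_diff[OF T S])
  have pos: "vl_disjoint (L x) y" if "0 \<le> x" "vl_disjoint x y" for x y
  proof -
    have "vl_disjoint (T x - S x) y" by (rule orthomorphism_disjoint[OF TS that(2)])
    moreover have "\<bar>L x - S x\<bar> \<le> \<bar>T x - S x\<bar>"
    proof -
      have 1: "0 \<le> L x - S x" using assms(4)[OF that(1)] by simp
      moreover have 2: "L x - S x \<le> T x - S x" using assms(5)[OF that(1)] by simp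
      ultimately have "0 \<le> T x - S x" by (rule order_trans)
      then show ?thesis using 1 2 by simp
    qed
    ultimately have "vl_disjoint (L x - S x) y" by (rule vl_disjoint_dominated)
    moreover have "vl_disjoint (S x) y" by (rule orthomorphism_disjoint[OF S that(2)])
    ultimately have "vl_disjoint (L x - S x + S x) y" by (rule vl_disjoint_add)
    then show ?thesis by simp
  qed
  have "vl_disjoint (L x) y" if "vl_disjoint x y" for x y
  proof -
    have "vl_disjoint (pprt x) y" "vl_disjoint (- nprt x) y"
      by (rule vl_disjoint_dominated[OF that], simp add: abs_prts)+
    then have "vl_disjoint (L (pprt x) - L (- nprt x)) y"
      by (intro vl_disjoint_diff pos) auto
    then show ?thesis by (simp only: linear_prts[OF L, of x])
  qed
  then have "band_preserving L" by (simp add: band_preserving_def)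
  moreover have "order_bounded_map L"
    by (rule order_bounded_map_dominated[OF orthomorphism_order_bounded[OF S] L assms(4)])
  ultimately show ?thesis using L by (simp add: orthomorphism_def)
qed

typedef (overloaded) 'e orth = "{T :: 'e::dedekind_complete_vector_lattice \<Rightarrow> 'e. orthomorphism T}"
  morphisms orth_app Orth
  using orthomorphism_zero by blast

lemma orthomorphism_orth_app: "orthomorphism (orth_app T)"
  using orth_app[of T] by simp

lemma linear_orth_app: "linear (orth_app T)"
  by (rule orthomorphism_linear[OF orthomorphism_orth_app])

lemma orth_app_Orth: "orthomorphism T \<Longrightarrow> orth_app (Orth T) = T"
  by (simp add: Orth_inverse)

lemma orth_eqI: "(\<And>x. orth_app S x = orth_app T x) \<Longrightarrow> S = T"
  by (simp add: orth_app_inject[symmetric] fun_eq_iff)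

lemma orth_eq_coneI: "(\<And>x. 0 \<le> x \<Longrightarrow> orth_app S x = orth_app T x) \<Longrightarrow> S = T"
  using linear_eq_on_cone[OF linear_orth_app[of S] linear_orth_app[of T]] by (simp add: orth_app_inject)

instantiation orth :: (dedekind_complete_vector_lattice) "{real_vector, ring, monoid_mult}"
begin

definition "0 = Orth (\<lambda>x. 0)"
definition "1 = Orth (\<lambda>x. x)"
definition "S + T = Orth (\<lambda>x. orth_app S x + orth_app T x)"
definition "S - T = Orth (\<lambda>x. orth_app S x - orth_app T x)"
definition "- T = Orth (\<lambda>x. - orth_app T x)"
definition "r *\<^sub>R T = Orth (\<lambda>x. r *\<^sub>R orth_app T x)"
definition "S * T = Orth (\<lambda>x. orth_app S (orth_app T x))"

lemma orth_app_zero: "orth_app 0 x = 0"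
  by (simp add: zero_orth_def orth_app_Orth orthomorphism_zero)
lemma orth_app_one: "orth_app 1 x = x"
  by (simp add: one_orth_def orth_app_Orth orthomorphism_id)
lemma orth_app_add: "orth_app (S + T) x = orth_app S x + orth_app T x"
  by (simp add: plus_orth_def orth_app_Orth orthomorphism_add orthomorphism_orth_app)
lemma orth_app_diff: "orth_app (S - T) x = orth_app S x - orth_app T x"
  by (simp add: minus_orth_def orth_app_Orth orthomorphism_diff orthomorphism_orth_app)
lemma orth_app_uminus: "orth_app (- T) x = - orth_app T x"
  by (simp add: uminus_orth_def orth_app_Orth orthomorphism_uminus orthomorphism_orth_app)
lemma orth_app_scaleR: "orth_app (r *\<^sub>R T) x = r *\<^sub>R orth_app T x"
  by (simp add: scaleR_orth_def orth_app_Orth orthomorphism_scaleR orthomorphism_orth_app)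
lemma orth_app_mult: "orth_app (S * T) x = orth_app S (orth_app T x)"
  by (simp add: times_orth_def orth_app_Orth orthomorphism_compose orthomorphism_orth_app)

lemmas orth_app_simps = orth_app_zero orth_app_one orth_app_add orth_app_diff orth_app_uminus
  orth_app_scaleR orth_app_mult

instance
  by standard (rule orth_eqI; simp add: orth_app_simps algebra_simps linear_add[OF linear_orth_app])+

end

instantiation orth :: (dedekind_complete_vector_lattice) "{ordered_real_vector, lattice_ab_group_add_abs}"
begin

definition "S \<le> T \<longleftrightarrow> (\<forall>x\<ge>0. orth_app S x \<le> orth_app T x)"
definition "S < (T :: 'a orth) \<longleftrightarrow> S \<le> T \<and> \<not> T \<le> S"
definition "sup S T = T + Orth (rk_pos (orth_app (S - T)))"
definition "inf S T = S - Orth (rk_pos (orth_app (S - T)))"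
definition "\<bar>T\<bar> = sup T (- T :: 'a orth)"
instance
proof -
  have refl: "S \<le> S" for S :: "'a orth" by (simp add: less_eq_orth_def)
  have trans: "S \<le> U" if "S \<le> T" "T \<le> U" for S T U :: "'a orth"
    using that by (auto simp: less_eq_orth_def intro: order_trans)
  have anti: "S = T" if "S \<le> T" "T \<le> S" for S T :: "'a orth"
    using that by (intro orth_eq_coneI) (auto simp: less_eq_orth_def intro: antisym)
  have addm: "U + S \<le> U + T" if "S \<le> T" for S T U :: "'a orth"
    using that by (simp add: less_eq_orth_def orth_app_simps)
  have minus_swap: "S \<le> T \<longleftrightarrow> - T \<le> - S" for S T :: "'a orth"
    by (simp add: less_eq_orth_def orth_app_simps)
  define P where "P D = Orth (rk_pos (orth_app D))" for D :: "'a orth"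
  have P: "0 \<le> P D" "D \<le> P D" for D
    using rk_pos(1-3)[OF orthomorphism_orth_app[of D]] by (simp_all add: P_def less_eq_orth_def orth_app_Orth orth_app_simps)
  have P3: "P D \<le> U" if "0 \<le> U" "D \<le> U" for D U
  proof -
    have "rk_pos (orth_app D) x \<le> orth_app U x" if "0 \<le> x" for x
      by (rule rk_pos(4)[OF orthomorphism_orth_app _ linear_orth_app that])
        (use \<open>0 \<le> U\<close> \<open>D \<le> U\<close> in \<open>simp add: less_eq_orth_def orth_app_simps\<close>)
    then show ?thesis by (simp add: P_def less_eq_orth_def orth_app_Orth rk_pos(1)[OF orthomorphism_orth_app])
  qed
  have sh: "S \<le> T \<longleftrightarrow> S + U \<le> T + U" for S T U :: "'a orth"
    by (simp add: less_eq_orth_def orth_app_simps)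
  have sup1: "S \<le> sup S T" and sup2: "T \<le> sup S T" for S T :: "'a orth"
    using P(2)[of "S - T"] addm[OF P(1)[of "S - T"], of T] sh[of "S - T" "P (S - T)" T]
    by (simp_all add: sup_orth_def P_def[symmetric] add.commute)
  have sup3: "sup S T \<le> U" if "S \<le> U" "T \<le> U" for S T U :: "'a orth"
  proof -
    have "P (S - T) \<le> U - T"
      using that sh[of 0 "U - T" T] sh[of "S - T" "U - T" T] by (intro P3) simp_all
    then show ?thesis
      using sh[of "P (S - T)" "U - T" T] by (simp add: sup_orth_def P_def[symmetric] add.commute)
  qed
  have inf1: "inf S T \<le> S" and inf2: "inf S T \<le> T" for S T :: "'a orth"
    using P(1)[of "S - T"] P(2)[of "S - T"]
    by (simp_all add: inf_orth_def P_def[symmetric] less_eq_orth_def orth_app_simps algebra_simps)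
  have inf3: "U \<le> inf S T" if "U \<le> S" "U \<le> T" for S T U :: "'a orth"
  proof -
    have "P (S - T) \<le> S - U"
      using that by (intro P3) (simp_all add: less_eq_orth_def orth_app_simps)
    then show ?thesis
      by (simp add: inf_orth_def P_def[symmetric] less_eq_orth_def orth_app_simps algebra_simps)
  qed
  show "OFCLASS('a orth, ordered_real_vector_class)"
  proof
    fix S T U :: "'a orth" and a b :: real
    show "S < T \<longleftrightarrow> S \<le> T \<and> \<not> T \<le> S" by (rule less_orth_def)
    show "S \<le> S" by (rule refl)
    show "S \<le> T \<Longrightarrow> T \<le> U \<Longrightarrow> S \<le> U" by (rule trans)
    show "S \<le> T \<Longrightarrow> T \<le> S \<Longrightarrow> S = T" by (rule anti)
    show "S \<le> T \<Longrightarrow> U + S \<le> U + T" by (rule addm)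
    show "S \<le> T \<Longrightarrow> 0 \<le> a \<Longrightarrow> a *\<^sub>R S \<le> a *\<^sub>R T"
      by (simp add: less_eq_orth_def orth_app_simps scaleR_left_mono)
    show "a \<le> b \<Longrightarrow> 0 \<le> S \<Longrightarrow> a *\<^sub>R S \<le> b *\<^sub>R S"
      by (simp add: less_eq_orth_def orth_app_simps scaleR_right_mono)
  qed
  show "OFCLASS('a orth, lattice_ab_group_add_abs_class)"
  proof
    fix S T U :: "'a orth"
    show "S < T \<longleftrightarrow> S \<le> T \<and> \<not> T \<le> S" by (rule less_orth_def)
    show "S \<le> S" by (rule refl)
    show "S \<le> T \<Longrightarrow> T \<le> U \<Longrightarrow> S \<le> U" by (rule trans)
    show "S \<le> T \<Longrightarrow> T \<le> S \<Longrightarrow> S = T" by (rule anti)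
    show "S \<le> T \<Longrightarrow> U + S \<le> U + T" by (rule addm)
    show "S \<le> sup S T" "T \<le> sup S T" by (rule sup1, rule sup2)
    show "S \<le> U \<Longrightarrow> T \<le> U \<Longrightarrow> sup S T \<le> U" by (rule sup3)
    show "inf S T \<le> S" "inf S T \<le> T" by (rule inf1, rule inf2)
    show "U \<le> S \<Longrightarrow> U \<le> T \<Longrightarrow> U \<le> inf S T" by (rule inf3)
    show "\<bar>S\<bar> = sup S (- S)" by (rule abs_orth_def)
  qed
qed

end

instantiation orth :: (dedekind_complete_vector_lattice) dedekind_complete_vector_lattice
begin

definition "Sup A = (THE U :: 'a orth. (\<forall>T\<in>A. T \<le> U) \<and> (\<forall>V. (\<forall>T\<in>A. T \<le> V) \<longrightarrow> U \<le> V))"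
definition "Inf A = (THE L :: 'a orth. (\<forall>T\<in>A. L \<le> T) \<and> (\<forall>V. (\<forall>T\<in>A. V \<le> T) \<longrightarrow> V \<le> L))"

instance
proof
  have lub: "\<exists>U. (\<forall>T\<in>A. T \<le> U) \<and> (\<forall>V. (\<forall>T\<in>A. T \<le> V) \<longrightarrow> U \<le> V)"
    if A: "A \<noteq> {}" "\<exists>B. \<forall>T\<in>A. T \<le> B" for A :: "'a orth set"
  proof -
    obtain B where B: "\<And>T. T \<in> A \<Longrightarrow> T \<le> B" using A by blast
    define A' where "A' = \<Inter>{C. A \<subseteq> C \<and> (\<forall>S\<in>C. \<forall>T\<in>C. sup S T \<in> C)}"
    have AA': "A \<subseteq> A'" by (auto simp: A'_def)
    have supA': "sup S T \<in> A'" if "S \<in> A'" "T \<in> A'" for S T using that by (auto simp: A'_def)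
    have ubA': "T \<le> V" if "T \<in> A'" "\<forall>S\<in>A. S \<le> V" for T V
    proof -
      have "A' \<subseteq> {T. T \<le> V}" unfolding A'_def using that(2) by (intro Inter_lower) auto
      then show ?thesis using that by blast
    qed
    obtain T0 where T0: "T0 \<in> A'" using A(1) AA' by blast
    define R where "R x = Sup ((\<lambda>T. orth_app T x) ` A')" for x
    have bdd: "bdd_above ((\<lambda>T. orth_app T x) ` A')" if "0 \<le> x" for x
      using ubA'[of _ B] B that by (intro bdd_aboveI[of _ "orth_app B x"]) (auto simp: less_eq_orth_def)
    have up: "orth_app T x \<le> R x" if "T \<in> A'" "0 \<le> x" for T x
      unfolding R_def using that by (intro cSup_upper bdd) auto
    have least: "R x \<le> z" if "\<And>T. T \<in> A' \<Longrightarrow> orth_app T x \<le> z" for x z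
      unfolding R_def using that T0 by (intro cSup_least) auto
    have radd: "R (x + y) = R x + R y" if xy: "0 \<le> x" "0 \<le> y" for x y
    proof (rule antisym)
      show "R (x + y) \<le> R x + R y"
        using xy by (intro least) (auto simp: linear_add[OF linear_orth_app] intro!: add_mono up)
      have "R x \<le> R (x + y) - R y"
      proof (rule least)
        fix S assume S: "S \<in> A'"
        have "R y \<le> R (x + y) - orth_app S x"
        proof (rule least)
          fix T assume T: "T \<in> A'"
          have "orth_app S x + orth_app T y \<le> orth_app (sup S T) x + orth_app (sup S T) y"
            using sup_ge1[of S T] sup_ge2[of T S] xy by (intro add_mono) (simp_all add: less_eq_orth_def)
          also have "\<dots> = orth_app (sup S T) (x + y)" by (simp add: linear_add[OF linear_orth_app])
          also have "\<dots> \<le> R (x + y)" using supA'[OF S T] xy by (intro up) auto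
          finally show "orth_app T y \<le> R (x + y) - orth_app S x" by (simp add: algebra_simps)
        qed
        then show "orth_app S x \<le> R (x + y) - R y" by (simp add: algebra_simps)
      qed
      then show "R x + R y \<le> R (x + y)" by (simp add: algebra_simps)
    qed
    have rsc: "R (c *\<^sub>R x) \<le> c *\<^sub>R R x" if "0 < c" "0 \<le> x" for c x
      using that by (intro least) (auto simp: linear_scale[OF linear_orth_app] intro!: scaleR_left_mono up)
    define L where "L = cone_ext R"
    have linL: "linear L" unfolding L_def by (rule cone_ext(1)[OF radd rsc])
    have on: "L x = R x" if "0 \<le> x" for x
      unfolding L_def by (rule cone_ext(2)[OF radd rsc that])
    have "orthomorphism L"
    proof (rule orthomorphism_sandwich[OF orthomorphism_orth_app[of T0] orthomorphism_orth_app[of B] linL])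
      show "orth_app T0 x \<le> L x" if "0 \<le> x" for x using up[OF T0 that] on[OF that] by simp
      show "L x \<le> orth_app B x" if "0 \<le> x" for x
        using ubA'[of _ B] B that by (auto simp: on less_eq_orth_def intro!: least)
    qed
    then have app: "orth_app (Orth L) = L" by (rule orth_app_Orth)
    have "T \<le> Orth L" if "T \<in> A" for T
      using that AA' by (auto simp: less_eq_orth_def app on intro!: up)
    moreover have "Orth L \<le> V" if "\<forall>T\<in>A. T \<le> V" for V
      using ubA'[OF _ that] by (auto simp: less_eq_orth_def app on intro!: least)
    ultimately show ?thesis by blast
  qed
  have Sup: "(\<forall>T\<in>A. T \<le> Sup A) \<and> (\<forall>V. (\<forall>T\<in>A. T \<le> V) \<longrightarrow> Sup A \<le> V)"
    if "A \<noteq> {}" "\<exists>B. \<forall>T\<in>A. T \<le> B" for A :: "'a orth set"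
    unfolding Sup_orth_def by (rule theI') (use lub[OF that] antisym in blast)
  have glb: "\<exists>L. (\<forall>T\<in>A. L \<le> T) \<and> (\<forall>V. (\<forall>T\<in>A. V \<le> T) \<longrightarrow> V \<le> L)"
    if A: "A \<noteq> {}" "\<exists>B. \<forall>T\<in>A. B \<le> T" for A :: "'a orth set"
  proof -
    have "\<exists>B. \<forall>T\<in>uminus ` A. T \<le> B" using A by (metis imageE neg_le_iff_le)
    then obtain U where U: "\<And>T. T \<in> A \<Longrightarrow> - T \<le> U" "\<And>V. (\<forall>T\<in>A. - T \<le> V) \<Longrightarrow> U \<le> V"
      using lub[of "uminus ` A"] A by auto
    show ?thesis
    proof (intro exI conjI ballI allI impI)
      show "- U \<le> T" if "T \<in> A" for T using U(1)[OF that] by (simp add: minus_le_iff)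
      show "V \<le> - U" if "\<forall>T\<in>A. V \<le> T" for V
        using U(2)[of "- V"] that by (simp add: le_minus_iff)
    qed
  qed
  have Inf: "(\<forall>T\<in>A. Inf A \<le> T) \<and> (\<forall>V. (\<forall>T\<in>A. V \<le> T) \<longrightarrow> V \<le> Inf A)"
    if "A \<noteq> {}" "\<exists>B. \<forall>T\<in>A. B \<le> T" for A :: "'a orth set"
    unfolding Inf_orth_def by (rule theI') (use glb[OF that] antisym in blast)
  fix A :: "'a orth set" and T V :: "'a orth"
  show "T \<in> A \<Longrightarrow> bdd_below A \<Longrightarrow> Inf A \<le> T" using Inf[of A] by (auto simp: bdd_below_def)
  show "A \<noteq> {} \<Longrightarrow> (\<And>T. T \<in> A \<Longrightarrow> V \<le> T) \<Longrightarrow> V \<le> Inf A" using Inf[of A] by blast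
  show "T \<in> A \<Longrightarrow> bdd_above A \<Longrightarrow> T \<le> Sup A" using Sup[of A] by (auto simp: bdd_above_def)
  show "A \<noteq> {} \<Longrightarrow> (\<And>T. T \<in> A \<Longrightarrow> T \<le> V) \<Longrightarrow> Sup A \<le> V" using Sup[of A] by blast
qed

end

section \<open>Lattice normed spaces\<close>

definition vl_band :: "'e::dedekind_complete_vector_lattice set \<Rightarrow> bool"
  where "vl_band B \<longleftrightarrow> subspace B \<and> (\<forall>x\<in>B. \<forall>y. \<bar>y\<bar> \<le> \<bar>x\<bar> \<longrightarrow> y \<in> B) \<and>
    (\<forall>A. A \<subseteq> B \<longrightarrow> A \<noteq> {} \<longrightarrow> bdd_above A \<longrightarrow> Sup A \<in> B)"

text \<open>Band projections are regarded as elements of the algebra of orthomorphisms; the order of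
  the Boolean algebra of band projections is the one induced by that algebra, its meet is \<open>inf\<close>
  (equivalently, composition), its unit is \<open>1\<close> and complements are \<open>1 - \<pi>\<close>.\<close>

definition band_projection :: "'e::dedekind_complete_vector_lattice orth \<Rightarrow> bool"
  where "band_projection \<pi> \<longleftrightarrow>
    (\<exists>B. vl_band B \<and> (\<forall>x. orth_app \<pi> x \<in> B \<and> x - orth_app \<pi> x \<in> disjoint_complement B))"

definition partition_of_unity :: "('s \<Rightarrow> 'e::dedekind_complete_vector_lattice orth) \<Rightarrow> bool"
  where "partition_of_unity \<pi> \<longleftrightarrow> (\<forall>s. band_projection (\<pi> s)) \<and>
    (\<forall>s t. s \<noteq> t \<longrightarrow> inf (\<pi> s) (\<pi> t) = 0) \<and>
    (\<forall>\<rho>. band_projection \<rho> \<and> (\<forall>s. \<pi> s \<le> \<rho>) \<longrightarrow> 1 \<le> \<rho>)"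

text \<open>Nets are represented by filters: a net corresponds to its filter of tails. The set \<open>D\<close> is the
  range of a net decreasing to \<open>0\<close>.\<close>

definition order_tendsto ::
  "('i \<Rightarrow> 'e::dedekind_complete_vector_lattice) \<Rightarrow> 'e \<Rightarrow> 'i filter \<Rightarrow> bool"
  where "order_tendsto f l F \<longleftrightarrow>
    (\<exists>D. D \<noteq> {} \<and> (\<forall>a\<in>D. \<forall>b\<in>D. \<exists>c\<in>D. c \<le> a \<and> c \<le> b) \<and> (\<forall>d\<in>D. 0 \<le> d) \<and> Inf D = 0 \<and>
      (\<forall>d\<in>D. \<forall>\<^sub>F i in F. \<bar>f i - l\<bar> \<le> d))"

definition ru_tendsto ::
  "('i \<Rightarrow> 'e::dedekind_complete_vector_lattice) \<Rightarrow> 'e \<Rightarrow> 'i filter \<Rightarrow> bool"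
  where "ru_tendsto f l F \<longleftrightarrow> (\<exists>u\<ge>0. \<forall>\<epsilon>>0. \<forall>\<^sub>F i in F. \<bar>f i - l\<bar> \<le> \<epsilon> *\<^sub>R u)"

definition order_sum :: "('i \<Rightarrow> 'e::dedekind_complete_vector_lattice) \<Rightarrow> 'e"
  where "order_sum f = (THE l. order_tendsto (sum f) l finite_sets_at_top)"

text \<open>By the theorem of Gelfand and Mazur the scalar field is \<open>real\<close> or \<open>complex\<close>, up to isometric
  isomorphism.\<close>

locale lattice_normed_space = vector_space scale
  for scale :: "'k::real_normed_field \<Rightarrow> 'x::ab_group_add \<Rightarrow> 'x" +
  fixes N :: "'x \<Rightarrow> 'e::dedekind_complete_vector_lattice"
  assumes lnorm_nonneg: "0 \<le> N x"
    and lnorm_eq_zeroD: "N x = 0 \<Longrightarrow> x = 0"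
    and lnorm_scale: "N (scale c x) = norm c *\<^sub>R N x"
    and lnorm_triangle: "N (x + y) \<le> N x + N y"
    and lnorm_full: "disjoint_complement (disjoint_complement (range N)) = UNIV"

definition norm_tendsto ::
  "('x::ab_group_add \<Rightarrow> 'e::dedekind_complete_vector_lattice) \<Rightarrow> ('i \<Rightarrow> 'x) \<Rightarrow> 'x \<Rightarrow> 'i filter \<Rightarrow> bool"
  where "norm_tendsto N f l F \<longleftrightarrow> order_tendsto (\<lambda>i. N (l - f i)) 0 F"

definition norm_o_complete ::
  "('x::ab_group_add \<Rightarrow> 'e::dedekind_complete_vector_lattice) \<Rightarrow> 'x set \<Rightarrow> bool"
  where "norm_o_complete N V \<longleftrightarrow>
    (\<forall>F. F \<noteq> bot \<and> (\<forall>\<^sub>F x in F. x \<in> V) \<and> norm_tendsto N (\<lambda>(x, y). x - y) 0 (F \<times>\<^sub>F F) \<longrightarrow>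
      (\<exists>l\<in>V. norm_tendsto N (\<lambda>x. x) l F))"

definition decomposable ::
  "('x::ab_group_add \<Rightarrow> 'e::dedekind_complete_vector_lattice) \<Rightarrow> 'x set \<Rightarrow> bool"
  where "decomposable N V \<longleftrightarrow>
    (\<forall>x\<in>V. \<forall>e1 e2. 0 \<le> e1 \<and> 0 \<le> e2 \<and> N x = e1 + e2 \<longrightarrow>
      (\<exists>x1\<in>V. \<exists>x2\<in>V. x = x1 + x2 \<and> N x1 = e1 \<and> N x2 = e2))"

definition Banach_Kantorovich_space ::
  "('k::real_normed_field \<Rightarrow> 'x::ab_group_add \<Rightarrow> 'x) \<Rightarrow>
    ('x \<Rightarrow> 'e::dedekind_complete_vector_lattice) \<Rightarrow> bool"
  where "Banach_Kantorovich_space sc N \<longleftrightarrow>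
    lattice_normed_space sc N \<and> decomposable N UNIV \<and> norm_o_complete N UNIV"

text \<open>The space \<open>(scY, NY)\<close>, with the embedding \<open>\<iota>\<close>, is a norm completion of \<open>(scX, NX)\<close>.\<close>

definition norm_completion ::
  "('k::real_normed_field \<Rightarrow> 'x::ab_group_add \<Rightarrow> 'x) \<Rightarrow>
    ('x \<Rightarrow> 'e::dedekind_complete_vector_lattice) \<Rightarrow>
    ('k \<Rightarrow> 'y::ab_group_add \<Rightarrow> 'y) \<Rightarrow> ('y \<Rightarrow> 'e) \<Rightarrow> ('x \<Rightarrow> 'y) \<Rightarrow> bool"
  where "norm_completion scX NX scY NY \<iota> \<longleftrightarrow>
    Banach_Kantorovich_space scY NY \<and>
    Vector_Spaces.linear scX scY \<iota> \<and> (\<forall>x. NY (\<iota> x) = NX x) \<and>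
    (\<forall>V. module.subspace scY V \<and> range \<iota> \<subseteq> V \<and> decomposable NY V \<and> norm_o_complete NY V \<longrightarrow>
      V = UNIV)"

text \<open>On a Banach--Kantorovich space there is exactly one module structure over the orthomorphisms
  that satisfies the norm identity below: the identity determines the action of band projections
  and of real multiples of \<open>1\<close>, and then of all orthomorphisms, by the spectral theorem of
  Freudenthal. It also implies that the action is faithful, that it is compatible with the scalar
  multiplication, and that \<open>N (\<pi> x + (1 - \<pi>) y) = \<pi> (N x) + (1 - \<pi>) (N y)\<close> for band
  projections \<open>\<pi>\<close>.\<close>

definition is_orth_action ::
  "('x::ab_group_add \<Rightarrow> 'e::dedekind_complete_vector_lattice) \<Rightarrow> ('e orth \<Rightarrow> 'x \<Rightarrow> 'x) \<Rightarrow> bool"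
  where "is_orth_action N act \<longleftrightarrow>
    (\<forall>S T x. act (S + T) x = act S x + act T x) \<and>
    (\<forall>T x y. act T (x + y) = act T x + act T y) \<and>
    (\<forall>S T x. act (S * T) x = act S (act T x)) \<and>
    (\<forall>x. act 1 x = x) \<and>
    (\<forall>T x. N (act T x) = orth_app \<bar>T\<bar> (N x))"

definition orth_action ::
  "('x::ab_group_add \<Rightarrow> 'e::dedekind_complete_vector_lattice) \<Rightarrow> 'e orth \<Rightarrow> 'x \<Rightarrow> 'x"
  where "orth_action N = (SOME act. is_orth_action N act)"

section \<open>Uniformly order continuous functions and states\<close>

text \<open>The lattice normed space of orthomorphisms over itself has \<open>N = abs\<close>, so that
  \<open>Cuo abs\<close> is the space of uniformly order continuous orthomorphism valued functions.\<close>

definition Cuo ::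
  "('x::ab_group_add \<Rightarrow> 'e::dedekind_complete_vector_lattice) \<Rightarrow> ('s::uniform_space \<Rightarrow> 'x) set"
  where "Cuo N = {f. (\<exists>e. \<forall>s. N (f s) \<le> e) \<and>
    (INF U\<in>{U. \<forall>\<^sub>F p in uniformity. p \<in> U}. SUP (s, t)\<in>U. N (f s - f t)) = 0}"

definition Cuo_norm ::
  "('x \<Rightarrow> 'e::dedekind_complete_vector_lattice) \<Rightarrow> ('s \<Rightarrow> 'x) \<Rightarrow> 'e"
  where "Cuo_norm N f = (SUP s. N (f s))"

type_synonym ('s, 'e) state = "('s \<Rightarrow> 'e orth) \<Rightarrow> 'e orth"

text \<open>Operators on \<open>Cuo abs\<close> are represented by functions that are \<open>undefined\<close> outside
  \<open>Cuo abs\<close>, so that equality of operators is equality.\<close>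

definition eps_subdifferential ::
  "('s::uniform_space, 'e::dedekind_complete_vector_lattice) state set"
  where "eps_subdifferential = {T \<in> extensional (Cuo abs).
    (\<forall>\<phi>\<in>Cuo abs. \<forall>\<psi>\<in>Cuo abs. T (\<lambda>s. \<phi> s + \<psi> s) = T \<phi> + T \<psi>) \<and>
    (\<forall>c. \<forall>\<phi>\<in>Cuo abs. T (\<lambda>s. c *\<^sub>R \<phi> s) = c *\<^sub>R T \<phi>) \<and>
    (\<forall>\<phi>\<in>Cuo abs. T \<phi> \<le> (SUP s. \<phi> s))}"

definition extremal_states ::
  "('s::uniform_space, 'e::dedekind_complete_vector_lattice) state set"
  where "extremal_states = {\<sigma> \<in> eps_subdifferential.
    \<forall>T1\<in>eps_subdifferential. \<forall>T2\<in>eps_subdifferential. \<forall>t. 0 < t \<and> t < 1 \<and>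
      (\<forall>\<phi>\<in>Cuo abs. \<sigma> \<phi> = (1 - t) *\<^sub>R T1 \<phi> + t *\<^sub>R T2 \<phi>) \<longrightarrow> T1 = T2}"

definition pure_state ::
  "('s::uniform_space \<Rightarrow> 'e::dedekind_complete_vector_lattice orth) \<Rightarrow> ('s, 'e) state"
  where "pure_state \<pi> = (\<lambda>\<phi>\<in>Cuo abs. order_sum (\<lambda>s. \<pi> s * \<phi> s))"

definition pure_states :: "('s::uniform_space, 'e::dedekind_complete_vector_lattice) state set"
  where "pure_states = {pure_state \<pi> | \<pi>. partition_of_unity \<pi>}"

definition pure_value ::
  "('y::ab_group_add \<Rightarrow> 'e::dedekind_complete_vector_lattice) \<Rightarrow> ('s::uniform_space \<Rightarrow> 'y) \<Rightarrow>
    ('s, 'e) state \<Rightarrow> 'y"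
  where "pure_value N f \<tau> = (THE y. \<exists>\<pi>. partition_of_unity \<pi> \<and> \<tau> = pure_state \<pi> \<and>
    (\<forall>s. orth_action N (\<pi> s) y = orth_action N (\<pi> s) (f s)))"

text \<open>The value \<open>f(\<sigma>)\<close>; if \<open>\<sigma>\<close> is itself pure, constant nets show that this is
  \<open>pure_value N f \<sigma>\<close>. Here \<open>N\<close> is the norm of the completion.\<close>

definition state_value ::
  "('y::ab_group_add \<Rightarrow> 'e::dedekind_complete_vector_lattice) \<Rightarrow> ('s::uniform_space \<Rightarrow> 'y) \<Rightarrow>
    ('s, 'e) state \<Rightarrow> 'y"
  where "state_value N f \<sigma> = (THE y. \<forall>F. F \<noteq> bot \<and> (\<forall>\<^sub>F \<tau> in F. \<tau> \<in> pure_states) \<and>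
      (\<forall>\<phi>\<in>Cuo abs. ru_tendsto (\<lambda>\<tau>. \<tau> \<phi>) (\<sigma> \<phi>) F) \<longrightarrow>
    norm_tendsto N (pure_value N f) y F)"

section \<open>Multipliers and separation\<close>

definition multipliers ::
  "('y::ab_group_add \<Rightarrow> 'e::dedekind_complete_vector_lattice) \<Rightarrow> ('x \<Rightarrow> 'y) \<Rightarrow>
    ('s::uniform_space \<Rightarrow> 'x) set \<Rightarrow> ('s \<Rightarrow> 'e orth) set"
  where "multipliers NY \<iota> W = {\<phi> \<in> Cuo abs. (\<forall>s. 0 \<le> \<phi> s \<and> \<phi> s \<le> 1) \<and>
    (\<forall>f\<in>W. \<forall>g\<in>W. \<exists>h\<in>W. \<forall>s.
      \<iota> (h s) = orth_action NY (\<phi> s) (\<iota> (f s)) + orth_action NY (1 - \<phi> s) (\<iota> (g s)))}"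

definition separates_states ::
  "('s::uniform_space \<Rightarrow> 'e::dedekind_complete_vector_lattice orth) set \<Rightarrow> bool"
  where "separates_states M \<longleftrightarrow>
    (\<forall>\<sigma>\<in>extremal_states. \<forall>\<tau>\<in>extremal_states. \<forall>b. band_projection b \<longrightarrow>
      (\<forall>\<phi>\<in>M. b * \<sigma> \<phi> = b * \<tau> \<phi>) \<longrightarrow> (\<forall>\<phi>\<in>Cuo abs. b * \<sigma> \<phi> = b * \<tau> \<phi>))"

end

theory Submission
  imports Defs
begin

text \<open>Closed sets of extremal states are encoded by supremum functionals
  \<open>\<phi> \<mapsto> sup \<sigma> \<phi>\<close>. Let \<open>d\<close> be the distance from \<open>f\<close> to \<open>W\<close>. As in the proofs of
  Machado and Ransford of the Stone--Weierstrass theorem, Zorn's lemma gives a minimal supremum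
  functional \<open>p\<close> under which \<open>W\<close> still stays at distance \<open>d\<close> from \<open>f\<close>. If a multiplier \<open>\<phi>\<close> took
  values below \<open>\<alpha>\<close> and above \<open>\<beta> > \<alpha>\<close> on the closed set of \<open>p\<close>, then by minimality
  \<open>f\<close> could be approximated better by some \<open>g1\<close> where \<open>\<phi>\<close> is not large and by some \<open>g2\<close> where
  \<open>\<phi>\<close> is not small, on some nonzero band; blending both with the multiplier \<open>(1 - \<phi>^m)^k\<close> would
  give a contradiction. So all multipliers are constant on the closed set of \<open>p\<close>, which by
  separation is a single state \<open>\<sigma>\<close>, and \<open>W(\<sigma>)\<close> stays at distance \<open>d\<close> from \<open>f(\<sigma>)\<close>.\<close>

section \<open>Principal projections\<close>

text \<open>Two features shape the argument. First, \<Lambda> is not totally ordered, so the failure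
  of an inequality does not give the reverse one. Each failure is therefore turned into a strict
  estimate on some nonzero band (\<open>orth_not_nonpos_component\<close>), and the final
  contradiction is that such a band is zero. Second, Dedekind completeness takes over the role of
  compactness of \<Sigma>: the pointwise infimum of a chain of supremum functionals exists and is
  again one, and extreme points are recovered as minimal functionals. The distance \<open>d\<close>
  lies in E while states act on \<Lambda>-valued functions. Dividing the truncation of
  \<open>N (f s - g s)\<close> at \<open>d\<close> by \<open>d\<close> moves the constraint of
  staying at distance \<open>d\<close> into \<Lambda>, where it reads
  \<open>principal_projection d \<le> p (Q g)\<close>. Since \<open>orth_action\<close> and
  \<open>state_value\<close> are given by descriptions, the existence of the module action and of
  the limits along nets of pure states has to be established as well.\<close>

lemma vl_archimedean:
  fixes x y :: "'e::dedekind_complete_vector_lattice"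
  assumes "\<And>n::nat. real n *\<^sub>R x \<le> y" shows "x \<le> 0"
proof -
  let ?A = "range (\<lambda>n::nat. real n *\<^sub>R x)"
  have bdd: "bdd_above ?A" using assms by (intro bdd_aboveI[of _ y]) auto
  have "Sup ?A \<le> Sup ?A - x"
  proof (rule cSup_least)
    fix z assume "z \<in> ?A"
    then obtain n where z: "z = real n *\<^sub>R x" by auto
    have "real (Suc n) *\<^sub>R x \<le> Sup ?A" by (rule cSup_upper[OF rangeI bdd])
    then show "z \<le> Sup ?A - x" by (simp add: z scaleR_add_left algebra_simps)
  qed simp
  then show ?thesis by (simp add: algebra_simps)
qed

lemma vl_le_epsI:
  fixes x y u :: "'e::dedekind_complete_vector_lattice"
  assumes "\<And>\<epsilon>. 0 < \<epsilon> \<Longrightarrow> x \<le> y + \<epsilon> *\<^sub>R u" shows "x \<le> y"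
proof -
  have "x - y \<le> 0"
  proof (rule vl_archimedean)
    fix n :: nat
    have "x - y \<le> (1 / real (Suc n)) *\<^sub>R u"
      using assms[of "1 / real (Suc n)"] by (simp add: algebra_simps)
    then have "real (Suc n) *\<^sub>R (x - y) \<le> real (Suc n) *\<^sub>R ((1 / real (Suc n)) *\<^sub>R u)"
      by (rule scaleR_left_mono) simp
    then have a: "real n *\<^sub>R (x - y) + (x - y) \<le> u" by (simp add: scaleR_add_left algebra_simps)
    \<comment> \<open>Division by \<open>Suc n\<close> avoids \<open>n = 0\<close> but leaves a
      surplus summand \<open>x - y\<close>; it is absorbed into a bound that does not depend on
      \<open>n\<close>.\<close>
    show "real n *\<^sub>R (x - y) \<le> u + \<bar>x - y\<bar>"
    proof -
      have "real n *\<^sub>R (x - y) \<le> u - (x - y)" using a by (simp add: algebra_simps)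
      also have "\<dots> \<le> u + \<bar>x - y\<bar>" using abs_ge_minus_self[of "x - y"] by simp
      finally show ?thesis .
    qed
  qed
  then show ?thesis by simp
qed

lemma vl_eq_zero_epsI:
  fixes x u :: "'e::dedekind_complete_vector_lattice"
  assumes "\<And>\<epsilon>. 0 < \<epsilon> \<Longrightarrow> \<bar>x\<bar> \<le> \<epsilon> *\<^sub>R u" shows "x = 0"
  using vl_le_epsI[of "\<bar>x\<bar>" 0 u] assms by simp

lemma pprt_nprt_disjoint:
  fixes w :: "'e::lattice_ab_group_add" shows "inf (pprt w) (- nprt w) = 0"
proof -
  have "inf (pprt w) (- nprt w) = inf (pprt w + nprt w) 0 - nprt w"
    using add_inf_distrib_right[of "pprt w + nprt w" 0 "- nprt w"] by simp
  also have "\<dots> = inf w 0 - nprt w" by (simp only: prts[symmetric])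
  finally show ?thesis by (simp add: nprt_def)
qed

lemma orth_app_mono:
  "0 \<le> T \<Longrightarrow> x \<le> y \<Longrightarrow> orth_app T x \<le> orth_app T y"
  using linear_diff[OF linear_orth_app[of T], of y x]
  unfolding less_eq_orth_def orth_app_zero by (metis diff_ge_0_iff_ge)

lemma orth_app_nonneg: "0 \<le> T \<Longrightarrow> 0 \<le> x \<Longrightarrow> 0 \<le> orth_app T x"
  by (simp add: less_eq_orth_def orth_app_simps)

lemma orth_app_mono_left: "S \<le> T \<Longrightarrow> 0 \<le> x \<Longrightarrow> orth_app S x \<le> orth_app T x"
  by (simp add: less_eq_orth_def)

lemma orth_leI: "(\<And>x. 0 \<le> x \<Longrightarrow> orth_app S x \<le> orth_app T x) \<Longrightarrow> S \<le> T"
  by (simp add: less_eq_orth_def)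

lemma vl_abs_ge:
  fixes T :: "'e::lattice_ab_group_add_abs" shows "T \<le> \<bar>T\<bar>" "- T \<le> \<bar>T\<bar>"
  by (simp_all add: abs_lattice)

lemmas orth_linear_simps =
  linear_add[OF linear_orth_app] linear_diff[OF linear_orth_app] linear_neg[OF linear_orth_app]
  linear_scale[OF linear_orth_app] linear_0[OF linear_orth_app]

lemma orth_one_nonneg: "0 \<le> (1 :: 'e::dedekind_complete_vector_lattice orth)"
  by (rule orth_leI) (simp add: orth_app_simps)


text \<open>The projection onto the band generated by \<open>v\<close>: on the positive cone it is
  the classical supremum of the truncations of \<open>x\<close> at the multiples of
  \<open>v\<close>.\<close>

definition principal_projection :: "'e::dedekind_complete_vector_lattice \<Rightarrow> 'e orth"
  where "principal_projection v = Orth (cone_ext (\<lambda>x. SUP n::nat. inf (real n *\<^sub>R v) x))"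

lemma principal_projection:
  fixes v :: "'e::dedekind_complete_vector_lattice"
  assumes v: "0 \<le> v"
  shows principal_projection_ge: "0 \<le> x \<Longrightarrow> inf (real n *\<^sub>R v) x \<le> orth_app (principal_projection v) x"
    and principal_projection_least:
      "0 \<le> x \<Longrightarrow> (\<And>n::nat. inf (real n *\<^sub>R v) x \<le> z) \<Longrightarrow> orth_app (principal_projection v) x \<le> z"
proof -
  define R where "R x = (SUP n::nat. inf (real n *\<^sub>R v) x)" for x
  have bdd: "bdd_above (range (\<lambda>n::nat. inf (real n *\<^sub>R v) x))" for x
    by (intro bdd_aboveI[of _ x]) auto
  have up: "inf (real n *\<^sub>R v) x \<le> R x" for n :: nat and x
    unfolding R_def by (intro cSUP_upper bdd) simp
  have least: "R x \<le> z" if "\<And>n::nat. inf (real n *\<^sub>R v) x \<le> z" for x z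
    unfolding R_def using that by (intro cSUP_least) auto
  have nv: "0 \<le> real n *\<^sub>R v" for n :: nat using v by (simp add: scaleR_nonneg_nonneg)
  have radd: "R (x + y) = R x + R y" if xy: "0 \<le> x" "0 \<le> y" for x y
  proof (rule antisym)
    show "R (x + y) \<le> R x + R y"
    proof (rule least)
      fix n :: nat
      have "inf (real n *\<^sub>R v) (x + y) \<le> inf x (real n *\<^sub>R v) + inf y (real n *\<^sub>R v)"
        using inf_add_le[OF xy nv] by (simp add: inf_commute)
      also have "\<dots> \<le> R x + R y" using up[of n x] up[of n y] by (simp add: inf_commute add_mono)
      finally show "inf (real n *\<^sub>R v) (x + y) \<le> R x + R y" .
    qed
    have "R x \<le> R (x + y) - R y"
    proof (rule least)
      fix n :: nat
      have "R y \<le> R (x + y) - inf (real n *\<^sub>R v) x"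
      proof (rule least)
        fix m :: nat
        have "inf (real n *\<^sub>R v) x + inf (real m *\<^sub>R v) y \<le> inf (real (n + m) *\<^sub>R v) (x + y)"
          by (intro inf_greatest) (auto simp: scaleR_add_left intro!: add_mono)
        also have "\<dots> \<le> R (x + y)" by (rule up)
        finally show "inf (real m *\<^sub>R v) y \<le> R (x + y) - inf (real n *\<^sub>R v) x"
          by (simp only: le_diff_eq add.commute)
      qed
      then show "inf (real n *\<^sub>R v) x \<le> R (x + y) - R y" by (simp only: le_diff_eq add.commute)
    qed
    then show "R x + R y \<le> R (x + y)" by (simp add: algebra_simps)
  qed
  have rsc: "R (c *\<^sub>R x) \<le> c *\<^sub>R R x" if c: "0 < c" and x: "0 \<le> x" for c x
  proof (rule least)
    fix n :: nat
    \<comment> \<open>The factor \<open>n / c\<close> need not be an integer, so a natural number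
      above it is used.\<close>
    obtain m :: nat where m: "real n / c \<le> real m" using real_arch_simple by blast
    have "real n *\<^sub>R v = c *\<^sub>R ((real n / c) *\<^sub>R v)" using c by simp
    then have "inf (real n *\<^sub>R v) (c *\<^sub>R x) = c *\<^sub>R inf ((real n / c) *\<^sub>R v) x"
      by (simp only: vl_scaleR_inf[OF c])
    also have "\<dots> \<le> c *\<^sub>R inf (real m *\<^sub>R v) x"
      using m c v by (intro scaleR_left_mono inf_mono scaleR_right_mono) auto
    also have "\<dots> \<le> c *\<^sub>R R x" using c by (intro scaleR_left_mono up) auto
    finally show "inf (real n *\<^sub>R v) (c *\<^sub>R x) \<le> c *\<^sub>R R x" .
  qed
  have lin: "linear (cone_ext R)" by (rule cone_ext(1)[OF radd rsc])
  have on: "cone_ext R x = R x" if "0 \<le> x" for x by (rule cone_ext(2)[OF radd rsc that])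
  have "orthomorphism (cone_ext R)"
  proof (rule orthomorphism_sandwich[OF orthomorphism_zero orthomorphism_id lin])
    fix x :: 'e assume x: "0 \<le> x"
    show "0 \<le> cone_ext R x" using up[of 0 x] x by (simp add: on inf_absorb1)
    show "cone_ext R x \<le> x" using x by (auto simp: on intro!: least)
  qed
  then have "orth_app (principal_projection v) x = R x" if "0 \<le> x" for x
    using that by (simp add: principal_projection_def R_def[abs_def, symmetric] orth_app_Orth on)
  then show "0 \<le> x \<Longrightarrow> inf (real n *\<^sub>R v) x \<le> orth_app (principal_projection v) x"
    "0 \<le> x \<Longrightarrow> (\<And>n::nat. inf (real n *\<^sub>R v) x \<le> z) \<Longrightarrow> orth_app (principal_projection v) x \<le> z"
    using up least by auto
qed

text \<open>The algebraic form of a band projection; \<open>band_projection_iff\<close> identifies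
  the two notions. It permits calculations in the algebra without naming the band.\<close>

definition component :: "'e::dedekind_complete_vector_lattice orth \<Rightarrow> bool"
  where "component b \<longleftrightarrow> b * b = b \<and> 0 \<le> b \<and> b \<le> 1"

lemma component_nonneg: "component b \<Longrightarrow> 0 \<le> b"
  and component_le_one: "component b \<Longrightarrow> b \<le> 1"
  and component_idem: "component b \<Longrightarrow> b * b = b"
  by (simp_all add: component_def)

lemma component_compl: "component b \<Longrightarrow> component (1 - b)"
  by (simp add: component_def left_diff_distrib right_diff_distrib)

lemma component_0: "component 0" and component_1: "component 1"
  by (simp_all add: component_def orth_one_nonneg)

lemma component_app_idem: "component b \<Longrightarrow> orth_app b (orth_app b x) = orth_app b x"
  by (metis component_idem orth_app_mult)

lemma component_app_compl:
  "component b \<Longrightarrow> orth_app b (orth_app (1 - b) x) = 0"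
  "component b \<Longrightarrow> orth_app (1 - b) (orth_app b x) = 0"
  by (simp_all add: orth_app_simps orth_linear_simps component_app_idem)

lemma component_app_le: "component b \<Longrightarrow> 0 \<le> x \<Longrightarrow> orth_app b x \<le> x"
  using orth_app_mono_left[OF component_le_one, of b x] by (simp add: orth_app_simps)

lemma component_split: "x = orth_app b x + orth_app (1 - b) x"
  by (simp add: orth_app_simps)

text \<open>The infimum is mapped below 0 both by \<open>b\<close> and by \<open>1 - b\<close>, and
  these add up to the identity.\<close>

lemma component_disjoint:
  assumes b: "component b" and x: "0 \<le> x" and y: "0 \<le> y"
  shows "inf (orth_app b x) (orth_app (1 - b) y) = 0"
proof (rule antisym)
  let ?w = "inf (orth_app b x) (orth_app (1 - b) y)"
  have b': "component (1 - b)" using b by (rule component_compl)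
  have "orth_app (1 - b) ?w \<le> orth_app (1 - b) (orth_app b x)"
    by (rule orth_app_mono[OF component_nonneg[OF b']]) simp
  moreover have "orth_app b ?w \<le> orth_app b (orth_app (1 - b) y)"
    by (rule orth_app_mono[OF component_nonneg[OF b]]) simp
  ultimately have "orth_app b ?w + orth_app (1 - b) ?w \<le> 0"
    using b by (simp add: component_app_compl add_nonpos_nonpos)
  then show "?w \<le> 0" using component_split[of ?w b] by simp
  show "0 \<le> ?w" using x y component_nonneg[OF b] component_nonneg[OF b'] by (simp add: orth_app_nonneg)
qed

lemma component_principal_projection:
  fixes v :: "'e::dedekind_complete_vector_lattice"
  assumes v: "0 \<le> v"
  shows "component (principal_projection v)"
proof -
  let ?P = "principal_projection v"
  have le: "orth_app ?P x \<le> x" if "0 \<le> x" for x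
    using that by (intro principal_projection_least[OF v]) auto
  have ge: "0 \<le> orth_app ?P x" if "0 \<le> x" for x
    using principal_projection_ge[OF v that, of 0] that by (simp add: inf_absorb1)
  have "?P * ?P = ?P"
  proof (rule orth_eq_coneI)
    fix x :: 'e assume x: "0 \<le> x"
    have "orth_app ?P x \<le> orth_app ?P (orth_app ?P x)"
    proof (rule principal_projection_least[OF v x])
      fix n :: nat
      have "inf (real n *\<^sub>R v) x \<le> inf (real n *\<^sub>R v) (orth_app ?P x)"
        using principal_projection_ge[OF v x] by simp
      also have "\<dots> \<le> orth_app ?P (orth_app ?P x)"
        by (rule principal_projection_ge[OF v ge[OF x]])
      finally show "inf (real n *\<^sub>R v) x \<le> orth_app ?P (orth_app ?P x)" .
    qed
    then show "orth_app (?P * ?P) x = orth_app ?P x"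
      using le[OF ge[OF x]] by (simp add: orth_app_mult antisym)
  qed
  then show ?thesis
    unfolding component_def using le ge by (intro conjI orth_leI) (simp_all only: orth_app_simps)
qed

lemma principal_projection_self: "0 \<le> v \<Longrightarrow> orth_app (principal_projection v) v = v"
  by (rule antisym) (use principal_projection_ge[of v v 1]
    component_app_le[OF component_principal_projection, of v v] in simp_all)

lemma inf_scaleR_eq_0:
  fixes v x :: "'e::dedekind_complete_vector_lattice"
  assumes "0 \<le> v" "0 \<le> x" "0 \<le> c" "inf v x = 0" shows "inf (c *\<^sub>R v) x = 0"
proof -
  have "vl_disjoint v x" using assms by (simp add: vl_disjoint_def)
  then have "vl_disjoint (c *\<^sub>R v) x" by (rule vl_disjoint_scaleR)
  then show ?thesis using assms by (simp add: vl_disjoint_def scaleR_nonneg_nonneg)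
qed

lemma principal_projection_disjoint:
  assumes "0 \<le> v" "0 \<le> x" "inf v x = 0" shows "orth_app (principal_projection v) x = 0"
proof (rule antisym)
  show "orth_app (principal_projection v) x \<le> 0"
    using assms by (intro principal_projection_least) (simp_all add: inf_scaleR_eq_0)
  show "0 \<le> orth_app (principal_projection v) x"
    by (rule orth_app_nonneg[OF component_nonneg[OF component_principal_projection[OF assms(1)]] assms(2)])
qed

text \<open>The infimum can be added to every truncation at \<open>n v\<close> and stays below the
  truncation at \<open>(n + 1) v\<close>. Hence it can be added to the supremum of the truncations
  without increasing it.\<close>

lemma principal_projection_compl_disjoint:
  assumes v: "0 \<le> v" and x: "0 \<le> x"
  shows "inf v (x - orth_app (principal_projection v) x) = 0"
proof (rule antisym)
  let ?P = "principal_projection v"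
  let ?w = "inf v (x - orth_app ?P x)"
  have "orth_app ?P x \<le> orth_app ?P x - ?w"
  proof (rule principal_projection_least[OF v x])
    fix n :: nat
    have "inf (real n *\<^sub>R v) x + ?w \<le> inf (real (Suc n) *\<^sub>R v) x"
    proof (rule inf_greatest)
      have "inf (real n *\<^sub>R v) x + ?w \<le> real n *\<^sub>R v + v" by (intro add_mono) auto
      then show "inf (real n *\<^sub>R v) x + ?w \<le> real (Suc n) *\<^sub>R v" by (simp add: scaleR_add_left add.commute)
      have "inf (real n *\<^sub>R v) x + ?w \<le> orth_app ?P x + (x - orth_app ?P x)"
        using principal_projection_ge[OF v x] by (intro add_mono) auto
      then show "inf (real n *\<^sub>R v) x + ?w \<le> x" by simp
    qed
    also have "\<dots> \<le> orth_app ?P x" by (rule principal_projection_ge[OF v x])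
    finally show "inf (real n *\<^sub>R v) x \<le> orth_app ?P x - ?w" by (simp only: le_diff_eq)
  qed
  then show "?w \<le> 0" by (simp only: le_diff_eq add_le_same_cancel1)
  show "0 \<le> ?w" using v component_app_le[OF component_principal_projection[OF v] x] by simp
qed

text \<open>Stands in for the case distinction on the sign of \<open>w\<close>: both signs occur,
  each on one of two complementary bands. The witness projects onto the band of the positive
  part.\<close>

lemma component_separating:
  fixes w :: "'e::dedekind_complete_vector_lattice"
  obtains b where "component b" "orth_app b w = pprt w" "orth_app (1 - b) w = nprt w"
proof
  let ?P = "principal_projection (pprt w)"
  show "component ?P" by (rule component_principal_projection) simp
  have 1: "orth_app ?P (pprt w) = pprt w" by (rule principal_projection_self) simp
  have "orth_app ?P (- nprt w) = 0"
    by (rule principal_projection_disjoint) (simp_all add: pprt_nprt_disjoint)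
  then have 2: "orth_app ?P (nprt w) = 0" by (simp add: orth_linear_simps)
  have "orth_app ?P w = orth_app ?P (pprt w + nprt w)" by (simp only: prts[symmetric])
  then show 3: "orth_app ?P w = pprt w" using 1 2 by (simp add: orth_linear_simps)
  have "orth_app (1 - ?P) w = w - pprt w" using 3 by (simp add: orth_app_simps)
  also have "\<dots> = nprt w" using prts[of w] by (simp add: algebra_simps)
  finally show "orth_app (1 - ?P) w = nprt w" .
qed

lemma abs_orth_app_le:
  assumes "0 \<le> T" shows "\<bar>orth_app T x\<bar> \<le> orth_app T \<bar>x\<bar>"
  using orth_app_mono[OF assms vl_abs_ge(1)[of x]] orth_app_mono[OF assms vl_abs_ge(2)[of x]]
  by (intro abs_leI) (simp_all add: orth_linear_simps)

text \<open>Band preservation makes \<open>T (b x)\<close> disjoint from its own part in the band of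
  \<open>1 - b\<close>, so that part is zero. Used for \<open>b\<close> and for
  \<open>1 - b\<close>, this gives commutation.\<close>

lemma component_commute:
  assumes b: "component b" shows "b * T = T * b"
proof (rule orth_eqI)
  have *: "orth_app (1 - b) (orth_app T (orth_app b x)) = 0" if b: "component b" and "0 \<le> x" for b x
  proof -
    let ?w = "orth_app T (orth_app b x)"
    have b': "component (1 - b)" using b by (rule component_compl)
    have p: "0 \<le> orth_app b x" "0 \<le> orth_app (1 - b) \<bar>?w\<bar>"
      using that component_nonneg[OF b] component_nonneg[OF b'] by (simp_all add: orth_app_nonneg)
    have "vl_disjoint (orth_app b x) (orth_app (1 - b) \<bar>?w\<bar>)"
      using component_disjoint[OF b that(2), of "\<bar>?w\<bar>"] p by (simp add: vl_disjoint_def)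
    then have "vl_disjoint ?w (orth_app (1 - b) \<bar>?w\<bar>)"
      by (rule orthomorphism_disjoint[OF orthomorphism_orth_app])
    then have "inf \<bar>?w\<bar> (orth_app (1 - b) \<bar>?w\<bar>) = 0" using p by (simp add: vl_disjoint_def)
    moreover have "orth_app (1 - b) \<bar>?w\<bar> \<le> \<bar>?w\<bar>" using b' by (simp add: component_app_le)
    ultimately have "orth_app (1 - b) \<bar>?w\<bar> = 0" by (simp add: inf_absorb2)
    then show ?thesis using abs_orth_app_le[OF component_nonneg[OF b'], of ?w] by simp
  qed
  have **: "orth_app (1 - b) (orth_app T (orth_app b x)) = 0" if b: "component b" for b x
  proof -
    have "orth_app (1 - b) (orth_app T (orth_app b (pprt x + nprt x))) = 0"
      using *[OF b, of "pprt x"] *[OF b, of "- nprt x"] unfolding orth_linear_simps by simp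
    then show ?thesis by (simp only: prts[symmetric])
  qed
  fix x
  have "orth_app b (orth_app T (orth_app (1 - b) x)) = 0"
    using **[OF component_compl[OF b], of x] by simp
  moreover have "orth_app (1 - b) (orth_app T (orth_app b x)) = 0" by (rule **[OF b])
  ultimately show "orth_app (b * T) x = orth_app (T * b) x"
    by (simp add: orth_app_simps orth_linear_simps)
qed

lemma component_mult: "component a \<Longrightarrow> component b \<Longrightarrow> component (a * b)"
proof -
  assume a: "component a" and b: "component b"
  have "a * b * (a * b) = a * (b * a) * b" by (simp add: mult.assoc)
  also have "\<dots> = a * a * (b * b)" by (simp add: component_commute[OF b, of a] mult.assoc)
  finally have "a * b * (a * b) = a * b" using a b by (simp add: component_idem)
  moreover have "orth_app (a * b) x \<le> x" "0 \<le> orth_app (a * b) x" if "0 \<le> x" for x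
  proof -
    have "orth_app a (orth_app b x) \<le> orth_app b x"
      using a b that by (simp add: component_app_le orth_app_nonneg component_nonneg)
    also have "\<dots> \<le> x" using b that by (rule component_app_le)
    finally show "orth_app (a * b) x \<le> x" by (simp add: orth_app_mult)
    show "0 \<le> orth_app (a * b) x" using a b that by (simp add: orth_app_mult component_nonneg orth_app_nonneg)
  qed
  ultimately show ?thesis unfolding component_def by (intro conjI orth_leI) (simp_all only: orth_app_simps)
qed

section \<open>Step orthomorphisms\<close>

text \<open>The components of a combination need not be disjoint. Sums are then step orthomorphisms
  at once; absolute values are dealt with in \<open>norm_step_action_affine\<close>.\<close>

inductive_set step_orth :: "'e::dedekind_complete_vector_lattice orth set" where
  zero: "0 \<in> step_orth"
| add: "S \<in> step_orth \<Longrightarrow> component b \<Longrightarrow> S + r *\<^sub>R b \<in> step_orth"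

lemma scaleR_orth_mult:
  fixes S T :: "'e::dedekind_complete_vector_lattice orth"
  shows "(r *\<^sub>R S) * T = r *\<^sub>R (S * T)" "S * (r *\<^sub>R T) = r *\<^sub>R (S * T)"
  by (rule orth_eqI, simp add: orth_app_simps orth_linear_simps)+

instance orth :: (dedekind_complete_vector_lattice) real_algebra
  by standard (simp_all add: scaleR_orth_mult)

lemma step_orth_commute: "S \<in> step_orth \<Longrightarrow> S * T = T * S"
  by (induction rule: step_orth.induct) (simp_all add: distrib_left distrib_right component_commute[of _ T])

text \<open>One binary digit of \<open>u\<close> measured against \<open>x\<close>: the digit is set
  on the band of the positive part of \<open>u - r x\<close>, and subtracting \<open>r x\<close>
  there halves the bound everywhere.\<close>

lemma dyadic_step:
  fixes u x :: "'e::dedekind_complete_vector_lattice"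
  assumes u: "0 \<le> u" "u \<le> (2 * r) *\<^sub>R x" and r: "0 \<le> r" and x: "0 \<le> x"
  obtains b where "component b" "0 \<le> u - r *\<^sub>R orth_app b x" "u - r *\<^sub>R orth_app b x \<le> r *\<^sub>R x"
proof -
  obtain b where b: "component b" "orth_app b (u - r *\<^sub>R x) = pprt (u - r *\<^sub>R x)"
    "orth_app (1 - b) (u - r *\<^sub>R x) = nprt (u - r *\<^sub>R x)"
    by (rule component_separating)
  let ?v = "u - r *\<^sub>R orth_app b x"
  have b': "component (1 - b)" using b(1) by (rule component_compl)
  have eq: "?v = orth_app b (u - r *\<^sub>R x) + orth_app (1 - b) u"
    by (simp add: orth_app_simps orth_linear_simps)
  have "orth_app (1 - b) u \<le> r *\<^sub>R orth_app (1 - b) x"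
    using b(3) nprt_le_zero[of "u - r *\<^sub>R x"]
    by (metis (no_types) orth_linear_simps(2,4) diff_le_0_iff_le)
  moreover have "orth_app b (u - r *\<^sub>R x) \<le> orth_app b (r *\<^sub>R x)"
  proof (intro orth_app_mono component_nonneg b)
    have "u \<le> r *\<^sub>R x + r *\<^sub>R x" using u(2) by (simp only: scaleR_add_left[symmetric] mult_2)
    then show "u - r *\<^sub>R x \<le> r *\<^sub>R x" by (simp add: diff_le_eq)
  qed
  ultimately have "?v \<le> orth_app b (r *\<^sub>R x) + r *\<^sub>R orth_app (1 - b) x" unfolding eq by (intro add_mono)
  also have "\<dots> = r *\<^sub>R x" by (simp add: orth_linear_simps orth_app_simps algebra_simps)
  finally have "?v \<le> r *\<^sub>R x" .
  moreover have "0 \<le> ?v"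
    unfolding eq b(2) by (intro add_nonneg_nonneg orth_app_nonneg component_nonneg b' u zero_le_pprt)
  ultimately show ?thesis using that[OF b(1)] by simp
qed

text \<open>The first \<open>n\<close> binary digits of the quotient of \<open>u\<close> by
  \<open>x\<close>. The bound \<open>1 - (1/2)^n\<close> is the sum of the weights of all digits and
  keeps the approximant below the identity.\<close>

lemma dyadic_approx:
  fixes u x :: "'e::dedekind_complete_vector_lattice"
  assumes u: "0 \<le> u" "u \<le> x"
  shows "\<exists>S\<in>step_orth. 0 \<le> S \<and> S \<le> (1 - (1/2)^n) *\<^sub>R 1 \<and> orth_app S x \<le> u \<and>
    u - orth_app S x \<le> (1/2)^n *\<^sub>R x"
proof (induction n)
  case 0
  show ?case using u by (intro bexI[of _ 0] step_orth.zero) (simp_all add: orth_app_simps)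
next
  case (Suc n)
  then obtain S where S: "S \<in> step_orth" "0 \<le> S" "S \<le> (1 - (1/2)^n) *\<^sub>R 1" "orth_app S x \<le> u"
    "u - orth_app S x \<le> (1/2)^n *\<^sub>R x" by blast
  define r :: real where "r = (1/2)^Suc n"
  have r: "0 \<le> r" "(1/2)^n = 2 * r" by (simp_all add: r_def)
  have x: "0 \<le> x" using u by (rule order_trans)
  obtain b where b: "component b" "0 \<le> (u - orth_app S x) - r *\<^sub>R orth_app b x"
    "(u - orth_app S x) - r *\<^sub>R orth_app b x \<le> r *\<^sub>R x"
    using dyadic_step[of "u - orth_app S x" r x] S(4,5) r x by auto
  show ?case
  proof (intro bexI[of _ "S + r *\<^sub>R b"] conjI step_orth.add S b)
    show "0 \<le> S + r *\<^sub>R b" using S b r by (simp add: component_nonneg scaleR_nonneg_nonneg)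
    have "S + r *\<^sub>R b \<le> (1 - (1/2)^n) *\<^sub>R 1 + r *\<^sub>R 1"
      using S b r by (intro add_mono scaleR_left_mono component_le_one) auto
    then show "S + r *\<^sub>R b \<le> (1 - (1 / 2) ^ Suc n) *\<^sub>R 1"
      by (simp add: scaleR_add_left[symmetric] r r_def[symmetric] del: power_Suc)
    show "orth_app (S + r *\<^sub>R b) x \<le> u" using b(2) by (simp add: orth_app_simps algebra_simps)
    show "u - orth_app (S + r *\<^sub>R b) x \<le> (1 / 2) ^ Suc n *\<^sub>R x"
      using b(3) by (simp add: orth_app_simps algebra_simps r_def)
  qed
qed

lemma half_power_small: "0 < (\<epsilon>::real) \<Longrightarrow> \<exists>n. (1/2)^n \<le> \<epsilon>"
  using real_arch_pow_inv[of \<epsilon> "1/2"] by (auto intro: less_imp_le)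

text \<open>Order boundedness enters here: \<open>u\<close> is a uniform limit of step multiples of \<open>x\<close>, and \<open>D\<close>
  commutes with step orthomorphisms.\<close>

lemma orth_nonpos_below:
  assumes u: "0 \<le> u" "u \<le> x" and b: "component b" and D: "orth_app b (orth_app D x) \<le> 0"
  shows "orth_app b (orth_app D u) \<le> 0"
proof (rule vl_le_epsI[where u = "orth_app \<bar>D\<bar> x"])
  fix \<epsilon> :: real assume "0 < \<epsilon>"
  then obtain n where n: "(1/2)^n \<le> \<epsilon>" using half_power_small by blast
  have x: "0 \<le> x" using u by (rule order_trans)
  obtain S where S: "S \<in> step_orth" "0 \<le> S" "orth_app S x \<le> u" "u - orth_app S x \<le> (1/2)^n *\<^sub>R x"
    using dyadic_approx[OF u, of n] by blast
  let ?r = "u - orth_app S x"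
  have r: "0 \<le> ?r" using S by simp
  have comm: "orth_app b (orth_app D (orth_app S x)) = orth_app S (orth_app b (orth_app D x))"
    using step_orth_commute[OF S(1), of "b * D"] by (metis mult.assoc orth_app_mult)
  have "orth_app b (orth_app D u) = orth_app S (orth_app b (orth_app D x)) + orth_app b (orth_app D ?r)"
    unfolding comm[symmetric] by (simp add: orth_linear_simps)
  moreover have "orth_app S (orth_app b (orth_app D x)) \<le> 0"
    using orth_app_mono[OF S(2) D] by (simp add: orth_linear_simps)
  moreover have "orth_app b (orth_app D ?r) \<le> \<epsilon> *\<^sub>R orth_app \<bar>D\<bar> x"
  proof -
    have "orth_app b (orth_app D ?r) \<le> orth_app b (orth_app \<bar>D\<bar> ?r)"
      using r by (intro orth_app_mono orth_app_mono_left component_nonneg b vl_abs_ge)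
    also have "\<dots> \<le> orth_app \<bar>D\<bar> ?r" using r by (intro component_app_le b orth_app_nonneg) auto
    also have "\<dots> \<le> orth_app \<bar>D\<bar> (\<epsilon> *\<^sub>R x)"
      by (rule orth_app_mono[OF abs_ge_zero order_trans[OF S(4) scaleR_right_mono[OF n x]]])
    finally show ?thesis by (simp add: orth_linear_simps)
  qed
  ultimately show "orth_app b (orth_app D u) \<le> 0 + \<epsilon> *\<^sub>R orth_app \<bar>D\<bar> x" by (simp only: add_mono)
qed

text \<open>On the band where \<open>D x\<close> is positive the Riesz-Kantorovich supremum over the
  interval from 0 to \<open>x\<close> is reached at \<open>x\<close>, on the complement at 0. As a
  consequence all lattice operations of orthomorphisms are pointwise on the positive cone.\<close>

lemma orth_app_pprt:
  assumes x: "0 \<le> x" shows "orth_app (pprt D) x = pprt (orth_app D x)"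
proof (rule antisym)
  have D: "orth_app (pprt D) = rk_pos (orth_app D)"
    by (simp add: pprt_def sup_orth_def orth_app_Orth rk_pos(1)[OF orthomorphism_orth_app])
  have "rk_pos (orth_app D) x = Sup (orth_app D ` {0..x})"
    using x by (simp add: rk_pos_def cone_ext_def orth_linear_simps)
  also have "\<dots> \<le> pprt (orth_app D x)"
  proof (rule cSup_least)
    show "orth_app D ` {0..x} \<noteq> {}" using x by simp
    fix y assume "y \<in> orth_app D ` {0..x}"
    then obtain u where u: "y = orth_app D u" "0 \<le> u" "u \<le> x" by auto
    obtain b where b: "component b" "orth_app b (orth_app D x) = pprt (orth_app D x)"
      "orth_app (1 - b) (orth_app D x) = nprt (orth_app D x)"
      by (rule component_separating)
    have "orth_app (1 - b) (orth_app D u) \<le> 0"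
      using u b by (intro orth_nonpos_below[OF u(2,3)] component_compl) auto
    moreover have "orth_app b (orth_app (- D) (x - u)) \<le> 0"
      using u b by (intro orth_nonpos_below[of "x - u" x]) (auto simp: orth_app_simps orth_linear_simps)
    then have "orth_app b (orth_app D u) \<le> pprt (orth_app D x)"
      using b by (simp add: orth_app_simps orth_linear_simps)
    ultimately show "y \<le> pprt (orth_app D x)"
      using component_split[of "orth_app D u" b] add_mono[of "orth_app b (orth_app D u)" _ "orth_app (1 - b) (orth_app D u)" 0]
      by (simp add: u(1))
  qed
  finally show "orth_app (pprt D) x \<le> pprt (orth_app D x)" by (simp add: D)
  have "orth_app D x \<le> orth_app (pprt D) x" "0 \<le> orth_app (pprt D) x"
    using x by (auto intro!: orth_app_mono_left orth_app_nonneg simp: pprt_def)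
  then show "pprt (orth_app D x) \<le> orth_app (pprt D) x" by (simp add: pprt_def)
qed

lemma vl_sup_pprt: "sup a b = b + pprt (a - b)" for a b :: "'e::lattice_ab_group_add"
  by (simp add: pprt_def add_sup_distrib_left)

lemma orth_app_sup: "0 \<le> x \<Longrightarrow> orth_app (sup S T) x = sup (orth_app S x) (orth_app T x)"
  by (simp add: vl_sup_pprt orth_app_simps orth_app_pprt)

lemma orth_app_inf: "0 \<le> x \<Longrightarrow> orth_app (inf S T) x = inf (orth_app S x) (orth_app T x)"
  unfolding inf_eq_neg_sup by (simp only: orth_app_simps orth_app_sup)

lemma orth_app_abs: "0 \<le> x \<Longrightarrow> orth_app \<bar>T\<bar> x = \<bar>orth_app T x\<bar>"
  by (simp add: abs_lattice orth_app_sup orth_app_simps)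

section \<open>The algebra of orthomorphisms\<close>

declare diff_inf_eq_sup [simp del] diff_sup_eq_inf [simp del]

lemma orth_mult_mono:
  fixes S T U :: "'e::dedekind_complete_vector_lattice orth"
  assumes "S \<le> T" "0 \<le> U" shows "U * S \<le> U * T" "S * U \<le> T * U"
  unfolding less_eq_orth_def orth_app_mult
  using assms by (blast intro: orth_app_mono orth_app_mono_left orth_app_nonneg)+

lemma orth_mult_nonneg: "0 \<le> S \<Longrightarrow> 0 \<le> T \<Longrightarrow> 0 \<le> S * T"
  for S T :: "'e::dedekind_complete_vector_lattice orth"
  using orth_mult_mono(1)[of 0 T S] by simp

instance orth :: (dedekind_complete_vector_lattice) lattice_ring
  by standard (simp_all add: orth_mult_mono)

text \<open>\<open>S u\<close> and \<open>T v\<close> are disjoint for all positive \<open>u\<close>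
  and \<open>v\<close>, because both can be enlarged to the argument \<open>u + v\<close>. So
  \<open>T x\<close> is disjoint from \<open>S (T x)\<close>, and band preservation of
  \<open>S\<close> makes \<open>S (T x)\<close> disjoint from itself.\<close>

lemma orth_disjoint_mult:
  fixes S T :: "'e::dedekind_complete_vector_lattice orth"
  assumes "0 \<le> S" "0 \<le> T" "inf S T = 0" shows "S * T = 0"
proof (rule orth_eq_coneI)
  fix x :: 'e assume x: "0 \<le> x"
  have *: "inf (orth_app S u) (orth_app T v) = 0" if uv: "0 \<le> u" "0 \<le> v" for u v
  proof (rule antisym)
    have "inf (orth_app S u) (orth_app T v) \<le> inf (orth_app S (u + v)) (orth_app T (u + v))"
      using uv assms by (intro inf_mono orth_app_mono) auto
    also have "\<dots> = orth_app (inf S T) (u + v)" using uv by (simp add: orth_app_inf)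
    finally show "inf (orth_app S u) (orth_app T v) \<le> 0" using assms by (simp add: orth_app_simps)
  qed (use uv assms in \<open>simp add: orth_app_nonneg\<close>)
  have p: "0 \<le> orth_app T x" "0 \<le> orth_app S (orth_app T x)" using x assms by (simp_all add: orth_app_nonneg)
  have "vl_disjoint (orth_app T x) (orth_app S (orth_app T x))"
    using *[OF p(1) x] p by (simp add: vl_disjoint_def inf_commute)
  then have "vl_disjoint (orth_app S (orth_app T x)) (orth_app S (orth_app T x))"
    by (rule orthomorphism_disjoint[OF orthomorphism_orth_app])
  then show "orth_app (S * T) x = orth_app 0 x" by (simp add: vl_disjoint_def orth_app_simps)
qed

lemma component_of_one:
  assumes "0 \<le> b" "b \<le> 1" "inf b (1 - b) = 0" shows "component b"
  using orth_disjoint_mult[of b "1 - b"] assms by (simp add: component_def right_diff_distrib)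

text \<open>\<open>'e orth\<close> is itself a Dedekind complete vector lattice, so everything shown
  about projections also holds one level up. Evaluation at the unit brings components of
  \<open>'e orth orth\<close> back to components of \<open>'e orth\<close>.\<close>

lemma component_app_one:
  fixes B :: "'e::dedekind_complete_vector_lattice orth orth"
  assumes "component B" shows "component (orth_app B 1)"
proof (rule component_of_one)
  show "0 \<le> orth_app B 1" using assms by (intro orth_app_nonneg component_nonneg orth_one_nonneg)
  show "orth_app B 1 \<le> 1" using assms by (intro component_app_le orth_one_nonneg)
  show "inf (orth_app B 1) (1 - orth_app B 1) = 0"
    using component_disjoint[OF assms orth_one_nonneg orth_one_nonneg] by (simp add: orth_app_simps)
qed

lemma orth_component_separating:
  fixes T :: "'e::dedekind_complete_vector_lattice orth"
  obtains b where "component b" "b * T = pprt T" "(1 - b) * T = nprt T"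
proof
  let ?P = "principal_projection (pprt T)"
  let ?b = "orth_app ?P 1"
  have P: "component ?P" by (rule component_principal_projection) simp
  show b: "component ?b" by (rule component_app_one[OF P])
  have "inf (pprt T) (1 - ?b) = 0"
    by (rule principal_projection_compl_disjoint) (simp_all add: orth_one_nonneg)
  then have "inf (1 - ?b) (pprt T) = 0" by (simp add: inf_commute)
  then have "(1 - ?b) * pprt T = 0"
    using component_nonneg[OF component_compl[OF b]] by (intro orth_disjoint_mult) auto
  then have 1: "?b * pprt T = pprt T" by (simp add: left_diff_distrib)
  \<comment> \<open>The infimum is disjoint from \<open>pprt T\<close> and hence killed by
    \<open>?P\<close>; it lies below \<open>?b\<close>, the image of 1 under \<open>?P\<close>, and
    hence is also killed by \<open>1 - ?P\<close>.\<close>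
  have "inf ?b (- nprt T) = 0"
  proof (rule antisym)
    let ?w = "inf ?b (- nprt T)"
    have w: "0 \<le> ?w" using component_nonneg[OF b] by simp
    have "inf (pprt T) ?w \<le> inf (pprt T) (- nprt T)" by (simp add: le_infI2)
    moreover have "0 \<le> inf (pprt T) ?w" using w by simp
    ultimately have "inf (pprt T) ?w = 0" by (metis antisym pprt_nprt_disjoint)
    then have "orth_app ?P ?w = 0" using w by (intro principal_projection_disjoint) auto
    moreover have "orth_app (1 - ?P) ?w \<le> orth_app (1 - ?P) ?b"
      using P by (intro orth_app_mono component_nonneg component_compl) auto
    ultimately show "?w \<le> 0"
      using component_app_compl(2)[OF P, of 1] by (simp add: orth_app_simps)
  qed (use component_nonneg[OF b] in simp)
  then have "?b * (- nprt T) = 0" using component_nonneg[OF b] by (intro orth_disjoint_mult) auto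
  then have 2: "?b * nprt T = 0" by simp
  have "?b * T = ?b * (pprt T + nprt T)" by (simp only: prts[symmetric])
  then show 3: "?b * T = pprt T" by (simp add: distrib_left 1 2)
  have "(1 - ?b) * T = T - pprt T" using 3 by (simp add: left_diff_distrib)
  also have "\<dots> = nprt T" using prts[of T] by (simp add: algebra_simps)
  finally show "(1 - ?b) * T = nprt T" .
qed

text \<open>Squares are positive, because the mixed products of positive and negative part vanish;
  \<open>b\<close> and \<open>1 - b\<close> are their own squares.\<close>

lemma idempotent_component:
  fixes b :: "'e::dedekind_complete_vector_lattice orth"
  assumes "b * b = b" shows "component b"
proof -
  have sq: "0 \<le> T * T" for T :: "'e orth"
  proof -
    have 1: "pprt T * (- nprt T) = 0" by (rule orth_disjoint_mult) (simp_all add: pprt_nprt_disjoint)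
    have 2: "(- nprt T) * pprt T = 0"
      by (rule orth_disjoint_mult) (simp_all add: pprt_nprt_disjoint inf_commute)
    have "T * T = (pprt T + nprt T) * (pprt T + nprt T)" by (simp only: prts[symmetric])
    also have "\<dots> = pprt T * pprt T + (- nprt T) * (- nprt T)"
      using 1 2 by (simp add: distrib_left distrib_right)
    also have "\<dots> \<ge> 0" by (intro add_nonneg_nonneg orth_mult_nonneg) auto
    finally show ?thesis .
  qed
  have "(1 - b) * (1 - b) = 1 - b" using assms by (simp add: left_diff_distrib right_diff_distrib)
  then show ?thesis using sq[of b] sq[of "1 - b"] assms by (simp add: component_def)
qed

text \<open>Stands in for the comparison of \<open>T\<close> with a real number: below
  \<open>r\<close> on one band, above \<open>r\<close> on the complementary one.\<close>

lemma component_bounding: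
  fixes T :: "'e::dedekind_complete_vector_lattice orth"
  obtains c where "component c" "c * T \<le> r *\<^sub>R c" "r *\<^sub>R (1 - c) \<le> (1 - c) * T"
proof -
  obtain b where b: "component b" "b * (T - r *\<^sub>R 1) = pprt (T - r *\<^sub>R 1)"
    "(1 - b) * (T - r *\<^sub>R 1) = nprt (T - r *\<^sub>R 1)"
    by (rule orth_component_separating)
  show ?thesis
  proof
    show "component (1 - b)" by (rule component_compl[OF b(1)])
    have "(1 - b) * (T - r *\<^sub>R 1) \<le> 0" "0 \<le> b * (T - r *\<^sub>R 1)"
      unfolding b by simp_all
    then show "(1 - b) * T \<le> r *\<^sub>R (1 - b)" "r *\<^sub>R (1 - (1 - b)) \<le> (1 - (1 - b)) * T"
      by (simp_all add: right_diff_distrib)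
  qed
qed

lemma step_orth_app_one:
  fixes S :: "'e::dedekind_complete_vector_lattice orth orth"
  shows "S \<in> step_orth \<Longrightarrow> orth_app S 1 \<in> step_orth"
  by (induction rule: step_orth.induct) (auto simp: orth_app_simps intro: step_orth.intros component_app_one)

lemma step_orth_scale: "S \<in> step_orth \<Longrightarrow> r *\<^sub>R S \<in> step_orth"
  by (induction rule: step_orth.induct) (auto simp: scaleR_add_right intro: step_orth.intros)

lemma step_orth_plus: "T \<in> step_orth \<Longrightarrow> S \<in> step_orth \<Longrightarrow> S + T \<in> step_orth"
  by (induction rule: step_orth.induct) (auto simp: add.assoc[symmetric] intro: step_orth.intros)

text \<open>\<open>T\<close> may be unbounded relative to 1, so it is cut at a level
  \<open>n\<close> with \<open>1 / \<epsilon> \<le> n\<close>. Where \<open>T\<close> is below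
  \<open>n\<close> the dyadic expansion applies. Where \<open>T\<close> is above \<open>n\<close>
  one has \<open>T \<le> (1 / n) T T\<close>, which explains the summand \<open>T * T\<close> in the
  error bound.\<close>

lemma step_orth_approx_nonneg:
  fixes T :: "'e::dedekind_complete_vector_lattice orth"
  assumes T: "0 \<le> T" and \<epsilon>: "0 < \<epsilon>"
  shows "\<exists>S\<in>step_orth. \<bar>T - S\<bar> \<le> \<epsilon> *\<^sub>R (1 + T * T)"
proof -
  obtain n :: nat where n: "1 / \<epsilon> \<le> real n" "0 < n"
    using real_arch_simple[of "1 / \<epsilon>"] \<epsilon> by (metis divide_pos_pos less_le_trans of_nat_0_less_iff zero_less_one)
  obtain c where c: "component c" "c * T \<le> real n *\<^sub>R c" "real n *\<^sub>R (1 - c) \<le> (1 - c) * T"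
    by (rule component_bounding)
  define u where "u = (1 / real n) *\<^sub>R (c * T)"
  have "u \<le> (1 / real n) *\<^sub>R (real n *\<^sub>R c)" unfolding u_def using c by (intro scaleR_left_mono) auto
  then have "u \<le> c" using n by simp
  then have u: "0 \<le> u" "u \<le> 1"
    using component_le_one[OF c(1)] T c by (auto simp: u_def component_nonneg intro: order_trans scaleR_nonneg_nonneg orth_mult_nonneg)
  \<comment> \<open>The approximation is made for the quotient by \<open>n\<close>; multiplying back
    enlarges the error by the factor \<open>n\<close>.\<close>
  obtain m where m: "(1/2)^m \<le> \<epsilon> / real n" using half_power_small[of "\<epsilon> / real n"] \<epsilon> n by auto
  obtain S where S: "S \<in> step_orth" "orth_app S 1 \<le> u" "u - orth_app S 1 \<le> (1/2)^m *\<^sub>R 1"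
    using dyadic_approx[OF u, of m] by blast
  let ?S = "real n *\<^sub>R orth_app S 1"
  have eq: "T - ?S = real n *\<^sub>R (u - orth_app S 1) + (1 - c) * T"
    using n by (simp add: u_def left_diff_distrib scaleR_diff_right)
  have c': "0 \<le> 1 - c" by (rule component_nonneg[OF component_compl[OF c(1)]])
  have "0 \<le> T - ?S" unfolding eq using S c' T by (intro add_nonneg_nonneg scaleR_nonneg_nonneg orth_mult_nonneg) auto
  moreover have "T - ?S \<le> \<epsilon> *\<^sub>R (1 + T * T)"
  proof -
    have "real n *\<^sub>R (u - orth_app S 1) \<le> real n *\<^sub>R ((\<epsilon> / real n) *\<^sub>R 1)"
      using m by (intro scaleR_left_mono order_trans[OF S(3)] scaleR_right_mono orth_one_nonneg) auto
    then have 1: "real n *\<^sub>R (u - orth_app S 1) \<le> \<epsilon> *\<^sub>R 1" using n by simp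
    have "(1 / real n) *\<^sub>R (real n *\<^sub>R (1 - c)) \<le> (1 / real n) *\<^sub>R ((1 - c) * T)"
      using c n by (intro scaleR_left_mono) auto
    then have "1 - c \<le> (1 / real n) *\<^sub>R ((1 - c) * T)" using n by simp
    then have "(1 - c) * T \<le> (1 / real n) *\<^sub>R ((1 - c) * T) * T" using T by (rule mult_right_mono)
    also have "\<dots> = (1 / real n) *\<^sub>R ((1 - c) * (T * T))" by (simp add: mult.assoc)
    also have "\<dots> \<le> (1 / real n) *\<^sub>R (1 * (T * T))"
      using T c by (intro scaleR_left_mono mult_right_mono orth_mult_nonneg) (auto simp: component_nonneg)
    also have "\<dots> \<le> \<epsilon> *\<^sub>R (T * T)"
      using n \<epsilon> T by (simp add: field_simps scaleR_right_mono orth_mult_nonneg)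
    finally show ?thesis unfolding eq using 1 by (simp add: scaleR_add_right add_mono)
  qed
  ultimately have "\<bar>T - ?S\<bar> \<le> \<epsilon> *\<^sub>R (1 + T * T)" by simp
  then show ?thesis using S by (intro bexI[of _ ?S] step_orth_scale step_orth_app_one)
qed

text \<open>A form of the spectral theorem of Freudenthal. The regulator \<open>u\<close> does not
  depend on the accuracy, so this is relatively uniform approximation.\<close>

lemma step_orth_approx:
  fixes T :: "'e::dedekind_complete_vector_lattice orth"
  obtains u where "0 \<le> u" "\<And>\<epsilon>. 0 < \<epsilon> \<Longrightarrow> \<exists>S\<in>step_orth. \<bar>T - S\<bar> \<le> \<epsilon> *\<^sub>R u"
proof
  let ?p = "pprt T" and ?n = "- nprt T"
  let ?u = "(1 + ?p * ?p) + (1 + ?n * ?n)"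
  show "0 \<le> ?u" by (intro add_nonneg_nonneg orth_mult_nonneg orth_one_nonneg) auto
  fix \<epsilon> :: real assume "0 < \<epsilon>"
  then obtain S S' where S: "S \<in> step_orth" "\<bar>?p - S\<bar> \<le> \<epsilon> *\<^sub>R (1 + ?p * ?p)"
    and S': "S' \<in> step_orth" "\<bar>?n - S'\<bar> \<le> \<epsilon> *\<^sub>R (1 + ?n * ?n)"
    using step_orth_approx_nonneg[of ?p \<epsilon>] step_orth_approx_nonneg[of ?n \<epsilon>] by auto
  have "T - (S + (- 1) *\<^sub>R S') = (pprt T + nprt T) - (S - S')" by (simp only: prts[symmetric]) simp
  also have "\<dots> = (?p - S) - (?n - S')" by simp
  also have "\<bar>\<dots>\<bar> \<le> \<bar>?p - S\<bar> + \<bar>?n - S'\<bar>" by (rule abs_triangle_ineq4)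
  also have "\<dots> \<le> \<epsilon> *\<^sub>R ?u" unfolding scaleR_add_right[of \<epsilon> "1 + ?p * ?p"] by (rule add_mono[OF S(2) S'(2)])
  finally show "\<exists>S\<in>step_orth. \<bar>T - S\<bar> \<le> \<epsilon> *\<^sub>R ?u"
    using S S' by (intro bexI[of _ "S + (- 1) *\<^sub>R S'"] step_orth_plus step_orth_scale)
qed

text \<open>A step orthomorphism near \<open>T\<close> commutes with \<open>S\<close>, so the
  commutator of \<open>S\<close> and \<open>T\<close> only involves the small error.\<close>

lemma orth_mult_commute:
  fixes S T :: "'e::dedekind_complete_vector_lattice orth"
  shows "S * T = T * S"
proof -
  obtain u where u: "0 \<le> u" "\<And>\<epsilon>. 0 < \<epsilon> \<Longrightarrow> \<exists>S\<in>step_orth. \<bar>T - S\<bar> \<le> \<epsilon> *\<^sub>R u"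
    using step_orth_approx[of T] by blast
  have "S * T - T * S = 0"
  proof (rule vl_eq_zero_epsI)
    fix \<epsilon> :: real assume "0 < \<epsilon>"
    then obtain R where R: "R \<in> step_orth" "\<bar>T - R\<bar> \<le> \<epsilon> *\<^sub>R u" using u by blast
    have "S * T - T * S = S * (T - R) - (T - R) * S"
      using step_orth_commute[OF R(1), of S] by (simp add: left_diff_distrib right_diff_distrib)
    also have "\<bar>\<dots>\<bar> \<le> \<bar>S * (T - R)\<bar> + \<bar>(T - R) * S\<bar>" by (rule abs_triangle_ineq4)
    also have "\<dots> \<le> \<bar>S\<bar> * \<bar>T - R\<bar> + \<bar>T - R\<bar> * \<bar>S\<bar>" by (intro add_mono abs_le_mult)
    also have "\<dots> \<le> \<bar>S\<bar> * (\<epsilon> *\<^sub>R u) + (\<epsilon> *\<^sub>R u) * \<bar>S\<bar>"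
      by (intro add_mono mult_left_mono mult_right_mono R abs_ge_zero)
    finally show "\<bar>S * T - T * S\<bar> \<le> \<epsilon> *\<^sub>R (\<bar>S\<bar> * u + u * \<bar>S\<bar>)" by (simp add: scaleR_add_right)
  qed
  then show ?thesis by simp
qed

instance orth :: (dedekind_complete_vector_lattice) "{comm_ring, comm_monoid_mult}"
proof
  fix a b c :: "'a orth"
  show "a * b = b * a" by (rule orth_mult_commute)
  show "(a + b) * c = a * c + b * c" by (rule distrib_right)
  show "1 * a = a" by simp
qed

lemma orth_le_componentI:
  fixes S T :: "'e::dedekind_complete_vector_lattice orth"
  assumes "b * S \<le> b * T" "(1 - b) * S \<le> (1 - b) * T" shows "S \<le> T"
  using add_mono[OF assms] by (simp add: left_diff_distrib)

text \<open>How a negated inequality is exploited: it yields a strict lower bound by a positive real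
  number on some nonzero band. The real number exists by the Archimedean property, the band by
  comparison with it.\<close>

lemma orth_not_nonpos_component:
  fixes T :: "'e::dedekind_complete_vector_lattice orth"
  assumes "\<not> T \<le> 0"
  obtains c \<epsilon> where "component c" "c \<noteq> 0" "0 < \<epsilon>" "\<epsilon> *\<^sub>R c \<le> c * T"
proof -
  have "\<exists>\<epsilon>>0. \<not> T \<le> \<epsilon> *\<^sub>R 1" using assms vl_le_epsI[of T 0 1] by auto
  then obtain \<epsilon> where \<epsilon>: "0 < \<epsilon>" "\<not> T \<le> \<epsilon> *\<^sub>R 1" by blast
  obtain c where c: "component c" "c * T \<le> \<epsilon> *\<^sub>R c" "\<epsilon> *\<^sub>R (1 - c) \<le> (1 - c) * T"
    by (rule component_bounding)
  have "1 - c \<noteq> 0" using \<epsilon> c by auto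
  then show ?thesis using that[OF component_compl[OF c(1)] _ \<epsilon>(1) c(3)] by simp
qed

lemma scaleR_component_nonpos:
  fixes c :: "'e::dedekind_complete_vector_lattice orth"
  assumes "component c" "0 < \<epsilon>" "\<epsilon> *\<^sub>R c \<le> 0" shows "c = 0"
proof -
  have "(1 / \<epsilon>) *\<^sub>R (\<epsilon> *\<^sub>R c) \<le> (1 / \<epsilon>) *\<^sub>R 0" using assms by (intro scaleR_left_mono) auto
  then show ?thesis using assms component_nonneg[OF assms(1)] by simp
qed

section \<open>Order continuity and division\<close>

text \<open>Infimum 0 in terms of lower bounds and without directedness, so that it is easy to
  verify; \<open>order_tendstoI\<close> supplies a directed set.\<close>

definition inf_zero :: "'e::dedekind_complete_vector_lattice set \<Rightarrow> bool"
  where "inf_zero D \<longleftrightarrow> D \<noteq> {} \<and> (\<forall>d\<in>D. 0 \<le> d) \<and> (\<forall>z. (\<forall>d\<in>D. z \<le> d) \<longrightarrow> z \<le> 0)"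

lemma inf_zero_iff: "inf_zero D \<longleftrightarrow> D \<noteq> {} \<and> (\<forall>d\<in>D. 0 \<le> d) \<and> Inf D = 0"
proof -
  have bdd: "bdd_below D" if "\<forall>d\<in>D. 0 \<le> d" using that by (intro bdd_belowI[of _ 0]) auto
  show ?thesis
  proof
    assume D: "inf_zero D"
    then have "Inf D \<le> 0" using cInf_lower[OF _ bdd] by (auto simp: inf_zero_def)
    moreover have "0 \<le> Inf D" using D by (intro cInf_greatest) (auto simp: inf_zero_def)
    ultimately show "D \<noteq> {} \<and> (\<forall>d\<in>D. 0 \<le> d) \<and> Inf D = 0" using D by (auto simp: inf_zero_def)
  next
    assume D: "D \<noteq> {} \<and> (\<forall>d\<in>D. 0 \<le> d) \<and> Inf D = 0"
    have "z \<le> 0" if "\<forall>d\<in>D. z \<le> d" for z using D that cInf_greatest[of D z] by auto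
    then show "inf_zero D" using D by (simp add: inf_zero_def)
  qed
qed

text \<open>Order continuity of positive orthomorphisms. Where \<open>T\<close> is at most
  \<open>n\<close>, the positive part of \<open>z\<close> is below \<open>n d\<close> for all
  \<open>d\<close> and vanishes. Elsewhere \<open>n\<close> times it is below its image under
  \<open>T\<close>. So all its multiples are bounded by one element.\<close>

lemma inf_zero_orth_app:
  assumes D: "inf_zero D" and T: "0 \<le> T" and z: "\<And>d. d \<in> D \<Longrightarrow> z \<le> orth_app T d"
  shows "z \<le> 0"
proof -
  let ?z = "pprt z"
  have D0: "0 \<le> d" if "d \<in> D" for d using D that by (simp add: inf_zero_def)
  have z': "?z \<le> orth_app T d" if "d \<in> D" for d
    unfolding pprt_def by (intro sup_least z that orth_app_nonneg T D0)
  have "?z \<le> 0"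
  proof (rule vl_archimedean)
    fix n :: nat
    obtain c where c: "component c" "c * T \<le> real n *\<^sub>R c" "real n *\<^sub>R (1 - c) \<le> (1 - c) * T"
      by (rule component_bounding)
    have cn: "0 \<le> c" by (rule component_nonneg[OF c(1)])
    have "inverse (real n) *\<^sub>R orth_app c ?z \<le> d" if d: "d \<in> D" for d
    proof (cases "n = 0")
      case True then show ?thesis using D0[OF d] by simp
    next
      case False
      have "orth_app c ?z \<le> orth_app c (orth_app T d)" by (intro orth_app_mono cn z' d)
      also have "\<dots> \<le> real n *\<^sub>R orth_app c d"
        using orth_app_mono_left[OF c(2) D0[OF d]] by (simp add: orth_app_simps)
      also have "\<dots> \<le> real n *\<^sub>R d" by (intro scaleR_left_mono component_app_le c D0 d) simp
      finally have "inverse (real n) *\<^sub>R orth_app c ?z \<le> inverse (real n) *\<^sub>R (real n *\<^sub>R d)"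
        by (rule scaleR_left_mono) simp
      then show ?thesis using False by simp
    qed
    then have "inverse (real n) *\<^sub>R orth_app c ?z \<le> 0" using D by (simp add: inf_zero_def)
    then have "real n *\<^sub>R (real n *\<^sub>R (inverse (real n) *\<^sub>R orth_app c ?z)) \<le> 0"
      by (metis of_nat_0_le_iff scaleR_left_mono scaleR_zero_right)
    then have 1: "real n *\<^sub>R orth_app c ?z \<le> 0" by (cases "n = 0") simp_all
    have "real n *\<^sub>R orth_app (1 - c) ?z \<le> orth_app (1 - c) (orth_app T ?z)"
      using orth_app_mono_left[OF c(3), of ?z] by (simp add: orth_app_simps)
    also have "\<dots> \<le> orth_app T ?z" by (intro component_app_le component_compl c orth_app_nonneg T) simp
    finally have "real n *\<^sub>R orth_app c ?z + real n *\<^sub>R orth_app (1 - c) ?z \<le> 0 + orth_app T ?z"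
      by (rule add_mono[OF 1])
    then show "real n *\<^sub>R ?z \<le> orth_app T ?z" by (simp add: orth_app_simps scaleR_diff_right)
  qed
  then show ?thesis by (simp add: pprt_def)
qed

text \<open>\<open>M\<close> kills the truncations at multiples of \<open>x\<close>, and by order
  continuity also their supremum, the projection onto the band of \<open>x\<close>.\<close>

lemma orth_app_zero_principal:
  assumes M: "0 \<le> M" and x: "0 \<le> x" and Mx: "orth_app M x = 0"
  shows "principal_projection x * M = 0"
proof (rule orth_eq_coneI)
  fix y :: 'a assume y: "0 \<le> y"
  let ?P = "principal_projection x"
  let ?D = "range (\<lambda>n::nat. orth_app ?P y - inf (real n *\<^sub>R x) y)"
  have "inf_zero ?D"
  proof -
    have "z \<le> 0" if z: "\<forall>d\<in>?D. z \<le> d" for z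
    proof -
      have "orth_app ?P y \<le> orth_app ?P y - z"
      proof (rule principal_projection_least[OF x y])
        fix n :: nat
        have "z \<le> orth_app ?P y - inf (real n *\<^sub>R x) y" using z by blast
        then show "inf (real n *\<^sub>R x) y \<le> orth_app ?P y - z" by (simp only: le_diff_eq add.commute)
      qed
      then show ?thesis by simp
    qed
    moreover have "\<forall>d\<in>?D. 0 \<le> d"
      using principal_projection_ge[OF x y] by auto
    ultimately show ?thesis by (simp add: inf_zero_def)
  qed
  then have "orth_app M (orth_app ?P y) \<le> 0"
  proof (rule inf_zero_orth_app[OF _ M])
    fix d assume "d \<in> ?D"
    then obtain n :: nat where d: "d = orth_app ?P y - inf (real n *\<^sub>R x) y" by auto
    have "orth_app M (inf (real n *\<^sub>R x) y) \<le> orth_app M (real n *\<^sub>R x)" by (intro orth_app_mono M) simp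
    then have "orth_app M (inf (real n *\<^sub>R x) y) \<le> 0" by (simp add: orth_linear_simps Mx)
    then show "orth_app M (orth_app ?P y) \<le> orth_app M d" by (simp add: d orth_linear_simps)
  qed
  moreover have "0 \<le> orth_app M (orth_app ?P y)"
    by (intro orth_app_nonneg M component_nonneg component_principal_projection x y)
  ultimately have "orth_app M (orth_app ?P y) = 0" by (rule antisym)
  moreover have "?P * M = M * ?P" by (rule mult.commute)
  ultimately show "orth_app (?P * M) y = orth_app 0 y" by (simp add: orth_app_simps)
qed

text \<open>An inequality between orthomorphisms can be tested at the single point \<open>x\<close>,
  provided that it is claimed on the band of \<open>x\<close> only.\<close>

lemma orth_app_nonneg_principal:
  assumes x: "0 \<le> x" and D: "0 \<le> orth_app D x"
  shows "0 \<le> principal_projection x * D"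
proof -
  let ?P = "principal_projection x"
  have "orth_app (pprt (- D)) x = 0" using D by (simp add: orth_app_pprt[OF x] orth_app_simps)
  then have "?P * pprt (- D) = 0" by (intro orth_app_zero_principal x) auto
  moreover have "?P * (- D) \<le> ?P * pprt (- D)"
    by (intro mult_left_mono component_nonneg component_principal_projection x) (simp add: pprt_def)
  ultimately show ?thesis by simp
qed

lemma orth_le_principal:
  assumes "0 \<le> T" "T \<le> b" "component b" shows "b * T = T"
proof -
  have "(1 - b) * T \<le> (1 - b) * b"
    by (rule mult_left_mono[OF assms(2) component_nonneg[OF component_compl[OF assms(3)]]])
  then have "(1 - b) * T \<le> 0" using assms by (simp add: left_diff_distrib component_idem)
  moreover have "0 \<le> (1 - b) * T"
    by (rule orth_mult_nonneg[OF component_nonneg[OF component_compl[OF assms(3)]] assms(1)])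
  ultimately have "(1 - b) * T = 0" by (rule antisym)
  then show ?thesis by (simp add: left_diff_distrib)
qed

text \<open>A Radon-Nikodym property. The quotient is the supremum of all \<open>S\<close> below the
  projection with \<open>S d \<le> x\<close>; dyadic approximants show that this supremum reaches
  \<open>x\<close>.\<close>

lemma orth_division:
  fixes x d :: "'e::dedekind_complete_vector_lattice"
  assumes x: "0 \<le> x" "x \<le> d"
  shows "\<exists>T. 0 \<le> T \<and> T \<le> principal_projection d \<and> orth_app T d = x"
proof -
  have d: "0 \<le> d" using x by (rule order_trans)
  define q where "q = principal_projection d"
  have q: "component q" "orth_app q d = d"
    unfolding q_def using d by (simp_all add: component_principal_projection principal_projection_self)
  define A where "A = {S. 0 \<le> S \<and> S \<le> q \<and> orth_app S d \<le> x}"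
  have "0 \<in> A" using x component_nonneg[OF q(1)] by (simp add: A_def orth_app_simps)
  then have ne: "A \<noteq> {}" by auto
  have bdd: "bdd_above A" by (intro bdd_aboveI[of _ q]) (simp add: A_def)
  have "0 \<le> Sup A" by (rule cSup_upper[OF \<open>0 \<in> A\<close> bdd])
  moreover have "Sup A \<le> q" using ne by (intro cSup_least) (auto simp: A_def)
  moreover have "orth_app (Sup A) d = x"
  proof -
    have *: "orth_app (Sup A) d \<le> x + \<epsilon> *\<^sub>R d \<and> x \<le> orth_app (Sup A) d + \<epsilon> *\<^sub>R d" if "0 < \<epsilon>" for \<epsilon> :: real
    proof -
      obtain n where n: "(1/2)^n \<le> \<epsilon>" using half_power_small[OF \<open>0 < \<epsilon>\<close>] by blast
      obtain S where S: "0 \<le> S" "S \<le> (1 - (1/2)^n) *\<^sub>R 1" "orth_app S d \<le> x"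
        "x - orth_app S d \<le> (1/2)^n *\<^sub>R d"
        using dyadic_approx[OF x, of n] by blast
      have xS: "x \<le> orth_app S d + \<epsilon> *\<^sub>R d"
        using S(4) scaleR_right_mono[OF n d] by (metis add.commute diff_le_eq order_trans)
      have S1: "S \<le> 1" using S(2) scaleR_right_mono[OF _ orth_one_nonneg, of "1 - (1/2)^n" 1] by (auto intro: order_trans)
      have qS: "orth_app (q * S) d = orth_app S d"
        by (metis mult.commute orth_app_mult q(2))
      have "q * S \<in> A"
        using S S1 q mult_left_mono[OF S1 component_nonneg[OF q(1)]]
        by (simp add: A_def qS orth_mult_nonneg component_nonneg)
      then have "q * S \<le> Sup A" by (rule cSup_upper[OF _ bdd])
      then have 1: "orth_app S d \<le> orth_app (Sup A) d" using orth_app_mono_left[OF _ d, of "q * S"] qS by simp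
      \<comment> \<open>Every element of \<open>A\<close> is compared with the dyadic approximant at
        the point \<open>d\<close>, where the latter misses \<open>x\<close> by at most
        \<open>\<epsilon> d\<close>.\<close>
      have "Sup A \<le> q * (S + \<epsilon> *\<^sub>R 1)"
      proof (rule cSup_least[OF ne])
        fix T assume T: "T \<in> A"
        have "orth_app T d \<le> orth_app S d + \<epsilon> *\<^sub>R d" using T xS by (auto simp: A_def intro: order_trans)
        then have "0 \<le> q * (S + \<epsilon> *\<^sub>R 1 - T)"
          unfolding q_def by (intro orth_app_nonneg_principal d) (simp add: orth_app_simps)
        moreover have "q * T = T" using T q by (intro orth_le_principal) (auto simp: A_def)
        ultimately show "T \<le> q * (S + \<epsilon> *\<^sub>R 1)" by (simp add: right_diff_distrib)
      qed
      then have "orth_app (Sup A) d \<le> orth_app (q * (S + \<epsilon> *\<^sub>R 1)) d" by (rule orth_app_mono_left[OF _ d])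
      also have "\<dots> = orth_app S d + \<epsilon> *\<^sub>R d"
        by (metis mult.commute orth_app_mult q(2) orth_app_add orth_app_scaleR orth_app_one)
      also have "\<dots> \<le> x + \<epsilon> *\<^sub>R d" using S by simp
      finally show ?thesis using xS 1 by (auto intro: order_trans add_right_mono)
    qed
    show ?thesis by (rule antisym; rule vl_le_epsI) (use * in blast)+
  qed
  ultimately show ?thesis unfolding q_def by blast
qed

text \<open>In one direction an element of a band that is disjoint from that band is zero, which
  gives idempotency. In the other the band is the kernel of \<open>1 - b\<close>.\<close>

lemma band_projection_iff: "band_projection b \<longleftrightarrow> component b"
proof
  assume "band_projection b"
  then obtain B where B: "vl_band B" "\<And>x. orth_app b x \<in> B"
    "\<And>x. x - orth_app b x \<in> disjoint_complement B" by (auto simp: band_projection_def)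
  have "b * b = b"
  proof (rule orth_eqI)
    fix x
    let ?y = "orth_app b x - orth_app b (orth_app b x)"
    have "?y \<in> B" using B(1) B(2)[of x] B(2)[of "orth_app b x"] by (auto simp: vl_band_def intro: subspace_diff)
    moreover have "?y \<in> disjoint_complement B" by (rule B(3))
    ultimately have "vl_disjoint ?y ?y" by (simp add: disjoint_complement_def)
    then show "orth_app (b * b) x = orth_app b x" by (simp add: vl_disjoint_def orth_app_simps)
  qed
  then show "component b" by (rule idempotent_component)
next
  assume b: "component b"
  have b': "component (1 - b)" by (rule component_compl[OF b])
  define B where "B = {x. orth_app (1 - b) x = 0}"
  have "vl_band B"
    unfolding vl_band_def
  proof (intro conjI allI ballI impI)
    show "subspace B" by (auto simp: B_def subspace_def orth_linear_simps)
    fix x y assume x: "x \<in> B" and y: "\<bar>y\<bar> \<le> \<bar>x\<bar>"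
    have "\<bar>orth_app (1 - b) y\<bar> \<le> orth_app (1 - b) \<bar>y\<bar>" by (rule abs_orth_app_le[OF component_nonneg[OF b']])
    also have "\<dots> \<le> orth_app (1 - b) \<bar>x\<bar>" by (rule orth_app_mono[OF component_nonneg[OF b'] y])
    also have "\<dots> = 0"
    proof -
      have "\<bar>x\<bar> = \<bar>orth_app b x\<bar>" using x by (simp add: B_def orth_app_simps)
      also have "\<dots> \<le> orth_app b \<bar>x\<bar>" by (rule abs_orth_app_le[OF component_nonneg[OF b]])
      finally have "orth_app (1 - b) \<bar>x\<bar> \<le> 0" by (simp add: orth_app_simps)
      moreover have "0 \<le> orth_app (1 - b) \<bar>x\<bar>" by (intro orth_app_nonneg component_nonneg b') simp
      ultimately show ?thesis by (rule antisym)
    qed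
    finally show "y \<in> B" by (simp add: B_def)
  next
    fix A assume A: "A \<subseteq> B" "A \<noteq> {}" "bdd_above A"
    then obtain a where a: "a \<in> A" "orth_app (1 - b) a = 0" by (auto simp: B_def)
    have "Sup A \<le> Sup A - orth_app (1 - b) (Sup A)"
    proof (rule cSup_least[OF A(2)])
      fix x assume x: "x \<in> A"
      have "orth_app b x \<le> orth_app b (Sup A)" using b x A by (intro orth_app_mono component_nonneg cSup_upper)
      moreover have "orth_app b x = x" using x A by (auto simp: B_def orth_app_simps)
      ultimately show "x \<le> Sup A - orth_app (1 - b) (Sup A)" by (simp add: orth_app_simps)
    qed
    moreover have "orth_app (1 - b) a \<le> orth_app (1 - b) (Sup A)"
      using b' a A by (intro orth_app_mono component_nonneg cSup_upper)
    ultimately have "orth_app (1 - b) (Sup A) = 0" using a(2) by (intro antisym) simp_all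
    then show "Sup A \<in> B" by (simp add: B_def)
  qed
  moreover have "orth_app b x \<in> B" for x using b by (simp add: B_def component_app_compl)
  moreover have "x - orth_app b x \<in> disjoint_complement B" for x
    unfolding disjoint_complement_def
  proof (intro CollectI ballI)
    fix y assume y: "y \<in> B"
    have 1: "\<bar>x - orth_app b x\<bar> \<le> orth_app (1 - b) \<bar>x\<bar>"
      using abs_orth_app_le[OF component_nonneg[OF b'], of x] by (simp add: orth_app_simps)
    have "orth_app b y = y" using y by (simp add: B_def orth_app_simps)
    then have "\<bar>y\<bar> \<le> orth_app b \<bar>y\<bar>" using abs_orth_app_le[OF component_nonneg[OF b], of y] by simp
    then have "inf \<bar>x - orth_app b x\<bar> \<bar>y\<bar> \<le> inf (orth_app (1 - b) \<bar>x\<bar>) (orth_app b \<bar>y\<bar>)"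
      using 1 by (rule inf_mono[rotated])
    also have "\<dots> = 0" using component_disjoint[OF b, of "\<bar>y\<bar>" "\<bar>x\<bar>"] by (simp add: inf_commute)
    finally have "inf \<bar>x - orth_app b x\<bar> \<bar>y\<bar> \<le> 0" .
    then show "vl_disjoint (x - orth_app b x) y" unfolding vl_disjoint_def by (intro antisym) simp_all
  qed
  ultimately show "band_projection b" by (auto simp: band_projection_def)
qed

section \<open>Order convergence\<close>

lemma inf_zeroD: "inf_zero D \<Longrightarrow> (\<And>d. d \<in> D \<Longrightarrow> z \<le> d) \<Longrightarrow> z \<le> 0"
  by (simp add: inf_zero_def)

lemma inf_zero_le:
  assumes "inf_zero D" "\<And>d. d \<in> D \<Longrightarrow> x - c \<le> d" shows "x \<le> c"
  using inf_zeroD[of D "x - c"] assms by simp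

lemma inf_zero_plus:
  assumes "inf_zero D" "inf_zero D'" shows "inf_zero {d + d' | d d'. d \<in> D \<and> d' \<in> D'}"
proof -
  have "z \<le> 0" if z: "\<forall>e\<in>{d + d' | d d'. d \<in> D \<and> d' \<in> D'}. z \<le> e" for z
  proof -
    have "z \<le> d" if d: "d \<in> D" for d
    proof -
      have "z - d \<le> d'" if d': "d' \<in> D'" for d'
      proof -
        have "d + d' \<in> {d + d' | d d'. d \<in> D \<and> d' \<in> D'}" using d d' by blast
        then have "z \<le> d + d'" using z by blast
        then show ?thesis by (simp only: diff_le_eq add.commute)
      qed
      then show ?thesis by (rule inf_zero_le[OF assms(2)])
    qed
    then show ?thesis by (rule inf_zeroD[OF assms(1)])
  qed
  then show ?thesis using assms unfolding inf_zero_def by (force intro: add_nonneg_nonneg)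
qed

lemma inf_zero_scaleR:
  fixes u :: "'e::dedekind_complete_vector_lattice"
  assumes "0 \<le> u" shows "inf_zero ((\<lambda>\<epsilon>. \<epsilon> *\<^sub>R u) ` {0<..})"
  using assms vl_le_epsI[of _ 0 u] unfolding inf_zero_def
  by (auto intro!: scaleR_nonneg_nonneg exI[of _ 1])

text \<open>The directed set that \<open>order_tendsto\<close> asks for consists of all eventual
  upper bounds of the error; it contains \<open>D\<close> and is closed under
  \<open>inf\<close>.\<close>

lemma order_tendstoI:
  assumes D: "inf_zero D" and ev: "\<And>d. d \<in> D \<Longrightarrow> \<forall>\<^sub>F i in F. \<bar>f i - l\<bar> \<le> d"
  shows "order_tendsto f l F"
proof -
  let ?D = "{d. 0 \<le> d \<and> (\<forall>\<^sub>F i in F. \<bar>f i - l\<bar> \<le> d)}"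
  have sub: "D \<subseteq> ?D" using D ev by (auto simp: inf_zero_def)
  have "inf_zero ?D"
    using D sub unfolding inf_zero_def by blast
  moreover have "\<exists>c\<in>?D. c \<le> a \<and> c \<le> b" if "a \<in> ?D" "b \<in> ?D" for a b
    using that by (intro bexI[of _ "inf a b"]) (auto elim: eventually_elim2)
  ultimately show ?thesis
    unfolding order_tendsto_def inf_zero_iff by (intro exI[of _ ?D]) blast
qed

lemma order_tendstoE:
  assumes "order_tendsto f l F"
  obtains D where "inf_zero D" "\<And>d. d \<in> D \<Longrightarrow> \<forall>\<^sub>F i in F. \<bar>f i - l\<bar> \<le> d"
  using assms unfolding order_tendsto_def inf_zero_iff by blast

lemma order_null_mono:
  assumes "order_tendsto h 0 F" "\<forall>\<^sub>F i in F. \<bar>h' i\<bar> \<le> h i"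
  shows "order_tendsto h' 0 F"
proof -
  obtain D where D: "inf_zero D" "\<And>d. d \<in> D \<Longrightarrow> \<forall>\<^sub>F i in F. \<bar>h i - 0\<bar> \<le> d"
    using order_tendstoE[OF assms(1)] by blast
  show ?thesis
  proof (rule order_tendstoI[OF D(1)])
    fix d assume "d \<in> D"
    from D(2)[OF this] assms(2) show "\<forall>\<^sub>F i in F. \<bar>h' i - 0\<bar> \<le> d"
      by eventually_elim (simp, meson order_trans abs_ge_self)
  qed
qed

lemma order_null_add:
  assumes "order_tendsto h 0 F" "order_tendsto h' 0 F"
  shows "order_tendsto (\<lambda>i. h i + h' i) 0 F"
proof -
  obtain D where D: "inf_zero D" "\<And>d. d \<in> D \<Longrightarrow> \<forall>\<^sub>F i in F. \<bar>h i - 0\<bar> \<le> d"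
    using order_tendstoE[OF assms(1)] by blast
  obtain D' where D': "inf_zero D'" "\<And>d. d \<in> D' \<Longrightarrow> \<forall>\<^sub>F i in F. \<bar>h' i - 0\<bar> \<le> d"
    using order_tendstoE[OF assms(2)] by blast
  show ?thesis
  proof (rule order_tendstoI[OF inf_zero_plus[OF D(1) D'(1)]])
    fix e assume "e \<in> {d + d' | d d'. d \<in> D \<and> d' \<in> D'}"
    then obtain d d' where e: "e = d + d'" "d \<in> D" "d' \<in> D'" by blast
    from D(2)[OF e(2)] D'(2)[OF e(3)] show "\<forall>\<^sub>F i in F. \<bar>h i + h' i - 0\<bar> \<le> e"
      unfolding e(1) by eventually_elim (auto intro: order_trans[OF abs_triangle_ineq] add_mono)
  qed
qed

lemma order_null_le:
  assumes "order_tendsto h 0 F" "F \<noteq> bot" "\<forall>\<^sub>F i in F. x \<le> c + h i"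
  shows "x \<le> c"
proof -
  obtain D where D: "inf_zero D" "\<And>d. d \<in> D \<Longrightarrow> \<forall>\<^sub>F i in F. \<bar>h i - 0\<bar> \<le> d"
    using order_tendstoE[OF assms(1)] by blast
  have "x - c \<le> d" if "d \<in> D" for d
  proof -
    from D(2)[OF that] assms(3) have "\<forall>\<^sub>F i in F. x - c \<le> d"
    proof eventually_elim
      case (elim i)
      have "x - c \<le> h i" using elim(2) by (simp only: diff_le_eq add.commute)
      also have "\<dots> \<le> \<bar>h i - 0\<bar>" by (simp add: abs_ge_self)
      also have "\<dots> \<le> d" by (rule elim(1))
      finally show ?case .
    qed
    then show ?thesis using assms(2) by (simp add: eventually_const_iff)
  qed
  then show ?thesis by (rule inf_zero_le[OF D(1)])
qed

lemma order_tendsto_iff_null: "order_tendsto f l F \<longleftrightarrow> order_tendsto (\<lambda>i. \<bar>f i - l\<bar>) 0 F"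
  by (simp add: order_tendsto_def)

lemma order_tendsto_unique:
  assumes "order_tendsto f l F" "order_tendsto f l' F" "F \<noteq> bot" shows "l = l'"
proof -
  have "order_tendsto (\<lambda>i. \<bar>f i - l\<bar> + \<bar>f i - l'\<bar>) 0 F"
    using assms by (intro order_null_add) (simp_all add: order_tendsto_iff_null[symmetric])
  then have "\<bar>l - l'\<bar> \<le> 0"
  proof (rule order_null_le[OF _ assms(3)])
    have "\<bar>l - l'\<bar> \<le> 0 + (\<bar>f i - l\<bar> + \<bar>f i - l'\<bar>)" for i
      using abs_triangle_ineq4[of "f i - l'" "f i - l"] by (simp add: add.commute)
    then show "\<forall>\<^sub>F i in F. \<bar>l - l'\<bar> \<le> 0 + (\<bar>f i - l\<bar> + \<bar>f i - l'\<bar>)" by simp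
  qed
  then show ?thesis by simp
qed

lemma order_null_orth_app:
  assumes "order_tendsto h 0 F" "0 \<le> T"
  shows "order_tendsto (\<lambda>i. orth_app T (h i)) 0 F"
proof -
  obtain D where D: "inf_zero D" "\<And>d. d \<in> D \<Longrightarrow> \<forall>\<^sub>F i in F. \<bar>h i - 0\<bar> \<le> d"
    using order_tendstoE[OF assms(1)] by blast
  have D0: "0 \<le> d" if "d \<in> D" for d using D that by (simp add: inf_zero_def)
  have "inf_zero (orth_app T ` D)"
    using D(1) inf_zero_orth_app[OF D(1) assms(2)] orth_app_nonneg[OF assms(2) D0]
    unfolding inf_zero_def[of "orth_app T ` D"] by (auto simp: inf_zero_def)
  then show ?thesis
  proof (rule order_tendstoI)
    fix e assume "e \<in> orth_app T ` D"
    then obtain d where d: "e = orth_app T d" "d \<in> D" by blast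
    from D(2)[OF d(2)] show "\<forall>\<^sub>F i in F. \<bar>orth_app T (h i) - 0\<bar> \<le> e"
      unfolding d(1) by eventually_elim
        (auto intro: order_trans[OF abs_orth_app_le[OF assms(2)]] orth_app_mono[OF assms(2)])
  qed
qed

lemma order_null_scaleR:
  assumes "0 \<le> u" "\<And>\<epsilon>. 0 < \<epsilon> \<Longrightarrow> \<forall>\<^sub>F i in F. \<bar>h i\<bar> \<le> \<epsilon> *\<^sub>R u"
  shows "order_tendsto h 0 F"
  by (rule order_tendstoI[OF inf_zero_scaleR[OF assms(1)]]) (auto simp: assms(2))

lemma order_null_compose:
  assumes "order_tendsto h 0 F" "filterlim g F G"
  shows "order_tendsto (\<lambda>i. h (g i)) 0 G"
  using assms unfolding order_tendsto_def filterlim_iff by blast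

section \<open>Banach--Kantorovich spaces\<close>

lemma component_abs:
  fixes X :: "'e::dedekind_complete_vector_lattice orth"
  assumes "component b" shows "b * \<bar>X\<bar> = \<bar>b * X\<bar>"
proof (rule orth_eq_coneI)
  fix x :: 'e assume x: "0 \<le> x"
  have bx: "0 \<le> orth_app b x" using x component_nonneg[OF assms] by (rule orth_app_nonneg[rotated])
  show "orth_app (b * \<bar>X\<bar>) x = orth_app \<bar>b * X\<bar> x"
    unfolding mult.commute[of b] orth_app_mult orth_app_abs[OF bx] orth_app_abs[OF x] ..
qed

lemma component_app_abs:
  assumes b: "component b" shows "orth_app b \<bar>x\<bar> = \<bar>orth_app b x\<bar>"
proof (rule antisym)
  have "\<bar>x\<bar> \<le> \<bar>orth_app b x\<bar> + \<bar>orth_app (1 - b) x\<bar>"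
    using abs_triangle_ineq[of "orth_app b x" "orth_app (1 - b) x"] component_split[of x b] by simp
  also have "\<dots> \<le> \<bar>orth_app b x\<bar> + orth_app (1 - b) \<bar>x\<bar>"
    by (intro add_left_mono abs_orth_app_le component_nonneg component_compl b)
  finally show "orth_app b \<bar>x\<bar> \<le> \<bar>orth_app b x\<bar>" by (simp add: orth_app_simps algebra_simps)
  show "\<bar>orth_app b x\<bar> \<le> orth_app b \<bar>x\<bar>" by (rule abs_orth_app_le[OF component_nonneg[OF b]])
qed

section \<open>Elementary norm estimates\<close>

context lattice_normed_space begin

lemma lnorm_zero: "N 0 = 0"
  using lnorm_scale[of 0 0] by simp

lemma lnorm_minus: "N (- x) = N x"
  using lnorm_scale[of "- 1" x] by simp

lemma lnorm_minus_commute: "N (x - y) = N (y - x)"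
  using lnorm_minus[of "x - y"] by simp

lemma lnorm_diff_triangle: "N (x - z) \<le> N (x - y) + N (y - z)"
  using lnorm_triangle[of "x - y" "y - z"] by simp

lemma lnorm_triangle_diff: "N (x - y) \<le> N x + N y"
  using lnorm_triangle[of x "- y"] by (simp add: lnorm_minus)

lemma lnorm_abs_diff: "\<bar>N x - N y\<bar> \<le> N (x - y)"
proof (rule abs_leI)
  show "N x - N y \<le> N (x - y)" using lnorm_triangle[of "x - y" y] by (simp add: diff_le_eq)
  show "- (N x - N y) \<le> N (x - y)"
    using lnorm_triangle[of "y - x" x] lnorm_minus_commute[of x y] by (simp add: diff_le_eq)
qed

lemma lnorm_eq_zero_le: "N x \<le> 0 \<Longrightarrow> x = 0"
  by (rule lnorm_eq_zeroD, rule antisym[OF _ lnorm_nonneg])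

end

locale bk_space = lattice_normed_space scale N
  for scale :: "'k::real_normed_field \<Rightarrow> 'y::ab_group_add \<Rightarrow> 'y"
    and N :: "'y \<Rightarrow> 'e::dedekind_complete_vector_lattice" +
  assumes decomposable: "decomposable N UNIV" and norm_complete: "norm_o_complete N UNIV"
begin

text \<open>Completeness is stated for filters on the space itself; a family indexed by another
  filter is handled through its image filter.\<close>

lemma norm_o_Cauchy_convergent:
  assumes G: "G \<noteq> bot" and cau: "order_tendsto (\<lambda>(i, j). N (z i - z j)) 0 (G \<times>\<^sub>F G)"
  shows "\<exists>l. order_tendsto (\<lambda>i. N (l - z i)) 0 G"
proof -
  let ?F = "filtermap z G"
  have "norm_tendsto N (\<lambda>(x, y). x - y) 0 (?F \<times>\<^sub>F ?F)"
    unfolding norm_tendsto_def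
  proof -
    obtain D where D: "inf_zero D" "\<And>d. d \<in> D \<Longrightarrow> \<forall>\<^sub>F p in G \<times>\<^sub>F G. \<bar>(case p of (i, j) \<Rightarrow> N (z i - z j)) - 0\<bar> \<le> d"
      using order_tendstoE[OF cau] by blast
    show "order_tendsto (\<lambda>i. N (0 - (case i of (x, y) \<Rightarrow> x - y))) 0 (?F \<times>\<^sub>F ?F)"
    proof (rule order_tendstoI[OF D(1)])
      fix d assume "d \<in> D"
      from D(2)[OF this] have "\<forall>\<^sub>F p in G \<times>\<^sub>F G. N (z (fst p) - z (snd p)) \<le> d"
        by eventually_elim (auto simp: abs_of_nonneg lnorm_nonneg split: prod.splits)
      then have "\<forall>\<^sub>F p in G \<times>\<^sub>F G. (\<lambda>q. N (fst q - snd q) \<le> d) (apfst z (apsnd z p))"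
        by (simp add: apfst_def apsnd_def map_prod_def case_prod_beta)
      then have "\<forall>\<^sub>F q in ?F \<times>\<^sub>F ?F. N (fst q - snd q) \<le> d"
        unfolding prod_filtermap1 prod_filtermap2 eventually_filtermap by simp
      then show "\<forall>\<^sub>F q in ?F \<times>\<^sub>F ?F. \<bar>N (0 - (case q of (x, y) \<Rightarrow> x - y)) - 0\<bar> \<le> d"
        by eventually_elim (auto simp: lnorm_minus_commute lnorm_minus lnorm_nonneg split: prod.splits)
    qed
  qed
  moreover have "?F \<noteq> bot" using G by (simp add: filtermap_bot_iff)
  ultimately obtain l where "norm_tendsto N (\<lambda>x. x) l ?F"
    using norm_complete unfolding norm_o_complete_def by (metis (no_types, lifting) UNIV_I always_eventually)
  then have "order_tendsto (\<lambda>i. N (l - z i)) 0 G"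
    unfolding norm_tendsto_def
    by (rule order_null_compose) (simp add: filterlim_def)
  then show ?thesis ..
qed

text \<open>The action of a band projection described by the norm alone, before a module structure
  is available. Existence comes from decomposability, uniqueness from the triangle
  inequality.\<close>

definition band_part :: "'e orth \<Rightarrow> 'y \<Rightarrow> 'y"
  where "band_part b y = (THE z. orth_app (1 - b) (N z) = 0 \<and> orth_app b (N (y - z)) = 0)"

lemma orth_app_norm_zero_le:
  assumes "0 \<le> T" "orth_app T u = 0" "N z \<le> u" shows "orth_app T (N z) = 0"
  using orth_app_mono[OF assms(1,3)] orth_app_nonneg[OF assms(1) lnorm_nonneg, of z] assms(2)
  by (intro antisym) simp_all

lemma band_part_unique:
  assumes b: "component b"
    and z: "orth_app (1 - b) (N z) = 0" "orth_app b (N (y - z)) = 0"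
    and z': "orth_app (1 - b) (N z') = 0" "orth_app b (N (y - z')) = 0"
  shows "z = z'"
proof -
  have "orth_app (1 - b) (N (z - z')) = 0"
    using z z' lnorm_triangle_diff[of z z']
    by (intro orth_app_norm_zero_le[of "1 - b" "N z + N z'"] component_nonneg component_compl b)
      (simp_all add: orth_linear_simps)
  moreover have "orth_app b (N (z - z')) = 0"
    using z z' lnorm_diff_triangle[of z z' y] lnorm_minus_commute[of z y]
    by (intro orth_app_norm_zero_le[of b "N (y - z) + N (y - z')"] component_nonneg b)
      (simp_all add: orth_linear_simps)
  ultimately have "N (z - z') = 0" using component_split[of "N (z - z')" b] by simp
  then show ?thesis using lnorm_eq_zeroD by fastforce
qed

lemma band_part_exists:
  assumes b: "component b"
  shows "\<exists>z. orth_app (1 - b) (N z) = 0 \<and> orth_app b (N (y - z)) = 0"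
proof -
  have "N y = orth_app b (N y) + orth_app (1 - b) (N y)" by (rule component_split)
  moreover have "0 \<le> orth_app b (N y)" "0 \<le> orth_app (1 - b) (N y)"
    by (intro orth_app_nonneg lnorm_nonneg component_nonneg component_compl b)+
  ultimately obtain z w where "y = z + w" "N z = orth_app b (N y)" "N w = orth_app (1 - b) (N y)"
    using decomposable unfolding decomposable_def by blast
  then show ?thesis using b by (intro exI[of _ z]) (simp add: component_app_compl)
qed

lemma band_part:
  assumes b: "component b"
  shows "orth_app (1 - b) (N (band_part b y)) = 0" "orth_app b (N (y - band_part b y)) = 0"
proof -
  have "\<exists>!z. orth_app (1 - b) (N z) = 0 \<and> orth_app b (N (y - z)) = 0"
    using band_part_exists[OF b, of y] band_part_unique[OF b] by blast
  from theI'[OF this] show "orth_app (1 - b) (N (band_part b y)) = 0"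
    "orth_app b (N (y - band_part b y)) = 0" by (simp_all add: band_part_def)
qed

lemma band_part_eqI:
  assumes "component b" "orth_app (1 - b) (N z) = 0" "orth_app b (N (y - z)) = 0"
  shows "band_part b y = z"
  using band_part_unique[OF assms(1) band_part[OF assms(1)] assms(2,3)] .

lemma norm_band_part:
  assumes b: "component b" shows "N (band_part b y) = orth_app b (N y)"
proof -
  let ?z = "band_part b y"
  have "\<bar>orth_app b (N y - N ?z)\<bar> \<le> orth_app b \<bar>N y - N ?z\<bar>"
    by (rule abs_orth_app_le[OF component_nonneg[OF b]])
  also have "\<dots> \<le> orth_app b (N (y - ?z))"
    by (rule orth_app_mono[OF component_nonneg[OF b] lnorm_abs_diff])
  also have "\<dots> = 0" by (rule band_part(2)[OF b])
  finally have "orth_app b (N y) = orth_app b (N ?z)" by (simp add: orth_linear_simps)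
  then show ?thesis using band_part(1)[OF b, of y] by (simp add: orth_app_simps)
qed

lemma band_part_add:
  assumes b: "component b" shows "band_part b (x + y) = band_part b x + band_part b y"
proof (rule band_part_eqI[OF b])
  let ?x = "band_part b x" and ?y = "band_part b y"
  show "orth_app (1 - b) (N (?x + ?y)) = 0"
    using band_part(1)[OF b] lnorm_triangle[of ?x ?y]
    by (intro orth_app_norm_zero_le[of "1 - b" "N ?x + N ?y"] component_nonneg component_compl b)
      (simp_all add: orth_linear_simps)
  have "N (x + y - (?x + ?y)) \<le> N (x - ?x) + N (y - ?y)"
    using lnorm_triangle[of "x - ?x" "y - ?y"] by (simp add: algebra_simps)
  then show "orth_app b (N (x + y - (?x + ?y))) = 0"
    using band_part(2)[OF b]
    by (intro orth_app_norm_zero_le[of b "N (x - ?x) + N (y - ?y)"] component_nonneg b)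
      (simp_all add: orth_linear_simps)
qed

abbreviation rscale :: "real \<Rightarrow> 'y \<Rightarrow> 'y" where "rscale r y \<equiv> scale (of_real r) y"

lemma norm_rscale: "N (rscale r y) = \<bar>r\<bar> *\<^sub>R N y"
  by (simp add: lnorm_scale)

lemma band_part_rscale:
  assumes b: "component b" shows "band_part b (rscale r y) = rscale r (band_part b y)"
proof (rule band_part_eqI[OF b])
  show "orth_app (1 - b) (N (rscale r (band_part b y))) = 0"
    using band_part(1)[OF b, of y] by (simp add: norm_rscale orth_linear_simps)
  show "orth_app b (N (rscale r y - rscale r (band_part b y))) = 0"
    using band_part(2)[OF b, of y] by (simp add: norm_rscale orth_linear_simps scale_right_diff_distrib[symmetric])
qed

lemma band_part_zero: "component b \<Longrightarrow> band_part b 0 = 0"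
  using band_part_add[of b 0 0] by simp


lemma band_part_mult:
  assumes b: "component b" and c: "component c"
  shows "band_part b (band_part c y) = band_part (b * c) y"
proof (rule sym, rule band_part_eqI)
  show bc: "component (b * c)" by (rule component_mult[OF b c])
  let ?z = "band_part b (band_part c y)"
  have Nz: "N ?z = orth_app (b * c) (N y)" using b c by (simp add: norm_band_part orth_app_mult)
  then show "orth_app (1 - b * c) (N ?z) = 0" using component_app_compl(2)[OF bc] by simp
  have "N (y - ?z) \<le> N (y - band_part c y) + N (band_part c y - ?z)" by (rule lnorm_diff_triangle)
  then show "orth_app (b * c) (N (y - ?z)) = 0"
  proof (rule orth_app_norm_zero_le[OF component_nonneg[OF bc], rotated])
    have "orth_app (b * c) (N (y - band_part c y)) = orth_app b (orth_app c (N (y - band_part c y)))"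
      by (simp add: orth_app_mult)
    moreover have "orth_app (c * b) (N (band_part c y - ?z)) = orth_app c (orth_app b (N (band_part c y - ?z)))"
      by (simp only: orth_app_mult)
    ultimately show "orth_app (b * c) (N (y - band_part c y) + N (band_part c y - ?z)) = 0"
      using band_part(2)[OF c, of y] band_part(2)[OF b, of "band_part c y"]
      by (simp add: orth_linear_simps mult.commute[of c b])
  qed
qed

text \<open>A relation and not a function of \<open>S\<close>, since a step orthomorphism has many
  representations. That the map depends on \<open>S\<close> only follows from
  \<open>norm_step_action\<close> applied to a difference.\<close>

inductive step_action :: "'e orth \<Rightarrow> ('y \<Rightarrow> 'y) \<Rightarrow> bool" where
  zero: "step_action 0 (\<lambda>y. 0)"
| add: "step_action S A \<Longrightarrow> component b \<Longrightarrow>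
    step_action (S + r *\<^sub>R b) (\<lambda>y. A y + rscale r (band_part b y))"

lemma step_action_exists: "S \<in> step_orth \<Longrightarrow> \<exists>A. step_action S A"
  by (induction rule: step_orth.induct) (blast intro: step_action.intros)+

lemma step_action_additive: "step_action S A \<Longrightarrow> A (x + y) = A x + A y"
  by (induction rule: step_action.induct) (simp_all add: band_part_add scale_right_distrib algebra_simps)

lemma step_action_band_part:
  "step_action S A \<Longrightarrow> component c \<Longrightarrow> band_part c (A y) = A (band_part c y)"
proof (induction rule: step_action.induct)
  case (add S A b r)
  have "band_part c (band_part b y) = band_part b (band_part c y)"
    using add by (simp add: band_part_mult mult.commute)
  then show ?case using add by (simp add: band_part_add band_part_rscale)
qed (simp add: band_part_zero)

text \<open>The term \<open>r0 y\<close> makes the induction work: a further step on the band of \<open>b\<close> merely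
  changes \<open>r0\<close> there.\<close>

lemma norm_step_action_affine:
  "step_action S A \<Longrightarrow> N (rscale r0 y + A y) = orth_app \<bar>r0 *\<^sub>R 1 + S\<bar> (N y)"
proof (induction arbitrary: r0 y rule: step_action.induct)
  case zero
  show ?case by (simp add: norm_rscale vl_abs_scaleR orth_app_simps abs_of_nonneg[OF orth_one_nonneg])
next
  case (add S A b r)
  let ?w = "rscale r0 y + (A y + rscale r (band_part b y))"
  let ?T = "r0 *\<^sub>R 1 + (S + r *\<^sub>R b)"
  note b = add(2)
  have b': "component (1 - b)" by (rule component_compl[OF b])
  have bb: "band_part b (band_part b y) = band_part b y"
    using band_part_mult[OF b b] b by (simp add: component_idem)
  have w: "band_part b ?w = rscale (r0 + r) (band_part b y) + A (band_part b y)"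
    using b by (simp add: band_part_add band_part_rscale step_action_band_part[OF add(1)] bb
        scale_left_distrib algebra_simps)
  have "orth_app b (N ?w) = N (band_part b ?w)" using b by (simp add: norm_band_part)
  also have "\<dots> = orth_app (\<bar>(r0 + r) *\<^sub>R 1 + S\<bar> * b) (N y)"
    using b unfolding w add.IH by (simp add: norm_band_part orth_app_mult)
  also have "\<bar>(r0 + r) *\<^sub>R 1 + S\<bar> * b = b * \<bar>?T\<bar>"
  proof -
    have "b * ((r0 + r) *\<^sub>R 1 + S) = b * ?T"
      using b by (simp add: distrib_left component_idem scaleR_add_left)
    then show ?thesis by (simp only: mult.commute[of _ b] component_abs[OF b])
  qed
  finally have 1: "orth_app b (N ?w) = orth_app (b * \<bar>?T\<bar>) (N y)" .
  have w': "?w - band_part b ?w = rscale r0 (y - band_part b y) + A (y - band_part b y)"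
  proof -
    have "A (y - band_part b y) = A y - A (band_part b y)"
      using step_action_additive[OF add(1), of "y - band_part b y" "band_part b y"] by simp
    then show ?thesis unfolding w by (simp add: scale_left_distrib scale_right_diff_distrib algebra_simps)
  qed
  have compl: "N (v - band_part b v) = orth_app (1 - b) (N v)" for v
  proof -
    have "band_part (1 - b) v = v - band_part b v"
      using band_part[OF b, of v] by (intro band_part_eqI b') simp_all
    then show ?thesis using norm_band_part[OF b', of v] by simp
  qed
  have "orth_app (1 - b) (N ?w) = orth_app (\<bar>r0 *\<^sub>R 1 + S\<bar> * (1 - b)) (N y)"
    unfolding compl[symmetric] w' by (simp add: add.IH compl orth_app_mult)
  also have "\<bar>r0 *\<^sub>R 1 + S\<bar> * (1 - b) = (1 - b) * \<bar>?T\<bar>"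
  proof -
    have "(1 - b) * (r0 *\<^sub>R 1 + S) = (1 - b) * ?T"
      using b by (simp add: distrib_left left_diff_distrib component_idem)
    then show ?thesis by (simp only: mult.commute[of _ "1 - b"] component_abs[OF b'])
  qed
  finally have 2: "orth_app (1 - b) (N ?w) = orth_app ((1 - b) * \<bar>?T\<bar>) (N y)" .
  have "N ?w = orth_app b (N ?w) + orth_app (1 - b) (N ?w)" by (rule component_split)
  also have "\<dots> = orth_app \<bar>?T\<bar> (N y)" unfolding 1 2 by (simp add: orth_app_simps)
  finally show ?case by simp
qed

lemma norm_step_action: "step_action S A \<Longrightarrow> N (A y) = orth_app \<bar>S\<bar> (N y)"
  using norm_step_action_affine[of S A 0 y] by simp

lemma step_action_plus:
  "step_action T B \<Longrightarrow> step_action S A \<Longrightarrow> step_action (S + T) (\<lambda>y. A y + B y)"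
proof (induction rule: step_action.induct)
  case (add T B b r)
  from step_action.add[OF add.IH[OF add.prems] add(2), of r] show ?case by (simp add: add.assoc)
qed simp

lemma step_action_scale: "step_action T B \<Longrightarrow> step_action (r *\<^sub>R T) (\<lambda>y. rscale r (B y))"
proof (induction rule: step_action.induct)
  case (add T B b s)
  from step_action.add[OF add.IH add(2), of "r * s"] show ?case
    by (simp add: scaleR_add_right scale_right_distrib)
qed (simp add: step_action.zero)

lemma step_action_diff:
  assumes "step_action S A" "step_action T B" shows "step_action (S - T) (\<lambda>y. A y - B y)"
  using step_action_plus[OF step_action_scale[OF assms(2), of "- 1"] assms(1)] by simp

lemma step_action_mult_component:
  assumes "component b"
  shows "step_action T B \<Longrightarrow> step_action (b * T) (\<lambda>y. band_part b (B y))"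
proof (induction rule: step_action.induct)
  case (add T B c s)
  have "step_action (b * T + s *\<^sub>R (b * c)) (\<lambda>y. band_part b (B y) + rscale s (band_part (b * c) y))"
    by (rule step_action.add[OF add.IH component_mult[OF assms add(2)]])
  then show ?case using assms add(2) by (simp add: distrib_left band_part_add band_part_rscale band_part_mult)
qed (simp add: step_action.zero band_part_zero assms)

lemma step_action_mult:
  assumes T: "step_action T B"
  shows "step_action S A \<Longrightarrow> step_action (S * T) (\<lambda>y. A (B y))"
proof (induction rule: step_action.induct)
  case (add S A b r)
  show ?case
    using step_action_plus[OF step_action_scale[OF step_action_mult_component[OF add(2) T], of r] add.IH]
    by (simp add: distrib_right)
qed (simp add: step_action.zero)

text \<open>The distances to all step actions determine the element \<open>T y\<close>, so they can
  serve as its description. It is the limit of step actions that approximate \<open>T\<close>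
  uniformly, and the identity passes to this limit.\<close>

lemma action_exists:
  "\<exists>z. \<forall>S A. step_action S A \<longrightarrow> N (z - A y) = orth_app \<bar>T - S\<bar> (N y)"
proof -
  obtain u where u: "0 \<le> u" "\<And>\<epsilon>. 0 < \<epsilon> \<Longrightarrow> \<exists>S\<in>step_orth. \<bar>T - S\<bar> \<le> \<epsilon> *\<^sub>R u"
    using step_orth_approx[of T] by blast
  have "\<exists>S A. step_action S A \<and> \<bar>T - S\<bar> \<le> (1 / real (Suc n)) *\<^sub>R u" for n
    using u(2)[of "1 / real (Suc n)"] step_action_exists by fastforce
  then obtain S A where SA: "\<And>n. step_action (S n) (A n)" "\<And>n. \<bar>T - S n\<bar> \<le> (1 / real (Suc n)) *\<^sub>R u"
    by metis
  define w where "w = orth_app u (N y)"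
  have w: "0 \<le> w" unfolding w_def by (intro orth_app_nonneg u lnorm_nonneg)
  have Tw: "orth_app \<bar>T - S n\<bar> (N y) \<le> (1 / real (Suc n)) *\<^sub>R w" for n
    using orth_app_mono_left[OF SA(2) lnorm_nonneg] by (simp add: w_def orth_app_simps)
  have small: "\<forall>\<^sub>F n in sequentially. 1 / real (Suc n) \<le> \<epsilon>" if "0 < \<epsilon>" for \<epsilon> :: real
    using order_tendstoD(2)[OF LIMSEQ_inverse_real_of_nat that]
    by (auto elim!: eventually_mono simp: inverse_eq_divide)
  have "order_tendsto (\<lambda>n. orth_app \<bar>T - S n\<bar> (N y)) 0 sequentially"
  proof (rule order_null_scaleR[OF w])
    fix \<epsilon> :: real assume "0 < \<epsilon>"
    from small[OF this] show "\<forall>\<^sub>F n in sequentially. \<bar>orth_app \<bar>T - S n\<bar> (N y)\<bar> \<le> \<epsilon> *\<^sub>R w"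
    proof eventually_elim
      case (elim n)
      have "orth_app \<bar>T - S n\<bar> (N y) \<le> \<epsilon> *\<^sub>R w" by (rule order_trans[OF Tw scaleR_right_mono[OF elim w]])
      moreover have "0 \<le> orth_app \<bar>T - S n\<bar> (N y)" by (intro orth_app_nonneg lnorm_nonneg) simp
      ultimately show ?case by simp
    qed
  qed
  note lim = this
  have diff: "N (A n y - B y) = orth_app \<bar>S n - R\<bar> (N y)" if "step_action R B" for n R B
    using norm_step_action[OF step_action_diff[OF SA(1) that]] by simp
  have tri: "orth_app \<bar>P - R\<bar> (N y) \<le> orth_app \<bar>T - P\<bar> (N y) + orth_app \<bar>T - R\<bar> (N y)" for P R
  proof -
    have "\<bar>P - R\<bar> \<le> \<bar>T - P\<bar> + \<bar>T - R\<bar>" using abs_triangle_ineq4[of "T - R" "T - P"] by (simp add: add.commute)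
    from orth_app_mono_left[OF this lnorm_nonneg] show ?thesis by (simp add: orth_app_simps)
  qed
  have "order_tendsto (\<lambda>(i, j). N (A i y - A j y)) 0 (sequentially \<times>\<^sub>F sequentially)"
  proof -
    have "order_tendsto (\<lambda>p. orth_app \<bar>T - S (fst p)\<bar> (N y) + orth_app \<bar>T - S (snd p)\<bar> (N y)) 0
        (sequentially \<times>\<^sub>F sequentially)"
      by (intro order_null_add order_null_compose[OF lim] filterlim_fst filterlim_snd)
    then show ?thesis
      by (rule order_null_mono, intro always_eventually allI)
        (simp add: case_prod_beta diff[OF SA(1)] orth_app_nonneg lnorm_nonneg tri)
  qed
  then obtain z where z: "order_tendsto (\<lambda>n. N (z - A n y)) 0 sequentially"
    using norm_o_Cauchy_convergent[of sequentially "\<lambda>n. A n y"] by auto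
  have "N (z - B y) = orth_app \<bar>T - R\<bar> (N y)" if R: "step_action R B" for R B
  proof (rule antisym)
    note both = order_null_add[OF z lim]
    have nb: "sequentially \<noteq> bot" by simp
    show "N (z - B y) \<le> orth_app \<bar>T - R\<bar> (N y)"
    proof (rule order_null_le[OF both nb], rule always_eventually, rule allI)
      fix n
      have "N (z - B y) \<le> N (z - A n y) + N (A n y - B y)" by (rule lnorm_diff_triangle)
      also have "\<dots> \<le> N (z - A n y) + (orth_app \<bar>T - S n\<bar> (N y) + orth_app \<bar>T - R\<bar> (N y))"
        unfolding diff[OF R] by (intro add_left_mono tri)
      finally show "N (z - B y) \<le> orth_app \<bar>T - R\<bar> (N y) + (N (z - A n y) + orth_app \<bar>T - S n\<bar> (N y))"
        by (simp add: algebra_simps)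
    qed
    show "orth_app \<bar>T - R\<bar> (N y) \<le> N (z - B y)"
    proof (rule order_null_le[OF both nb], rule always_eventually, rule allI)
      fix n
      have "orth_app \<bar>T - R\<bar> (N y) \<le> orth_app (\<bar>T - S n\<bar> + \<bar>S n - R\<bar>) (N y)"
        using abs_triangle_ineq[of "T - S n" "S n - R"] by (intro orth_app_mono_left lnorm_nonneg) simp
      also have "\<dots> = orth_app \<bar>T - S n\<bar> (N y) + N (A n y - B y)" by (simp add: orth_app_simps diff[OF R])
      also have "\<dots> \<le> orth_app \<bar>T - S n\<bar> (N y) + (N (z - A n y) + N (z - B y))"
        using lnorm_diff_triangle[of "A n y" "B y" z] lnorm_minus_commute[of "A n y" z] by simp
      finally show "orth_app \<bar>T - R\<bar> (N y) \<le> N (z - B y) + (N (z - A n y) + orth_app \<bar>T - S n\<bar> (N y))"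
        by (simp add: algebra_simps)
    qed
  qed
  then show ?thesis by blast
qed

lemma is_orth_action_exists: "\<exists>act. is_orth_action N act"
proof -
  define act where
    "act T y = (SOME z. \<forall>S A. step_action S A \<longrightarrow> N (z - A y) = orth_app \<bar>T - S\<bar> (N y))" for T y
  have act: "N (act T y - A y) = orth_app \<bar>T - S\<bar> (N y)" if "step_action S A" for T y S A
    using someI_ex[OF action_exists[of y T]] that unfolding act_def by blast
  have approx: "\<exists>u\<ge>0. \<forall>\<epsilon>>0. \<exists>S A. step_action S A \<and> \<bar>T - S\<bar> \<le> \<epsilon> *\<^sub>R u" for T :: "'e orth"
  proof -
    obtain u where u: "0 \<le> u" "\<And>\<epsilon>. 0 < \<epsilon> \<Longrightarrow> \<exists>S\<in>step_orth. \<bar>T - S\<bar> \<le> \<epsilon> *\<^sub>R u"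
      using step_orth_approx[of T] by blast
    have "\<exists>S A. step_action S A \<and> \<bar>T - S\<bar> \<le> \<epsilon> *\<^sub>R u" if \<epsilon>: "0 < \<epsilon>" for \<epsilon> :: real
    proof -
      obtain S where S: "S \<in> step_orth" "\<bar>T - S\<bar> \<le> \<epsilon> *\<^sub>R u" using u(2)[OF \<epsilon>] by (elim bexE)
      moreover obtain A where "step_action S A" using step_action_exists[OF S(1)] by (elim exE)
      ultimately show ?thesis by (intro exI conjI)
    qed
    then show ?thesis using u(1) by (intro exI[of _ u]) simp
  qed
  have norm: "N (act T y) = orth_app \<bar>T\<bar> (N y)" for T y
    using act[OF step_action.zero, of T y] by simp
  have close: "N (act T y - A y) \<le> \<epsilon> *\<^sub>R orth_app u (N y)" if "step_action S A" "\<bar>T - S\<bar> \<le> \<epsilon> *\<^sub>R u" for T y S A \<epsilon> u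
    using orth_app_mono_left[OF that(2) lnorm_nonneg, of y] act[OF that(1), of T y] by (simp add: orth_app_simps)
  have eqI: "x = z" if "\<And>\<epsilon>. 0 < \<epsilon> \<Longrightarrow> N (x - z) \<le> \<epsilon> *\<^sub>R u" for x z u
    using lnorm_eq_zero_le[of "x - z"] vl_le_epsI[of "N (x - z)" 0 u] that by simp
  have "is_orth_action N act"
    unfolding is_orth_action_def
  proof (intro conjI allI)
    fix S T :: "'e orth" and x y
    obtain u where u: "0 \<le> u" "\<And>\<epsilon>. 0 < \<epsilon> \<Longrightarrow> \<exists>R A. step_action R A \<and> \<bar>S - R\<bar> \<le> \<epsilon> *\<^sub>R u"
      using approx[of S] by blast
    obtain v where v: "0 \<le> v" "\<And>\<epsilon>. 0 < \<epsilon> \<Longrightarrow> \<exists>R A. step_action R A \<and> \<bar>T - R\<bar> \<le> \<epsilon> *\<^sub>R v"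
      using approx[of T] by blast
    show "act (S + T) x = act S x + act T x"
    proof (rule eqI)
      fix \<epsilon> :: real assume "0 < \<epsilon>"
      then obtain R A P B where R: "step_action R A" "\<bar>S - R\<bar> \<le> \<epsilon> *\<^sub>R u"
        and P: "step_action P B" "\<bar>T - P\<bar> \<le> \<epsilon> *\<^sub>R v" using u v by meson
      have RP: "step_action (R + P) (\<lambda>y. A y + B y)" by (rule step_action_plus[OF P(1) R(1)])
      have "\<bar>S + T - (R + P)\<bar> \<le> \<bar>S - R\<bar> + \<bar>T - P\<bar>"
        using abs_triangle_ineq[of "S - R" "T - P"] by (simp add: algebra_simps)
      also have "\<dots> \<le> \<epsilon> *\<^sub>R u + \<epsilon> *\<^sub>R v" by (rule add_mono[OF R(2) P(2)])
      finally have le: "\<bar>S + T - (R + P)\<bar> \<le> \<epsilon> *\<^sub>R (u + v)" by (simp add: scaleR_add_right)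
      have "act (S + T) x - (act S x + act T x) =
          ((act (S + T) x - (A x + B x)) - (act S x - A x)) - (act T x - B x)" by simp
      then have "N (act (S + T) x - (act S x + act T x)) \<le>
          N (act (S + T) x - (A x + B x)) + N (act S x - A x) + N (act T x - B x)"
        by (metis add_right_mono lnorm_triangle_diff order_trans)
      also have "\<dots> \<le> \<epsilon> *\<^sub>R orth_app (u + v) (N x) + \<epsilon> *\<^sub>R orth_app u (N x) + \<epsilon> *\<^sub>R orth_app v (N x)"
        by (intro add_mono close[OF RP le] close[OF R] close[OF P])
      finally show "N (act (S + T) x - (act S x + act T x)) \<le>
          \<epsilon> *\<^sub>R (orth_app (u + v) (N x) + orth_app u (N x) + orth_app v (N x))"
        by (simp add: scaleR_add_right)
    qed
    show "act T (x + y) = act T x + act T y"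
    proof (rule eqI)
      fix \<epsilon> :: real assume "0 < \<epsilon>"
      then obtain P B where P: "step_action P B" "\<bar>T - P\<bar> \<le> \<epsilon> *\<^sub>R v" using v by meson
      have "act T (x + y) - (act T x + act T y) =
          ((act T (x + y) - B (x + y)) - (act T x - B x)) - (act T y - B y)"
        by (simp add: step_action_additive[OF P(1)])
      then have "N (act T (x + y) - (act T x + act T y)) \<le>
          N (act T (x + y) - B (x + y)) + N (act T x - B x) + N (act T y - B y)"
        by (metis add_right_mono lnorm_triangle_diff order_trans)
      also have "\<dots> \<le> \<epsilon> *\<^sub>R orth_app v (N (x + y)) + \<epsilon> *\<^sub>R orth_app v (N x) + \<epsilon> *\<^sub>R orth_app v (N y)"
        by (intro add_mono close[OF P])
      finally show "N (act T (x + y) - (act T x + act T y)) \<le>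
          \<epsilon> *\<^sub>R (orth_app v (N (x + y)) + orth_app v (N x) + orth_app v (N y))"
        by (simp add: scaleR_add_right)
    qed
    show "act (S * T) x = act S (act T x)"
    proof (rule eqI)
      fix \<epsilon> :: real assume e: "0 < \<epsilon>"
      \<comment> \<open>Besides being small, the accuracy is kept below 1, so that
        \<open>\<bar>R\<bar>\<close> has the bound \<open>\<bar>S\<bar> + u\<close> independent of
        \<epsilon>. This is needed for the error term \<open>R * (T - P)\<close>.\<close>
      define \<delta> where "\<delta> = min \<epsilon> 1"
      have \<delta>: "0 < \<delta>" "\<delta> \<le> \<epsilon>" "\<delta> \<le> 1" using e by (auto simp: \<delta>_def)
      obtain R A P B where R: "step_action R A" "\<bar>S - R\<bar> \<le> \<delta> *\<^sub>R u"
        and P: "step_action P B" "\<bar>T - P\<bar> \<le> \<delta> *\<^sub>R v" using u v \<delta>(1) by meson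
      have RP: "step_action (R * P) (\<lambda>y. A (B y))" by (rule step_action_mult[OF P(1) R(1)])
      have Ru: "\<bar>R\<bar> \<le> \<bar>S\<bar> + u"
      proof -
        have "\<bar>R\<bar> \<le> \<bar>S\<bar> + \<bar>S - R\<bar>" using abs_triangle_ineq4[of S "S - R"] by simp
        also have "\<dots> \<le> \<bar>S\<bar> + u"
          using order_trans[OF R(2) scaleR_right_mono[OF \<delta>(3) u(1)]] by simp
        finally show ?thesis .
      qed
      let ?v = "(\<bar>S\<bar> + u) * v"
      have v0: "0 \<le> ?v" by (intro orth_mult_nonneg add_nonneg_nonneg u v) simp
      have RTP: "\<bar>R\<bar> * \<bar>T - P\<bar> \<le> \<delta> *\<^sub>R ?v"
      proof -
        have "\<bar>R\<bar> * \<bar>T - P\<bar> \<le> (\<bar>S\<bar> + u) * (\<delta> *\<^sub>R v)"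
          by (intro mult_mono Ru P add_nonneg_nonneg u abs_ge_zero)
        then show ?thesis by simp
      qed
      have "\<bar>S * T - R * P\<bar> = \<bar>(S - R) * T + R * (T - P)\<bar>" by (simp add: left_diff_distrib right_diff_distrib)
      also have "\<dots> \<le> \<bar>(S - R) * T\<bar> + \<bar>R * (T - P)\<bar>" by (rule abs_triangle_ineq)
      also have "\<dots> \<le> \<bar>S - R\<bar> * \<bar>T\<bar> + \<bar>R\<bar> * \<bar>T - P\<bar>" by (intro add_mono abs_le_mult)
      also have "\<dots> \<le> (\<delta> *\<^sub>R u) * \<bar>T\<bar> + \<delta> *\<^sub>R ?v" by (intro add_mono mult_right_mono R RTP abs_ge_zero)
      finally have le: "\<bar>S * T - R * P\<bar> \<le> \<delta> *\<^sub>R (u * \<bar>T\<bar> + ?v)" by (simp add: scaleR_add_right)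
      have 3: "N (A (act T x) - A (B x)) \<le> \<delta> *\<^sub>R orth_app ?v (N x)"
      proof -
        have "A (act T x) - A (B x) = A (act T x - B x)"
          using step_action_additive[OF R(1), of "act T x - B x" "B x"] by simp
        then have "N (A (act T x) - A (B x)) = orth_app \<bar>R\<bar> (N (act T x - B x))"
          by (simp add: norm_step_action[OF R(1)])
        also have "\<dots> = orth_app (\<bar>R\<bar> * \<bar>T - P\<bar>) (N x)" by (simp add: act[OF P(1)] orth_app_mult)
        also have "\<dots> \<le> orth_app (\<delta> *\<^sub>R ?v) (N x)" by (rule orth_app_mono_left[OF RTP lnorm_nonneg])
        finally show ?thesis by (simp add: orth_app_simps)
      qed
      let ?w1 = "orth_app (u * \<bar>T\<bar> + ?v) (N x)" and ?w2 = "orth_app u (N (act T x))" and ?w3 = "orth_app ?v (N x)"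
      have "act (S * T) x - act S (act T x) =
          ((act (S * T) x - A (B x)) - (act S (act T x) - A (act T x))) - (A (act T x) - A (B x))" by simp
      then have "N (act (S * T) x - act S (act T x)) \<le>
          N (act (S * T) x - A (B x)) + N (act S (act T x) - A (act T x)) + N (A (act T x) - A (B x))"
        by (metis add_right_mono lnorm_triangle_diff order_trans)
      also have "\<dots> \<le> \<delta> *\<^sub>R ?w1 + \<delta> *\<^sub>R ?w2 + \<delta> *\<^sub>R ?w3"
        by (intro add_mono close[OF RP le] close[OF R] 3)
      also have "\<dots> = \<delta> *\<^sub>R (?w1 + ?w2 + ?w3)" by (simp add: scaleR_add_right)
      also have "\<dots> \<le> \<epsilon> *\<^sub>R (?w1 + ?w2 + ?w3)"
        by (intro scaleR_right_mono \<delta> add_nonneg_nonneg orth_app_nonneg lnorm_nonneg u v orth_mult_nonneg abs_ge_zero)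
      finally show "N (act (S * T) x - act S (act T x)) \<le> \<epsilon> *\<^sub>R (?w1 + ?w2 + ?w3)" .
    qed
    show "act 1 x = x"
    proof -
      have "step_action (0 + 1 *\<^sub>R 1) (\<lambda>y. 0 + rscale 1 (band_part 1 y))"
        by (rule step_action.add[OF step_action.zero component_1])
      moreover have "band_part 1 y = y" for y
        by (rule band_part_eqI[OF component_1]) (simp_all add: orth_app_simps lnorm_zero)
      ultimately have "step_action 1 (\<lambda>y. y)" by simp
      from act[OF this, of 1 x] have "N (act 1 x - x) \<le> 0" by (simp add: orth_app_simps)
      then show ?thesis using lnorm_eq_zero_le by fastforce
    qed
    show "N (act T x) = orth_app \<bar>T\<bar> (N x)" by (rule norm)
  qed
  then show ?thesis by (rule exI[of "is_orth_action N"])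
qed

end

section \<open>Compact Hausdorff uniform spaces\<close>

lemma finite_subcover_family:
  assumes "compact (UNIV :: 's::topological_space set)"
    and "\<And>x. open (U x)" "\<And>x. x \<in> (U x :: 's set)"
  obtains X where "finite X" "\<And>y. \<exists>x\<in>X. y \<in> U x"
proof -
  have "UNIV \<subseteq> (\<Union>x\<in>UNIV. U x)" using assms(3) by auto
  then obtain X where "X \<subseteq> UNIV" "finite X" "UNIV \<subseteq> (\<Union>x\<in>X. U x)"
    using compactE_image[OF assms(1), of UNIV U] assms(2) by blast
  then show ?thesis using that[of X] by auto
qed

lemma eventually_uniformity_nhds:
  fixes x :: "'s::uniform_space"
  assumes "eventually D uniformity"
  obtains O' where "open O'" "x \<in> O'" "\<And>y. y \<in> O' \<Longrightarrow> D (x, y)"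
proof -
  have "eventually (\<lambda>y. D (x, y)) (nhds x)"
    unfolding eventually_nhds_uniformity using assms by (auto elim: eventually_mono)
  then show ?thesis using that unfolding eventually_nhds by blast
qed

text \<open>The Heine-Cantor theorem. The entourage at \<open>x\<close> is halved, so that
  \<open>f z\<close> is still close to \<open>f x\<close> when \<open>y\<close> is close to
  \<open>x\<close> and \<open>z\<close> is close to \<open>y\<close>.\<close>

lemma compact_continuous_imp_uniform:
  fixes f :: "'s::uniform_space \<Rightarrow> real"
  assumes "compact (UNIV :: 's set)" "continuous_on UNIV f" "0 < \<epsilon>"
  shows "\<forall>\<^sub>F (s, t) in uniformity. \<bar>f s - f t\<bar> < \<epsilon>"
proof -
  have "\<exists>D O'. eventually D uniformity \<and> open O' \<and> x \<in> O' \<and> (\<forall>y\<in>O'. D (x, y)) \<and>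
    (\<forall>y z. D (x, y) \<longrightarrow> D (y, z) \<longrightarrow> \<bar>f z - f x\<bar> < \<epsilon> / 2)" for x
  proof -
    have "eventually (\<lambda>y. \<bar>f y - f x\<bar> < \<epsilon> / 2) (nhds x)"
    proof -
      have "(f \<longlongrightarrow> f x) (nhds x)"
        using assms(2) unfolding continuous_on_def tendsto_at_iff_tendsto_nhds by simp
      from tendstoD[OF this, of "\<epsilon> / 2"] show ?thesis using assms(3) by (simp add: dist_real_def)
    qed
    then have "eventually (\<lambda>(x', y). x' = x \<longrightarrow> \<bar>f y - f x\<bar> < \<epsilon> / 2) uniformity"
      unfolding eventually_nhds_uniformity .
    then obtain D where D: "eventually D uniformity"
      "\<And>u y z. D (u, y) \<Longrightarrow> D (y, z) \<Longrightarrow> u = x \<longrightarrow> \<bar>f z - f x\<bar> < \<epsilon> / 2"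
      by (rule uniformity_transE) auto
    obtain O' where "open O'" "x \<in> O'" "\<And>y. y \<in> O' \<Longrightarrow> D (x, y)"
      using eventually_uniformity_nhds[OF D(1)] by blast
    then show ?thesis using D by blast
  qed
  then obtain D O' where DO: "\<And>x. eventually (D x) uniformity" "\<And>x. open (O' x)" "\<And>x. x \<in> O' x"
    "\<And>x y. y \<in> O' x \<Longrightarrow> D x (x, y)"
    "\<And>x y z. D x (x, y) \<Longrightarrow> D x (y, z) \<Longrightarrow> \<bar>f z - f x\<bar> < \<epsilon> / 2" by metis
  obtain X where X: "finite X" "\<And>y. \<exists>x\<in>X. y \<in> O' x"
    using finite_subcover_family[OF assms(1), of O'] DO(2,3) by blast
  have "\<forall>\<^sub>F p in uniformity. \<forall>x\<in>X. D x p"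
    using X(1) DO(1) by (simp add: eventually_ball_finite)
  then show ?thesis
  proof eventually_elim
    case (elim p)
    obtain y z where p: "p = (y, z)" by (cases p)
    obtain x where x: "x \<in> X" "y \<in> O' x" using X(2) by blast
    have "D x (y, y)" using uniformity_refl[OF DO(1)] .
    then have "\<bar>f y - f x\<bar> < \<epsilon> / 2" by (rule DO(5)[OF DO(4)[OF x(2)]])
    moreover have "\<bar>f z - f x\<bar> < \<epsilon> / 2" using DO(5)[OF DO(4)[OF x(2)]] elim x(1) p by blast
    ultimately have "\<bar>f y - f z\<bar> < \<epsilon>" by linarith
    then show ?case using p by simp
  qed
qed

lemma uniformity_urysohn:
  fixes x :: "'s::{uniform_space, t2_space}"
  assumes "compact (UNIV :: 's set)" "eventually E uniformity"
  obtains f :: "'s \<Rightarrow> real" where "continuous_on UNIV f" "\<And>y. 0 \<le> f y" "\<And>y. f y \<le> 1" "f x = 0"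
    "\<And>y. \<not> E (x, y) \<Longrightarrow> f y = 1"
proof -
  obtain O' where O': "open O'" "x \<in> O'" "\<And>y. y \<in> O' \<Longrightarrow> E (x, y)"
    using eventually_uniformity_nhds[OF assms(2)] by blast
  have "Hausdorff_space (euclidean :: 's topology)"
    unfolding Hausdorff_space_def using hausdorff by (simp add: disjnt_def) blast
  then have "normal_space (euclidean :: 's topology)"
    using assms(1) by (intro compact_Hausdorff_or_regular_imp_normal_space) (auto simp: compact_space_def)
  moreover have "closedin euclidean {x}" "closedin euclidean (- O')" "disjnt {x} (- O')"
    using O' by (auto simp: disjnt_def)
  ultimately obtain f :: "'s \<Rightarrow> real" where f: "continuous_map euclidean (top_of_set {0..1}) f"
    "f ` {x} \<subseteq> {0}" "f ` (- O') \<subseteq> {1}"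
    using Urysohn_lemma[of euclidean "{x}" "- O'" 0 1] by (metis zero_le_one)
  then have "continuous_on UNIV f" "\<And>y. f y \<in> {0..1}"
    by (auto simp: continuous_map_in_subtopology)
  then show ?thesis using that[of f] f O'(3) by fastforce
qed

text \<open>Convergence of states gives information about points only through functions; finitely
  many Urysohn functions suffice to control an entourage. The function of \<open>x\<close> is 0 at
  \<open>x\<close> and 1 away from it. If it is below 1/2 at \<open>s\<close> and changes by less
  than 1/2, it stays below 1 at \<open>t\<close>, so both points are close to
  \<open>x\<close>.\<close>

lemma uniformity_separating_functions:
  fixes E :: "'s::{uniform_space, t2_space} \<times> 's \<Rightarrow> bool"
  assumes "compact (UNIV :: 's set)" "eventually E uniformity"
  obtains \<Phi> :: "('s \<Rightarrow> real) set" where "finite \<Phi>" "\<And>\<phi>. \<phi> \<in> \<Phi> \<Longrightarrow> continuous_on UNIV \<phi>"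
    "\<And>\<phi> s. \<phi> \<in> \<Phi> \<Longrightarrow> 0 \<le> \<phi> s \<and> \<phi> s \<le> 1"
    "\<And>s t. (\<And>\<phi>. \<phi> \<in> \<Phi> \<Longrightarrow> \<bar>\<phi> s - \<phi> t\<bar> < 1/2) \<Longrightarrow> E (s, t)"
proof -
  obtain D0 where D0: "eventually D0 uniformity" "\<And>x y z. D0 (x, y) \<Longrightarrow> D0 (y, z) \<Longrightarrow> E (x, z)"
    using uniformity_transE[OF assms(2)] by blast
  define D where "D p \<longleftrightarrow> D0 p \<and> D0 (snd p, fst p)" for p
  have evD: "eventually D uniformity"
    using uniformity_sym[OF D0(1)] D0(1) unfolding D_def by eventually_elim auto
  have "\<exists>f :: 's \<Rightarrow> real. continuous_on UNIV f \<and> (\<forall>y. 0 \<le> f y \<and> f y \<le> 1) \<and> f x = 0 \<and>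
    (\<forall>y. \<not> D (x, y) \<longrightarrow> f y = 1)" for x
    using uniformity_urysohn[OF assms(1) evD, of x] by metis
  then obtain f :: "'s \<Rightarrow> 's \<Rightarrow> real" where f: "\<And>x. continuous_on UNIV (f x)"
    "\<And>x y. 0 \<le> f x y \<and> f x y \<le> 1" "\<And>x. f x x = 0" "\<And>x y. \<not> D (x, y) \<Longrightarrow> f x y = 1" by metis
  have "open {y. f x y < 1/2}" for x
    by (rule open_Collect_less[OF f(1) continuous_on_const])
  then obtain X where X: "finite X" "\<And>y. \<exists>x\<in>X. y \<in> {y. f x y < 1/2}"
    using finite_subcover_family[OF assms(1), of "\<lambda>x. {y. f x y < 1/2}"] f(3) by auto
  show ?thesis
  proof
    show "finite (f ` X)" using X by simp
    fix s t assume st: "\<And>\<phi>. \<phi> \<in> f ` X \<Longrightarrow> \<bar>\<phi> s - \<phi> t\<bar> < 1/2"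
    obtain x where x: "x \<in> X" "f x s < 1/2" using X(2) by blast
    moreover have "\<bar>f x s - f x t\<bar> < 1/2" using st[of "f x"] x by simp
    ultimately have "f x t < 1" by linarith
    then have "D (x, s)" "D (x, t)" using f(4)[of x s] f(4)[of x t] x by auto
    then show "E (s, t)" using D0(2)[of s x t] by (simp add: D_def)
  qed (use f in auto)
qed

section \<open>Uniformly order continuous functions\<close>

context lattice_normed_space begin

text \<open>The infimum of suprema is order convergence along the uniformity. In this form the side
  conditions of conditional completeness have been discharged once and for all.\<close>

lemma Cuo_iff:
  fixes f :: "'s::uniform_space \<Rightarrow> 'x"
  shows "f \<in> Cuo N \<longleftrightarrow> (\<exists>e. \<forall>s. N (f s) \<le> e) \<and> order_tendsto (\<lambda>(s, t). N (f s - f t)) 0 uniformity"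
proof (cases "\<exists>e. \<forall>s. N (f s) \<le> e")
  case True
  then obtain e where e: "\<And>s. N (f s) \<le> e" by blast
  let ?h = "\<lambda>(s, t). N (f s - f t)"
  let ?UU = "{U :: ('s \<times> 's) set. \<forall>\<^sub>F p in uniformity. p \<in> U}"
  have he: "?h p \<le> e + e" for p
    by (cases p) (auto intro: order_trans[OF lnorm_triangle_diff] add_mono e)
  have h0: "0 \<le> ?h p" for p by (cases p) (simp add: lnorm_nonneg)
  have bdd: "bdd_above (?h ` U)" for U by (rule bdd_aboveI[of _ "e + e"]) (use he in blast)
  have up: "?h p \<le> (SUP p\<in>U. ?h p)" if "p \<in> U" for p U
    by (rule cSUP_upper[OF that bdd])
  \<comment> \<open>The uniformity is a proper filter, so no entourage is empty and no supremum over
    the empty set occurs.\<close>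
  have ne: "U \<noteq> {}" if "U \<in> ?UU" for U
    using that by (auto simp: uniformity_bot)
  have pos: "0 \<le> (SUP p\<in>U. ?h p)" if "U \<in> ?UU" for U
    using ne[OF that] up[of _ U] h0 by (meson all_not_in_conv order_trans)
  have UU: "UNIV \<in> ?UU" by simp
  have "(INF U\<in>?UU. SUP p\<in>U. ?h p) = 0 \<longleftrightarrow> order_tendsto ?h 0 uniformity"
  proof
    assume inf: "(INF U\<in>?UU. SUP p\<in>U. ?h p) = 0"
    have "inf_zero ((\<lambda>U. SUP p\<in>U. ?h p) ` ?UU)" unfolding inf_zero_iff using inf pos UU by blast
    then show "order_tendsto ?h 0 uniformity"
    proof (rule order_tendstoI)
      fix d assume "d \<in> (\<lambda>U. SUP p\<in>U. ?h p) ` ?UU"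
      then obtain U where U: "U \<in> ?UU" "d = (SUP p\<in>U. ?h p)" by blast
      then have "\<forall>\<^sub>F p in uniformity. p \<in> U" by blast
      then show "\<forall>\<^sub>F p in uniformity. \<bar>?h p - 0\<bar> \<le> d"
        by eventually_elim (simp only: U(2) diff_zero abs_of_nonneg[OF h0] up)
    qed
  next
    assume "order_tendsto ?h 0 uniformity"
    then obtain D where D: "inf_zero D" "\<And>d. d \<in> D \<Longrightarrow> \<forall>\<^sub>F p in uniformity. \<bar>?h p - 0\<bar> \<le> d"
      using order_tendstoE by blast
    have bb: "bdd_below ((\<lambda>U. SUP p\<in>U. ?h p) ` ?UU)" by (rule bdd_belowI[of _ 0]) (use pos in blast)
    have "(INF U\<in>?UU. SUP p\<in>U. ?h p) \<le> 0"
    proof (rule inf_zeroD[OF D(1)])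
      fix d assume "d \<in> D"
      from D(2)[OF this] have "\<forall>\<^sub>F p in uniformity. ?h p \<le> d"
        by eventually_elim (simp only: diff_zero abs_of_nonneg[OF h0])
      then have U: "{p. ?h p \<le> d} \<in> ?UU" by simp
      have "(INF U\<in>?UU. SUP p\<in>U. ?h p) \<le> (SUP p\<in>{p. ?h p \<le> d}. ?h p)"
        by (rule cINF_lower[OF bb U])
      also have "\<dots> \<le> d" by (rule cSUP_least[OF ne[OF U]]) blast
      finally show "(INF U\<in>?UU. SUP p\<in>U. ?h p) \<le> d" .
    qed
    moreover have "0 \<le> (INF U\<in>?UU. SUP p\<in>U. ?h p)"
      by (rule cINF_greatest) (use UU pos in blast)+
    ultimately show "(INF U\<in>?UU. SUP p\<in>U. ?h p) = 0" by (rule antisym)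
  qed
  then show ?thesis using True by (simp add: Cuo_def)
next
  case False
  then show ?thesis unfolding Cuo_def by blast
qed

lemma Cuo_bounded:
  assumes "f \<in> Cuo N" obtains e where "0 \<le> e" "\<And>s. N (f s) \<le> e"
  using assms unfolding Cuo_iff by (meson lnorm_nonneg order_trans)

lemma Cuo_modulus: "f \<in> Cuo N \<Longrightarrow> order_tendsto (\<lambda>(s, t). N (f s - f t)) 0 uniformity"
  by (simp add: Cuo_iff)

lemma CuoI:
  assumes "\<And>s. N (f s) \<le> e" "order_tendsto h 0 uniformity" "\<And>s t. N (f s - f t) \<le> h (s, t)"
  shows "f \<in> Cuo N"
  unfolding Cuo_iff
proof (intro conjI exI allI)
  show "order_tendsto (\<lambda>(s, t). N (f s - f t)) 0 uniformity"
    by (rule order_null_mono[OF assms(2)], intro always_eventually allI)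
      (metis (no_types, lifting) abs_of_nonneg assms(3) case_prod_conv lnorm_nonneg surj_pair)
qed (rule assms(1))

end

interpretation orth_lns: lattice_normed_space scaleR "abs :: 'e::dedekind_complete_vector_lattice orth \<Rightarrow> 'e orth"
proof
  have "x = 0" if "vl_disjoint x x" for x :: "'e orth" using that by (simp add: vl_disjoint_def)
  then have "disjoint_complement (range abs) = ({0} :: 'e orth set)"
    by (auto simp: disjoint_complement_def vl_disjoint_zero)
      (metis abs_idempotent vl_disjoint_def)
  then show "disjoint_complement (disjoint_complement (range abs)) = (UNIV :: 'e orth set)"
    by (auto simp: disjoint_complement_def vl_disjoint_def inf_absorb2)
qed (auto simp: vl_abs_scaleR abs_triangle_ineq scaleR_add_right scaleR_add_left)

abbreviation orth_functions :: "('s::uniform_space \<Rightarrow> 'e::dedekind_complete_vector_lattice orth) set"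
  where "orth_functions \<equiv> Cuo abs"

lemma Cuo_const: "(\<lambda>s. l) \<in> orth_functions"
  by (rule orth_lns.CuoI[of _ "\<bar>l\<bar>" "\<lambda>p. 0"])
    (auto simp: order_tendsto_def intro!: exI[of _ "{0}"])

text \<open>Multiplication by a positive element is an orthomorphism of the lattice of
  orthomorphisms, so order continuity is used one level up.\<close>

lemma order_null_orth_mult:
  fixes h :: "'i \<Rightarrow> 'e::dedekind_complete_vector_lattice orth"
  assumes "order_tendsto h 0 F" "0 \<le> a"
  shows "order_tendsto (\<lambda>i. a * h i) 0 F"
proof -
  have "orthomorphism (\<lambda>x. a * x)"
  proof (rule orthomorphismI)
    show "linear (\<lambda>x. a * x)" by (rule linearI) (simp_all add: distrib_left)
    show "\<exists>c d. \<forall>x. u \<le> x \<and> x \<le> v \<longrightarrow> c \<le> a * x \<and> a * x \<le> d" for u v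
      by (intro exI[of _ "a * u"] exI[of _ "a * v"]) (simp add: mult_left_mono assms)
    fix x y :: "'e orth" assume xy: "vl_disjoint x y"
    have "inf \<bar>a * x\<bar> \<bar>y\<bar> \<le> 0"
    proof (rule orth_leI)
      fix z :: 'e assume z: "0 \<le> z"
      have xyz: "inf (orth_app \<bar>x\<bar> z) (orth_app \<bar>y\<bar> z) = 0"
        using xy orth_app_inf[OF z, of "\<bar>x\<bar>" "\<bar>y\<bar>"] by (simp add: vl_disjoint_def orth_app_simps)
      then have "vl_disjoint (orth_app \<bar>x\<bar> z) (orth_app \<bar>y\<bar> z)"
        using z by (simp add: vl_disjoint_def orth_app_nonneg)
      then have "vl_disjoint (orth_app a (orth_app \<bar>x\<bar> z)) (orth_app \<bar>y\<bar> z)"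
        by (rule orthomorphism_disjoint[OF orthomorphism_orth_app])
      then have "inf (orth_app (a * \<bar>x\<bar>) z) (orth_app \<bar>y\<bar> z) = 0"
        using z assms by (simp add: vl_disjoint_def orth_app_nonneg orth_app_mult)
      moreover have "\<bar>a * x\<bar> \<le> a * \<bar>x\<bar>" using abs_le_mult[of a x] assms by simp
      then have "orth_app \<bar>a * x\<bar> z \<le> orth_app (a * \<bar>x\<bar>) z" by (rule orth_app_mono_left[OF _ z])
      ultimately show "orth_app (inf \<bar>a * x\<bar> \<bar>y\<bar>) z \<le> orth_app 0 z"
        unfolding orth_app_inf[OF z] orth_app_zero by (metis inf_mono order_refl)
    qed
    moreover have "0 \<le> inf \<bar>a * x\<bar> \<bar>y\<bar>" by simp
    ultimately show "vl_disjoint (a * x) y" unfolding vl_disjoint_def by (rule antisym)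
  qed
  then have app: "orth_app (Orth ((*) a)) x = a * x" for x by (simp add: orth_app_Orth)
  have "0 \<le> Orth ((*) a)" by (rule orth_leI) (simp add: app orth_app_simps orth_mult_nonneg assms)
  from order_null_orth_app[OF assms(1) this] show ?thesis by (simp add: app)
qed

lemma Cuo_add:
  assumes "\<phi> \<in> orth_functions" "\<psi> \<in> orth_functions" shows "(\<lambda>s. \<phi> s + \<psi> s) \<in> orth_functions"
proof -
  obtain e e' where e: "\<And>s. \<bar>\<phi> s\<bar> \<le> e" "\<And>s. \<bar>\<psi> s\<bar> \<le> e'"
    using orth_lns.Cuo_bounded[OF assms(1)] orth_lns.Cuo_bounded[OF assms(2)] by metis
  show ?thesis
  proof (rule orth_lns.CuoI)
    show "\<bar>\<phi> s + \<psi> s\<bar> \<le> e + e'" for s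
      by (rule order_trans[OF abs_triangle_ineq add_mono[OF e]])
    show "order_tendsto (\<lambda>p. (case p of (s, t) \<Rightarrow> \<bar>\<phi> s - \<phi> t\<bar>) + (case p of (s, t) \<Rightarrow> \<bar>\<psi> s - \<psi> t\<bar>)) 0 uniformity"
      by (intro order_null_add orth_lns.Cuo_modulus assms)
    show "\<bar>\<phi> s + \<psi> s - (\<phi> t + \<psi> t)\<bar> \<le>
      (case (s, t) of (s, t) \<Rightarrow> \<bar>\<phi> s - \<phi> t\<bar>) + (case (s, t) of (s, t) \<Rightarrow> \<bar>\<psi> s - \<psi> t\<bar>)" for s t
      using abs_triangle_ineq[of "\<phi> s - \<phi> t" "\<psi> s - \<psi> t"] by (simp add: algebra_simps)
  qed
qed

lemma Cuo_lipschitz: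
  assumes "\<phi> \<in> orth_functions" "\<And>s. \<bar>\<psi> s\<bar> \<le> a" "\<And>s t. \<bar>\<psi> s - \<psi> t\<bar> \<le> \<bar>\<phi> s - \<phi> t\<bar>"
  shows "\<psi> \<in> orth_functions"
proof (rule orth_lns.CuoI[OF assms(2)])
  show "order_tendsto (\<lambda>(s, t). \<bar>\<phi> s - \<phi> t\<bar>) 0 uniformity" by (rule orth_lns.Cuo_modulus[OF assms(1)])
qed (simp add: assms(3))

lemma Cuo_mult:
  assumes "\<phi> \<in> orth_functions" "\<psi> \<in> orth_functions" shows "(\<lambda>s. \<phi> s * \<psi> s) \<in> orth_functions"
proof -
  obtain e where e: "0 \<le> e" "\<And>s. \<bar>\<phi> s\<bar> \<le> e" using orth_lns.Cuo_bounded[OF assms(1)] by blast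
  obtain e' where e': "0 \<le> e'" "\<And>s. \<bar>\<psi> s\<bar> \<le> e'" using orth_lns.Cuo_bounded[OF assms(2)] by blast
  show ?thesis
  proof (rule orth_lns.CuoI)
    show "\<bar>\<phi> s * \<psi> s\<bar> \<le> e * e'" for s
      by (rule order_trans[OF abs_le_mult mult_mono[OF e(2) e'(2) e(1)]]) simp
    show "order_tendsto (\<lambda>p. e' * (case p of (s, t) \<Rightarrow> \<bar>\<phi> s - \<phi> t\<bar>) + e * (case p of (s, t) \<Rightarrow> \<bar>\<psi> s - \<psi> t\<bar>)) 0 uniformity"
      by (intro order_null_add order_null_orth_mult orth_lns.Cuo_modulus assms e e')
    fix s t
    have "\<bar>\<phi> s * \<psi> s - \<phi> t * \<psi> t\<bar> = \<bar>\<psi> s * (\<phi> s - \<phi> t) + \<phi> t * (\<psi> s - \<psi> t)\<bar>"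
      by (simp add: algebra_simps)
    also have "\<dots> \<le> \<bar>\<psi> s * (\<phi> s - \<phi> t)\<bar> + \<bar>\<phi> t * (\<psi> s - \<psi> t)\<bar>" by (rule abs_triangle_ineq)
    also have "\<dots> \<le> e' * \<bar>\<phi> s - \<phi> t\<bar> + e * \<bar>\<psi> s - \<psi> t\<bar>"
      by (intro add_mono order_trans[OF abs_le_mult] mult_right_mono e e' abs_ge_zero)
    finally show "\<bar>\<phi> s * \<psi> s - \<phi> t * \<psi> t\<bar> \<le>
      e' * (case (s, t) of (s, t) \<Rightarrow> \<bar>\<phi> s - \<phi> t\<bar>) + e * (case (s, t) of (s, t) \<Rightarrow> \<bar>\<psi> s - \<psi> t\<bar>)" by simp
  qed
qed

lemma Cuo_const_mult: "\<phi> \<in> orth_functions \<Longrightarrow> (\<lambda>s. l * \<phi> s) \<in> orth_functions"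
  by (rule Cuo_mult[OF Cuo_const])

lemma Cuo_scaleR: "\<phi> \<in> orth_functions \<Longrightarrow> (\<lambda>s. r *\<^sub>R \<phi> s) \<in> orth_functions"
  using Cuo_const_mult[of \<phi> "r *\<^sub>R 1"] by simp

lemma Cuo_minus: "\<phi> \<in> orth_functions \<Longrightarrow> (\<lambda>s. - \<phi> s) \<in> orth_functions"
  using Cuo_scaleR[of \<phi> "- 1"] by simp

lemma Cuo_diff: "\<phi> \<in> orth_functions \<Longrightarrow> \<psi> \<in> orth_functions \<Longrightarrow> (\<lambda>s. \<phi> s - \<psi> s) \<in> orth_functions"
  using Cuo_add[OF _ Cuo_minus, of \<phi> \<psi>] by simp

lemma Cuo_abs:
  assumes "\<phi> \<in> orth_functions" shows "(\<lambda>s. \<bar>\<phi> s\<bar>) \<in> orth_functions"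
proof -
  obtain e where "\<And>s. \<bar>\<phi> s\<bar> \<le> e" using orth_lns.Cuo_bounded[OF assms] by blast
  then show ?thesis by (intro Cuo_lipschitz[OF assms, of _ e]) (simp_all add: abs_triangle_ineq3)
qed

lemma vl_two_sup: "2 *\<^sub>R sup a b = a + b + \<bar>a - b\<bar>" for a b :: "'e::dedekind_complete_vector_lattice"
proof -
  have "2 *\<^sub>R sup a b = sup a b + sup a b" by (simp add: scaleR_2)
  also have "\<dots> = (b + pprt (a - b)) + (a + pprt (b - a))" by (metis vl_sup_pprt sup_commute)
  also have "pprt (b - a) = - nprt (a - b)" using pprt_neg[of "a - b"] by simp
  finally show ?thesis by (simp add: abs_prts algebra_simps)
qed

lemma vl_sup_eq_half: "sup a b = (1/2) *\<^sub>R (a + b + \<bar>a - b\<bar>)" for a b :: "'e::dedekind_complete_vector_lattice"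
  unfolding vl_two_sup[symmetric] by simp

lemma Cuo_sup: "\<phi> \<in> orth_functions \<Longrightarrow> \<psi> \<in> orth_functions \<Longrightarrow> (\<lambda>s. sup (\<phi> s) (\<psi> s)) \<in> orth_functions"
  unfolding vl_sup_eq_half by (intro Cuo_scaleR Cuo_add Cuo_abs Cuo_diff)

lemma Cuo_inf: "\<phi> \<in> orth_functions \<Longrightarrow> \<psi> \<in> orth_functions \<Longrightarrow> (\<lambda>s. inf (\<phi> s) (\<psi> s)) \<in> orth_functions"
  unfolding inf_eq_neg_sup by (intro Cuo_minus Cuo_sup)

lemma Cuo_pprt: "\<phi> \<in> orth_functions \<Longrightarrow> (\<lambda>s. pprt (\<phi> s)) \<in> orth_functions"
  unfolding pprt_def by (intro Cuo_sup Cuo_const)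


lemma Cuo_continuous:
  fixes f :: "'s::uniform_space \<Rightarrow> real"
  assumes "compact (UNIV :: 's set)" "continuous_on UNIV f" "\<And>s. 0 \<le> f s \<and> f s \<le> 1"
  shows "(\<lambda>s. f s *\<^sub>R (1 :: 'e::dedekind_complete_vector_lattice orth)) \<in> orth_functions"
proof (rule orth_lns.CuoI)
  show "\<bar>f s *\<^sub>R (1 :: 'e orth)\<bar> \<le> 1 *\<^sub>R 1" for s
    unfolding vl_abs_scaleR abs_of_nonneg[OF orth_one_nonneg] using assms(3)[of s]
    by (intro scaleR_right_mono orth_one_nonneg) auto
  show "order_tendsto (\<lambda>(s, t). \<bar>f s *\<^sub>R (1 :: 'e orth) - f t *\<^sub>R 1\<bar>) 0 uniformity"
  proof (rule order_null_scaleR[OF orth_one_nonneg])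
    fix \<epsilon> :: real assume "0 < \<epsilon>"
    from compact_continuous_imp_uniform[OF assms(1,2) this]
    show "\<forall>\<^sub>F p in uniformity. \<bar>case p of (s, t) \<Rightarrow> \<bar>f s *\<^sub>R (1 :: 'e orth) - f t *\<^sub>R 1\<bar>\<bar> \<le> \<epsilon> *\<^sub>R 1"
    proof eventually_elim
      case (elim p)
      then have "\<bar>f (fst p) - f (snd p)\<bar> *\<^sub>R (1 :: 'e orth) \<le> \<epsilon> *\<^sub>R 1"
        by (intro scaleR_right_mono orth_one_nonneg) (auto simp: case_prod_beta)
      then show ?case
        by (simp add: case_prod_beta scaleR_diff_left[symmetric] vl_abs_scaleR abs_of_nonneg[OF orth_one_nonneg])
    qed
  qed
qed simp

section \<open>Partitions of unity\<close>

lemma component_mult_le: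
  "component b \<Longrightarrow> 0 \<le> T \<Longrightarrow> b * T \<le> T"
  using mult_right_mono[OF component_le_one, of b T] by simp

lemma component_mult_zero_iff:
  assumes "component a" "component b" shows "a * b = 0 \<longleftrightarrow> a \<le> 1 - b"
proof
  assume ab: "a * b = 0"
  have "a = a * (1 - b)" by (simp add: right_diff_distrib ab)
  also have "\<dots> \<le> 1 * (1 - b)"
    using assms by (intro mult_right_mono component_le_one component_nonneg component_compl)
  finally show "a \<le> 1 - b" by simp
next
  assume "a \<le> 1 - b"
  from mult_right_mono[OF this component_nonneg[OF assms(2)]]
  have "a * b \<le> 0" using assms(2) by (simp add: left_diff_distrib component_idem)
  moreover have "0 \<le> a * b" using assms by (simp add: orth_mult_nonneg component_nonneg)
  ultimately show "a * b = 0" by (rule antisym)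
qed

lemma component_Sup:
  assumes A: "A \<noteq> {}" "\<And>b. b \<in> A \<Longrightarrow> component b" shows "component (Sup A)"
proof (rule idempotent_component, rule antisym)
  have bdd: "bdd_above A" by (intro bdd_aboveI[of _ 1]) (simp add: A component_le_one)
  have up: "b \<le> Sup A" if "b \<in> A" for b by (rule cSup_upper[OF that bdd])
  have le1: "Sup A \<le> 1" by (rule cSup_least[OF A(1)]) (simp add: A component_le_one)
  obtain b where "b \<in> A" using A(1) by blast
  then have ge0: "0 \<le> Sup A" using up[of b] component_nonneg[OF A(2), of b] by simp
  show "Sup A * Sup A \<le> Sup A" using mult_right_mono[OF le1 ge0] by simp
  show "Sup A \<le> Sup A * Sup A"
  proof (rule cSup_least[OF A(1)])
    fix b assume b: "b \<in> A"
    have "b * b \<le> Sup A * Sup A" by (intro mult_mono up b ge0 component_nonneg A)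
    then show "b \<le> Sup A * Sup A" using A(2)[OF b] by (simp add: component_idem)
  qed
qed

lemma partition_component: "partition_of_unity \<pi> \<Longrightarrow> component (\<pi> s)"
  by (simp add: partition_of_unity_def band_projection_iff)

lemma partition_disjoint: "partition_of_unity \<pi> \<Longrightarrow> s \<noteq> t \<Longrightarrow> \<pi> s * \<pi> t = 0"
  by (rule orth_disjoint_mult) (simp_all add: partition_component component_nonneg partition_of_unity_def)

text \<open>All pieces are disjoint from the projection onto the band of \<open>x\<close>, so they
  lie below its complement, which must then be 1.\<close>

lemma partition_app_zeroI:
  assumes \<pi>: "partition_of_unity \<pi>" and x: "0 \<le> x" "\<And>s. orth_app (\<pi> s) x = 0"
  shows "x = 0"
proof -
  let ?P = "principal_projection x"
  have P: "component ?P" by (rule component_principal_projection[OF x(1)])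
  have "\<pi> s \<le> 1 - ?P" for s
    using orth_app_zero_principal[OF component_nonneg[OF partition_component[OF \<pi>]] x(1) x(2), of s]
    by (simp add: component_mult_zero_iff[symmetric] partition_component[OF \<pi>] P mult.commute)
  then have "1 \<le> 1 - ?P"
    using \<pi> component_compl[OF P] unfolding partition_of_unity_def band_projection_iff by blast
  then have "?P = 0" using component_nonneg[OF P] by (simp add: antisym)
  then show ?thesis using principal_projection_self[OF x(1)] by (simp add: orth_app_simps)
qed

lemma vl_abs_add_self_nonneg: "0 \<le> \<bar>z\<bar> + z" for z :: "'e::lattice_ab_group_add_abs"
  using vl_abs_ge(2)[of z] add_right_mono[of "- z" "\<bar>z\<bar>" z] by simp

lemma partition_app_leI:
  assumes \<pi>: "partition_of_unity \<pi>" and xy: "\<And>s. orth_app (\<pi> s) x \<le> orth_app (\<pi> s) y"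
  shows "x \<le> y"
proof -
  let ?z = "x - y"
  \<comment> \<open>This sum is twice the positive part of \<open>?z\<close>, written so that
    components can be applied to it term by term.\<close>
  have "\<bar>?z\<bar> + ?z = 0"
  proof (rule partition_app_zeroI[OF \<pi> vl_abs_add_self_nonneg])
    fix s
    have "orth_app (\<pi> s) ?z \<le> 0" using xy[of s] by (simp add: orth_linear_simps)
    then have "\<bar>orth_app (\<pi> s) ?z\<bar> = - orth_app (\<pi> s) ?z" by (rule abs_of_nonpos)
    then show "orth_app (\<pi> s) (\<bar>?z\<bar> + ?z) = 0"
      using component_app_abs[OF partition_component[OF \<pi>], of s ?z] by (simp add: orth_linear_simps)
  qed
  then have "?z = - \<bar>?z\<bar>" by (simp add: eq_neg_iff_add_eq_0 add.commute)
  then have "?z \<le> 0" by (metis abs_ge_zero neg_le_0_iff_le)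
  then show ?thesis by simp
qed

lemma partition_leI:
  assumes "partition_of_unity \<pi>" "\<And>s. \<pi> s * S \<le> \<pi> s * T" shows "S \<le> T"
proof (rule orth_leI)
  fix x :: 'b assume x: "0 \<le> x"
  show "orth_app S x \<le> orth_app T x"
    by (rule partition_app_leI[OF assms(1)])
      (use orth_app_mono_left[OF assms(2) x] in \<open>simp add: orth_app_mult\<close>)
qed

lemma partition_eqI:
  assumes "partition_of_unity \<pi>" "\<And>s. \<pi> s * S = \<pi> s * T" shows "S = T"
  by (rule antisym; rule partition_leI[OF assms(1)]; simp add: assms(2))

lemma partition_mult_sum:
  assumes "partition_of_unity \<pi>" "finite J"
  shows "\<pi> t * (\<Sum>s\<in>J. \<pi> s * \<phi> s) = (if t \<in> J then \<pi> t * \<phi> t else 0)"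
proof -
  have "\<pi> t * (\<Sum>s\<in>J. \<pi> s * \<phi> s) = (\<Sum>s\<in>J. if s = t then \<pi> t * \<phi> t else 0)"
    unfolding sum_distrib_left
  proof (rule sum.cong[OF refl])
    fix s
    show "\<pi> t * (\<pi> s * \<phi> s) = (if s = t then \<pi> t * \<phi> t else 0)"
      using partition_disjoint[OF assms(1), of t s] component_idem[OF partition_component[OF assms(1)], of t]
      by (simp add: mult.assoc[symmetric])
  qed
  also have "\<dots> = (if t \<in> J then \<pi> t * \<phi> t else 0)" using assms(2) by (simp add: sum.delta')
  finally show ?thesis .
qed

lemma partition_mult_compl_sum:
  assumes "partition_of_unity \<pi>" "finite J"
  shows "\<pi> t * (1 - (\<Sum>s\<in>J. \<pi> s)) = (if t \<in> J then 0 else \<pi> t)"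
  using partition_mult_sum[OF assms, of t "\<lambda>s. 1"] by (simp add: right_diff_distrib)

lemma partition_compl_sum_mono:
  assumes \<pi>: "partition_of_unity \<pi>" and JK: "finite K" "J \<subseteq> K"
  shows "1 - (\<Sum>s\<in>K. \<pi> s) \<le> 1 - (\<Sum>s\<in>J. \<pi> s)" "0 \<le> 1 - (\<Sum>s\<in>J. \<pi> s)"
proof -
  have J: "finite J" using JK finite_subset by blast
  show "1 - (\<Sum>s\<in>K. \<pi> s) \<le> 1 - (\<Sum>s\<in>J. \<pi> s)"
    using JK J component_nonneg[OF partition_component[OF \<pi>]]
    by - (rule partition_leI[OF \<pi>], auto simp: partition_mult_compl_sum[OF \<pi>])
  show "0 \<le> 1 - (\<Sum>s\<in>J. \<pi> s)"
    using J component_nonneg[OF partition_component[OF \<pi>]]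
    by - (rule partition_leI[OF \<pi>], auto simp: partition_mult_compl_sum[OF \<pi>])
qed

lemma partition_inf_zero:
  assumes \<pi>: "partition_of_unity \<pi>" and e: "0 \<le> e"
  shows "inf_zero ((\<lambda>J. orth_app (1 - (\<Sum>s\<in>J. \<pi> s)) e) ` Collect finite)"
  unfolding inf_zero_def
proof (intro conjI allI impI ballI)
  fix d assume "d \<in> (\<lambda>J. orth_app (1 - (\<Sum>s\<in>J. \<pi> s)) e) ` Collect finite"
  then show "0 \<le> d" using partition_compl_sum_mono(2)[OF \<pi>] e by (auto intro!: orth_app_nonneg)
next
  fix z assume z: "\<forall>d\<in>(\<lambda>J. orth_app (1 - (\<Sum>s\<in>J. \<pi> s)) e) ` Collect finite. z \<le> d"
  show "z \<le> 0"
  proof (rule partition_app_leI[OF \<pi>])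
    fix t
    have "z \<le> orth_app (1 - (\<Sum>s\<in>{t}. \<pi> s)) e" using z by blast
    then have "orth_app (\<pi> t) z \<le> orth_app (\<pi> t * (1 - (\<Sum>s\<in>{t}. \<pi> s))) e"
      unfolding orth_app_mult by (rule orth_app_mono[OF component_nonneg[OF partition_component[OF \<pi>]]])
    also have "\<dots> = 0" unfolding partition_mult_compl_sum[OF \<pi> finite.insertI[OF finite.emptyI]] by (simp add: orth_app_simps)
    finally show "orth_app (\<pi> t) z \<le> orth_app (\<pi> t) 0" by (simp add: orth_linear_simps)
  qed
qed blast

text \<open>Disjointification of a covering family. The index set is arbitrary, so it is
  well-ordered and each \<open>b s\<close> loses what earlier members already cover.\<close>

lemma partition_refinement:
  fixes b :: "'s \<Rightarrow> 'e::dedekind_complete_vector_lattice orth"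
  assumes b: "\<And>s. component (b s)"
    and cover: "\<And>c. component c \<Longrightarrow> (\<And>s. c * b s = 0) \<Longrightarrow> c = 0"
  obtains \<pi> where "partition_of_unity \<pi>" "\<And>s. \<pi> s * b s = \<pi> s"
proof -
  obtain r :: "'s rel" where r: "well_order_on UNIV r" using well_order_on by blast
  define less where "less = r - Id"
  have wf: "wf less" using r by (simp add: well_order_on_def less_def)
  have tot: "(s, t) \<in> less \<or> (t, s) \<in> less" if "s \<noteq> t" for s t
    using r that by (auto simp: well_order_on_def linear_order_on_def total_on_def less_def)
  \<comment> \<open>The element 0 keeps the set nonempty for the least index.\<close>
  define A where "A s = insert 0 (b ` {t. (t, s) \<in> less})" for s
  define u where "u s = Sup (A s)" for s
  have A: "A s \<noteq> {}" "component a" if "a \<in> A s" for a s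
    using that b by (auto simp: A_def component_0)
  have u: "component (u s)" for s
    unfolding u_def using A by (intro component_Sup) (auto simp: A_def)
  have u_up: "b t \<le> u s" if "(t, s) \<in> less" for s t
    unfolding u_def using that A(2)[of _ s]
    by (intro cSup_upper bdd_aboveI[of _ 1]) (auto simp: A_def intro: component_le_one b component_0)
  have u_least: "u s \<le> z" if "0 \<le> z" "\<And>t. (t, s) \<in> less \<Longrightarrow> b t \<le> z" for s z
    unfolding u_def using that by (intro cSup_least) (auto simp: A_def)
  define \<pi> where "\<pi> s = b s * (1 - u s)" for s
  have \<pi>: "component (\<pi> s)" for s unfolding \<pi>_def by (intro component_mult component_compl b u)
  have dis: "\<pi> t * \<pi> s = 0" if "(t, s) \<in> less" for s t
  proof -
    have "b t * (1 - u s) = 0"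
      using u_up[OF that] by (simp add: component_mult_zero_iff b u component_compl)
    then have "b t * (1 - u s) * ((1 - u t) * b s) = 0" by simp
    then show ?thesis by (simp add: \<pi>_def mult_ac)
  qed
  have dis': "\<pi> s * \<pi> t = 0" if "s \<noteq> t" for s t
    using tot[OF that] dis[of s t] dis[of t s] mult.commute[of "\<pi> s" "\<pi> t"] by auto
  have "partition_of_unity \<pi>"
    unfolding partition_of_unity_def band_projection_iff
  proof (intro conjI allI impI)
    fix s t :: 's assume "s \<noteq> t"
    then have "\<pi> s \<le> 1 - \<pi> t" using dis' \<pi> by (simp add: component_mult_zero_iff[symmetric])
    then have "inf (\<pi> s) (\<pi> t) \<le> inf (1 - \<pi> t) (\<pi> t)" by (rule inf_mono) simp
    also have "\<dots> = 0"
      by (rule antisym, rule orth_leI)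
        (use component_disjoint[OF \<pi>[of t]] component_nonneg[OF \<pi>] component_nonneg[OF component_compl[OF \<pi>]] in
          \<open>auto simp: orth_app_inf inf_commute orth_app_zero\<close>)
    finally show "inf (\<pi> s) (\<pi> t) = 0" using component_nonneg[OF \<pi>] by (intro antisym) auto
  next
    fix \<rho> assume \<rho>: "component \<rho> \<and> (\<forall>s. \<pi> s \<le> \<rho>)"
    let ?c = "1 - \<rho>"
    have c: "component ?c" using \<rho> component_compl by blast
    have c\<pi>: "?c * \<pi> s = 0" for s
      using \<rho> \<pi> c component_mult_zero_iff[OF \<pi> c, of s] by (simp add: mult.commute)
    \<comment> \<open>By transfinite induction: if \<open>?c\<close> misses all earlier members, it
      misses \<open>u s\<close>, so on \<open>?c\<close> the trimmed piece equals
      \<open>b s\<close>.\<close>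
    have "?c * b s = 0" for s
    proof (induction s rule: wf_induct_rule[OF wf])
      case (1 s)
      have "u s \<le> 1 - ?c"
        using 1 component_mult_zero_iff[OF b c] \<rho> component_nonneg
        by (intro u_least) (auto simp: mult.commute)
      then have "u s * ?c = 0" using component_mult_zero_iff[OF u c] by simp
      then have "?c * \<pi> s = ?c * b s" by (simp add: \<pi>_def right_diff_distrib mult_ac)
      then show ?case using c\<pi> by simp
    qed
    then have "?c = 0" by (rule cover[OF c])
    then show "1 \<le> \<rho>" by simp
  qed (rule \<pi>)
  moreover have "\<pi> s * b s = \<pi> s" for s
    using component_idem[OF b[of s]] by (simp add: \<pi>_def mult_ac) (metis mult.assoc)
  ultimately show ?thesis using that by blast
qed

section \<open>Pure states and values at pure states\<close>

text \<open>A bounded family can be mixed along a partition. Shifting by the bound makes all pieces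
  positive, so that the mixture is a supremum.\<close>

lemma glue_orth:
  assumes \<pi>: "partition_of_unity \<pi>" and e: "\<And>s. \<bar>\<phi> s\<bar> \<le> e"
  shows "\<exists>l. \<forall>s. \<pi> s * l = \<pi> s * \<phi> s"
proof -
  let ?A = "range (\<lambda>s. \<pi> s * (\<phi> s + e))"
  have e0: "0 \<le> e" using e abs_ge_zero order_trans by blast
  have p: "0 \<le> \<phi> s + e" "\<phi> s + e \<le> e + e" for s
    using e[of s] vl_abs_ge[of "\<phi> s"] order_trans[OF vl_abs_ge(2) e, of s] order_trans[OF vl_abs_ge(1) e, of s]
      add_right_mono[of "- \<phi> s" e "\<phi> s"] by (simp_all add: add.commute)
  have le: "\<pi> s * (\<phi> s + e) \<le> \<phi> s + e" for s
    by (rule component_mult_le[OF partition_component[OF \<pi>] p(1)])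
  have bdd: "bdd_above ?A" by (intro bdd_aboveI[of _ "e + e"]) (auto intro: order_trans[OF le p(2)])
  let ?m = "Sup ?A"
  have m: "\<pi> t * ?m = \<pi> t * (\<phi> t + e)" for t
  proof (rule antisym)
    have c: "component (\<pi> t)" "component (1 - \<pi> t)" using partition_component[OF \<pi>] component_compl by auto
    have up: "\<pi> s * (\<phi> s + e) \<le> ?m" for s by (rule cSup_upper[OF rangeI bdd])
    \<comment> \<open>Multiplying this bound by \<open>\<pi> t\<close> leaves the piece with index
      \<open>t\<close> alone.\<close>
    have "?m \<le> \<pi> t * (\<phi> t + e) + (1 - \<pi> t) * ?m"
    proof (rule cSup_least)
      fix x assume "x \<in> ?A"
      then obtain s where x: "x = \<pi> s * (\<phi> s + e)" by blast
      show "x \<le> \<pi> t * (\<phi> t + e) + (1 - \<pi> t) * ?m"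
      proof (cases "s = t")
        case True
        have "0 \<le> x" unfolding x by (intro orth_mult_nonneg component_nonneg partition_component \<pi> p)
        also have "x \<le> ?m" unfolding x by (rule up)
        finally have "0 \<le> (1 - \<pi> t) * ?m" by (rule orth_mult_nonneg[OF component_nonneg[OF c(2)]])
        then show ?thesis using True x by simp
      next
        case False
        have "x = (1 - \<pi> t) * x"
          using partition_disjoint[OF \<pi>, of t s] False
          by (simp add: x left_diff_distrib mult.assoc[symmetric])
        also have "\<dots> \<le> (1 - \<pi> t) * ?m" unfolding x by (intro mult_left_mono up component_nonneg c)
        also have "\<dots> \<le> \<pi> t * (\<phi> t + e) + (1 - \<pi> t) * ?m"
          using orth_mult_nonneg[OF component_nonneg[OF c(1)] p(1)] by simp
        finally show ?thesis .
      qed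
    qed simp
    from mult_left_mono[OF this component_nonneg[OF c(1)]]
    show "\<pi> t * ?m \<le> \<pi> t * (\<phi> t + e)"
      using component_idem[OF c(1)] by (simp add: distrib_left right_diff_distrib left_diff_distrib mult.assoc[symmetric])
    from mult_left_mono[OF up[of t] component_nonneg[OF c(1)]]
    show "\<pi> t * (\<phi> t + e) \<le> \<pi> t * ?m" using component_idem[OF c(1)] by (simp add: mult.assoc[symmetric])
  qed
  have "\<pi> s * (?m - e) = \<pi> s * \<phi> s" for s unfolding right_diff_distrib m by (simp add: distrib_left)
  then show ?thesis by (intro exI[of _ "?m - e"]) simp
qed

lemma eventually_finite_sets_superset:
  "finite J \<Longrightarrow> \<forall>\<^sub>F K in finite_sets_at_top. finite K \<and> J \<subseteq> K"
  by (auto simp: eventually_finite_subsets_at_top)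

text \<open>The partial sum over \<open>K\<close> misses \<open>l\<close> by \<open>l\<close> times
  the complement of the pieces in \<open>K\<close>, and these errors have infimum 0.\<close>

lemma pure_state_eqI:
  assumes \<pi>: "partition_of_unity \<pi>" and \<phi>: "\<phi> \<in> orth_functions"
    and l: "\<And>s. \<pi> s * l = \<pi> s * \<phi> s"
  shows "pure_state \<pi> \<phi> = l"
proof -
  let ?S = "\<lambda>J. 1 - (\<Sum>s\<in>J. \<pi> s)"
  have "inf_zero ((\<lambda>J. ?S J * \<bar>l\<bar>) ` Collect finite)"
    unfolding inf_zero_def
  proof (intro conjI allI impI ballI)
    fix d assume "d \<in> (\<lambda>J. ?S J * \<bar>l\<bar>) ` Collect finite"
    then show "0 \<le> d" using partition_compl_sum_mono(2)[OF \<pi>] by (auto intro!: orth_mult_nonneg)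
  next
    fix z assume z: "\<forall>d\<in>(\<lambda>J. ?S J * \<bar>l\<bar>) ` Collect finite. z \<le> d"
    show "z \<le> 0"
    proof (rule partition_leI[OF \<pi>])
      fix t
      have "z \<le> ?S {t} * \<bar>l\<bar>" using z by blast
      then have "\<pi> t * z \<le> \<pi> t * (?S {t} * \<bar>l\<bar>)"
        by (rule mult_left_mono[OF _ component_nonneg[OF partition_component[OF \<pi>]]])
      then show "\<pi> t * z \<le> \<pi> t * 0"
        using partition_mult_compl_sum[OF \<pi>, of "{t}" t] by (simp add: mult.assoc[symmetric])
    qed
  qed blast
  then have "order_tendsto (sum (\<lambda>s. \<pi> s * \<phi> s)) l finite_sets_at_top"
  proof (rule order_tendstoI)
    fix d assume "d \<in> (\<lambda>J. ?S J * \<bar>l\<bar>) ` Collect finite"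
    then obtain J where J: "finite J" "d = ?S J * \<bar>l\<bar>" by blast
    from eventually_finite_sets_superset[OF J(1)]
    show "\<forall>\<^sub>F K in finite_sets_at_top. \<bar>sum (\<lambda>s. \<pi> s * \<phi> s) K - l\<bar> \<le> d"
    proof eventually_elim
      case (elim K)
      have "sum (\<lambda>s. \<pi> s * \<phi> s) K - l = - (?S K * l)"
      proof (rule partition_eqI[OF \<pi>])
        fix t
        have K: "finite K" using elim by simp
        have "\<pi> t * (sum (\<lambda>s. \<pi> s * \<phi> s) K - l) = (if t \<in> K then 0 else - (\<pi> t * l))"
          unfolding right_diff_distrib partition_mult_sum[OF \<pi> K] l by simp
        also have "\<dots> = - ((\<pi> t * ?S K) * l)"
          unfolding partition_mult_compl_sum[OF \<pi> K] by simp
        also have "\<dots> = \<pi> t * - (?S K * l)"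
          by (simp only: mult_minus_right mult.assoc)
        finally show "\<pi> t * (sum (\<lambda>s. \<pi> s * \<phi> s) K - l) = \<pi> t * - (?S K * l)" .
      qed
      then have "\<bar>sum (\<lambda>s. \<pi> s * \<phi> s) K - l\<bar> = \<bar>?S K * l\<bar>" by simp
      also have "\<dots> \<le> \<bar>?S K\<bar> * \<bar>l\<bar>" by (rule abs_le_mult)
      also have "\<bar>?S K\<bar> = ?S K" using partition_compl_sum_mono(2)[OF \<pi>, of K K] elim by simp
      also have "?S K * \<bar>l\<bar> \<le> d" unfolding J(2)
        using partition_compl_sum_mono(1)[OF \<pi>, of K J] elim by (intro mult_right_mono) auto
      finally show ?case .
    qed
  qed
  then have "order_sum (\<lambda>s. \<pi> s * \<phi> s) = l"
    unfolding order_sum_def by (intro the_equality) (auto intro: order_tendsto_unique)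
  then show ?thesis using \<phi> by (simp add: pure_state_def)
qed

lemma pure_state_mult:
  assumes "partition_of_unity \<pi>" "\<phi> \<in> orth_functions"
  shows "\<pi> s * pure_state \<pi> \<phi> = \<pi> s * \<phi> s"
proof -
  obtain e where e: "\<And>s. \<bar>\<phi> s\<bar> \<le> e" using orth_lns.Cuo_bounded[OF assms(2)] by blast
  obtain l where l: "\<And>s. \<pi> s * l = \<pi> s * \<phi> s" 
    using glue_orth[OF assms(1), of \<phi> e] e by auto
  show ?thesis unfolding pure_state_eqI[OF assms l] by (rule l)
qed

text \<open>\<open>pure_value\<close> speaks of some partition that represents the state, so the
  partition has to be unique. A Urysohn function with value 0 at \<open>s\<close> and 1 at
  \<open>t\<close> forces \<open>\<pi> s * \<rho> t = 0\<close>; hence both partitions have the same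
  pieces.\<close>

lemma pure_state_inject:
  fixes \<pi> \<rho> :: "'s::{uniform_space, t2_space} \<Rightarrow> 'e::dedekind_complete_vector_lattice orth"
  assumes "compact (UNIV :: 's set)" and \<pi>: "partition_of_unity \<pi>" and \<rho>: "partition_of_unity \<rho>"
    and eq: "pure_state \<pi> = pure_state \<rho>"
  shows "\<pi> = \<rho>"
proof -
  have dis: "\<pi> s * \<rho> t = 0" if st: "s \<noteq> t" for s t
  proof -
    obtain U where U: "open U" "s \<in> U" "t \<notin> U" using st t1_space by blast
    then have "eventually (\<lambda>y. y \<noteq> t) (nhds s)" unfolding eventually_nhds by blast
    then have "eventually (\<lambda>(x, y). x = s \<longrightarrow> y \<noteq> t) uniformity" unfolding eventually_nhds_uniformity .
    from uniformity_urysohn[OF assms(1) this, of s]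
    obtain f :: "'s \<Rightarrow> real" where f: "continuous_on UNIV f" "\<And>y. 0 \<le> f y \<and> f y \<le> 1" "f s = 0" "f t = 1"
      by (metis (mono_tags, lifting) case_prod_conv)
    let ?\<phi> = "\<lambda>s. f s *\<^sub>R (1 :: 'e orth)"
    have \<phi>: "?\<phi> \<in> orth_functions" by (rule Cuo_continuous[OF assms(1) f(1,2)])
    have 1: "\<pi> s * pure_state \<rho> ?\<phi> = 0" unfolding eq[symmetric] using pure_state_mult[OF \<pi> \<phi>, of s] f by simp
    have 2: "\<rho> t * pure_state \<rho> ?\<phi> = \<rho> t" using pure_state_mult[OF \<rho> \<phi>, of t] f by simp
    have "\<pi> s * \<rho> t = \<pi> s * (\<rho> t * pure_state \<rho> ?\<phi>)" by (simp only: 2)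
    also have "\<dots> = \<rho> t * (\<pi> s * pure_state \<rho> ?\<phi>)" by (rule mult.left_commute)
    finally show ?thesis by (simp only: 1 mult_zero_right)
  qed
  show ?thesis
  proof
    fix s
    have "\<pi> t * \<pi> s = \<pi> t * \<rho> s" for t
    proof (cases "t = s")
      case True
      have "\<rho> u * \<pi> s = \<rho> u * (\<pi> s * \<rho> s)" for u
      proof (cases "u = s")
        case True
        have "\<rho> s * (\<pi> s * \<rho> s) = (\<rho> s * \<rho> s) * \<pi> s" by (simp only: mult_ac)
        then show ?thesis using component_idem[OF partition_component[OF \<rho>], of s] True by simp
      next
        case False
        then have "\<pi> s * \<rho> u = 0" using dis[of s u] by blast
        then have "\<rho> u * \<pi> s = 0" by (simp only: mult.commute)
        then show ?thesis by (simp only: mult.assoc[symmetric] mult_zero_left)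
      qed
      then have "\<pi> s = \<pi> s * \<rho> s" by (rule partition_eqI[OF \<rho>])
      then show ?thesis using True component_idem[OF partition_component[OF \<pi>], of s] by simp
    next
      case False
      then show ?thesis using dis[of t s] partition_disjoint[OF \<pi>, of t s] by simp
    qed
    then show "\<pi> s = \<rho> s" by (rule partition_eqI[OF \<pi>])
  qed
qed

section \<open>Gluing and values at pure states\<close>

context bk_space begin

abbreviation act where "act \<equiv> orth_action N"

lemma is_orth_action_act: "is_orth_action N act"
  unfolding orth_action_def by (rule someI_ex[OF is_orth_action_exists])

lemma act_add_left: "act (S + T) x = act S x + act T x"
  and act_add_right: "act T (x + y) = act T x + act T y"
  and act_mult: "act (S * T) x = act S (act T x)"
  and act_one: "act 1 x = x"
  and norm_act: "N (act T x) = orth_app \<bar>T\<bar> (N x)"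
  using is_orth_action_act by (simp_all add: is_orth_action_def)

lemma act_diff_right: "act T (x - y) = act T x - act T y"
  using act_add_right[of T "x - y" y] by simp

lemma act_diff_left: "act (S - T) x = act S x - act T x"
  using act_add_left[of "S - T" T x] by simp

lemma act_zero_left: "act 0 x = 0"
  using act_add_left[of 0 0 x] by simp

lemma act_zero_right: "act T 0 = 0"
  using act_add_right[of T 0 0] by simp

lemma act_sum_right: "act T (\<Sum>i\<in>J. g i) = (\<Sum>i\<in>J. act T (g i))"
  by (induction J rule: infinite_finite_induct) (simp_all add: act_zero_right act_add_right)

lemma norm_act_component: "component b \<Longrightarrow> N (act b x) = orth_app b (N x)"
  by (simp add: norm_act component_nonneg abs_of_nonneg)

lemma glue_unique:
  assumes \<pi>: "partition_of_unity \<pi>" and eq: "\<And>s. act (\<pi> s) y = act (\<pi> s) z"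
  shows "y = z"
proof -
  have "N (y - z) = 0"
  proof (rule partition_app_zeroI[OF \<pi> lnorm_nonneg])
    fix s
    show "orth_app (\<pi> s) (N (y - z)) = 0"
      by (simp add: norm_act_component[OF partition_component[OF \<pi>], symmetric] act_diff_right eq lnorm_zero)
  qed
  then show ?thesis using lnorm_eq_zeroD by fastforce
qed

text \<open>Two partial sums over finite sets containing \<open>J\<close> agree on the pieces in
  \<open>J\<close>, so they differ by at most the part of \<open>e\<close> in the remaining pieces.
  These bounds have infimum 0, and completeness gives a limit.\<close>

lemma glue_exists:
  fixes f :: "'s \<Rightarrow> 'y"
  assumes \<pi>: "partition_of_unity \<pi>" and e: "\<And>s. N (f s) \<le> e"
  shows "\<exists>y. \<forall>s. act (\<pi> s) y = act (\<pi> s) (f s)"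
proof -
  define z where "z J = (\<Sum>s\<in>J. act (\<pi> s) (f s))" for J
  have e0: "0 \<le> e" using e lnorm_nonneg order_trans by blast
  have c: "component (\<pi> s)" for s by (rule partition_component[OF \<pi>])
  have z: "act (\<pi> t) (z J) = (if t \<in> J then act (\<pi> t) (f t) else 0)" if "finite J" for t J
  proof -
    have "act (\<pi> t) (z J) = (\<Sum>s\<in>J. if s = t then act (\<pi> t) (f t) else 0)"
      unfolding z_def act_sum_right
    proof (rule sum.cong[OF refl])
      fix s
      show "act (\<pi> t) (act (\<pi> s) (f s)) = (if s = t then act (\<pi> t) (f t) else 0)"
        using partition_disjoint[OF \<pi>, of t s] component_idem[OF c, of t]
        by (simp add: act_mult[symmetric] act_zero_left)
    qed
    then show ?thesis using that by (simp add: sum.delta')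
  qed
  let ?S = "\<lambda>J. 1 - (\<Sum>s\<in>J. \<pi> s)"
  have close: "N (z K - z L) \<le> orth_app (?S J) e" if J: "finite J" "finite K" "finite L" "J \<subseteq> K" "J \<subseteq> L" for J K L
  proof (rule partition_app_leI[OF \<pi>])
    fix t
    have "orth_app (\<pi> t) (N (z K - z L)) = N (act (\<pi> t) (z K) - act (\<pi> t) (z L))"
      by (simp add: norm_act_component[OF c, symmetric] act_diff_right)
    also have "\<dots> \<le> (if t \<in> J then 0 else orth_app (\<pi> t) e)"
      using J orth_app_mono[OF component_nonneg[OF c] e, of t t] orth_app_nonneg[OF component_nonneg[OF c] e0, of t]
      by (auto simp: z lnorm_zero lnorm_minus norm_act_component[OF c])
    also have "\<dots> = orth_app (\<pi> t * ?S J) e"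
      by (simp add: partition_mult_compl_sum[OF \<pi> J(1)] orth_app_simps)
    finally show "orth_app (\<pi> t) (N (z K - z L)) \<le> orth_app (\<pi> t) (orth_app (?S J) e)" by (simp only: orth_app_mult)
  qed
  let ?F = "finite_sets_at_top :: 's set filter"
  have "order_tendsto (\<lambda>(K, L). N (z K - z L)) 0 (?F \<times>\<^sub>F ?F)"
  proof (rule order_tendstoI[OF partition_inf_zero[OF \<pi> e0]])
    fix d assume "d \<in> (\<lambda>J. orth_app (?S J) e) ` Collect finite"
    then obtain J where J: "finite J" "d = orth_app (?S J) e" by blast
    show "\<forall>\<^sub>F p in ?F \<times>\<^sub>F ?F. \<bar>(case p of (K, L) \<Rightarrow> N (z K - z L)) - 0\<bar> \<le> d"
      unfolding eventually_prod_same
      using eventually_finite_sets_superset[OF J(1)] close[OF J(1)] J(2) by (auto simp: lnorm_nonneg)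
  qed
  then obtain y where y: "order_tendsto (\<lambda>K. N (y - z K)) 0 ?F"
    using norm_o_Cauchy_convergent[of ?F z] by auto
  have "act (\<pi> t) y = act (\<pi> t) (f t)" for t
  proof -
    have "N (act (\<pi> t) (y - f t)) \<le> 0"
    proof (rule order_null_le[OF y])
      show "\<forall>\<^sub>F K in ?F. N (act (\<pi> t) (y - f t)) \<le> 0 + N (y - z K)"
      proof (rule eventually_mono[OF eventually_finite_sets_superset[of "{t}"]])
        fix K assume "finite K \<and> {t} \<subseteq> K"
        then have "act (\<pi> t) (y - f t) = act (\<pi> t) (y - z K)" by (simp add: act_diff_right z)
        then have "N (act (\<pi> t) (y - f t)) = orth_app (\<pi> t) (N (y - z K))" by (simp add: norm_act_component[OF c])
        also have "\<dots> \<le> N (y - z K)" by (rule component_app_le[OF c lnorm_nonneg])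
        finally show "N (act (\<pi> t) (y - f t)) \<le> 0 + N (y - z K)" by simp
      qed simp
    qed simp
    then show ?thesis using lnorm_eq_zero_le act_diff_right by fastforce
  qed
  then show ?thesis by blast
qed

lemma pure_value_eqI:
  fixes \<pi> :: "'s::{uniform_space, t2_space} \<Rightarrow> 'e orth"
  assumes "compact (UNIV :: 's set)" and \<pi>: "partition_of_unity \<pi>"
    and y: "\<And>s. act (\<pi> s) y = act (\<pi> s) (f s)"
  shows "pure_value N f (pure_state \<pi>) = y"
  unfolding pure_value_def
proof (rule the_equality)
  show "\<exists>\<rho>. partition_of_unity \<rho> \<and> pure_state \<pi> = pure_state \<rho> \<and> (\<forall>s. act (\<rho> s) y = act (\<rho> s) (f s))"
    using \<pi> y by blast
  fix z assume "\<exists>\<rho>. partition_of_unity \<rho> \<and> pure_state \<pi> = pure_state \<rho> \<and> (\<forall>s. act (\<rho> s) z = act (\<rho> s) (f s))"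
  then have "\<forall>s. act (\<pi> s) z = act (\<pi> s) (f s)" using pure_state_inject[OF assms(1) \<pi>] by metis
  then show "z = y" by - (rule glue_unique[OF \<pi>], simp add: y)
qed

lemma act_pure_value:
  fixes \<pi> :: "'s::{uniform_space, t2_space} \<Rightarrow> 'e orth"
  assumes "compact (UNIV :: 's set)" and \<pi>: "partition_of_unity \<pi>" and f: "f \<in> Cuo N"
  shows "act (\<pi> s) (pure_value N f (pure_state \<pi>)) = act (\<pi> s) (f s)"
proof -
  obtain e where e: "\<And>s. N (f s) \<le> e" using Cuo_bounded[OF f] by blast
  obtain y where y: "\<And>s. act (\<pi> s) y = act (\<pi> s) (f s)" 
    using glue_exists[OF \<pi>, of f e] e by auto
  show ?thesis using pure_value_eqI[OF assms(1) \<pi> y] y by simp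
qed

lemma norm_diff_pure_value:
  fixes \<pi> :: "'s::{uniform_space, t2_space} \<Rightarrow> 'e orth"
  assumes "compact (UNIV :: 's set)" and \<pi>: "partition_of_unity \<pi>" and "f \<in> Cuo N" "g \<in> Cuo N"
  shows "orth_app (\<pi> s) (N (pure_value N f (pure_state \<pi>) - pure_value N g (pure_state \<pi>))) =
    orth_app (\<pi> s) (N (f s - g s))"
proof -
  have c: "component (\<pi> s)" by (rule partition_component[OF \<pi>])
  show ?thesis
    using act_pure_value[OF assms(1,2,3), of s] act_pure_value[OF assms(1,2,4), of s]
    by (simp add: norm_act_component[OF c, symmetric] act_diff_right)
qed

end

section \<open>Extremal states\<close>

context
  fixes T :: "('s::uniform_space, 'e::dedekind_complete_vector_lattice) state"
  assumes T: "T \<in> eps_subdifferential"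
begin

lemma state_add: "\<phi> \<in> orth_functions \<Longrightarrow> \<psi> \<in> orth_functions \<Longrightarrow> T (\<lambda>s. \<phi> s + \<psi> s) = T \<phi> + T \<psi>"
  using T by (simp add: eps_subdifferential_def)

lemma state_scaleR: "\<phi> \<in> orth_functions \<Longrightarrow> T (\<lambda>s. c *\<^sub>R \<phi> s) = c *\<^sub>R T \<phi>"
  using T by (simp add: eps_subdifferential_def)

lemma state_minus: "\<phi> \<in> orth_functions \<Longrightarrow> T (\<lambda>s. - \<phi> s) = - T \<phi>"
  using state_scaleR[of \<phi> "- 1"] by simp

lemma state_diff: "\<phi> \<in> orth_functions \<Longrightarrow> \<psi> \<in> orth_functions \<Longrightarrow> T (\<lambda>s. \<phi> s - \<psi> s) = T \<phi> - T \<psi>"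
  using state_add[OF _ Cuo_minus, of \<phi> \<psi>] by (simp add: state_minus)

lemma state_le:
  assumes "\<phi> \<in> orth_functions" "\<And>s. \<phi> s \<le> l" shows "T \<phi> \<le> l"
proof -
  have "T \<phi> \<le> (SUP s. \<phi> s)" using T assms(1) by (simp add: eps_subdifferential_def)
  also have "\<dots> \<le> l" by (rule cSUP_least) (auto simp: assms(2))
  finally show ?thesis .
qed

lemma state_ge:
  assumes "\<phi> \<in> orth_functions" "\<And>s. l \<le> \<phi> s" shows "l \<le> T \<phi>"
  using state_le[OF Cuo_minus[OF assms(1)], of "- l"] assms by (simp add: state_minus)

lemma state_const: "T (\<lambda>s. l) = l"
  by (rule antisym) (auto intro: state_le state_ge Cuo_const)

lemma state_mono:
  assumes "\<phi> \<in> orth_functions" "\<psi> \<in> orth_functions" "\<And>s. \<phi> s \<le> \<psi> s" shows "T \<phi> \<le> T \<psi>"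
  using state_ge[OF Cuo_diff[OF assms(2,1)], of 0] assms by (simp add: state_diff)

lemma state_abs_le:
  assumes "\<phi> \<in> orth_functions" "\<And>s. \<bar>\<phi> s\<bar> \<le> l" shows "\<bar>T \<phi>\<bar> \<le> l"
proof (rule abs_leI)
  show "T \<phi> \<le> l" using assms by (meson state_le abs_le_D1)
  have "- l \<le> T \<phi>" by (rule state_ge[OF assms(1)]) (use assms(2) in \<open>metis abs_le_D2 minus_le_iff\<close>)
  then show "- T \<phi> \<le> l" by (simp add: minus_le_iff)
qed

text \<open>The definition of the subdifferential provides real linearity; linearity over \<Lambda>
  is derived, for components first. Since states are monotone and reproduce constants, a function
  with modulus below \<open>c * e\<close> has its value in the band of \<open>c\<close>.\<close>

lemma state_component_mult:
  assumes b: "component b" and \<phi>: "\<phi> \<in> orth_functions" shows "T (\<lambda>s. b * \<phi> s) = b * T \<phi>"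
proof -
  have *: "(1 - c) * T (\<lambda>s. c * \<phi> s) = 0" if c: "component c" for c
  proof -
    obtain e where e: "0 \<le> e" "\<And>s. \<bar>\<phi> s\<bar> \<le> e" using orth_lns.Cuo_bounded[OF \<phi>] by blast
    have "\<bar>c * \<phi> s\<bar> \<le> c * e" for s
      unfolding component_abs[OF c, symmetric] by (intro mult_left_mono e component_nonneg c)
    then have "\<bar>T (\<lambda>s. c * \<phi> s)\<bar> \<le> c * e" by (intro state_abs_le Cuo_const_mult \<phi>)
    then have "(1 - c) * \<bar>T (\<lambda>s. c * \<phi> s)\<bar> \<le> (1 - c) * (c * e)"
      by (intro mult_left_mono component_nonneg component_compl c)
    also have "\<dots> = 0" using component_idem[OF c] by (simp add: left_diff_distrib mult.assoc[symmetric])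
    finally show ?thesis unfolding component_abs[OF component_compl[OF c]] by simp
  qed
  have "T \<phi> = T (\<lambda>s. b * \<phi> s + (1 - b) * \<phi> s)" by (simp add: left_diff_distrib)
  also have "\<dots> = T (\<lambda>s. b * \<phi> s) + T (\<lambda>s. (1 - b) * \<phi> s)" by (intro state_add Cuo_const_mult \<phi>)
  finally have "b * T \<phi> = b * T (\<lambda>s. b * \<phi> s) + b * T (\<lambda>s. (1 - b) * \<phi> s)" by (simp only: distrib_left)
  moreover have "b * T (\<lambda>s. (1 - b) * \<phi> s) = 0" using *[OF component_compl[OF b]] by simp
  moreover have "b * T (\<lambda>s. b * \<phi> s) = T (\<lambda>s. b * \<phi> s)" using *[OF b] by (simp add: left_diff_distrib)
  ultimately show ?thesis by simp
qed

text \<open>Step orthomorphisms follow from components by linearity; the general case is a uniform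
  limit, as \<phi> is order bounded.\<close>

lemma state_orth_mult:
  assumes \<phi>: "\<phi> \<in> orth_functions" shows "T (\<lambda>s. l * \<phi> s) = l * T \<phi>"
proof -
  have step: "T (\<lambda>s. S * \<phi> s) = S * T \<phi>" if "S \<in> step_orth" for S
    using that
  proof (induction rule: step_orth.induct)
    case zero show ?case using state_const[of 0] by simp
  next
    case (add S b r)
    have "T (\<lambda>s. S * \<phi> s + r *\<^sub>R (b * \<phi> s)) = S * T \<phi> + r *\<^sub>R (b * T \<phi>)"
      by (simp add: state_add Cuo_const_mult Cuo_scaleR \<phi> state_scaleR add state_component_mult)
    then show ?case by (simp add: distrib_right)
  qed
  obtain e where e: "0 \<le> e" "\<And>s. \<bar>\<phi> s\<bar> \<le> e" using orth_lns.Cuo_bounded[OF \<phi>] by blast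
  obtain u where u: "0 \<le> u" "\<And>\<epsilon>. 0 < \<epsilon> \<Longrightarrow> \<exists>S\<in>step_orth. \<bar>l - S\<bar> \<le> \<epsilon> *\<^sub>R u"
    using step_orth_approx[of l] by auto
  have "T (\<lambda>s. l * \<phi> s) - l * T \<phi> = 0"
  proof (rule vl_eq_zero_epsI)
    fix \<epsilon> :: real assume \<epsilon>: "0 < \<epsilon>"
    obtain S where S: "S \<in> step_orth" "\<bar>l - S\<bar> \<le> \<epsilon> *\<^sub>R u" using u(2)[OF \<epsilon>] by (elim bexE)
    have "T (\<lambda>s. l * \<phi> s) - l * T \<phi> = T (\<lambda>s. (l - S) * \<phi> s) - (l - S) * T \<phi>"
      using step[OF S(1)] by (simp add: left_diff_distrib state_diff Cuo_const_mult \<phi>)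
    also have "\<bar>\<dots>\<bar> \<le> \<bar>T (\<lambda>s. (l - S) * \<phi> s)\<bar> + \<bar>(l - S) * T \<phi>\<bar>" by (rule abs_triangle_ineq4)
    also have "\<dots> \<le> (\<epsilon> *\<^sub>R u) * e + (\<epsilon> *\<^sub>R u) * e"
    proof (rule add_mono)
      have *: "\<bar>(l - S) * x\<bar> \<le> (\<epsilon> *\<^sub>R u) * e" if "\<bar>x\<bar> \<le> e" for x
        by (rule order_trans[OF abs_le_mult mult_mono[OF S(2) that order_trans[OF abs_ge_zero S(2)] abs_ge_zero]])
      show "\<bar>T (\<lambda>s. (l - S) * \<phi> s)\<bar> \<le> (\<epsilon> *\<^sub>R u) * e"
        by (intro state_abs_le Cuo_const_mult \<phi> * e)
      show "\<bar>(l - S) * T \<phi>\<bar> \<le> (\<epsilon> *\<^sub>R u) * e" by (intro * state_abs_le \<phi> e)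
    qed
    finally show "\<bar>T (\<lambda>s. l * \<phi> s) - l * T \<phi>\<bar> \<le> \<epsilon> *\<^sub>R (u * e + u * e)" by (simp add: scaleR_add_right)
  qed
  then show ?thesis by simp
qed

end

section \<open>Multiplicativity and vanishing variance of extreme points\<close>

lemma orth_square_zero:
  fixes m :: "'e::dedekind_complete_vector_lattice orth"
  assumes "0 \<le> m" "m * m = 0" shows "m = 0"
proof (rule ccontr)
  assume "m \<noteq> 0"
  then have "\<not> m \<le> 0" using assms(1) by (metis antisym)
  then obtain c \<epsilon> where c: "component c" "c \<noteq> 0" "0 < \<epsilon>" "\<epsilon> *\<^sub>R c \<le> c * m" by (rule orth_not_nonpos_component)
  have "(\<epsilon> *\<^sub>R c) * (\<epsilon> *\<^sub>R c) \<le> (c * m) * (c * m)"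
  proof (rule mult_mono[OF c(4) c(4)])
    show "0 \<le> c * m" by (rule orth_mult_nonneg[OF component_nonneg[OF c(1)] assms(1)])
    show "0 \<le> \<epsilon> *\<^sub>R c" using c(3) component_nonneg[OF c(1)] by (simp add: scaleR_nonneg_nonneg)
  qed
  also have "(c * m) * (c * m) = c * c * (m * m)" by (simp only: mult_ac)
  finally have "(\<epsilon> * \<epsilon>) *\<^sub>R c \<le> 0" using c assms by (simp add: component_idem)
  then show False using scaleR_component_nonpos[OF c(1), of "\<epsilon> * \<epsilon>"] c by simp
qed

text \<open>Perturbing an extreme point \<open>\<sigma>\<close> by \<open>\<omega> \<mapsto> \<sigma> (\<theta> \<omega>) - \<sigma> \<theta> \<sigma> \<omega>\<close> in both directions stays in the
  subdifferential.\<close>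

lemma extremal_state_mult:
  fixes \<sigma> :: "('s::uniform_space, 'e::dedekind_complete_vector_lattice) state"
  assumes \<sigma>: "\<sigma> \<in> extremal_states" and \<theta>: "\<theta> \<in> orth_functions" "\<And>s. 0 \<le> \<theta> s \<and> \<theta> s \<le> 1"
    and \<omega>: "\<omega> \<in> orth_functions"
  shows "\<sigma> (\<lambda>s. \<theta> s * \<omega> s) = \<sigma> \<theta> * \<sigma> \<omega>"
proof -
  have eps: "\<sigma> \<in> eps_subdifferential" using \<sigma> by (simp add: extremal_states_def)
  note st = state_add[OF eps] state_scaleR[OF eps] state_diff[OF eps] state_const[OF eps] state_orth_mult[OF eps]
  have \<theta>0: "0 \<le> \<sigma> \<theta>" "\<sigma> \<theta> \<le> 1" using \<theta> by (auto intro: state_ge[OF eps] state_le[OF eps])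
  define P where "P \<psi> = \<sigma> (\<lambda>s. \<theta> s * \<psi> s) - \<sigma> \<theta> * \<sigma> \<psi>" for \<psi>
  have Padd: "P (\<lambda>s. \<phi> s + \<psi> s) = P \<phi> + P \<psi>" if "\<phi> \<in> orth_functions" "\<psi> \<in> orth_functions" for \<phi> \<psi>
    using that \<theta>(1) by (simp add: P_def distrib_left st Cuo_mult)
  have Pscale: "P (\<lambda>s. c *\<^sub>R \<phi> s) = c *\<^sub>R P \<phi>" if "\<phi> \<in> orth_functions" for c \<phi>
    using that \<theta>(1) by (simp add: P_def st Cuo_mult scaleR_diff_right)
  have Pconst: "P (\<lambda>s. l) = 0" for l
    using st(5)[OF \<theta>(1), of l] by (simp add: P_def st(4) mult.commute)
  \<comment> \<open>Both terms of \<open>P \<psi>\<close> lie between 0 and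
    \<open>\<sigma> \<psi>\<close>, so \<open>\<sigma> + P\<close> and \<open>\<sigma> - P\<close>
    are positive.\<close>
  have Pbound: "- \<sigma> \<psi> \<le> P \<psi> \<and> P \<psi> \<le> \<sigma> \<psi>" if \<psi>: "\<psi> \<in> orth_functions" "\<And>s. 0 \<le> \<psi> s" for \<psi>
  proof
    have 1: "0 \<le> \<sigma> (\<lambda>s. \<theta> s * \<psi> s)"
      using \<theta> \<psi> by (intro state_ge[OF eps] Cuo_mult orth_mult_nonneg) auto
    have 2: "\<sigma> (\<lambda>s. \<theta> s * \<psi> s) \<le> \<sigma> \<psi>"
      using \<theta> \<psi> mult_right_mono[of "\<theta> _" 1 "\<psi> _"] by (intro state_mono[OF eps] Cuo_mult) auto
    have \<psi>0: "0 \<le> \<sigma> \<psi>" using \<psi> by (intro state_ge[OF eps])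
    have 3: "\<sigma> \<theta> * \<sigma> \<psi> \<le> \<sigma> \<psi>" "0 \<le> \<sigma> \<theta> * \<sigma> \<psi>"
      using mult_right_mono[OF \<theta>0(2) \<psi>0] orth_mult_nonneg[OF \<theta>0(1) \<psi>0] by auto
    show "- \<sigma> \<psi> \<le> P \<psi>" using add_mono[OF 1 le_imp_neg_le[OF 3(1)]] by (simp add: P_def)
    show "P \<psi> \<le> \<sigma> \<psi>" using add_mono[OF 2 le_imp_neg_le[OF 3(2)]] by (simp add: P_def)
  qed
  define T where "T r = (\<lambda>\<psi>\<in>orth_functions. \<sigma> \<psi> + r *\<^sub>R P \<psi>)" for r :: real
  have T: "T r \<in> eps_subdifferential" if r: "r = 1 \<or> r = - 1" for r
    unfolding eps_subdifferential_def
  proof (intro CollectI conjI ballI allI)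
    show "T r \<in> extensional orth_functions" by (simp add: T_def)
    fix \<phi> :: "'s \<Rightarrow> 'e orth" assume \<phi>: "\<phi> \<in> orth_functions"
    show "T r (\<lambda>s. c *\<^sub>R \<phi> s) = c *\<^sub>R T r \<phi>" for c
      using \<phi> by (simp add: T_def st Pscale Cuo_scaleR scaleR_add_right)
    show "T r (\<lambda>s. \<phi> s + \<psi> s) = T r \<phi> + T r \<psi>" if "\<psi> \<in> orth_functions" for \<psi>
      using \<phi> that by (simp add: T_def st Padd Cuo_add scaleR_add_right)
    define m where "m = (SUP s. \<phi> s)"
    obtain e where "\<And>s. \<bar>\<phi> s\<bar> \<le> e" using orth_lns.Cuo_bounded[OF \<phi>] by blast
    then have "bdd_above (range \<phi>)" by (intro bdd_aboveI[of _ e]) (auto intro: abs_le_D1)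
    then have m: "\<phi> s \<le> m" for s unfolding m_def by (rule cSUP_upper[rotated]) simp
    \<comment> \<open>Positivity at the distance of \<phi> from its supremum is the required
      estimate, because \<open>P\<close> vanishes at constants.\<close>
    let ?\<psi> = "\<lambda>s. m - \<phi> s"
    have \<psi>: "?\<psi> \<in> orth_functions" by (intro Cuo_diff Cuo_const \<phi>)
    have P\<psi>: "P ?\<psi> = - P \<phi>"
      using Padd[OF Cuo_const Cuo_scaleR[OF \<phi>], of m "- 1"] Pscale[OF \<phi>, of "- 1"] by (simp add: Pconst)
    have \<sigma>\<psi>: "\<sigma> ?\<psi> = m - \<sigma> \<phi>" by (simp add: st Cuo_const \<phi>)
    have "0 \<le> \<sigma> ?\<psi> + r *\<^sub>R P ?\<psi>"
      using Pbound[OF \<psi>] m add_left_mono[of "- \<sigma> ?\<psi>" "P ?\<psi>" "\<sigma> ?\<psi>"] r by auto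
    then have "T r \<phi> \<le> m" using \<phi> by (simp add: T_def P\<psi> \<sigma>\<psi> algebra_simps)
    then show "T r \<phi> \<le> (SUP s. \<phi> s)" by (simp add: m_def)
  qed
  have "\<sigma> \<phi> = (1 - 1/2) *\<^sub>R T 1 \<phi> + (1/2) *\<^sub>R T (- 1) \<phi>" if "\<phi> \<in> orth_functions" for \<phi>
    using that by (simp add: T_def scaleR_add_right scaleR_add_left[symmetric] algebra_simps)
  then have "T 1 = T (- 1)"
    using \<sigma> T[of 1] T[of "- 1"] unfolding extremal_states_def
    by (elim CollectE conjE) (drule bspec[of _ _ "T 1"], simp, drule bspec[of _ _ "T (- 1)"], simp,
      drule spec[of _ "1/2"], simp)
  then have "T 1 \<omega> = T (- 1) \<omega>" by simp
  then have "P \<omega> = - P \<omega>" using \<omega> by (simp add: T_def)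
  then have "P \<omega> + P \<omega> = 0" by (metis add.right_inverse)
  then have "P \<omega> = 0" by simp
  then show ?thesis by (simp add: P_def)
qed

text \<open>Under an extreme point \<psi> has no variance. The positive and negative part of
  \<open>\<psi> - \<sigma> \<psi>\<close> have the same value \<open>m\<close> and product 0, so
  multiplicativity leads to \<open>m * m = 0\<close>.\<close>

lemma extremal_state_abs_diff:
  fixes \<sigma> :: "('s::uniform_space, 'e::dedekind_complete_vector_lattice) state"
  assumes \<sigma>: "\<sigma> \<in> extremal_states" and \<psi>: "\<psi> \<in> orth_functions"
  shows "\<sigma> (\<lambda>s. \<bar>\<psi> s - \<sigma> \<psi>\<bar>) = 0"
proof -
  have eps: "\<sigma> \<in> eps_subdifferential" using \<sigma> by (simp add: extremal_states_def)
  define p where "p s = pprt (\<psi> s - \<sigma> \<psi>)" for s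
  define n where "n s = pprt (\<sigma> \<psi> - \<psi> s)" for s
  have d: "(\<lambda>s. \<psi> s - \<sigma> \<psi>) \<in> orth_functions" "(\<lambda>s. \<sigma> \<psi> - \<psi> s) \<in> orth_functions"
    by (intro Cuo_diff Cuo_const \<psi>)+
  have pV: "p \<in> orth_functions" and nV: "n \<in> orth_functions"
    unfolding p_def[abs_def] n_def[abs_def] by (intro Cuo_pprt d)+
  have n_eq: "n s = - nprt (\<psi> s - \<sigma> \<psi>)" for s unfolding n_def using pprt_neg[of "\<psi> s - \<sigma> \<psi>"] by simp
  have pn: "p s - n s = \<psi> s - \<sigma> \<psi>" "p s + n s = \<bar>\<psi> s - \<sigma> \<psi>\<bar>" for s
    using prts[of "\<psi> s - \<sigma> \<psi>"] abs_prts[of "\<psi> s - \<sigma> \<psi>"] by (simp_all add: p_def n_eq)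
  have p0: "0 \<le> p s" "0 \<le> n s" for s by (simp_all add: p_def n_def)
  have pn0: "p s * n s = 0" for s
    by (rule orth_disjoint_mult[OF p0]) (simp add: p_def n_eq pprt_nprt_disjoint)
  define m where "m = \<sigma> p"
  have "\<sigma> p - \<sigma> n = \<sigma> (\<lambda>s. \<psi> s - \<sigma> \<psi>)" by (simp add: state_diff[OF eps pV nV, symmetric] pn)
  also have "\<dots> = 0" by (simp add: state_diff[OF eps \<psi> Cuo_const] state_const[OF eps])
  finally have \<sigma>n: "\<sigma> n = m" by (simp add: m_def)
  have m0: "0 \<le> m" unfolding m_def by (rule state_ge[OF eps pV p0(1)])
  obtain e where e: "0 \<le> e" "\<And>s. \<bar>p s\<bar> \<le> e" using orth_lns.Cuo_bounded[OF pV] by blast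
  have pe: "p s \<le> e" for s using e(2)[of s] p0(1)[of s] by simp
  have "m * m \<le> 0"
  proof (rule vl_archimedean)
    fix k :: nat
    \<comment> \<open>Multiplicativity needs a factor between 0 and 1, but \<open>p\<close> is only
      bounded by an element \<open>e\<close> of \<Lambda>. On the band \<open>c\<close>, where
      \<open>e\<close> is at most \<open>k + 1\<close>, it can be rescaled. On the complement
      \<open>k + 1\<close> is at most \<open>e\<close>, and letting \<open>k\<close> grow gives the
      claim.\<close>
    obtain c where c: "component c" "c * e \<le> real (Suc k) *\<^sub>R c" "real (Suc k) *\<^sub>R (1 - c) \<le> (1 - c) * e"
      by (rule component_bounding)
    define \<theta> where "\<theta> s = (1 / real (Suc k)) *\<^sub>R (c * p s)" for s
    have \<theta>V: "\<theta> \<in> orth_functions" unfolding \<theta>_def[abs_def] by (intro Cuo_scaleR Cuo_const_mult pV)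
    have "\<theta> s \<le> 1" for s
    proof -
      have "c * p s \<le> c * e" by (rule mult_left_mono[OF pe component_nonneg[OF c(1)]])
      also note c(2)
      also have "real (Suc k) *\<^sub>R c \<le> real (Suc k) *\<^sub>R 1" by (rule scaleR_left_mono[OF component_le_one[OF c(1)]]) simp
      finally have "(1 / real (Suc k)) *\<^sub>R (c * p s) \<le> (1 / real (Suc k)) *\<^sub>R (real (Suc k) *\<^sub>R 1)"
        by (rule scaleR_left_mono) simp
      then show ?thesis by (simp add: \<theta>_def)
    qed
    moreover have "0 \<le> \<theta> s" for s
      unfolding \<theta>_def by (intro scaleR_nonneg_nonneg orth_mult_nonneg component_nonneg c p0) simp
    ultimately have "\<sigma> (\<lambda>s. \<theta> s * n s) = \<sigma> \<theta> * \<sigma> n" by (intro extremal_state_mult[OF \<sigma> \<theta>V _ nV]) simp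
    moreover have "\<theta> s * n s = 0" for s by (simp add: \<theta>_def mult.assoc pn0)
    moreover have "\<sigma> \<theta> = (1 / real (Suc k)) *\<^sub>R (c * m)"
      unfolding \<theta>_def[abs_def] m_def
      by (simp only: state_scaleR[OF eps Cuo_const_mult[OF pV]] state_orth_mult[OF eps pV])
    ultimately have "(1 / real (Suc k)) *\<^sub>R (c * m) * m = 0" by (simp add: state_const[OF eps] \<sigma>n)
    then have cm: "c * (m * m) = 0" by (simp add: mult.assoc)
    have mm: "0 \<le> m * m" by (rule orth_mult_nonneg[OF m0 m0])
    have "real k *\<^sub>R (m * m) \<le> real (Suc k) *\<^sub>R (m * m)" by (rule scaleR_right_mono[OF _ mm]) simp
    also have "\<dots> = (real (Suc k) *\<^sub>R (1 - c)) * (m * m)" by (simp add: left_diff_distrib cm)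
    also have "\<dots> \<le> ((1 - c) * e) * (m * m)" by (rule mult_right_mono[OF c(3) mm])
    also have "\<dots> \<le> e * (m * m)" by (intro mult_right_mono mm component_mult_le component_compl c e)
    finally show "real k *\<^sub>R (m * m) \<le> e * (m * m)" .
  qed
  then have "m * m = 0" using orth_mult_nonneg[OF m0 m0] by (rule antisym)
  then have "m = 0" by (rule orth_square_zero[OF m0])
  then have "\<sigma> (\<lambda>s. p s + n s) = 0" using state_add[OF eps pV nV] \<sigma>n by (simp add: m_def)
  then show ?thesis by (simp only: pn)
qed

section \<open>Approximation of extremal states by pure states\<close>

lemma Cuo_sum:
  "finite A \<Longrightarrow> (\<And>i. i \<in> A \<Longrightarrow> \<phi> i \<in> orth_functions) \<Longrightarrow> (\<lambda>s. \<Sum>i\<in>A. \<phi> i s) \<in> orth_functions"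
  by (induction A rule: finite_induct) (simp_all add: Cuo_const Cuo_add)

lemma state_sum:
  assumes "T \<in> eps_subdifferential" "finite A" "\<And>i. i \<in> A \<Longrightarrow> \<phi> i \<in> orth_functions"
  shows "T (\<lambda>s. \<Sum>i\<in>A. \<phi> i s) = (\<Sum>i\<in>A. T (\<phi> i))"
  using assms(2,3)
  by (induction A rule: finite_induct) (simp_all add: state_const[OF assms(1)] state_add[OF assms(1)] Cuo_sum)

text \<open>The total deviation \<psi> has value 0 under \<sigma>. At each point the band where
  \<psi> is at most \<epsilon> is taken. A component disjoint from all these bands would satisfy
  \<open>\<epsilon> c \<le> \<psi> s\<close> everywhere and thus
  \<open>\<epsilon> c \<le> \<sigma> \<psi>\<close>; so the bands cover, and disjointification
  yields the pure state.\<close>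

lemma pure_state_approx:
  fixes \<sigma> :: "('s::uniform_space, 'e::dedekind_complete_vector_lattice) state"
  assumes \<sigma>: "\<sigma> \<in> extremal_states" and A: "finite A" "A \<subseteq> orth_functions" and \<epsilon>: "0 < \<epsilon>"
  shows "\<exists>\<tau>\<in>pure_states. \<forall>\<phi>\<in>A. \<bar>\<tau> \<phi> - \<sigma> \<phi>\<bar> \<le> \<epsilon> *\<^sub>R 1"
proof -
  have eps: "\<sigma> \<in> eps_subdifferential" using \<sigma> by (simp add: extremal_states_def)
  define \<psi> where "\<psi> s = (\<Sum>\<phi>\<in>A. \<bar>\<phi> s - \<sigma> \<phi>\<bar>)" for s
  have abs: "(\<lambda>s. \<bar>\<phi> s - \<sigma> \<phi>\<bar>) \<in> orth_functions" if "\<phi> \<in> A" for \<phi>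
    using A that by (intro Cuo_abs Cuo_diff Cuo_const) auto
  have \<psi>V: "\<psi> \<in> orth_functions" unfolding \<psi>_def[abs_def] by (rule Cuo_sum[OF A(1) abs])
  have \<sigma>\<psi>: "\<sigma> \<psi> = 0"
    unfolding \<psi>_def[abs_def] using extremal_state_abs_diff[OF \<sigma>] A
    by (intro trans[OF state_sum[OF eps A(1) abs] sum.neutral]) auto
  have "\<exists>b. component b \<and> b * \<psi> s \<le> \<epsilon> *\<^sub>R b \<and> \<epsilon> *\<^sub>R (1 - b) \<le> (1 - b) * \<psi> s" for s
    using component_bounding[of "\<psi> s" \<epsilon>] by metis
  then obtain b where b: "\<And>s. component (b s)" "\<And>s. b s * \<psi> s \<le> \<epsilon> *\<^sub>R b s"
    "\<And>s. \<epsilon> *\<^sub>R (1 - b s) \<le> (1 - b s) * \<psi> s" by metis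
  have \<psi>0: "0 \<le> \<psi> s" for s by (simp add: \<psi>_def sum_nonneg)
  have "c = 0" if c: "component c" and cb: "\<And>s. c * b s = 0" for c
  proof (rule scaleR_component_nonpos[OF c \<epsilon>])
    have "\<epsilon> *\<^sub>R c \<le> \<psi> s" for s
    proof -
      have "\<epsilon> *\<^sub>R c = c * (\<epsilon> *\<^sub>R (1 - b s))" by (simp add: right_diff_distrib cb)
      also have "\<dots> \<le> c * ((1 - b s) * \<psi> s)" by (rule mult_left_mono[OF b(3) component_nonneg[OF c]])
      also have "\<dots> \<le> \<psi> s"
        by (rule order_trans[OF component_mult_le[OF c] component_mult_le])
          (intro orth_mult_nonneg component_nonneg component_compl b \<psi>0)+
      finally show ?thesis .
    qed
    then have "\<epsilon> *\<^sub>R c \<le> \<sigma> \<psi>" by (rule state_ge[OF eps \<psi>V])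
    then show "\<epsilon> *\<^sub>R c \<le> 0" by (simp add: \<sigma>\<psi>)
  qed
  from partition_refinement[of b, OF b(1) this]
  obtain \<pi> where \<pi>: "partition_of_unity \<pi>" "\<And>s. \<pi> s * b s = \<pi> s" by blast
  have "\<bar>pure_state \<pi> \<phi> - \<sigma> \<phi>\<bar> \<le> \<epsilon> *\<^sub>R 1" if \<phi>: "\<phi> \<in> A" for \<phi>
  proof (rule partition_leI[OF \<pi>(1)])
    fix s
    have c: "component (\<pi> s)" by (rule partition_component[OF \<pi>(1)])
    have "\<pi> s * \<bar>pure_state \<pi> \<phi> - \<sigma> \<phi>\<bar> = \<bar>\<pi> s * (\<phi> s - \<sigma> \<phi>)\<bar>"
      using pure_state_mult[OF \<pi>(1), of \<phi> s] \<phi> A by (auto simp: component_abs[OF c] right_diff_distrib)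
    also have "\<dots> = \<pi> s * \<bar>\<phi> s - \<sigma> \<phi>\<bar>" by (simp add: component_abs[OF c])
    also have "\<dots> \<le> \<pi> s * \<psi> s"
    proof (rule mult_left_mono[OF _ component_nonneg[OF c]])
      show "\<bar>\<phi> s - \<sigma> \<phi>\<bar> \<le> \<psi> s"
        using sum_mono2[OF A(1), of "{\<phi>}" "\<lambda>\<phi>. \<bar>\<phi> s - \<sigma> \<phi>\<bar>"] \<phi> by (simp add: \<psi>_def)
    qed
    also have "\<dots> = \<pi> s * (b s * \<psi> s)" by (simp only: mult.assoc[symmetric] \<pi>(2))
    also have "\<dots> \<le> \<pi> s * (\<epsilon> *\<^sub>R b s)" by (rule mult_left_mono[OF b(2) component_nonneg[OF c]])
    also have "\<dots> = \<pi> s * (\<epsilon> *\<^sub>R 1)" by (simp add: \<pi>(2))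
    finally show "\<pi> s * \<bar>pure_state \<pi> \<phi> - \<sigma> \<phi>\<bar> \<le> \<pi> s * (\<epsilon> *\<^sub>R 1)" .
  qed
  then show ?thesis using \<pi>(1) by (auto simp: pure_states_def)
qed

text \<open>The condition on nets inside \<open>state_value\<close>, named so that it can be folded
  there.\<close>

definition pure_net :: "('s::uniform_space, 'e::dedekind_complete_vector_lattice) state \<Rightarrow> ('s, 'e) state filter \<Rightarrow> bool"
  where "pure_net \<sigma> F \<longleftrightarrow> F \<noteq> bot \<and> (\<forall>\<^sub>F \<tau> in F. \<tau> \<in> pure_states) \<and>
    (\<forall>\<phi>\<in>Cuo abs. ru_tendsto (\<lambda>\<tau>. \<tau> \<phi>) (\<sigma> \<phi>) F)"

text \<open>Without such a net every element would satisfy the condition in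
  \<open>state_value\<close>, and the description would determine nothing.\<close>

lemma pure_net_exists:
  fixes \<sigma> :: "('s::uniform_space, 'e::dedekind_complete_vector_lattice) state"
  assumes \<sigma>: "\<sigma> \<in> extremal_states"
  shows "\<exists>F. pure_net \<sigma> F"
proof -
  have "\<exists>\<tau>\<in>pure_states. \<forall>\<phi>\<in>A. \<bar>\<tau> \<phi> - \<sigma> \<phi>\<bar> \<le> (1 / real (Suc n)) *\<^sub>R 1"
    if "finite A \<and> A \<subseteq> orth_functions" for A and n :: nat
    using that by (intro pure_state_approx[OF \<sigma>]) auto
  then obtain \<tau> where \<tau>: "\<And>A n. finite A \<and> A \<subseteq> orth_functions \<Longrightarrow> \<tau> A n \<in> pure_states"
    "\<And>A n \<phi>. finite A \<and> A \<subseteq> orth_functions \<Longrightarrow> \<phi> \<in> A \<Longrightarrow> \<bar>\<tau> A n \<phi> - \<sigma> \<phi>\<bar> \<le> (1 / real (Suc n)) *\<^sub>R 1"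
    by metis
  \<comment> \<open>The net is indexed by a finite set of functions to be controlled together with
    an accuracy.\<close>
  let ?G = "finite_subsets_at_top orth_functions :: ('s \<Rightarrow> 'e orth) set filter"
  let ?F = "filtermap (\<lambda>p. \<tau> (fst p) (snd p)) (?G \<times>\<^sub>F sequentially)"
  have fin: "\<forall>\<^sub>F A in ?G. finite A \<and> A \<subseteq> orth_functions" by (rule eventually_finite_subsets_at_top_weakI) simp
  have "pure_net \<sigma> ?F"
    unfolding pure_net_def
  proof (intro conjI ballI)
    show "?F \<noteq> bot" by (simp add: filtermap_bot_iff prod_filter_eq_bot finite_subsets_at_top_neq_bot)
    show "\<forall>\<^sub>F \<tau> in ?F. \<tau> \<in> pure_states"
      unfolding eventually_filtermap
      using eventually_compose_filterlim[OF fin filterlim_fst] by eventually_elim (rule \<tau>(1))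
    fix \<phi> :: "'s \<Rightarrow> 'e orth" assume \<phi>: "\<phi> \<in> orth_functions"
    have mem: "\<forall>\<^sub>F A in ?G. (finite A \<and> A \<subseteq> orth_functions) \<and> \<phi> \<in> A"
      unfolding eventually_finite_subsets_at_top using \<phi> by (intro exI[of _ "{\<phi>}"]) auto
    show "ru_tendsto (\<lambda>\<tau>. \<tau> \<phi>) (\<sigma> \<phi>) ?F"
      unfolding ru_tendsto_def eventually_filtermap
    proof (intro exI[of _ 1] conjI allI impI orth_one_nonneg)
      fix \<epsilon> :: real assume "0 < \<epsilon>"
      then have "\<forall>\<^sub>F n in sequentially. 1 / real (Suc n) < \<epsilon>"
        using order_tendstoD(2)[OF LIMSEQ_inverse_real_of_nat] by (simp add: inverse_eq_divide)
      from eventually_compose_filterlim[OF mem filterlim_fst] eventually_compose_filterlim[OF this filterlim_snd]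
      show "\<forall>\<^sub>F p in ?G \<times>\<^sub>F sequentially. \<bar>\<tau> (fst p) (snd p) \<phi> - \<sigma> \<phi>\<bar> \<le> \<epsilon> *\<^sub>R 1"
      proof eventually_elim
        case (elim p)
        have "\<bar>\<tau> (fst p) (snd p) \<phi> - \<sigma> \<phi>\<bar> \<le> (1 / real (Suc (snd p))) *\<^sub>R 1"
          using elim(1) by (intro \<tau>(2)) auto
        also have "\<dots> \<le> \<epsilon> *\<^sub>R 1" using elim(2) by (intro scaleR_right_mono orth_one_nonneg) simp
        finally show ?case .
      qed
    qed
  qed
  then show ?thesis by blast
qed


section \<open>Values at extremal states\<close>

lemma component_scaleR_le_cases:
  fixes a :: "'e::dedekind_complete_vector_lattice orth"
  assumes "component a" "r *\<^sub>R a \<le> q *\<^sub>R a" "q < r" shows "a = 0"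
  using scaleR_component_nonpos[OF assms(1), of "r - q"] assms by (simp add: scaleR_diff_left)

section \<open>Limits of values along nets of pure states\<close>

context bk_space begin

text \<open>On the piece \<open>\<pi> s * \<rho> t\<close> the two values are \<open>f s\<close> and
  \<open>f t\<close>, and the states take the values \<open>\<phi> s\<close> and
  \<open>\<phi> t\<close>. If this piece meets \<open>c\<close>, closeness of the states bounds the
  real number \<open>\<bar>\<phi> s - \<phi> t\<bar>\<close> by 1/4, below the 1/2 that separation
  allows. Off \<open>c\<close> only the norm bound remains.\<close>

lemma pure_value_close:
  fixes \<pi> \<rho> :: "'s::{uniform_space, t2_space} \<Rightarrow> 'e orth" and \<Phi> :: "('s \<Rightarrow> real) set"
  assumes cpt: "compact (UNIV :: 's set)" and \<pi>: "partition_of_unity \<pi>" and \<rho>: "partition_of_unity \<rho>"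
    and f: "f \<in> Cuo N" and e: "0 \<le> e" "\<And>s. N (f s) \<le> e"
    and cont: "\<And>\<phi>. \<phi> \<in> \<Phi> \<Longrightarrow> (\<lambda>s. \<phi> s *\<^sub>R 1 :: 'e orth) \<in> orth_functions"
    and sep: "\<And>s t. (\<And>\<phi>. \<phi> \<in> \<Phi> \<Longrightarrow> \<bar>\<phi> s - \<phi> t\<bar> < 1/2) \<Longrightarrow> N (f s - f t) \<le> d"
    and c: "component c" and d: "0 \<le> d"
    and close: "\<And>\<phi>. \<phi> \<in> \<Phi> \<Longrightarrow>
      c * \<bar>pure_state \<pi> (\<lambda>s. \<phi> s *\<^sub>R 1) - pure_state \<rho> (\<lambda>s. \<phi> s *\<^sub>R 1)\<bar> \<le> (1/4) *\<^sub>R c"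
  shows "N (pure_value N f (pure_state \<pi>) - pure_value N f (pure_state \<rho>)) \<le> d + orth_app (1 - c) (e + e)"
    (is "N (?x - ?y) \<le> _")
proof -
  have cmp: "component (\<pi> s)" "component (\<rho> s)" "component (1 - c)" for s
    using \<pi> \<rho> c by (simp_all add: partition_component component_compl)
  have val: "orth_app (\<pi> s * \<rho> t) (N (?x - ?y)) = orth_app (\<pi> s * \<rho> t) (N (f s - f t))" for s t
  proof -
    have ab: "component (\<pi> s * \<rho> t)" by (intro component_mult cmp)
    have "act (\<pi> s * \<rho> t) ?x = act (\<pi> s * \<rho> t) (f s)"
      by (simp only: mult.commute[of "\<pi> s"] act_mult act_pure_value[OF cpt \<pi> f])
    moreover have "act (\<pi> s * \<rho> t) ?y = act (\<pi> s * \<rho> t) (f t)"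
      by (simp only: act_mult act_pure_value[OF cpt \<rho> f])
    ultimately show ?thesis by (simp add: norm_act_component[OF ab, symmetric] act_diff_right)
  qed
  show ?thesis
  proof (rule partition_app_leI[OF \<pi>], rule partition_app_leI[OF \<rho>])
    fix s t
    let ?a = "c * (\<pi> s * \<rho> t)"
    have a: "component ?a" by (intro component_mult cmp c)
    have 1: "orth_app ?a (N (f s - f t)) \<le> orth_app (\<pi> s * \<rho> t) d"
    proof (cases "?a = 0")
      case True
      have "0 \<le> orth_app (\<pi> s * \<rho> t) d" by (intro orth_app_nonneg component_nonneg component_mult cmp d)
      then show ?thesis by (simp only: True orth_app_zero)
    next
      case False
      have "\<bar>\<phi> s - \<phi> t\<bar> < 1/2" if \<phi>: "\<phi> \<in> \<Phi>" for \<phi>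
      proof (rule ccontr)
        assume "\<not> \<bar>\<phi> s - \<phi> t\<bar> < 1/2"
        let ?\<phi> = "\<lambda>s. \<phi> s *\<^sub>R (1 :: 'e orth)"
        let ?p = "pure_state \<pi> ?\<phi>" and ?r = "pure_state \<rho> ?\<phi>"
        have "?a * ?p = c * \<rho> t * (\<pi> s * ?p)" by (simp only: mult_ac)
        also have "\<dots> = c * \<rho> t * (\<pi> s * ?\<phi> s)" by (simp only: pure_state_mult[OF \<pi> cont[OF \<phi>]])
        also have "\<dots> = ?a * ?\<phi> s" by (simp only: mult_ac)
        finally have p: "?a * ?p = \<phi> s *\<^sub>R ?a" by simp
        have "?a * ?r = c * \<pi> s * (\<rho> t * ?r)" by (simp only: mult_ac)
        also have "\<dots> = c * \<pi> s * (\<rho> t * ?\<phi> t)" by (simp only: pure_state_mult[OF \<rho> cont[OF \<phi>]])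
        also have "\<dots> = ?a * ?\<phi> t" by (simp only: mult_ac)
        finally have r: "?a * ?r = \<phi> t *\<^sub>R ?a" by simp
        have "\<bar>\<phi> s - \<phi> t\<bar> *\<^sub>R ?a = \<bar>?a * (?p - ?r)\<bar>"
          by (simp add: right_diff_distrib p r scaleR_diff_left[symmetric] vl_abs_scaleR component_nonneg[OF a])
        also have "\<dots> = ?a * \<bar>?p - ?r\<bar>" by (simp only: component_abs[OF a])
        also have "\<dots> = \<pi> s * \<rho> t * (c * \<bar>?p - ?r\<bar>)" by (simp only: mult_ac)
        also have "\<dots> \<le> \<pi> s * \<rho> t * ((1/4) *\<^sub>R c)"
          by (rule mult_left_mono[OF close[OF \<phi>] component_nonneg[OF component_mult[OF cmp(1,2)]]])
        also have "\<dots> = (1/4) *\<^sub>R ?a" by (simp add: mult_ac)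
        finally have "?a = 0" using \<open>\<not> \<bar>\<phi> s - \<phi> t\<bar> < 1/2\<close>
          by (intro component_scaleR_le_cases[OF a, of "\<bar>\<phi> s - \<phi> t\<bar>" "1/4"]) auto
        then show False using False by contradiction
      qed
      then have "N (f s - f t) \<le> d" by (rule sep)
      then have "orth_app ?a (N (f s - f t)) \<le> orth_app ?a d" by (rule orth_app_mono[OF component_nonneg[OF a]])
      also have "\<dots> \<le> orth_app (\<pi> s * \<rho> t) d"
        by (intro orth_app_mono_left component_mult_le c component_nonneg component_mult cmp d)
      finally show ?thesis .
    qed
    have 2: "orth_app ((1 - c) * (\<pi> s * \<rho> t)) (N (f s - f t)) \<le> orth_app (\<pi> s * \<rho> t) (orth_app (1 - c) (e + e))"
    proof -
      have "N (f s - f t) \<le> e + e" by (rule order_trans[OF lnorm_triangle_diff add_mono[OF e(2) e(2)]])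
      then have "orth_app ((1 - c) * (\<pi> s * \<rho> t)) (N (f s - f t)) \<le> orth_app ((1 - c) * (\<pi> s * \<rho> t)) (e + e)"
        by (rule orth_app_mono[OF component_nonneg[OF component_mult[OF cmp(3) component_mult[OF cmp(1,2)]]]])
      then show ?thesis by (simp only: mult.commute[of "1 - c"] orth_app_mult)
    qed
    have "orth_app (\<pi> s * \<rho> t) (N (?x - ?y)) =
        orth_app ?a (N (f s - f t)) + orth_app ((1 - c) * (\<pi> s * \<rho> t)) (N (f s - f t))"
      unfolding val by (simp add: left_diff_distrib orth_app_simps)
    also have "\<dots> \<le> orth_app (\<pi> s * \<rho> t) (d + orth_app (1 - c) (e + e))"
      using add_mono[OF 1 2] by (simp only: orth_linear_simps)
    finally show "orth_app (\<rho> t) (orth_app (\<pi> s) (N (?x - ?y))) \<le>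
        orth_app (\<rho> t) (orth_app (\<pi> s) (d + orth_app (1 - c) (e + e)))"
      by (simp only: orth_app_mult[symmetric] mult.commute)
  qed
qed

text \<open>Two nets are compared instead of one net with itself: this gives both the convergence
  and the independence of the limit from the net.\<close>

lemma pure_net_values_Cauchy:
  fixes \<sigma> :: "('s::{uniform_space, t2_space}, 'e) state"
  assumes cpt: "compact (UNIV :: 's set)" and f: "f \<in> Cuo N"
    and F: "pure_net \<sigma> F" and G: "pure_net \<sigma> G"
  shows "order_tendsto (\<lambda>(\<tau>, \<tau>'). N (pure_value N f \<tau> - pure_value N f \<tau>')) 0 (F \<times>\<^sub>F G)"
proof -
  let ?h = "\<lambda>(\<tau>, \<tau>'). N (pure_value N f \<tau> - pure_value N f \<tau>')"
  obtain e where e: "0 \<le> e" "\<And>s. N (f s) \<le> e" using Cuo_bounded[OF f] by auto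
  obtain D where D: "inf_zero D" "\<And>d. d \<in> D \<Longrightarrow> \<forall>\<^sub>F p in uniformity. \<bar>(case p of (s, t) \<Rightarrow> N (f s - f t)) - 0\<bar> \<le> d"
    using order_tendstoE[OF Cuo_modulus[OF f]] by auto
  have key: "\<exists>w. \<forall>\<epsilon>>0. \<forall>\<^sub>F p in F \<times>\<^sub>F G. ?h p \<le> d + \<epsilon> *\<^sub>R w" if d: "d \<in> D" for d
  proof -
    have d0: "0 \<le> d" using D(1) d by (simp add: inf_zero_def)
    let ?E = "\<lambda>p. \<bar>(case p of (s, t) \<Rightarrow> N (f s - f t)) - 0\<bar> \<le> d"
    obtain \<Phi> :: "('s \<Rightarrow> real) set" where \<Phi>: "finite \<Phi>" "\<And>\<phi>. \<phi> \<in> \<Phi> \<Longrightarrow> continuous_on UNIV \<phi>"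
      "\<And>\<phi> s. \<phi> \<in> \<Phi> \<Longrightarrow> 0 \<le> \<phi> s \<and> \<phi> s \<le> 1"
      "\<And>s t. (\<And>\<phi>. \<phi> \<in> \<Phi> \<Longrightarrow> \<bar>\<phi> s - \<phi> t\<bar> < 1/2) \<Longrightarrow> ?E (s, t)"
      using uniformity_separating_functions[OF cpt D(2)[OF d]] by metis
    let ?V = "\<lambda>\<phi> s. \<phi> s *\<^sub>R (1 :: 'e orth)"
    have V: "?V \<phi> \<in> orth_functions" if "\<phi> \<in> \<Phi>" for \<phi>
      by (rule Cuo_continuous[OF cpt \<Phi>(2)[OF that] \<Phi>(3)[OF that]])
    have sep: "N (f s - f t) \<le> d" if "\<And>\<phi>. \<phi> \<in> \<Phi> \<Longrightarrow> \<bar>\<phi> s - \<phi> t\<bar> < 1/2" for s t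
      using \<Phi>(4)[OF that] by (simp add: lnorm_nonneg)
    have "\<exists>u\<ge>0. \<forall>\<epsilon>>0. \<forall>\<^sub>F \<tau> in H. \<forall>\<phi>\<in>\<Phi>. \<bar>\<tau> (?V \<phi>) - \<sigma> (?V \<phi>)\<bar> \<le> \<epsilon> *\<^sub>R u" if H: "pure_net \<sigma> H" for H
    proof -
      have "\<exists>u\<ge>0. \<forall>\<epsilon>>0. \<forall>\<^sub>F \<tau> in H. \<bar>\<tau> (?V \<phi>) - \<sigma> (?V \<phi>)\<bar> \<le> \<epsilon> *\<^sub>R u" if "\<phi> \<in> \<Phi>" for \<phi>
        using H V[OF that] unfolding pure_net_def ru_tendsto_def by blast
      then obtain u where u: "\<And>\<phi>. \<phi> \<in> \<Phi> \<Longrightarrow> 0 \<le> u \<phi>"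
        "\<And>\<phi> \<epsilon>. \<phi> \<in> \<Phi> \<Longrightarrow> 0 < \<epsilon> \<Longrightarrow> \<forall>\<^sub>F \<tau> in H. \<bar>\<tau> (?V \<phi>) - \<sigma> (?V \<phi>)\<bar> \<le> \<epsilon> *\<^sub>R u \<phi>" by metis
      have le: "u \<phi> \<le> (\<Sum>\<phi>\<in>\<Phi>. u \<phi>)" if "\<phi> \<in> \<Phi>" for \<phi>
        using sum_mono2[OF \<Phi>(1), of "{\<phi>}" u] u(1) that by simp
      show ?thesis
      proof (intro exI[of _ "\<Sum>\<phi>\<in>\<Phi>. u \<phi>"] conjI allI impI sum_nonneg u(1))
        fix \<epsilon> :: real assume \<epsilon>: "0 < \<epsilon>"
        show "\<forall>\<^sub>F \<tau> in H. \<forall>\<phi>\<in>\<Phi>. \<bar>\<tau> (?V \<phi>) - \<sigma> (?V \<phi>)\<bar> \<le> \<epsilon> *\<^sub>R (\<Sum>\<phi>\<in>\<Phi>. u \<phi>)"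
        proof (rule eventually_ball_finite[OF \<Phi>(1)], rule ballI)
          fix \<phi> assume \<phi>: "\<phi> \<in> \<Phi>"
          show "\<forall>\<^sub>F \<tau> in H. \<bar>\<tau> (?V \<phi>) - \<sigma> (?V \<phi>)\<bar> \<le> \<epsilon> *\<^sub>R (\<Sum>\<phi>\<in>\<Phi>. u \<phi>)"
            using u(2)[OF \<phi> \<epsilon>]
            by eventually_elim (rule order_trans[OF _ scaleR_left_mono[OF le[OF \<phi>] less_imp_le[OF \<epsilon>]]])
        qed
      qed
    qed
    from this[OF F] this[OF G] obtain u v where u: "0 \<le> u"
      "\<And>\<epsilon>. 0 < \<epsilon> \<Longrightarrow> \<forall>\<^sub>F \<tau> in F. \<forall>\<phi>\<in>\<Phi>. \<bar>\<tau> (?V \<phi>) - \<sigma> (?V \<phi>)\<bar> \<le> \<epsilon> *\<^sub>R u"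
      and v: "0 \<le> v" "\<And>\<epsilon>. 0 < \<epsilon> \<Longrightarrow> \<forall>\<^sub>F \<tau> in G. \<forall>\<phi>\<in>\<Phi>. \<bar>\<tau> (?V \<phi>) - \<sigma> (?V \<phi>)\<bar> \<le> \<epsilon> *\<^sub>R v" by auto
    define w where "w = orth_app (u + v) (e + e)"
    have "\<forall>\<^sub>F p in F \<times>\<^sub>F G. ?h p \<le> d + \<epsilon> *\<^sub>R w" if \<epsilon>: "0 < \<epsilon>" for \<epsilon>
    proof -
      \<comment> \<open>On \<open>c\<close> the regulators are at most
        \<open>1 / \<epsilon>\<close>, which turns the tolerance \<open>\<epsilon> / 4\<close> into
        the 1/4 of \<open>pure_value_close\<close>. Off \<open>c\<close> one has
        \<open>1 - c \<le> \<epsilon> (u + v)\<close>, so the crude bound \<open>e + e\<close>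
        contributes at most \<open>\<epsilon> w\<close>.\<close>
      obtain c where c: "component c" "c * (u + v) \<le> (1 / \<epsilon>) *\<^sub>R c" "(1 / \<epsilon>) *\<^sub>R (1 - c) \<le> (1 - c) * (u + v)"
        by (rule component_bounding)
      have c': "1 - c \<le> \<epsilon> *\<^sub>R (u + v)"
      proof -
        have "(1 / \<epsilon>) *\<^sub>R (1 - c) \<le> u + v"
          by (rule order_trans[OF c(3) component_mult_le]) (intro component_compl c add_nonneg_nonneg u v)+
        from scaleR_left_mono[OF this less_imp_le[OF \<epsilon>]] show ?thesis using \<epsilon> by simp
      qed
      have \<epsilon>4: "0 < \<epsilon> / 4" using \<epsilon> by simp
      have pF: "\<forall>\<^sub>F \<tau> in F. \<tau> \<in> pure_states" and pG: "\<forall>\<^sub>F \<tau> in G. \<tau> \<in> pure_states"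
        using F G by (simp_all add: pure_net_def)
      from eventually_compose_filterlim[OF u(2)[OF \<epsilon>4] filterlim_fst]
        eventually_compose_filterlim[OF v(2)[OF \<epsilon>4] filterlim_snd]
        eventually_compose_filterlim[OF pF filterlim_fst] eventually_compose_filterlim[OF pG filterlim_snd]
      show ?thesis
      proof eventually_elim
        case (elim p)
        obtain \<pi> where \<pi>: "fst p = pure_state \<pi>" "partition_of_unity \<pi>" using elim(3) by (auto simp: pure_states_def)
        obtain \<rho> where \<rho>: "snd p = pure_state \<rho>" "partition_of_unity \<rho>" using elim(4) by (auto simp: pure_states_def)
        have "N (pure_value N f (pure_state \<pi>) - pure_value N f (pure_state \<rho>)) \<le> d + orth_app (1 - c) (e + e)"
        proof (rule pure_value_close[OF cpt \<pi>(2) \<rho>(2) f e V sep c(1) d0])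
          fix \<phi> assume \<phi>: "\<phi> \<in> \<Phi>"
          let ?p = "pure_state \<pi> (?V \<phi>)" and ?r = "pure_state \<rho> (?V \<phi>)"
          have "\<bar>?p - \<sigma> (?V \<phi>)\<bar> \<le> (\<epsilon> / 4) *\<^sub>R u" "\<bar>?r - \<sigma> (?V \<phi>)\<bar> \<le> (\<epsilon> / 4) *\<^sub>R v"
            using elim(1,2) \<phi> \<pi>(1) \<rho>(1) by simp_all
          note pr = add_mono[OF this]
          have "\<bar>?p - ?r\<bar> \<le> \<bar>?p - \<sigma> (?V \<phi>)\<bar> + \<bar>?r - \<sigma> (?V \<phi>)\<bar>"
            using abs_triangle_ineq4[of "?p - \<sigma> (?V \<phi>)" "?r - \<sigma> (?V \<phi>)"] by simp
          also have "\<dots> \<le> (\<epsilon> / 4) *\<^sub>R (u + v)" using pr by (simp only: scaleR_add_right)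
          finally have "c * \<bar>?p - ?r\<bar> \<le> c * ((\<epsilon> / 4) *\<^sub>R (u + v))" by (rule mult_left_mono[OF _ component_nonneg[OF c(1)]])
          also have "\<dots> = (\<epsilon> / 4) *\<^sub>R (c * (u + v))" by simp
          also have "\<dots> \<le> (\<epsilon> / 4) *\<^sub>R ((1 / \<epsilon>) *\<^sub>R c)" using \<epsilon> by (intro scaleR_left_mono c(2)) simp
          also have "\<dots> = (1/4) *\<^sub>R c" using \<epsilon> by simp
          finally show "c * \<bar>?p - ?r\<bar> \<le> (1/4) *\<^sub>R c" .
        qed
        also have "\<dots> \<le> d + \<epsilon> *\<^sub>R w"
          using orth_app_mono_left[OF c' add_nonneg_nonneg[OF e(1) e(1)]]
          by (simp add: w_def orth_app_scaleR)
        finally show ?case using \<pi>(1) \<rho>(1) by (simp add: case_prod_beta)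
      qed
    qed
    then show ?thesis by blast
  qed
  \<comment> \<open>The regulator \<open>w\<close> depends on \<open>d\<close>, so the bounds
    \<open>d + \<epsilon> w\<close> are no sum of two sets with infimum 0. For the set of all
    eventual bounds the infimum is taken over \<epsilon> first and over \<open>d\<close>
    afterwards.\<close>
  let ?B = "{b. 0 \<le> b \<and> (\<forall>\<^sub>F p in F \<times>\<^sub>F G. \<bar>?h p - 0\<bar> \<le> b)}"
  have h0: "0 \<le> ?h p" for p by (cases p) (simp add: lnorm_nonneg)
  have B: "b \<in> ?B" if "\<forall>\<^sub>F p in F \<times>\<^sub>F G. ?h p \<le> b" for b
  proof -
    have "F \<times>\<^sub>F G \<noteq> bot" using F G by (simp add: pure_net_def prod_filter_eq_bot)
    moreover have "\<forall>\<^sub>F p in F \<times>\<^sub>F G. 0 \<le> b" using that by eventually_elim (rule order_trans[OF h0])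
    ultimately have "0 \<le> b" by simp
    moreover have "\<forall>\<^sub>F p in F \<times>\<^sub>F G. \<bar>?h p - 0\<bar> \<le> b"
      using that by eventually_elim (simp only: diff_zero abs_of_nonneg[OF h0])
    ultimately show ?thesis by blast
  qed
  have below: "z \<le> 0" if z: "\<forall>b\<in>?B. z \<le> b" for z
  proof (rule inf_zeroD[OF D(1)])
    fix d assume "d \<in> D"
    from key[OF this] obtain w where w: "\<And>\<epsilon>. 0 < \<epsilon> \<Longrightarrow> \<forall>\<^sub>F p in F \<times>\<^sub>F G. ?h p \<le> d + \<epsilon> *\<^sub>R w" by auto
    show "z \<le> d" by (rule vl_le_epsI[of _ _ w]) (use z B[OF w] in blast)
  qed
  obtain d where "d \<in> D" using D(1) by (auto simp: inf_zero_def)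
  from key[OF this] obtain w where "\<And>\<epsilon>. 0 < \<epsilon> \<Longrightarrow> \<forall>\<^sub>F p in F \<times>\<^sub>F G. ?h p \<le> d + \<epsilon> *\<^sub>R w" by auto
  from B[OF this[OF zero_less_one]] have "?B \<noteq> {}" by blast
  with below have "inf_zero ?B" unfolding inf_zero_def by blast
  then show ?thesis by (rule order_tendstoI) blast
qed

text \<open>The limit along \<open>F\<close> is also the limit along every other such net, by the
  joint Cauchy estimate; so the description in \<open>state_value\<close> has exactly one
  solution.\<close>

lemma state_value_tendsto:
  fixes \<sigma> :: "('s::{uniform_space, t2_space}, 'e) state"
  assumes cpt: "compact (UNIV :: 's set)" and f: "f \<in> Cuo N" and \<sigma>: "\<sigma> \<in> extremal_states"
    and F: "pure_net \<sigma> F"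
  shows "order_tendsto (\<lambda>\<tau>. N (state_value N f \<sigma> - pure_value N f \<tau>)) 0 F"
proof -
  let ?v = "pure_value N f"
  have "order_tendsto (\<lambda>(\<tau>, \<tau>'). N (?v \<tau> - ?v \<tau>')) 0 (F \<times>\<^sub>F F)"
    by (rule pure_net_values_Cauchy[OF cpt f F F])
  then obtain y where y: "order_tendsto (\<lambda>\<tau>. N (y - ?v \<tau>)) 0 F"
    using norm_o_Cauchy_convergent[of F ?v] F by (auto simp: pure_net_def)
  have lim: "order_tendsto (\<lambda>\<tau>. N (y - ?v \<tau>)) 0 G" if G: "pure_net \<sigma> G" for G
  proof -
    obtain D where D: "inf_zero D" "\<And>d. d \<in> D \<Longrightarrow> \<forall>\<^sub>F p in F \<times>\<^sub>F G.
        \<bar>N (y - ?v (fst p)) + (case p of (\<tau>, \<tau>') \<Rightarrow> N (?v \<tau> - ?v \<tau>')) - 0\<bar> \<le> d"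
      using order_tendstoE[OF order_null_add[OF order_null_compose[OF y filterlim_fst]
          pure_net_values_Cauchy[OF cpt f F G]]] by auto
    show ?thesis
    proof (rule order_tendstoI[OF D(1)])
      fix d assume "d \<in> D"
      from D(2)[OF this] have "\<forall>\<^sub>F p in F \<times>\<^sub>F G. N (y - ?v (snd p)) \<le> d"
      proof eventually_elim
        case (elim p)
        have "N (y - ?v (snd p)) \<le> N (y - ?v (fst p)) + N (?v (fst p) - ?v (snd p))" by (rule lnorm_diff_triangle)
        also have "\<dots> \<le> d" using order_trans[OF abs_ge_self elim] by (simp add: case_prod_beta)
        finally show ?case .
      qed
      then obtain Pf Pg where P: "eventually Pf F" "eventually Pg G" "\<And>\<tau> \<tau>'. Pf \<tau> \<Longrightarrow> Pg \<tau>' \<Longrightarrow> N (y - ?v \<tau>') \<le> d"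
        unfolding eventually_prod_filter by auto
      have "\<exists>\<tau>. Pf \<tau>" using P(1) F by (auto simp: pure_net_def intro: eventually_happens')
      then show "\<forall>\<^sub>F \<tau> in G. \<bar>N (y - ?v \<tau>) - 0\<bar> \<le> d"
        using P(2,3) by (auto simp: lnorm_nonneg elim!: eventually_mono)
    qed
  qed
  have eq: "state_value N f \<sigma> = y"
    unfolding state_value_def pure_net_def[symmetric] norm_tendsto_def
  proof (rule the_equality)
    show "\<forall>G. pure_net \<sigma> G \<longrightarrow> order_tendsto (\<lambda>\<tau>. N (y - ?v \<tau>)) 0 G" using lim by blast
    fix z assume "\<forall>G. pure_net \<sigma> G \<longrightarrow> order_tendsto (\<lambda>\<tau>. N (z - ?v \<tau>)) 0 G"
    then have "order_tendsto (\<lambda>\<tau>. N (z - ?v \<tau>)) 0 F" using F by blast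
    from order_null_add[OF this y] have "N (z - y) \<le> 0"
    proof (rule order_null_le)
      show "F \<noteq> bot" using F by (simp add: pure_net_def)
      show "\<forall>\<^sub>F \<tau> in F. N (z - y) \<le> 0 + (N (z - ?v \<tau>) + N (y - ?v \<tau>))"
      proof (intro always_eventually allI)
        fix \<tau>
        show "N (z - y) \<le> 0 + (N (z - ?v \<tau>) + N (y - ?v \<tau>))"
          using lnorm_diff_triangle[of z y "?v \<tau>"] lnorm_minus_commute[of "?v \<tau>" y] by simp
      qed
    qed
    then show "z = y" using lnorm_eq_zero_le by fastforce
  qed
  show ?thesis unfolding eq by (rule y)
qed

lemma norm_state_value_diff_le:
  fixes \<sigma> :: "('s::{uniform_space, t2_space}, 'e) state"
  assumes cpt: "compact (UNIV :: 's set)" and f: "f \<in> Cuo N" and g: "g \<in> Cuo N" and \<sigma>: "\<sigma> \<in> extremal_states"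
    and b: "\<And>s. N (f s - g s) \<le> b"
  shows "N (state_value N f \<sigma> - state_value N g \<sigma>) \<le> b"
proof -
  obtain F where F: "pure_net \<sigma> F" using pure_net_exists[OF \<sigma>] by blast
  let ?x = "state_value N f \<sigma>" and ?y = "state_value N g \<sigma>"
  have pF: "\<forall>\<^sub>F \<tau> in F. \<tau> \<in> pure_states" "F \<noteq> bot" using F by (simp_all add: pure_net_def)
  from order_null_add[OF state_value_tendsto[OF cpt f \<sigma> F] state_value_tendsto[OF cpt g \<sigma> F]]
  show ?thesis
  proof (rule order_null_le[OF _ pF(2)])
    show "\<forall>\<^sub>F \<tau> in F. N (?x - ?y) \<le> b + (N (?x - pure_value N f \<tau>) + N (?y - pure_value N g \<tau>))"
      using pF(1)
    proof eventually_elim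
      case (elim \<tau>)
      then obtain \<pi> where \<pi>: "\<tau> = pure_state \<pi>" "partition_of_unity \<pi>" by (auto simp: pure_states_def)
      let ?p = "pure_value N f \<tau>" and ?r = "pure_value N g \<tau>"
      have pr: "N (?p - ?r) \<le> b"
      proof (rule partition_app_leI[OF \<pi>(2)])
        fix s
        have "orth_app (\<pi> s) (N (?p - ?r)) = orth_app (\<pi> s) (N (f s - g s))"
          unfolding \<pi>(1) by (rule norm_diff_pure_value[OF cpt \<pi>(2) f g])
        also have "\<dots> \<le> orth_app (\<pi> s) b"
          by (rule orth_app_mono[OF component_nonneg[OF partition_component[OF \<pi>(2)]] b])
        finally show "orth_app (\<pi> s) (N (?p - ?r)) \<le> orth_app (\<pi> s) b" .
      qed
      have "N (?x - ?y) \<le> N (?x - ?p) + (N (?p - ?r) + N (?r - ?y))"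
        by (rule order_trans[OF lnorm_diff_triangle add_left_mono[OF lnorm_diff_triangle]])
      also have "\<dots> \<le> N (?x - ?p) + (b + N (?y - ?r))"
        using pr lnorm_minus_commute[of ?r ?y] by (intro add_left_mono add_mono) simp_all
      finally show ?case by (simp add: algebra_simps)
    qed
  qed
qed

text \<open>Converts a lower bound on the state, an element of \<Lambda>, into one on the values, an
  element of E. It is checked piecewise on pure states and passes to the limit.\<close>

lemma norm_state_value_diff_ge:
  fixes \<sigma> :: "('s::{uniform_space, t2_space}, 'e) state"
  assumes cpt: "compact (UNIV :: 's set)" and f: "f \<in> Cuo N" and g: "g \<in> Cuo N" and \<sigma>: "\<sigma> \<in> extremal_states"
    and D: "D \<in> orth_functions" and d: "0 \<le> d" and le: "\<And>s. orth_app (D s) d \<le> N (f s - g s)"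
  shows "orth_app (\<sigma> D) d \<le> N (state_value N f \<sigma> - state_value N g \<sigma>)"
proof -
  obtain F where F: "pure_net \<sigma> F" using pure_net_exists[OF \<sigma>] by blast
  let ?x = "state_value N f \<sigma>" and ?y = "state_value N g \<sigma>"
  have pF: "\<forall>\<^sub>F \<tau> in F. \<tau> \<in> pure_states" "F \<noteq> bot" using F by (simp_all add: pure_net_def)
  obtain u where u: "0 \<le> u" "\<And>\<epsilon>. 0 < \<epsilon> \<Longrightarrow> \<forall>\<^sub>F \<tau> in F. \<bar>\<tau> D - \<sigma> D\<bar> \<le> \<epsilon> *\<^sub>R u"
    using F D unfolding pure_net_def ru_tendsto_def by blast
  have "order_tendsto (\<lambda>\<tau>. orth_app \<bar>\<tau> D - \<sigma> D\<bar> d) 0 F"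
  proof (rule order_null_scaleR[OF orth_app_nonneg[OF u(1) d]])
    fix \<epsilon> :: real assume "0 < \<epsilon>"
    from u(2)[OF this] show "\<forall>\<^sub>F \<tau> in F. \<bar>orth_app \<bar>\<tau> D - \<sigma> D\<bar> d\<bar> \<le> \<epsilon> *\<^sub>R orth_app u d"
    proof eventually_elim
      case (elim \<tau>)
      then show ?case using orth_app_mono_left[OF elim d] orth_app_nonneg[OF abs_ge_zero d, of "\<tau> D - \<sigma> D"]
        by (simp add: orth_app_scaleR)
    qed
  qed
  from order_null_add[OF this order_null_add[OF state_value_tendsto[OF cpt f \<sigma> F] state_value_tendsto[OF cpt g \<sigma> F]]]
  show ?thesis
  proof (rule order_null_le[OF _ pF(2)])
    show "\<forall>\<^sub>F \<tau> in F. orth_app (\<sigma> D) d \<le> N (?x - ?y) +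
      (orth_app \<bar>\<tau> D - \<sigma> D\<bar> d + (N (?x - pure_value N f \<tau>) + N (?y - pure_value N g \<tau>)))"
      using pF(1)
    proof eventually_elim
      case (elim \<tau>)
      then obtain \<pi> where \<pi>: "\<tau> = pure_state \<pi>" "partition_of_unity \<pi>" by (auto simp: pure_states_def)
      let ?p = "pure_value N f \<tau>" and ?r = "pure_value N g \<tau>"
      have pr: "orth_app (\<tau> D) d \<le> N (?p - ?r)"
      proof (rule partition_app_leI[OF \<pi>(2)])
        fix s
        have "orth_app (\<pi> s) (orth_app (\<tau> D) d) = orth_app (\<pi> s) (orth_app (D s) d)"
          unfolding \<pi>(1) orth_app_mult[symmetric] pure_state_mult[OF \<pi>(2) D] ..
        also have "\<dots> \<le> orth_app (\<pi> s) (N (f s - g s))"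
          by (rule orth_app_mono[OF component_nonneg[OF partition_component[OF \<pi>(2)]] le])
        also have "\<dots> = orth_app (\<pi> s) (N (?p - ?r))"
          unfolding \<pi>(1) by (rule norm_diff_pure_value[OF cpt \<pi>(2) f g, symmetric])
        finally show "orth_app (\<pi> s) (orth_app (\<tau> D) d) \<le> orth_app (\<pi> s) (N (?p - ?r))" .
      qed
      have "N (?p - ?r) \<le> N (?p - ?x) + (N (?x - ?y) + N (?y - ?r))"
        by (rule order_trans[OF lnorm_diff_triangle add_left_mono[OF lnorm_diff_triangle]])
      then have 1: "N (?p - ?r) \<le> N (?x - ?y) + (N (?x - ?p) + N (?y - ?r))"
        using lnorm_minus_commute[of ?p ?x] by (simp add: algebra_simps)
      have "\<sigma> D \<le> \<tau> D + \<bar>\<tau> D - \<sigma> D\<bar>" using vl_abs_ge(2)[of "\<tau> D - \<sigma> D"] by (simp add: algebra_simps)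
      from orth_app_mono_left[OF this d]
      have "orth_app (\<sigma> D) d \<le> orth_app (\<tau> D) d + orth_app \<bar>\<tau> D - \<sigma> D\<bar> d" by (simp add: orth_app_simps)
      also have "\<dots> \<le> (N (?x - ?y) + (N (?x - ?p) + N (?y - ?r))) + orth_app \<bar>\<tau> D - \<sigma> D\<bar> d"
        by (rule add_right_mono[OF order_trans[OF pr 1]])
      finally show ?case by (simp add: algebra_simps)
    qed
  qed
qed

end

section \<open>Suprema over closed sets of states\<close>

text \<open>The intended \<open>p\<close> is \<open>\<phi> \<mapsto> sup \<sigma> \<phi>\<close>, with \<open>\<sigma>\<close> running through a closed set of extremal
  states.\<close>

definition sup_functional :: "('s::uniform_space, 'e::dedekind_complete_vector_lattice) state \<Rightarrow> bool"
  where "sup_functional p \<longleftrightarrow> p \<in> extensional orth_functions \<and>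
    (\<forall>\<phi>\<in>orth_functions. \<forall>\<psi>\<in>orth_functions. p (\<lambda>s. \<phi> s + \<psi> s) \<le> p \<phi> + p \<psi>) \<and>
    (\<forall>\<phi>\<in>orth_functions. \<forall>c>0. p (\<lambda>s. c *\<^sub>R \<phi> s) \<le> c *\<^sub>R p \<phi>) \<and>
    (\<forall>\<phi>\<in>orth_functions. \<forall>\<psi>\<in>orth_functions. p (\<lambda>s. sup (\<phi> s) (\<psi> s)) = sup (p \<phi>) (p \<psi>)) \<and>
    (\<forall>l. p (\<lambda>s. l) = l)"

context
  fixes p :: "('s::uniform_space, 'e::dedekind_complete_vector_lattice) state"
  assumes p: "sup_functional p"
begin

lemma sup_functional_add: "\<phi> \<in> orth_functions \<Longrightarrow> \<psi> \<in> orth_functions \<Longrightarrow> p (\<lambda>s. \<phi> s + \<psi> s) \<le> p \<phi> + p \<psi>"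
  and sup_functional_sup: "\<phi> \<in> orth_functions \<Longrightarrow> \<psi> \<in> orth_functions \<Longrightarrow> p (\<lambda>s. sup (\<phi> s) (\<psi> s)) = sup (p \<phi>) (p \<psi>)"
  and sup_functional_const: "p (\<lambda>s. l) = l"
  and sup_functional_extensional: "p \<in> extensional orth_functions"
  using p by (simp_all add: sup_functional_def)

lemma sup_functional_scaleR:
  assumes "\<phi> \<in> orth_functions" "0 \<le> c" shows "p (\<lambda>s. c *\<^sub>R \<phi> s) = c *\<^sub>R p \<phi>"
proof (cases "c = 0")
  case True then show ?thesis by (simp add: sup_functional_const)
next
  case False
  then have c: "0 < c" using assms by simp
  have le: "p (\<lambda>s. r *\<^sub>R \<psi> s) \<le> r *\<^sub>R p \<psi>" if "\<psi> \<in> orth_functions" "0 < r" for r \<psi>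
    using p that by (simp add: sup_functional_def)
  have "p (\<lambda>s. inverse c *\<^sub>R (c *\<^sub>R \<phi> s)) \<le> inverse c *\<^sub>R p (\<lambda>s. c *\<^sub>R \<phi> s)"
    using c by (intro le Cuo_scaleR assms) simp
  then have "c *\<^sub>R p \<phi> \<le> c *\<^sub>R (inverse c *\<^sub>R p (\<lambda>s. c *\<^sub>R \<phi> s))"
    using c by (intro scaleR_left_mono) auto
  then show ?thesis using c by (intro antisym le assms) simp_all
qed

lemma sup_functional_mono:
  assumes "\<phi> \<in> orth_functions" "\<psi> \<in> orth_functions" "\<And>s. \<phi> s \<le> \<psi> s" shows "p \<phi> \<le> p \<psi>"
proof -
  have "(\<lambda>s. sup (\<phi> s) (\<psi> s)) = \<psi>" using assms by (simp add: sup_absorb2)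
  then have "p \<psi> = sup (p \<phi>) (p \<psi>)" using sup_functional_sup[OF assms(1,2)] by simp
  then show ?thesis by (metis sup_ge1)
qed

lemma sup_functional_add_const:
  assumes "\<phi> \<in> orth_functions" shows "p (\<lambda>s. \<phi> s + l) = p \<phi> + l"
proof (rule antisym)
  show "p (\<lambda>s. \<phi> s + l) \<le> p \<phi> + l"
    using sup_functional_add[OF assms Cuo_const, of l] by (simp add: sup_functional_const)
  have "p (\<lambda>s. (\<phi> s + l) + - l) \<le> p (\<lambda>s. \<phi> s + l) + - l"
    using sup_functional_add[OF Cuo_add[OF assms Cuo_const] Cuo_const, of l "- l"] by (simp add: sup_functional_const)
  then show "p \<phi> + l \<le> p (\<lambda>s. \<phi> s + l)" by (simp add: le_diff_eq)
qed

lemma sup_functional_minus_le: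
  assumes "\<phi> \<in> orth_functions" shows "- p (\<lambda>s. - \<phi> s) \<le> p \<phi>"
proof -
  have "0 \<le> p \<phi> + p (\<lambda>s. - \<phi> s)"
    using sup_functional_add[OF assms Cuo_minus[OF assms]] by (simp add: sup_functional_const)
  then have "0 - p (\<lambda>s. - \<phi> s) \<le> p \<phi>" by (simp only: diff_le_eq)
  then show ?thesis by simp
qed

text \<open>Supremum functionals are local: on a band, the result depends on the function within
  that band only. Adding a large constant supported outside \<open>b\<close> makes the inequality
  global, and \<open>b\<close> removes this constant again.\<close>

lemma sup_functional_component_mono:
  assumes b: "component b" and \<phi>: "\<phi> \<in> orth_functions" and \<psi>: "\<psi> \<in> orth_functions"
    and le: "\<And>s. b * \<phi> s \<le> b * \<psi> s"
  shows "b * p \<phi> \<le> b * p \<psi>"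
proof -
  obtain e where e: "0 \<le> e" "\<And>s. \<bar>\<phi> s\<bar> \<le> e" using orth_lns.Cuo_bounded[OF \<phi>] by auto
  obtain e' where e': "0 \<le> e'" "\<And>s. \<bar>\<psi> s\<bar> \<le> e'" using orth_lns.Cuo_bounded[OF \<psi>] by auto
  let ?l = "(1 - b) * (e + e')"
  have b': "component (1 - b)" by (rule component_compl[OF b])
  have "\<phi> s \<le> \<psi> s + ?l" for s
  proof (rule orth_le_componentI[of b])
    have "b * ?l = 0" using component_idem[OF b] by (simp add: mult.assoc[symmetric] right_diff_distrib)
    then show "b * \<phi> s \<le> b * (\<psi> s + ?l)" using le[of s] by (simp only: distrib_left add_0_right)
    have "\<phi> s \<le> \<psi> s + (e + e')"
      using add_mono[OF order_trans[OF vl_abs_ge(1) e(2)[of s]] order_trans[OF vl_abs_ge(2) e'(2)[of s]]]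
      by (simp add: algebra_simps)
    from mult_left_mono[OF this component_nonneg[OF b']]
    show "(1 - b) * \<phi> s \<le> (1 - b) * (\<psi> s + ?l)"
      using component_idem[OF b'] by (simp only: distrib_left mult.assoc[symmetric])
  qed
  then have "p \<phi> \<le> p (\<lambda>s. \<psi> s + ?l)" by (intro sup_functional_mono \<phi> Cuo_add \<psi> Cuo_const)
  also have "\<dots> = p \<psi> + ?l" by (rule sup_functional_add_const[OF \<psi>])
  finally have "b * p \<phi> \<le> b * (p \<psi> + ?l)" by (rule mult_left_mono[OF _ component_nonneg[OF b]])
  moreover have "b * ?l = 0" using component_idem[OF b] by (simp add: mult.assoc[symmetric] right_diff_distrib)
  ultimately show ?thesis by (simp only: distrib_left add_0_right)
qed

lemma sup_functional_component_cong:
  assumes "component b" "\<phi> \<in> orth_functions" "\<psi> \<in> orth_functions" "\<And>s. b * \<phi> s = b * \<psi> s"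
  shows "b * p \<phi> = b * p \<psi>"
  using assms by (intro antisym sup_functional_component_mono) auto

lemma sup_functional_le:
  assumes "\<phi> \<in> orth_functions" "\<And>s. \<phi> s \<le> l" shows "p \<phi> \<le> l"
  using sup_functional_mono[OF assms(1) Cuo_const, of l] assms(2) by (simp add: sup_functional_const)


end

text \<open>Infinite distributivity in a lattice ordered group, obtained from
  \<open>a + b = sup a b + inf a b\<close>; \<open>l\<close> is the infimum of
  \<open>A\<close>.\<close>

lemma vl_le_sup_inf:
  fixes z :: "'e::lattice_ab_group_add"
  assumes inf: "\<And>w. (\<And>a. a \<in> A \<Longrightarrow> w \<le> a) \<Longrightarrow> w \<le> l" and l: "\<And>a. a \<in> A \<Longrightarrow> l \<le> a"
    and z: "\<And>a. a \<in> A \<Longrightarrow> z \<le> sup a b"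
  shows "z \<le> sup l b"
proof -
  have "z - b + inf l b \<le> l"
  proof (rule inf)
    fix a assume a: "a \<in> A"
    have "z + inf l b \<le> sup a b + inf a b" using z[OF a] l[OF a] by (intro add_mono inf_mono) auto
    also have "\<dots> = a + b" by (rule add_eq_inf_sup[symmetric])
    finally show "z - b + inf l b \<le> a" by (simp add: algebra_simps)
  qed
  then have "z + inf l b \<le> l + b" by (simp add: algebra_simps)
  also have "\<dots> = sup l b + inf l b" by (rule add_eq_inf_sup)
  finally show ?thesis by simp
qed

text \<open>Serves both faces and chains of functionals. The index \<open>k\<close> may differ from
  \<open>i\<close> and \<open>j\<close>, so a single \<open>Q i\<close> need not be subadditive; the
  infimum is.\<close>

lemma sup_functional_Inf:
  fixes Q :: "'i \<Rightarrow> ('s::uniform_space, 'e::dedekind_complete_vector_lattice) state"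
  assumes ne: "I \<noteq> {}"
    and below: "\<And>\<phi>. \<phi> \<in> orth_functions \<Longrightarrow> bdd_below ((\<lambda>i. Q i \<phi>) ` I)"
    and add: "\<And>i j \<phi> \<psi>. i \<in> I \<Longrightarrow> j \<in> I \<Longrightarrow> \<phi> \<in> orth_functions \<Longrightarrow> \<psi> \<in> orth_functions \<Longrightarrow>
      \<exists>k\<in>I. Q k (\<lambda>s. \<phi> s + \<psi> s) \<le> Q i \<phi> + Q j \<psi>"
    and scale: "\<And>i c \<phi>. i \<in> I \<Longrightarrow> 0 < c \<Longrightarrow> \<phi> \<in> orth_functions \<Longrightarrow> \<exists>k\<in>I. Q k (\<lambda>s. c *\<^sub>R \<phi> s) \<le> c *\<^sub>R Q i \<phi>"
    and sup: "\<And>i j \<phi> \<psi>. i \<in> I \<Longrightarrow> j \<in> I \<Longrightarrow> \<phi> \<in> orth_functions \<Longrightarrow> \<psi> \<in> orth_functions \<Longrightarrow>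
      \<exists>k\<in>I. Q k (\<lambda>s. sup (\<phi> s) (\<psi> s)) \<le> sup (Q i \<phi>) (Q j \<psi>)"
    and mono: "\<And>i \<phi> \<psi>. i \<in> I \<Longrightarrow> \<phi> \<in> orth_functions \<Longrightarrow> \<psi> \<in> orth_functions \<Longrightarrow> (\<And>s. \<phi> s \<le> \<psi> s) \<Longrightarrow> Q i \<phi> \<le> Q i \<psi>"
    and const: "\<And>i l. i \<in> I \<Longrightarrow> Q i (\<lambda>s. l) = l"
  shows "sup_functional (\<lambda>\<phi>\<in>orth_functions. INF i\<in>I. Q i \<phi>)"
proof -
  let ?r = "\<lambda>\<phi>. INF i\<in>I. Q i \<phi>"
  have low: "?r \<phi> \<le> Q i \<phi>" if "\<phi> \<in> orth_functions" "i \<in> I" for \<phi> i by (rule cINF_lower[OF below[OF that(1)] that(2)])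
  have gr: "z \<le> ?r \<phi>" if "\<And>i. i \<in> I \<Longrightarrow> z \<le> Q i \<phi>" for z \<phi> by (rule cINF_greatest[OF ne that])
  have "?r (\<lambda>s. \<phi> s + \<psi> s) \<le> ?r \<phi> + ?r \<psi>" if V: "\<phi> \<in> orth_functions" "\<psi> \<in> orth_functions" for \<phi> \<psi>
  proof -
    have "?r (\<lambda>s. \<phi> s + \<psi> s) - ?r \<phi> \<le> ?r \<psi>"
    proof (rule gr)
      fix j assume j: "j \<in> I"
      have "?r (\<lambda>s. \<phi> s + \<psi> s) - Q j \<psi> \<le> ?r \<phi>"
      proof (rule gr)
        fix i assume i: "i \<in> I"
        obtain k where k: "k \<in> I" "Q k (\<lambda>s. \<phi> s + \<psi> s) \<le> Q i \<phi> + Q j \<psi>" using add[OF i j V] by blast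
        have "?r (\<lambda>s. \<phi> s + \<psi> s) \<le> Q i \<phi> + Q j \<psi>" by (rule order_trans[OF low[OF Cuo_add[OF V] k(1)] k(2)])
        then show "?r (\<lambda>s. \<phi> s + \<psi> s) - Q j \<psi> \<le> Q i \<phi>" by (simp add: algebra_simps)
      qed
      then show "?r (\<lambda>s. \<phi> s + \<psi> s) - ?r \<phi> \<le> Q j \<psi>" by (simp add: algebra_simps)
    qed
    then show ?thesis by (simp add: algebra_simps)
  qed
  moreover have "?r (\<lambda>s. c *\<^sub>R \<phi> s) \<le> c *\<^sub>R ?r \<phi>" if V: "\<phi> \<in> orth_functions" and c: "0 < c" for \<phi> c
  proof -
    have "inverse c *\<^sub>R ?r (\<lambda>s. c *\<^sub>R \<phi> s) \<le> ?r \<phi>"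
    proof (rule gr)
      fix i assume i: "i \<in> I"
      obtain k where k: "k \<in> I" "Q k (\<lambda>s. c *\<^sub>R \<phi> s) \<le> c *\<^sub>R Q i \<phi>" using scale[OF i c V] by blast
      have "inverse c *\<^sub>R ?r (\<lambda>s. c *\<^sub>R \<phi> s) \<le> inverse c *\<^sub>R (c *\<^sub>R Q i \<phi>)"
        using c by (intro scaleR_left_mono order_trans[OF low[OF Cuo_scaleR[OF V] k(1)] k(2)]) simp
      then show "inverse c *\<^sub>R ?r (\<lambda>s. c *\<^sub>R \<phi> s) \<le> Q i \<phi>" using c by simp
    qed
    from scaleR_left_mono[OF this less_imp_le[OF c]] show ?thesis using c by simp
  qed
  moreover have "?r (\<lambda>s. sup (\<phi> s) (\<psi> s)) = sup (?r \<phi>) (?r \<psi>)" if V: "\<phi> \<in> orth_functions" "\<psi> \<in> orth_functions" for \<phi> \<psi>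
  proof (rule antisym)
    let ?z = "?r (\<lambda>s. sup (\<phi> s) (\<psi> s))"
    \<comment> \<open>The two infima are pulled out of the supremum one at a time, each by infinite
      distributivity.\<close>
    have 1: "?z \<le> sup (Q i \<phi>) (?r \<psi>)" if i: "i \<in> I" for i
    proof -
      have "?z \<le> sup (?r \<psi>) (Q i \<phi>)"
      proof (rule vl_le_sup_inf[of "(\<lambda>j. Q j \<psi>) ` I"])
        fix a assume "a \<in> (\<lambda>j. Q j \<psi>) ` I"
        then obtain j where j: "j \<in> I" "a = Q j \<psi>" by blast
        obtain k where k: "k \<in> I" "Q k (\<lambda>s. sup (\<phi> s) (\<psi> s)) \<le> sup (Q i \<phi>) (Q j \<psi>)" using sup[OF i j(1) V] by blast
        show "?z \<le> sup a (Q i \<phi>)"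
          using order_trans[OF low[OF Cuo_sup[OF V] k(1)] k(2)] j by (simp add: sup_commute)
        show "?r \<psi> \<le> a" using low[OF V(2) j(1)] j(2) by simp
      qed (rule gr, blast)
      then show ?thesis by (simp add: sup_commute)
    qed
    show "?z \<le> sup (?r \<phi>) (?r \<psi>)"
    proof (rule vl_le_sup_inf[of "(\<lambda>i. Q i \<phi>) ` I"])
      fix a assume "a \<in> (\<lambda>i. Q i \<phi>) ` I"
      then obtain i where i: "i \<in> I" "a = Q i \<phi>" by blast
      show "?z \<le> sup a (?r \<psi>)" using 1[OF i(1)] i by simp
      show "?r \<phi> \<le> a" using low[OF V(1) i(1)] i(2) by simp
    qed (rule gr, blast)
    have "?r \<phi> \<le> ?z" "?r \<psi> \<le> ?z"
      by (rule gr, rule order_trans[OF low mono], use V Cuo_sup[OF V] in auto)+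
    then show "sup (?r \<phi>) (?r \<psi>) \<le> ?z" by simp
  qed
  moreover have "?r (\<lambda>s. l) = l" for l using ne by (simp add: const cong: INF_cong)
  ultimately show ?thesis by (simp add: sup_functional_def Cuo_add Cuo_scaleR Cuo_sup Cuo_const)
qed

text \<open>The face on which \<open>k\<close> attains its maximum.\<close>

definition face :: "('s::uniform_space, 'e::dedekind_complete_vector_lattice) state \<Rightarrow> ('s \<Rightarrow> 'e orth) \<Rightarrow> ('s, 'e) state"
  where "face p k = (\<lambda>\<phi>\<in>orth_functions. INF t\<in>{0::real..}. p (\<lambda>s. \<phi> s + t *\<^sub>R k s) - t *\<^sub>R p k)"

context
  fixes p :: "('s::uniform_space, 'e::dedekind_complete_vector_lattice) state"
    and k :: "'s \<Rightarrow> 'e orth"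
  assumes p: "sup_functional p" and k: "k \<in> orth_functions"
begin

lemma face_bdd_below:
  assumes "\<phi> \<in> orth_functions" "0 \<le> t"
  shows "- p (\<lambda>s. - \<phi> s) \<le> p (\<lambda>s. \<phi> s + t *\<^sub>R k s) - t *\<^sub>R p k"
proof -
  have "p (\<lambda>s. (\<phi> s + t *\<^sub>R k s) + - \<phi> s) \<le> p (\<lambda>s. \<phi> s + t *\<^sub>R k s) + p (\<lambda>s. - \<phi> s)"
    by (intro sup_functional_add[OF p] Cuo_add Cuo_scaleR Cuo_minus k assms)
  then show ?thesis using sup_functional_scaleR[OF p k assms(2)] by (simp add: algebra_simps)
qed

lemma face_le: "\<phi> \<in> orth_functions \<Longrightarrow> 0 \<le> t \<Longrightarrow> face p k \<phi> \<le> p (\<lambda>s. \<phi> s + t *\<^sub>R k s) - t *\<^sub>R p k"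
  by (simp add: face_def) (intro cINF_lower bdd_belowI2[of _ "- p (\<lambda>s. - \<phi> s)"], auto intro: face_bdd_below)

lemma face_greatest:
  "\<phi> \<in> orth_functions \<Longrightarrow> (\<And>t. 0 \<le> t \<Longrightarrow> z \<le> p (\<lambda>s. \<phi> s + t *\<^sub>R k s) - t *\<^sub>R p k) \<Longrightarrow> z \<le> face p k \<phi>"
  by (auto simp: face_def intro: cINF_greatest)

lemma face_le_self: "\<phi> \<in> orth_functions \<Longrightarrow> face p k \<phi> \<le> p \<phi>"
  using face_le[of \<phi> 0] by simp

lemma face_antimono:
  assumes "\<phi> \<in> orth_functions" "0 \<le> t" "t \<le> r"
  shows "p (\<lambda>s. \<phi> s + r *\<^sub>R k s) - r *\<^sub>R p k \<le> p (\<lambda>s. \<phi> s + t *\<^sub>R k s) - t *\<^sub>R p k"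
proof -
  have "p (\<lambda>s. (\<phi> s + t *\<^sub>R k s) + (r - t) *\<^sub>R k s) \<le> p (\<lambda>s. \<phi> s + t *\<^sub>R k s) + p (\<lambda>s. (r - t) *\<^sub>R k s)"
    by (intro sup_functional_add[OF p] Cuo_add Cuo_scaleR k assms)
  also have "p (\<lambda>s. (r - t) *\<^sub>R k s) = r *\<^sub>R p k - t *\<^sub>R p k"
    using sup_functional_scaleR[OF p k, of "r - t"] assms(3) by (simp add: scaleR_diff_left)
  also have "(\<lambda>s. (\<phi> s + t *\<^sub>R k s) + (r - t) *\<^sub>R k s) = (\<lambda>s. \<phi> s + r *\<^sub>R k s)"
    by (simp add: scaleR_diff_left)
  finally show ?thesis by (simp add: algebra_simps)
qed

lemma sup_functional_face: "sup_functional (face p k)"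
  unfolding face_def
proof (rule sup_functional_Inf)
  let ?Q = "\<lambda>t \<phi>. p (\<lambda>s. \<phi> s + t *\<^sub>R k s) - t *\<^sub>R p k"
  show "bdd_below ((\<lambda>t. ?Q t \<phi>) ` {0..})" if "\<phi> \<in> orth_functions" for \<phi>
    by (rule bdd_belowI2[of _ "- p (\<lambda>s. - \<phi> s)"]) (auto intro: face_bdd_below that)
  fix t :: real assume t: "t \<in> {0..}"
  fix \<phi> :: "'s \<Rightarrow> 'e orth" assume \<phi>: "\<phi> \<in> orth_functions"
  show "\<exists>u\<in>{0..}. ?Q u (\<lambda>s. c *\<^sub>R \<phi> s) \<le> c *\<^sub>R ?Q t \<phi>" if "0 < c" for c
  proof (intro bexI[of _ "c * t"])
    have "?Q (c * t) (\<lambda>s. c *\<^sub>R \<phi> s) = p (\<lambda>s. c *\<^sub>R (\<phi> s + t *\<^sub>R k s)) - c *\<^sub>R (t *\<^sub>R p k)"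
      by (simp add: scaleR_add_right)
    also have "\<dots> = c *\<^sub>R ?Q t \<phi>"
      using sup_functional_scaleR[OF p Cuo_add[OF \<phi> Cuo_scaleR[OF k]], of c t] that by (simp add: scaleR_diff_right)
    finally show "?Q (c * t) (\<lambda>s. c *\<^sub>R \<phi> s) \<le> c *\<^sub>R ?Q t \<phi>" by simp
  qed (use t that in simp)
  fix \<psi> :: "'s \<Rightarrow> 'e orth" assume \<psi>: "\<psi> \<in> orth_functions"
  show "?Q t \<phi> \<le> ?Q t \<psi>" if "\<And>s. \<phi> s \<le> \<psi> s"
    by (intro diff_mono sup_functional_mono[OF p] Cuo_add Cuo_scaleR k \<phi> \<psi>) (simp_all add: that)
  fix u :: real assume u: "u \<in> {0..}"
  show "\<exists>v\<in>{0..}. ?Q v (\<lambda>s. \<phi> s + \<psi> s) \<le> ?Q t \<phi> + ?Q u \<psi>"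
  proof (intro bexI[of _ "t + u"])
    have "p (\<lambda>s. (\<phi> s + t *\<^sub>R k s) + (\<psi> s + u *\<^sub>R k s)) \<le> p (\<lambda>s. \<phi> s + t *\<^sub>R k s) + p (\<lambda>s. \<psi> s + u *\<^sub>R k s)"
      by (intro sup_functional_add[OF p] Cuo_add Cuo_scaleR k \<phi> \<psi>)
    then show "?Q (t + u) (\<lambda>s. \<phi> s + \<psi> s) \<le> ?Q t \<phi> + ?Q u \<psi>" by (simp add: algebra_simps)
  qed (use t u in simp)
  show "\<exists>v\<in>{0..}. ?Q v (\<lambda>s. sup (\<phi> s) (\<psi> s)) \<le> sup (?Q t \<phi>) (?Q u \<psi>)"
  \<comment> \<open>By \<open>face_antimono\<close> the terms decrease in the parameter, so the
    larger one serves both functions.\<close>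
  proof (intro bexI[of _ "max t u"])
    let ?v = "max t u"
    have "p (\<lambda>s. sup (\<phi> s) (\<psi> s) + ?v *\<^sub>R k s) = sup (p (\<lambda>s. \<phi> s + ?v *\<^sub>R k s)) (p (\<lambda>s. \<psi> s + ?v *\<^sub>R k s))"
      unfolding add_sup_distrib_right by (intro sup_functional_sup[OF p] Cuo_add Cuo_scaleR k \<phi> \<psi>)
    then have "?Q ?v (\<lambda>s. sup (\<phi> s) (\<psi> s)) = sup (?Q ?v \<phi>) (?Q ?v \<psi>)"
      using add_sup_distrib_right[of _ _ "- (?v *\<^sub>R p k)"] by simp
    also have "\<dots> \<le> sup (?Q t \<phi>) (?Q u \<psi>)" using t u by (intro sup_mono face_antimono \<phi> \<psi>) auto
    finally show "?Q ?v (\<lambda>s. sup (\<phi> s) (\<psi> s)) \<le> sup (?Q t \<phi>) (?Q u \<psi>)" .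
  qed (use t in auto)
next
  fix t :: real and l assume t: "t \<in> {0..}"
  show "p (\<lambda>s. l + t *\<^sub>R k s) - t *\<^sub>R p k = l"
    using sup_functional_add_const[OF p Cuo_scaleR[OF k], of t l] sup_functional_scaleR[OF p k, of t] t
    by (simp add: add.commute)
qed simp

end

text \<open>Along a chain the pointwise infimum is the lower bound required by Zorn's lemma; the
  constraints survive because \<open>q\<close> is a lower bound of all the values at
  \<open>D\<close>.\<close>

lemma sup_functional_minimal:
  fixes p :: "('s::uniform_space, 'e::dedekind_complete_vector_lattice) state"
  assumes p: "sup_functional p" and C: "C \<subseteq> orth_functions" "\<And>D. D \<in> C \<Longrightarrow> q \<le> p D"
  obtains r where "sup_functional r" "\<And>\<phi>. \<phi> \<in> orth_functions \<Longrightarrow> r \<phi> \<le> p \<phi>" "\<And>D. D \<in> C \<Longrightarrow> q \<le> r D"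
    "\<And>r'. sup_functional r' \<Longrightarrow> (\<And>\<phi>. \<phi> \<in> orth_functions \<Longrightarrow> r' \<phi> \<le> r \<phi>) \<Longrightarrow> (\<And>D. D \<in> C \<Longrightarrow> q \<le> r' D) \<Longrightarrow> r' = r"
proof -
  define A where "A = {r. sup_functional r \<and> (\<forall>\<phi>\<in>orth_functions. r \<phi> \<le> p \<phi>) \<and> (\<forall>D\<in>C. q \<le> r D)}"
  \<comment> \<open>The order is reversed, so that maximal elements are minimal functionals.\<close>
  define P where "P r r' \<longleftrightarrow> (\<forall>\<phi>\<in>orth_functions. r' \<phi> \<le> r \<phi>)" for r r' :: "('s, 'e) state"
  have "\<exists>m\<in>A. \<forall>a\<in>A. P m a \<longrightarrow> a = m"
  proof (rule predicate_Zorn)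
    show "partial_order_on A (relation_of P A)"
    proof (rule partial_order_on_relation_ofI)
      show "P a a" for a by (simp add: P_def)
      show "P a c" if "P a b" "P b c" for a b c using that unfolding P_def by (meson order_trans)
      show "a = b" if "a \<in> A" "b \<in> A" "P a b" "P b a" for a b
        using that by (intro extensionalityI[of _ orth_functions])
          (auto simp: A_def P_def sup_functional_def intro: antisym)
    qed
    fix Ch assume Ch: "Ch \<in> Chains (relation_of P A)"
    have sub: "Ch \<subseteq> A" using Ch by (auto simp: Chains_def relation_of_def)
    have lin: "P a b \<or> P b a" if "a \<in> Ch" "b \<in> Ch" for a b
      using Ch that by (auto simp: Chains_def relation_of_def)
    show "\<exists>u\<in>A. \<forall>a\<in>Ch. P a u"
    proof (cases "Ch = {}")
      case True
      then show ?thesis using p C(2) by (intro bexI[of _ p]) (auto simp: A_def)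
    next
      case False
      let ?r = "\<lambda>\<phi>\<in>orth_functions. INF a\<in>Ch. a \<phi>"
      have sf: "sup_functional a" if "a \<in> Ch" for a using sub that by (auto simp: A_def)
      \<comment> \<open>The infimum over the chain exists because \<open>p\<close> gives a lower
        bound that is common to all members.\<close>
      have below: "- p (\<lambda>s. - \<phi> s) \<le> a \<phi>" if a: "a \<in> Ch" and \<phi>: "\<phi> \<in> orth_functions" for a \<phi>
      proof -
        have "a (\<lambda>s. - \<phi> s) \<le> p (\<lambda>s. - \<phi> s)" using sub a Cuo_minus[OF \<phi>] by (auto simp: A_def)
        then have "- p (\<lambda>s. - \<phi> s) \<le> - a (\<lambda>s. - \<phi> s)" by simp
        also have "\<dots> \<le> a \<phi>" by (rule sup_functional_minus_le[OF sf[OF a] \<phi>])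
        finally show ?thesis .
      qed
      have bdd: "bdd_below ((\<lambda>a. a \<phi>) ` Ch)" if "\<phi> \<in> orth_functions" for \<phi>
        by (rule bdd_belowI2[of _ "- p (\<lambda>s. - \<phi> s)"]) (rule below[OF _ that])
      have low: "?r \<phi> \<le> a \<phi>" if "a \<in> Ch" "\<phi> \<in> orth_functions" for a \<phi>
        using cINF_lower[OF bdd[OF that(2)] that(1)] that(2) by simp
      have "sup_functional ?r"
      proof (rule sup_functional_Inf[OF False bdd])
        fix a b and \<phi> \<psi> :: "'s \<Rightarrow> 'e orth" assume ab: "a \<in> Ch" "b \<in> Ch" and V: "\<phi> \<in> orth_functions" "\<psi> \<in> orth_functions"
        have "P a a" "P b b" by (simp_all add: P_def)
        then have "\<exists>c\<in>Ch. P a c \<and> P b c" using lin[OF ab] ab by blast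
        then obtain c where c: "c \<in> Ch" "P a c" "P b c" by blast
        then have le: "c \<phi> \<le> a \<phi>" "c \<psi> \<le> b \<psi>" using V by (auto simp: P_def)
        show "\<exists>c\<in>Ch. c (\<lambda>s. \<phi> s + \<psi> s) \<le> a \<phi> + b \<psi>"
          by (rule bexI[of _ c], rule order_trans[OF sup_functional_add[OF sf[OF c(1)] V] add_mono[OF le]], rule c(1))
        show "\<exists>c\<in>Ch. c (\<lambda>s. sup (\<phi> s) (\<psi> s)) \<le> sup (a \<phi>) (b \<psi>)"
          by (rule bexI[of _ c], simp only: sup_functional_sup[OF sf[OF c(1)] V], rule sup_mono[OF le], rule c(1))
      next
        fix a and c :: real and \<phi> :: "'s \<Rightarrow> 'e orth" assume a: "a \<in> Ch" and c: "0 < c" and \<phi>: "\<phi> \<in> orth_functions"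
        show "\<exists>b\<in>Ch. b (\<lambda>s. c *\<^sub>R \<phi> s) \<le> c *\<^sub>R a \<phi>"
          by (rule bexI[OF _ a], simp only: sup_functional_scaleR[OF sf[OF a] \<phi> less_imp_le[OF c]] order_refl)
      next
        show "a \<phi> \<le> a \<psi>" if "a \<in> Ch" "\<phi> \<in> orth_functions" "\<psi> \<in> orth_functions" "\<And>s. \<phi> s \<le> \<psi> s"
          for a and \<phi> \<psi> :: "'s \<Rightarrow> 'e orth"
          by (rule sup_functional_mono[OF sf[OF that(1)] that(2,3,4)])
      next
        show "a (\<lambda>s. l) = l" if "a \<in> Ch" for a l by (rule sup_functional_const[OF sf[OF that]])
      qed
      moreover obtain a where a: "a \<in> Ch" using False by blast
      have "?r \<phi> \<le> p \<phi>" if "\<phi> \<in> orth_functions" for \<phi>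
        using order_trans[OF low[OF a that]] sub a that by (auto simp: A_def)
      moreover have "q \<le> ?r D" if D: "D \<in> C" for D
      proof -
        have "q \<le> (INF a\<in>Ch. a D)" using sub D by (intro cINF_greatest[OF False]) (auto simp: A_def)
        then show ?thesis using D C(1) by auto
      qed
      ultimately have "?r \<in> A" unfolding A_def by blast
      then show ?thesis using low by (intro bexI[of _ ?r]) (auto simp: P_def)
    qed
  qed
  then obtain m where m: "m \<in> A" "\<And>a. a \<in> A \<Longrightarrow> P m a \<Longrightarrow> a = m" by blast
  show ?thesis
  proof (rule that[of m])
    fix r' assume r': "sup_functional r'" "\<And>\<phi>. \<phi> \<in> orth_functions \<Longrightarrow> r' \<phi> \<le> m \<phi>" "\<And>D. D \<in> C \<Longrightarrow> q \<le> r' D"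
    have mp: "m \<phi> \<le> p \<phi>" if "\<phi> \<in> orth_functions" for \<phi> using m(1) that by (simp add: A_def)
    have "r' \<phi> \<le> p \<phi>" if "\<phi> \<in> orth_functions" for \<phi> by (rule order_trans[OF r'(2)[OF that] mp[OF that]])
    then have "r' \<in> A" unfolding A_def using r'(1,3) by blast
    moreover have "P m r'" unfolding P_def using r'(2) by blast
    ultimately show "r' = m" by (rule m(2))
  qed (use m(1) in \<open>auto simp: A_def\<close>)
qed

text \<open>A minimal supremum functional equals each of its faces, which forces additivity.\<close>

lemma extremal_state_below:
  fixes p :: "('s::uniform_space, 'e::dedekind_complete_vector_lattice) state"
  assumes p: "sup_functional p" and k: "k \<in> orth_functions"
  obtains \<sigma> where "\<sigma> \<in> extremal_states" "\<And>\<phi>. \<phi> \<in> orth_functions \<Longrightarrow> \<sigma> \<phi> \<le> p \<phi>" "\<sigma> k = p k"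
proof -
  obtain r where r: "sup_functional r" "\<And>\<phi>. \<phi> \<in> orth_functions \<Longrightarrow> r \<phi> \<le> face p k \<phi>"
    and min: "\<And>r'. sup_functional r' \<Longrightarrow> (\<And>\<phi>. \<phi> \<in> orth_functions \<Longrightarrow> r' \<phi> \<le> r \<phi>) \<Longrightarrow> r' = r"
    by (rule sup_functional_minimal[OF sup_functional_face[OF p k], of "{}"]) auto
  have rp: "r \<phi> \<le> p \<phi>" if "\<phi> \<in> orth_functions" for \<phi>
    using order_trans[OF r(2) face_le_self[OF p k]] that by blast
  have add: "r (\<lambda>s. \<phi> s + \<psi> s) = r \<phi> + r \<psi>" if V: "\<phi> \<in> orth_functions" "\<psi> \<in> orth_functions" for \<phi> \<psi>
  proof (rule antisym[OF sup_functional_add[OF r(1) V]])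
    \<comment> \<open>Minimality identifies \<open>r\<close> with its own face in direction \<psi>;
      the face inequality at \<open>t = 1\<close> then is superadditivity.\<close>
    have "face r \<psi> = r" by (rule min[OF sup_functional_face[OF r(1) V(2)] face_le_self[OF r(1) V(2)]])
    then show "r \<phi> + r \<psi> \<le> r (\<lambda>s. \<phi> s + \<psi> s)" using face_le[OF r(1) V(2) V(1), of 1] by (simp add: le_diff_eq)
  qed
  have minus: "r (\<lambda>s. - \<phi> s) = - r \<phi>" if "\<phi> \<in> orth_functions" for \<phi>
    using add[OF that Cuo_minus[OF that]] by (simp add: sup_functional_const[OF r(1)] eq_neg_iff_add_eq_0 add.commute)
  have eps: "r \<in> eps_subdifferential"
    unfolding eps_subdifferential_def
  proof (intro CollectI conjI ballI allI)
    show "r \<in> extensional orth_functions" by (rule sup_functional_extensional[OF r(1)])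
    fix \<phi> :: "'s \<Rightarrow> 'e orth" assume \<phi>: "\<phi> \<in> orth_functions"
    show "r (\<lambda>s. \<phi> s + \<psi> s) = r \<phi> + r \<psi>" if "\<psi> \<in> orth_functions" for \<psi> by (rule add[OF \<phi> that])
    show "r (\<lambda>s. c *\<^sub>R \<phi> s) = c *\<^sub>R r \<phi>" for c
    proof (cases "0 \<le> c")
      case True then show ?thesis by (rule sup_functional_scaleR[OF r(1) \<phi>])
    next
      case False
      have "r (\<lambda>s. - ((- c) *\<^sub>R \<phi> s)) = - ((- c) *\<^sub>R r \<phi>)"
        using False sup_functional_scaleR[OF r(1) \<phi>, of "- c"] minus[OF Cuo_scaleR[OF \<phi>], of "- c"] by simp
      then show ?thesis by simp
    qed
    obtain e where "\<And>s. \<bar>\<phi> s\<bar> \<le> e" using orth_lns.Cuo_bounded[OF \<phi>] by blast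
    then have "bdd_above (range \<phi>)" by (intro bdd_aboveI[of _ e]) (auto intro: abs_le_D1)
    then show "r \<phi> \<le> (SUP s. \<phi> s)" by (intro sup_functional_le[OF r(1) \<phi>] cSUP_upper) auto
  qed
  have "r \<in> extremal_states"
    unfolding extremal_states_def
  proof (intro CollectI conjI ballI allI impI eps)
    fix T1 T2 :: "('s, 'e) state" and t
    assume T: "T1 \<in> eps_subdifferential" "T2 \<in> eps_subdifferential"
      and t: "0 < t \<and> t < 1 \<and> (\<forall>\<phi>\<in>orth_functions. r \<phi> = (1 - t) *\<^sub>R T1 \<phi> + t *\<^sub>R T2 \<phi>)"
    have key: "U \<phi> = r \<phi>" if U: "U \<in> eps_subdifferential" and U0: "U (\<lambda>s. \<bar>\<phi> s - r \<phi>\<bar>) = 0"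
      and \<phi>: "\<phi> \<in> orth_functions" for U :: "('s, 'e) state" and \<phi>
    proof -
      have d: "(\<lambda>s. \<phi> s - r \<phi>) \<in> orth_functions" by (intro Cuo_diff Cuo_const \<phi>)
      have "U (\<lambda>s. \<phi> s - r \<phi>) \<le> 0"
        using state_mono[OF U d Cuo_abs[OF d]] vl_abs_ge(1) U0 by metis
      moreover have "U (\<lambda>s. - (\<phi> s - r \<phi>)) \<le> 0"
        using state_mono[OF U Cuo_minus[OF d] Cuo_abs[OF d]] vl_abs_ge(2) U0 by metis
      ultimately have "U (\<lambda>s. \<phi> s - r \<phi>) = 0" using state_minus[OF U d] by (intro antisym) simp_all
      then show ?thesis by (simp add: state_diff[OF U \<phi> Cuo_const] state_const[OF U])
    qed
    show "T1 = T2"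
    proof (rule extensionalityI[of _ orth_functions])
      fix \<phi> :: "'s \<Rightarrow> 'e orth" assume \<phi>: "\<phi> \<in> orth_functions"
      let ?\<psi> = "\<lambda>s. \<bar>\<phi> s - r \<phi>\<bar>"
      have d: "(\<lambda>s. \<phi> s - r \<phi>) \<in> orth_functions" by (intro Cuo_diff Cuo_const \<phi>)
      have \<psi>: "?\<psi> \<in> orth_functions" by (rule Cuo_abs[OF d])
      \<comment> \<open>Being additive and sup-preserving, \<open>r\<close> vanishes at the
        deviation of \<phi> from \<open>r \<phi>\<close>. The positive operators \<open>T1\<close>
        and \<open>T2\<close>, both with positive weight, then vanish there too, which fixes their
        values at \<phi>.\<close>
      have "r ?\<psi> = sup (r (\<lambda>s. \<phi> s - r \<phi>)) (r (\<lambda>s. - (\<phi> s - r \<phi>)))"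
        unfolding abs_lattice by (rule sup_functional_sup[OF r(1) d Cuo_minus[OF d]])
      also have "\<dots> = 0"
        unfolding minus[OF d] by (simp add: state_diff[OF eps \<phi> Cuo_const] state_const[OF eps])
      finally have "(1 - t) *\<^sub>R T1 ?\<psi> + t *\<^sub>R T2 ?\<psi> = 0" using t \<psi> by simp
      moreover have "0 \<le> (1 - t) *\<^sub>R T1 ?\<psi>" "0 \<le> t *\<^sub>R T2 ?\<psi>"
        using t by (auto intro!: scaleR_nonneg_nonneg state_ge[OF T(1) \<psi>] state_ge[OF T(2) \<psi>])
      ultimately have "(1 - t) *\<^sub>R T1 ?\<psi> = 0" "t *\<^sub>R T2 ?\<psi> = 0" by (simp_all add: add_nonneg_eq_0_iff)
      then have "T1 ?\<psi> = 0" "T2 ?\<psi> = 0" using t by auto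
      then show "T1 \<phi> = T2 \<phi>" using key[OF T(1) _ \<phi>] key[OF T(2) _ \<phi>] by simp
    qed (use T in \<open>auto simp: eps_subdifferential_def\<close>)
  qed
  moreover have "r k = p k"
  proof (rule antisym[OF rp[OF k]])
    \<comment> \<open>In the face \<open>k\<close> takes its maximal value: the term with
      \<open>t = 1\<close> cancels \<open>- k\<close> and leaves \<open>- p k\<close>.\<close>
    have "r (\<lambda>s. - k s) \<le> face p k (\<lambda>s. - k s)" by (rule r(2)[OF Cuo_minus[OF k]])
    also have "\<dots> \<le> p (\<lambda>s. - k s + 1 *\<^sub>R k s) - 1 *\<^sub>R p k" by (rule face_le[OF p k Cuo_minus[OF k]]) simp
    also have "\<dots> = - p k" by (simp add: sup_functional_const[OF p])
    finally show "p k \<le> r k" by (simp add: minus[OF k])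
  qed
  ultimately show ?thesis using that rp by blast
qed

text \<open>The functional at which the descent to a minimal one starts.\<close>

lemma sup_functional_SUP: "sup_functional (\<lambda>\<phi>\<in>orth_functions. SUP s. \<phi> s)"
proof -
  have bdd: "bdd_above (range \<phi>)" if \<phi>: "\<phi> \<in> orth_functions" for \<phi> :: "'a \<Rightarrow> 'b orth"
  proof -
    obtain e where "\<And>s. \<bar>\<phi> s\<bar> \<le> e" using orth_lns.Cuo_bounded[OF \<phi>] by blast
    then show ?thesis by (intro bdd_aboveI[of _ e]) (auto intro: abs_le_D1)
  qed
  have up: "\<phi> s \<le> (SUP s. \<phi> s)" if "\<phi> \<in> orth_functions" for \<phi> :: "'a \<Rightarrow> 'b orth" and s
    by (rule cSUP_upper[OF _ bdd[OF that]]) simp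
  have least: "(SUP s. \<phi> s) \<le> z" if "\<And>s. \<phi> s \<le> z" for \<phi> :: "'a \<Rightarrow> 'b orth" and z
    by (rule cSUP_least) (auto simp: that)
  have "(SUP s. sup (\<phi> s) (\<psi> s)) = sup (SUP s. \<phi> s) (SUP s. \<psi> s)"
    if V: "\<phi> \<in> orth_functions" "\<psi> \<in> orth_functions" for \<phi> \<psi> :: "'a \<Rightarrow> 'b orth"
  proof (rule antisym)
    show "(SUP s. sup (\<phi> s) (\<psi> s)) \<le> sup (SUP s. \<phi> s) (SUP s. \<psi> s)"
      by (rule least, rule sup_mono) (rule up[OF V(1)], rule up[OF V(2)])
    show "sup (SUP s. \<phi> s) (SUP s. \<psi> s) \<le> (SUP s. sup (\<phi> s) (\<psi> s))"
    proof (rule sup_least; rule least)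
      show "\<phi> s \<le> (SUP s. sup (\<phi> s) (\<psi> s))" for s by (rule order_trans[OF sup_ge1 up[OF Cuo_sup[OF V]]])
      show "\<psi> s \<le> (SUP s. sup (\<phi> s) (\<psi> s))" for s by (rule order_trans[OF sup_ge2 up[OF Cuo_sup[OF V]]])
    qed
  qed
  moreover have "(SUP s. \<phi> s + \<psi> s) \<le> (SUP s. \<phi> s) + (SUP s. \<psi> s)"
    if V: "\<phi> \<in> orth_functions" "\<psi> \<in> orth_functions" for \<phi> \<psi> :: "'a \<Rightarrow> 'b orth"
    by (intro least add_mono up V)
  moreover have "(SUP s. c *\<^sub>R \<phi> s) \<le> c *\<^sub>R (SUP s. \<phi> s)" if "\<phi> \<in> orth_functions" "0 < c"
    for \<phi> :: "'a \<Rightarrow> 'b orth" and c :: real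
    using that by (intro least scaleR_left_mono up) auto
  ultimately show ?thesis
    by (simp add: sup_functional_def Cuo_add Cuo_scaleR Cuo_sup Cuo_const)
qed

section \<open>Lattice identities\<close>

text \<open>The dual distributive law, with \<open>Y\<close> given as least upper bound so that it
  applies to suprema of any origin.\<close>

lemma vl_inf_Sup_le:
  fixes x d Y :: "'e::lattice_ab_group_add"
  assumes le: "\<And>i. inf (y i) d \<le> x" and up: "\<And>i. y i \<le> Y" and least: "\<And>z. (\<And>i. y i \<le> z) \<Longrightarrow> Y \<le> z"
  shows "inf Y d \<le> x"
proof -
  have "Y \<le> x + sup Y d - d"
  proof (rule least)
    fix i
    have "y i + d = sup (y i) d + inf (y i) d" by (rule add_eq_inf_sup)
    also have "\<dots> \<le> sup Y d + x" using up[of i] by (intro add_mono le sup_mono) auto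
    finally show "y i \<le> x + sup Y d - d" by (simp add: algebra_simps)
  qed
  then have "Y + d \<le> sup Y d + x" by (simp add: algebra_simps)
  then show ?thesis by (simp add: add_eq_inf_sup[of Y d])
qed

lemma vl_inf_sup_distrib:
  fixes a b d :: "'e::lattice_ab_group_add"
  shows "inf (sup a b) d \<le> sup (inf a d) (inf b d)"
proof (rule vl_inf_Sup_le)
  let ?y = "\<lambda>i. if i then a else b"
  show "inf (?y i) d \<le> sup (inf a d) (inf b d)" "?y i \<le> sup a b" for i by simp_all
  show "sup a b \<le> z" if "\<And>i. ?y i \<le> z" for z using that[of True] that[of False] by simp
qed

lemma vl_inf_add_le:
  fixes u d y :: "'e::lattice_ab_group_add"
  assumes "0 \<le> y" shows "inf (u + y) d \<le> inf u d + y"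
proof -
  have "inf (u + y) d \<le> inf (u + y) (d + y)" using assms by (intro inf_mono) auto
  then show ?thesis by (simp add: add_inf_distrib_right)
qed

lemma vl_inf_lipschitz:
  fixes x y d :: "'e::lattice_ab_group_add_abs"
  shows "\<bar>inf x d - inf y d\<bar> \<le> \<bar>x - y\<bar>"
proof -
  have *: "inf x d - inf y d \<le> \<bar>x - y\<bar>" for x y :: 'e
  proof -
    have "x \<le> y + \<bar>x - y\<bar>" using vl_abs_ge(1)[of "x - y"] by (simp add: algebra_simps)
    then have "inf x d \<le> inf (y + \<bar>x - y\<bar>) d" by (intro inf_mono) auto
    also have "\<dots> \<le> inf y d + \<bar>x - y\<bar>" by (rule vl_inf_add_le) simp
    finally show ?thesis by (simp add: algebra_simps)
  qed
  show ?thesis using *[of x y] *[of y x] by (intro abs_leI) (simp_all add: abs_minus_commute)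
qed

lemma component_sup:
  assumes "component c" shows "c * sup A B = sup (c * A) (c * B)"
  unfolding vl_sup_eq_half by (simp add: distrib_left component_abs[OF assms] right_diff_distrib)

lemma component_pprt: "component c \<Longrightarrow> c * pprt A = pprt (c * A)"
  unfolding pprt_def by (simp add: component_sup)

lemma component_app_sup:
  assumes "component c" shows "orth_app c (sup a b) = sup (orth_app c a) (orth_app c b)"
  unfolding vl_sup_eq_half by (simp add: orth_linear_simps component_app_abs[OF assms])

lemma component_app_inf:
  assumes "component c" shows "orth_app c (inf a b) = inf (orth_app c a) (orth_app c b)"
  unfolding inf_eq_neg_sup by (simp only: orth_linear_simps component_app_sup[OF assms])

section \<open>Truncated quotients\<close>

text \<open>The quotient of \<open>x\<close> by \<open>d\<close>, cut off at 1 and supported in the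
  band of \<open>d\<close>. The cut-off is what makes division possible for an \<open>x\<close> that
  is not below \<open>d\<close>.\<close>

definition truncated_quotient :: "'e::dedekind_complete_vector_lattice \<Rightarrow> 'e \<Rightarrow> 'e orth"
  where "truncated_quotient d x = (SOME T. 0 \<le> T \<and> T \<le> principal_projection d \<and> orth_app T d = inf x d)"

lemma truncated_quotient:
  assumes "0 \<le> d" "0 \<le> x"
  shows "0 \<le> truncated_quotient d x" "truncated_quotient d x \<le> principal_projection d"
    "orth_app (truncated_quotient d x) d = inf x d"
proof -
  have "\<exists>T. 0 \<le> T \<and> T \<le> principal_projection d \<and> orth_app T d = inf x d"
    by (rule orth_division) (use assms in auto)
  from someI_ex[OF this] show "0 \<le> truncated_quotient d x" "truncated_quotient d x \<le> principal_projection d"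
    "orth_app (truncated_quotient d x) d = inf x d" by (simp_all add: truncated_quotient_def)
qed

lemma orth_le_principalI:
  assumes d: "0 \<le> d" and le: "orth_app S d \<le> orth_app T d"
  shows "principal_projection d * S \<le> principal_projection d * T"
  using orth_app_nonneg_principal[OF d, of "T - S"] le by (simp add: orth_app_diff right_diff_distrib)

text \<open>The modulus of continuity is transported from E to \<Lambda>. The truncated quotients of
  the bounds in \<open>D\<close> dominate the differences of quotients, because the comparison can
  be made at \<open>d\<close>, and again have infimum 0.\<close>

lemma truncated_quotient_Cuo:
  fixes h :: "'s::uniform_space \<Rightarrow> 'e::dedekind_complete_vector_lattice"
  assumes d: "0 \<le> d" and h: "\<And>s. 0 \<le> h s"
    and H: "order_tendsto H 0 uniformity" and hH: "\<And>s t. \<bar>h s - h t\<bar> \<le> H (s, t)"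
  shows "(\<lambda>s. truncated_quotient d (h s)) \<in> orth_functions"
proof -
  let ?q = "principal_projection d" and ?T = "truncated_quotient d"
  have q: "component ?q" by (rule component_principal_projection[OF d])
  have qT: "?q * ?T x = ?T x" if "0 \<le> x" for x by (rule orth_le_principal[OF truncated_quotient(1,2)[OF d that] q])
  obtain D where D: "inf_zero D" "\<And>e. e \<in> D \<Longrightarrow> \<forall>\<^sub>F p in uniformity. \<bar>H p - 0\<bar> \<le> e"
    using order_tendstoE[OF H] by auto
  have D0: "0 \<le> e" if "e \<in> D" for e using D(1) that by (simp add: inf_zero_def)
  have "inf_zero (?T ` D)"
    unfolding inf_zero_def
  proof (intro conjI ballI allI impI)
    show "?T ` D \<noteq> {}" using D(1) by (simp add: inf_zero_def)
    show "0 \<le> x" if "x \<in> ?T ` D" for x using that truncated_quotient(1)[OF d D0] by auto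
    fix z assume z: "\<forall>x\<in>?T ` D. z \<le> x"
    \<comment> \<open>Inside the band of \<open>d\<close> the lower bound is tested at the point
      \<open>d\<close>; outside it all truncated quotients vanish.\<close>
    have "orth_app z d \<le> 0"
    proof (rule inf_zeroD[OF D(1)])
      fix e assume e: "e \<in> D"
      have "orth_app z d \<le> orth_app (?T e) d" using z e by (intro orth_app_mono_left d) blast
      also have "\<dots> \<le> e" by (simp add: truncated_quotient(3)[OF d D0[OF e]])
      finally show "orth_app z d \<le> e" .
    qed
    then have "?q * z \<le> ?q * 0" by (intro orth_le_principalI d) (simp add: orth_app_zero)
    moreover obtain e where e: "e \<in> D" using D(1) by (auto simp: inf_zero_def)
    have "(1 - ?q) * z \<le> (1 - ?q) * ?T e"
      using z e by (intro mult_left_mono component_nonneg component_compl q) blast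
    then have "(1 - ?q) * z \<le> (1 - ?q) * 0" using qT[OF D0[OF e]] by (simp add: left_diff_distrib)
    ultimately show "z \<le> 0" by (rule orth_le_componentI)
  qed
  moreover have "\<forall>\<^sub>F p in uniformity. \<bar>(case p of (s, t) \<Rightarrow> \<bar>?T (h s) - ?T (h t)\<bar>) - 0\<bar> \<le> x" if x: "x \<in> ?T ` D" for x
  proof -
    obtain e where e: "e \<in> D" "x = ?T e" using x by blast
    from D(2)[OF e(1)] show ?thesis
    proof eventually_elim
      case (elim p)
      obtain s t where p: "p = (s, t)" by (cases p)
      have "\<bar>h s - h t\<bar> \<le> e" using order_trans[OF hH order_trans[OF vl_abs_ge(1)]] elim p by simp
      then have 1: "\<bar>inf (h s) d - inf (h t) d\<bar> \<le> e" by (rule order_trans[OF vl_inf_lipschitz])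
      have 2: "\<bar>inf (h s) d - inf (h t) d\<bar> \<le> d"
      proof -
        have *: "inf (h s) d - inf (h t) d \<le> d" for s t
          using h[of t] d by (simp add: diff_le_eq add_increasing2)
        show ?thesis using *[of s t] *[of t s] by (intro abs_leI) simp_all
      qed
      have "orth_app \<bar>?T (h s) - ?T (h t)\<bar> d = \<bar>inf (h s) d - inf (h t) d\<bar>"
        by (simp add: orth_app_abs[OF d] orth_app_diff truncated_quotient(3)[OF d h])
      also have "\<dots> \<le> orth_app (?T e) d" using 1 2 by (simp add: truncated_quotient(3)[OF d D0[OF e(1)]])
      finally have "?q * \<bar>?T (h s) - ?T (h t)\<bar> \<le> ?q * ?T e" by (rule orth_le_principalI[OF d])
      moreover have "?q * \<bar>?T (h s) - ?T (h t)\<bar> = \<bar>?T (h s) - ?T (h t)\<bar>"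
        unfolding component_abs[OF q] right_diff_distrib qT[OF h] ..
      ultimately show ?case by (simp add: p e(2) qT[OF D0[OF e(1)]])
    qed
  qed
  ultimately have "order_tendsto (\<lambda>(s, t). \<bar>?T (h s) - ?T (h t)\<bar>) 0 uniformity" by (rule order_tendstoI)
  moreover have "\<bar>?T (h s)\<bar> \<le> 1" for s
    using truncated_quotient(1,2)[OF d h, of s] component_le_one[OF q] by simp
  ultimately show ?thesis by (intro orth_lns.CuoI) auto
qed

section \<open>Polynomial multipliers\<close>

lemma orth_power_bounds:
  fixes x :: "'e::dedekind_complete_vector_lattice orth"
  assumes "0 \<le> x" "x \<le> 1" shows "0 \<le> x ^ m \<and> x ^ m \<le> 1"
proof (induction m)
  case (Suc m)
  then have "x * x ^ m \<le> 1 * 1" using assms by (intro mult_mono) (auto simp: orth_one_nonneg)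
  then show ?case using Suc assms by (simp add: orth_mult_nonneg)
qed (simp add: orth_one_nonneg)

lemma orth_power_component_le:
  fixes x :: "'e::dedekind_complete_vector_lattice orth"
  assumes b: "component b" and x: "0 \<le> x" and r: "0 \<le> r" and le: "b * x \<le> r *\<^sub>R b"
  shows "b * x ^ m \<le> r ^ m *\<^sub>R b"
proof (induction m)
  case (Suc m)
  have "0 \<le> x ^ m" by (induction m) (simp_all add: orth_one_nonneg orth_mult_nonneg x)
  then have "(b * x) * (b * x ^ m) \<le> (r *\<^sub>R b) * (r ^ m *\<^sub>R b)"
    using r b by (intro mult_mono le Suc scaleR_nonneg_nonneg orth_mult_nonneg) (auto intro: component_nonneg)
  moreover have "(b * x) * (b * x ^ m) = (b * b) * (x * x ^ m)" by (simp only: mult_ac)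
  ultimately show ?case using b by (simp add: component_idem mult.commute[of r])
qed simp

lemma orth_power_component_ge:
  fixes x :: "'e::dedekind_complete_vector_lattice orth"
  assumes b: "component b" and x: "0 \<le> x" and r: "0 \<le> r" and le: "r *\<^sub>R b \<le> b * x"
  shows "r ^ m *\<^sub>R b \<le> b * x ^ m"
proof (induction m)
  case (Suc m)
  have bx: "0 \<le> b * x" by (rule orth_mult_nonneg[OF component_nonneg[OF b] x])
  have "(r *\<^sub>R b) * (r ^ m *\<^sub>R b) \<le> (b * x) * (b * x ^ m)"
    by (rule mult_mono[OF le Suc bx]) (intro scaleR_nonneg_nonneg component_nonneg[OF b] zero_le_power r)
  moreover have "(b * x) * (b * x ^ m) = (b * b) * (x * x ^ m)" by (simp only: mult_ac)
  ultimately show ?case using b by (simp add: component_idem mult.commute[of r])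
qed simp

lemma orth_bernoulli:
  fixes y :: "'e::dedekind_complete_vector_lattice orth"
  assumes y: "0 \<le> y" "y \<le> 1" shows "1 - real k *\<^sub>R y \<le> (1 - y) ^ k"
proof (induction k)
  case (Suc k)
  have "1 - real (Suc k) *\<^sub>R y \<le> (1 - real (Suc k) *\<^sub>R y) + real k *\<^sub>R (y * y)"
    using y by (simp add: scaleR_nonneg_nonneg orth_mult_nonneg)
  also have "\<dots> = (1 - y) * (1 - real k *\<^sub>R y)"
    by (simp add: right_diff_distrib left_diff_distrib scaleR_add_left algebra_simps)
  also have "\<dots> \<le> (1 - y) * (1 - y) ^ k" using y by (intro mult_left_mono Suc) simp
  finally show ?case by simp
qed simp

text \<open>With \<bar>ln \<eta>\<bar> written as \<open>L\<close>, \<open>k\<close> is about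
  \<open>L / \<beta>^m\<close>. Then \<open>(1 - \<beta>^m)^k\<close> is at most
  \<open>exp (- k \<beta>^m)\<close> and so at most \<eta>, while \<open>k \<alpha>^m\<close> is at
  most \<open>L (\<alpha> / \<beta>)^m + \<alpha>^m\<close>, which tends to 0 as \<open>m\<close>
  grows.\<close>

lemma threshold_powers:
  fixes \<alpha> \<beta> \<eta> :: real
  assumes "0 < \<alpha>" "\<alpha> < \<beta>" "\<beta> < 1" "0 < \<eta>"
  obtains m k :: nat where "real k * \<alpha> ^ m \<le> \<eta>" "(1 - \<beta> ^ m) ^ k \<le> \<eta>"
proof -
  define L where "L = \<bar>ln \<eta>\<bar>"
  have "(\<lambda>m. L * (\<alpha> / \<beta>) ^ m + \<alpha> ^ m) \<longlonglongrightarrow> L * 0 + 0"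
    using assms by (intro tendsto_intros LIMSEQ_power_zero) auto
  then have "\<forall>\<^sub>F m in sequentially. L * (\<alpha> / \<beta>) ^ m + \<alpha> ^ m < \<eta>"
    using assms(4) by (intro order_tendstoD(2)[of _ "L * 0 + 0"]) auto
  then obtain m where m: "L * (\<alpha> / \<beta>) ^ m + \<alpha> ^ m < \<eta>" by (auto simp: eventually_sequentially)
  define k where "k = nat \<lceil>L / \<beta> ^ m\<rceil>"
  have \<beta>m: "0 < \<beta> ^ m" "\<beta> ^ m \<le> 1" using assms by (auto intro: power_le_one)
  have L0: "0 \<le> L" by (simp add: L_def)
  have k: "L / \<beta> ^ m \<le> real k" "real k \<le> L / \<beta> ^ m + 1"
    using \<beta>m L0 by (auto simp: k_def intro: real_nat_ceiling_ge)
  have "real k * \<alpha> ^ m \<le> (L / \<beta> ^ m + 1) * \<alpha> ^ m" using k assms by (intro mult_right_mono) auto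
  also have "\<dots> = L * (\<alpha> / \<beta>) ^ m + \<alpha> ^ m" by (simp add: field_simps power_divide)
  finally have 1: "real k * \<alpha> ^ m \<le> \<eta>" using m by simp
  have "1 - \<beta> ^ m \<le> exp (- (\<beta> ^ m))" using exp_ge_add_one_self[of "- (\<beta> ^ m)"] by simp
  then have "(1 - \<beta> ^ m) ^ k \<le> exp (- (\<beta> ^ m)) ^ k" using \<beta>m by (intro power_mono) auto
  also have "\<dots> = exp (- (real k * \<beta> ^ m))" by (simp add: exp_of_nat_mult[symmetric])
  also have "\<dots> \<le> exp (- L)" using k(1) \<beta>m by (simp add: field_simps)
  also have "\<dots> \<le> exp (ln \<eta>)" by (simp add: L_def)
  finally have 2: "(1 - \<beta> ^ m) ^ k \<le> \<eta>" using assms by simp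
  show ?thesis by (rule that[OF 1 2])
qed

text \<open>The weight \<psi> is nearly 1 where \<phi> is below \<open>\<gamma>0\<close> and nearly
  0 where it is above \<open>\<gamma>1\<close>, so there \<open>y\<close> is nearly bounded by
  \<open>x1\<close> and by \<open>x2\<close> respectively. In between nothing is known about \<psi>,
  but both penalty terms vanish and the larger of the two bounds suffices.\<close>

lemma blend_estimate:
  fixes d x1 x2 y :: "'e::dedekind_complete_vector_lattice" and \<phi> :: "'e orth"
  assumes d: "0 \<le> d" and c: "component c" "c * principal_projection d = c"
    and \<phi>: "0 \<le> \<phi>" "\<phi> \<le> 1" and x: "0 \<le> x1" "0 \<le> x2"
    and xK: "orth_app c x1 \<le> K *\<^sub>R orth_app c d" "orth_app c x2 \<le> K *\<^sub>R orth_app c d"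
    and \<psi>: "\<psi> = (1 - \<phi> ^ m) ^ k" and y: "y \<le> orth_app \<psi> x1 + orth_app (1 - \<psi>) x2"
    and A: "orth_app A d = inf y d" and B1: "orth_app B1 d = inf x1 d" and B2: "orth_app B2 d = inf x2 d"
    and \<gamma>: "0 \<le> \<gamma>0" "\<gamma>0 < \<gamma>1" "\<gamma>1 \<le> 1" and K: "0 \<le> K" and \<eta>: "0 \<le> \<eta>" "real k * \<gamma>0 ^ m \<le> \<eta>" "(1 - \<gamma>1 ^ m) ^ k \<le> \<eta>"
  shows "c * A \<le> c * (sup (B1 - t1 *\<^sub>R pprt (\<phi> - \<gamma>1 *\<^sub>R 1)) (B2 - t2 *\<^sub>R pprt (\<gamma>0 *\<^sub>R 1 - \<phi>)) + (\<eta> * K) *\<^sub>R 1)"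
    (is "_ \<le> c * ?R")
proof -
  let ?q = "principal_projection d"
  have \<phi>m: "0 \<le> \<phi> ^ m" "\<phi> ^ m \<le> 1" using orth_power_bounds[OF \<phi>] by auto
  have \<psi>01: "0 \<le> \<psi>" "\<psi> \<le> 1" unfolding \<psi> using orth_power_bounds[of "1 - \<phi> ^ m" k] \<phi>m by auto
  \<comment> \<open>Components below \<open>c\<close> lie in the band of \<open>d\<close>, so
    orthomorphisms may be compared there at the point \<open>d\<close>.\<close>
  have conclude: "e * A \<le> e * S" if e: "component e" "e * c = e" and le: "orth_app e (inf y d) \<le> orth_app (e * S) d" for e S
  proof -
    have "?q * (e * A) \<le> ?q * (e * S)"
      by (rule orth_le_principalI[OF d]) (use le A in \<open>simp add: orth_app_mult\<close>)
    moreover have "?q * (e * T) = e * T" for T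
    proof -
      have "?q * (e * T) = ?q * ((e * c) * T)" by (simp only: e(2))
      also have "\<dots> = (e * (c * ?q)) * T" by (simp only: mult_ac)
      finally show ?thesis by (simp only: c(2) e(2))
    qed
    ultimately show ?thesis by simp
  qed
  have shift: "orth_app e (inf y d) \<le> orth_app e (inf u d) + z"
    if e: "component e" and le: "orth_app e y \<le> orth_app e u + z" and z: "0 \<le> z" for e u z
  proof -
    have "orth_app e (inf y d) \<le> inf (orth_app e u + z) (orth_app e d)"
      unfolding component_app_inf[OF e] by (rule inf_mono[OF le order_refl])
    also have "\<dots> \<le> inf (orth_app e u) (orth_app e d) + z" by (rule vl_inf_add_le[OF z])
    finally show ?thesis by (simp add: component_app_inf[OF e])
  qed
  have ex: "orth_app e v \<le> K *\<^sub>R orth_app e d" if e: "component e" "e * c = e" and "orth_app c v \<le> K *\<^sub>R orth_app c d" for e v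
  proof -
    have "orth_app e (orth_app c v) \<le> orth_app e (K *\<^sub>R orth_app c d)"
      by (rule orth_app_mono[OF component_nonneg[OF e(1)] that(3)])
    then show ?thesis by (simp only: orth_linear_simps orth_app_mult[symmetric] e(2))
  qed
  have pprt0: "e * pprt X = 0" if "component e" "e * X \<le> 0" for e X
    using that by (simp add: component_pprt)
  have small: "orth_app e (orth_app T v) \<le> (\<eta> * K) *\<^sub>R orth_app e d"
    if e: "component e" "e * c = e" and T: "e * T \<le> \<eta> *\<^sub>R e" and v: "0 \<le> v" "orth_app c v \<le> K *\<^sub>R orth_app c d" for e T v
  proof -
    have "orth_app e (orth_app T v) \<le> \<eta> *\<^sub>R orth_app e v"
      using orth_app_mono_left[OF T v(1)] by (simp add: orth_app_mult orth_app_scaleR)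
    also have "\<dots> \<le> \<eta> *\<^sub>R (K *\<^sub>R orth_app e d)" by (rule scaleR_left_mono[OF ex[OF e v(2)] \<eta>(1)])
    finally show ?thesis by simp
  qed
  have big: "orth_app e (orth_app T v) \<le> orth_app e v" if e: "component e" and T: "T \<le> 1" and v: "0 \<le> v" for e T v
    using orth_app_mono[OF component_nonneg[OF e] orth_app_mono_left[OF T v]] by (simp add: orth_app_one)
  have dK: "0 \<le> (\<eta> * K) *\<^sub>R orth_app e d" if "component e" for e
    using d \<eta>(1) K that by (intro scaleR_nonneg_nonneg orth_app_nonneg component_nonneg) auto
  have ey: "orth_app e y \<le> orth_app e (orth_app \<psi> x1) + orth_app e (orth_app (1 - \<psi>) x2)" if "component e" for e
    using orth_app_mono[OF component_nonneg[OF that] y] by (simp add: orth_linear_simps)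
  have low: "e * A \<le> e * ?R" if e: "component e" "e * c = e" and e\<phi>: "e * \<phi> \<le> \<gamma>0 *\<^sub>R e" for e
  proof -
    have "e * (\<phi> - \<gamma>1 *\<^sub>R 1) \<le> 0"
      using e\<phi> scaleR_right_mono[of \<gamma>0 \<gamma>1 e] \<gamma>(2) component_nonneg[OF e(1)] by (simp add: right_diff_distrib)
    then have p0: "e * pprt (\<phi> - \<gamma>1 *\<^sub>R 1) = 0" by (rule pprt0[OF e(1)])
    \<comment> \<open>The Bernoulli inequality bounds the weight of \<open>x2\<close> where \<phi>
      is small.\<close>
    have "1 - \<psi> \<le> real k *\<^sub>R \<phi> ^ m" using orth_bernoulli[OF \<phi>m, of k] by (simp add: \<psi> algebra_simps)
    then have "e * (1 - \<psi>) \<le> real k *\<^sub>R (e * \<phi> ^ m)"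
      using mult_left_mono[OF _ component_nonneg[OF e(1)]] by fastforce
    also have "\<dots> \<le> real k *\<^sub>R (\<gamma>0 ^ m *\<^sub>R e)"
      by (intro scaleR_left_mono orth_power_component_le e \<phi> \<gamma> e\<phi>) simp
    also have "\<dots> \<le> \<eta> *\<^sub>R e" using scaleR_right_mono[OF \<eta>(2) component_nonneg[OF e(1)]] by simp
    finally have e\<psi>: "e * (1 - \<psi>) \<le> \<eta> *\<^sub>R e" .
    have "orth_app e y \<le> orth_app e x1 + (\<eta> * K) *\<^sub>R orth_app e d"
      by (rule order_trans[OF ey[OF e(1)] add_mono[OF big[OF e(1) \<psi>01(2) x(1)] small[OF e e\<psi> x(2) xK(2)]]])
    from shift[OF e(1) this dK[OF e(1)]]
    have "orth_app e (inf y d) \<le> orth_app (e * (B1 - t1 *\<^sub>R pprt (\<phi> - \<gamma>1 *\<^sub>R 1) + (\<eta> * K) *\<^sub>R 1)) d"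
      by (simp add: distrib_left right_diff_distrib p0 orth_app_add orth_app_scaleR orth_app_mult B1)
    from conclude[OF e this] show ?thesis
      by (rule order_trans) (intro mult_left_mono component_nonneg e add_right_mono sup_ge1)
  qed
  have high: "e * A \<le> e * ?R" if e: "component e" "e * c = e" and e\<phi>: "\<gamma>1 *\<^sub>R e \<le> e * \<phi>" for e
  proof -
    have "e * (\<gamma>0 *\<^sub>R 1 - \<phi>) \<le> 0"
      using order_trans[OF scaleR_right_mono[of \<gamma>0 \<gamma>1 e] e\<phi>] \<gamma>(2) component_nonneg[OF e(1)] by (simp add: right_diff_distrib)
    then have p0: "e * pprt (\<gamma>0 *\<^sub>R 1 - \<phi>) = 0" by (rule pprt0[OF e(1)])
    have "\<gamma>1 ^ m *\<^sub>R e \<le> e * \<phi> ^ m" using \<gamma> by (intro orth_power_component_ge e \<phi> e\<phi>) auto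
    then have "e * (1 - \<phi> ^ m) \<le> (1 - \<gamma>1 ^ m) *\<^sub>R e" by (simp add: right_diff_distrib scaleR_diff_left)
    then have "e * (1 - \<phi> ^ m) ^ k \<le> (1 - \<gamma>1 ^ m) ^ k *\<^sub>R e"
      using \<phi>m \<gamma> by (intro orth_power_component_le e) (auto intro: power_le_one)
    also have "\<dots> \<le> \<eta> *\<^sub>R e" by (rule scaleR_right_mono[OF \<eta>(3) component_nonneg[OF e(1)]])
    finally have e\<psi>: "e * \<psi> \<le> \<eta> *\<^sub>R e" by (simp add: \<psi>)
    have \<psi>1: "1 - \<psi> \<le> 1" using \<psi>01 by simp
    have "orth_app e y \<le> (\<eta> * K) *\<^sub>R orth_app e d + orth_app e x2"
      by (rule order_trans[OF ey[OF e(1)] add_mono[OF small[OF e e\<psi> x(1) xK(1)] big[OF e(1) \<psi>1 x(2)]]])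
    then have "orth_app e y \<le> orth_app e x2 + (\<eta> * K) *\<^sub>R orth_app e d" by (simp only: add.commute)
    from shift[OF e(1) this dK[OF e(1)]]
    have "orth_app e (inf y d) \<le> orth_app (e * (B2 - t2 *\<^sub>R pprt (\<gamma>0 *\<^sub>R 1 - \<phi>) + (\<eta> * K) *\<^sub>R 1)) d"
      by (simp add: distrib_left right_diff_distrib p0 orth_app_add orth_app_scaleR orth_app_mult B2)
    from conclude[OF e this] show ?thesis
      by (rule order_trans) (intro mult_left_mono component_nonneg e add_right_mono sup_ge2)
  qed
  have mid: "e * A \<le> e * ?R" if e: "component e" "e * c = e" and e\<phi>: "\<gamma>0 *\<^sub>R e \<le> e * \<phi>" "e * \<phi> \<le> \<gamma>1 *\<^sub>R e" for e
  proof -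
    have p0: "e * pprt (\<phi> - \<gamma>1 *\<^sub>R 1) = 0" "e * pprt (\<gamma>0 *\<^sub>R 1 - \<phi>) = 0"
      using e\<phi> by (auto intro!: pprt0[OF e(1)] simp: right_diff_distrib)
    let ?x = "sup x1 x2"
    \<comment> \<open>Any weight between 0 and 1 keeps the combination below the supremum of
      \<open>x1\<close> and \<open>x2\<close>.\<close>
    have "y \<le> orth_app \<psi> ?x + orth_app (1 - \<psi>) ?x"
      using \<psi>01 by (intro order_trans[OF y] add_mono orth_app_mono) auto
    then have "y \<le> ?x" using component_split[of ?x \<psi>] by simp
    then have "orth_app e (inf y d) \<le> orth_app e (inf ?x d)"
      by (intro orth_app_mono component_nonneg e inf_mono) auto
    also have "\<dots> \<le> orth_app e (sup (inf x1 d) (inf x2 d))"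
      by (intro orth_app_mono component_nonneg e vl_inf_sup_distrib)
    also have "\<dots> = orth_app (e * sup B1 B2) d" by (simp add: orth_app_mult orth_app_sup[OF d] B1 B2)
    finally have "e * A \<le> e * sup B1 B2" by (rule conclude[OF e])
    also have "\<dots> = e * sup (B1 - t1 *\<^sub>R pprt (\<phi> - \<gamma>1 *\<^sub>R 1)) (B2 - t2 *\<^sub>R pprt (\<gamma>0 *\<^sub>R 1 - \<phi>))"
      by (simp add: component_sup[OF e(1)] right_diff_distrib p0)
    also have "\<dots> \<le> e * ?R"
      using \<eta>(1) K by (intro mult_left_mono component_nonneg e) (simp add: scaleR_nonneg_nonneg orth_one_nonneg)
    finally show ?thesis .
  qed
  obtain b where b: "component b" "b * \<phi> \<le> \<gamma>0 *\<^sub>R b" "\<gamma>0 *\<^sub>R (1 - b) \<le> (1 - b) * \<phi>" by (rule component_bounding)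
  obtain a where a: "component a" "a * \<phi> \<le> \<gamma>1 *\<^sub>R a" "\<gamma>1 *\<^sub>R (1 - a) \<le> (1 - a) * \<phi>" by (rule component_bounding)
  have cc: "c * c = c" by (rule component_idem[OF c(1)])
  have scale_le: "(u * v) * \<phi> \<le> r *\<^sub>R (u * v)" if "component u" "v * \<phi> \<le> r *\<^sub>R v" for u v r
    using mult_left_mono[OF that(2) component_nonneg[OF that(1)]] by (simp add: mult.assoc)
  have scale_ge: "r *\<^sub>R (u * v) \<le> (u * v) * \<phi>" if "component u" "r *\<^sub>R v \<le> v * \<phi>" for u v r
    using mult_left_mono[OF that(2) component_nonneg[OF that(1)]] by (simp add: mult.assoc)
  have absorb: "(u * c) * c = u * c" for u by (simp only: mult.assoc cc)
  have comp: "component (1 - b)" "component (1 - a)" using a b component_compl by auto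
  show ?thesis
  proof (rule orth_le_componentI[of b])
    have "(b * c) * A \<le> (b * c) * ?R"
    proof (rule low[OF component_mult[OF b(1) c(1)] absorb])
      show "(b * c) * \<phi> \<le> \<gamma>0 *\<^sub>R (b * c)" using scale_le[OF c(1) b(2)] by (simp only: mult.commute)
    qed
    then show "b * (c * A) \<le> b * (c * ?R)" by (simp only: mult.assoc)
    show "(1 - b) * (c * A) \<le> (1 - b) * (c * ?R)"
    proof (rule orth_le_componentI[of a])
      have "(a * (1 - b) * c) * A \<le> (a * (1 - b) * c) * ?R"
      proof (rule mid[OF component_mult[OF component_mult[OF a(1) comp(1)] c(1)] absorb])
        show "\<gamma>0 *\<^sub>R (a * (1 - b) * c) \<le> (a * (1 - b) * c) * \<phi>"
          using scale_ge[OF component_mult[OF a(1) c(1)] b(3)] by (simp only: mult_ac)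
        show "(a * (1 - b) * c) * \<phi> \<le> \<gamma>1 *\<^sub>R (a * (1 - b) * c)"
          using scale_le[OF component_mult[OF comp(1) c(1)] a(2)] by (simp only: mult_ac)
      qed
      then show "a * ((1 - b) * (c * A)) \<le> a * ((1 - b) * (c * ?R))" by (simp only: mult.assoc)
      have "((1 - a) * (1 - b) * c) * A \<le> ((1 - a) * (1 - b) * c) * ?R"
      proof (rule high[OF component_mult[OF component_mult[OF comp(2,1)] c(1)] absorb])
        show "\<gamma>1 *\<^sub>R ((1 - a) * (1 - b) * c) \<le> ((1 - a) * (1 - b) * c) * \<phi>"
          using scale_ge[OF component_mult[OF comp(1) c(1)] a(3)] by (simp only: mult_ac)
      qed
      then show "(1 - a) * ((1 - b) * (c * A)) \<le> (1 - a) * ((1 - b) * (c * ?R))" by (simp only: mult.assoc)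
    qed
  qed
qed

section \<open>The multiplier argument\<close>

text \<open>If the supremum of \<open>h\<close> over the closed set is nonnegative, that of its
  negative part is 0. Since \<open>p\<close> commutes with suprema only, the negative part is
  reached indirectly: were its supremum below \<open>- \<epsilon>\<close> on a band, that of
  \<open>h\<close> would be so as well.\<close>

lemma sup_functional_inf_zero:
  fixes p :: "('s::uniform_space, 'e::dedekind_complete_vector_lattice) state"
  assumes p: "sup_functional p" and c: "component c" and h: "h \<in> orth_functions"
    and m: "\<And>s. h s \<le> m *\<^sub>R 1" and ph: "0 \<le> c * p h"
  shows "c * p (\<lambda>s. nprt (h s)) = 0"
proof (rule ccontr)
  let ?j = "\<lambda>s. nprt (h s)"
  have j: "?j \<in> orth_functions" unfolding nprt_def by (intro Cuo_inf h Cuo_const)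
  have j0: "p ?j \<le> 0" by (rule sup_functional_le[OF p j]) simp
  then have cj: "c * p ?j \<le> 0" using mult_left_mono[OF j0 component_nonneg[OF c]] by simp
  assume "c * p ?j \<noteq> 0"
  then have "\<not> - (c * p ?j) \<le> 0" using cj by (metis antisym neg_le_0_iff_le)
  then obtain b \<epsilon> where b: "component b" "b \<noteq> 0" "0 < \<epsilon>" "\<epsilon> *\<^sub>R b \<le> b * - (c * p ?j)"
    by (rule orth_not_nonpos_component)
  define a where "a = b * c"
  have a: "component a" unfolding a_def by (rule component_mult[OF b(1) c])
  \<comment> \<open>The element to be bounded below lies in the band of \<open>c\<close>; therefore
    \<open>b\<close> lies below \<open>c\<close>.\<close>
  have "(1 - c) * (\<epsilon> *\<^sub>R b) \<le> (1 - c) * (b * - (c * p ?j))"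
    by (intro mult_left_mono b component_nonneg component_compl c)
  also have "(1 - c) * (b * - (c * p ?j)) = - (((1 - c) * c) * (b * p ?j))" by (simp add: mult_ac)
  also have "\<dots> = 0" using component_idem[OF c] by (simp add: left_diff_distrib)
  finally have "\<epsilon> *\<^sub>R ((1 - c) * b) \<le> 0" by simp
  then have "(1 - c) * b = 0"
    by (intro scaleR_component_nonpos[OF component_mult[OF component_compl[OF c] b(1)] b(3)])
  then have "b - c * b = 0" by (simp only: left_diff_distrib mult_1_left)
  then have ab: "a = b" by (simp add: a_def mult.commute[of b])
  have aj: "a * p ?j \<le> (- \<epsilon>) *\<^sub>R a"
    using b(4) by (simp add: ab a_def[symmetric, unfolded ab] mult.assoc[symmetric] le_minus_iff)
  \<comment> \<open>The multiple is so large that \<open>m + n\<close> times the negative part is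
    still at most \<open>- \<epsilon>\<close> on \<open>a\<close>.\<close>
  obtain n :: nat where n: "(\<bar>m\<bar> + \<epsilon>) / \<epsilon> \<le> real n" using real_arch_simple by blast
  then have n': "m - real n * \<epsilon> \<le> - \<epsilon>" using b(3) by (simp add: field_simps)
  let ?g = "\<lambda>s. m *\<^sub>R 1 + real n *\<^sub>R ?j s"
  have g: "?g \<in> orth_functions" by (intro Cuo_add Cuo_const Cuo_scaleR j)
  \<comment> \<open>Where \<open>h s\<close> is positive the negative part is 0 and \<open>m\<close>
    is the bound; elsewhere \<open>h s\<close> is its own negative part.\<close>
  have "h s \<le> sup (?j s) (?g s)" for s
  proof -
    obtain e where e: "component e" "e * h s = pprt (h s)" "(1 - e) * h s = nprt (h s)"
      by (rule orth_component_separating)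
    show ?thesis
    proof (rule orth_le_componentI[of e])
      have ej: "e * ?j s = 0" using component_idem[OF e(1)]
        by (simp only: e(3)[symmetric] mult.assoc[symmetric] right_diff_distrib) simp
      have "e * h s \<le> e * (m *\<^sub>R 1)" by (rule mult_left_mono[OF m component_nonneg[OF e(1)]])
      also have "\<dots> = e * ?g s" by (simp add: distrib_left ej)
      also have "\<dots> \<le> e * sup (?j s) (?g s)" by (rule mult_left_mono[OF sup_ge2 component_nonneg[OF e(1)]])
      finally show "e * h s \<le> e * sup (?j s) (?g s)" .
      have ej': "(1 - e) * ?j s = (1 - e) * h s" using ej by (simp add: left_diff_distrib e(3)[symmetric])
      show "(1 - e) * h s \<le> (1 - e) * sup (?j s) (?g s)"
        unfolding ej'[symmetric] by (rule mult_left_mono[OF sup_ge1 component_nonneg[OF component_compl[OF e(1)]]])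
    qed
  qed
  then have "p h \<le> p (\<lambda>s. sup (?j s) (?g s))" by (intro sup_functional_mono[OF p] h Cuo_sup j g)
  also have "\<dots> = sup (p ?j) (p ?g)" by (rule sup_functional_sup[OF p j g])
  also have "p ?g = m *\<^sub>R 1 + real n *\<^sub>R p ?j"
    using sup_functional_add_const[OF p Cuo_scaleR[OF j], of "real n" "m *\<^sub>R 1"]
      sup_functional_scaleR[OF p j, of "real n"] by (simp add: add.commute)
  finally have "a * p h \<le> a * sup (p ?j) (m *\<^sub>R 1 + real n *\<^sub>R p ?j)"
    by (rule mult_left_mono[OF _ component_nonneg[OF a]])
  also have "\<dots> = sup (a * p ?j) (m *\<^sub>R a + real n *\<^sub>R (a * p ?j))"
    by (simp add: component_sup[OF a] distrib_left)
  also have "\<dots> \<le> (- \<epsilon>) *\<^sub>R a"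
  proof (rule sup_least[OF aj])
    have "m *\<^sub>R a + real n *\<^sub>R (a * p ?j) \<le> m *\<^sub>R a + real n *\<^sub>R ((- \<epsilon>) *\<^sub>R a)"
      by (intro add_left_mono scaleR_left_mono aj) simp
    also have "\<dots> = (m - real n * \<epsilon>) *\<^sub>R a" by (simp add: scaleR_diff_left)
    also have "\<dots> \<le> (- \<epsilon>) *\<^sub>R a" by (rule scaleR_right_mono[OF n' component_nonneg[OF a]])
    finally show "m *\<^sub>R a + real n *\<^sub>R (a * p ?j) \<le> (- \<epsilon>) *\<^sub>R a" .
  qed
  finally have "a * p h \<le> (- \<epsilon>) *\<^sub>R a" .
  moreover have "0 \<le> a * p h"
    using mult_left_mono[OF ph component_nonneg[OF b(1)]] by (simp add: a_def mult.assoc)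
  ultimately have "0 \<le> (- \<epsilon>) *\<^sub>R a" by (rule order_trans[rotated])
  then have "\<epsilon> *\<^sub>R a \<le> 0" by simp
  then have "a = 0" by (rule scaleR_component_nonpos[OF a b(3)])
  then show False using ab b(2) by simp
qed

text \<open>Restricting a minimal functional to the part of its closed set where \<open>\<phi> \<le> \<gamma>\<close> must
  violate the constraint.\<close>

lemma minimal_functional_restrict:
  fixes p :: "('s::uniform_space, 'e::dedekind_complete_vector_lattice) state"
  assumes p: "sup_functional p" and C: "C \<subseteq> orth_functions" "\<And>D. D \<in> C \<Longrightarrow> q \<le> p D"
    and D01: "\<forall>D\<in>C. \<forall>s. 0 \<le> D s \<and> D s \<le> q" and q: "component q"
    and min: "\<And>r. sup_functional r \<Longrightarrow> (\<And>\<phi>. \<phi> \<in> orth_functions \<Longrightarrow> r \<phi> \<le> p \<phi>) \<Longrightarrow>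
      (\<And>D. D \<in> C \<Longrightarrow> q \<le> r D) \<Longrightarrow> r = p"
    and \<phi>: "\<phi> \<in> orth_functions" "\<And>s. 0 \<le> \<phi> s" and c: "component c" "c \<noteq> 0"
    and \<alpha>\<gamma>\<beta>: "\<alpha> < \<gamma>" "\<gamma> < \<beta>"
    and low: "c * - p (\<lambda>s. - \<phi> s) \<le> \<alpha> *\<^sub>R c" and high: "\<beta> *\<^sub>R c \<le> c * p \<phi>"
  obtains D c' \<epsilon> t where "D \<in> C" "component c'" "c' \<noteq> 0" "c' * c = c'" "c' * q = c'" "0 < \<epsilon>" "0 \<le> t"
    "c' * p (\<lambda>s. D s - t *\<^sub>R pprt (\<phi> s - \<gamma> *\<^sub>R 1)) \<le> (1 - \<epsilon>) *\<^sub>R c'"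
proof -
  let ?f = "\<lambda>s. pprt (\<phi> s - \<gamma> *\<^sub>R 1)"
  let ?h = "\<lambda>s. \<gamma> *\<^sub>R 1 - \<phi> s"
  \<comment> \<open>On the band \<open>c\<close> this function attains its maximum 0 where \<phi> is
    at most \<gamma>; off \<open>c\<close> it is 0 and restricts nothing.\<close>
  let ?k = "\<lambda>s. c * - ?f s"
  have f: "?f \<in> orth_functions" by (intro Cuo_pprt Cuo_diff \<phi> Cuo_const)
  have h: "?h \<in> orth_functions" by (intro Cuo_diff \<phi> Cuo_const)
  have k: "?k \<in> orth_functions" by (intro Cuo_const_mult Cuo_minus f)
  have f_eq: "nprt (?h s) = - ?f s" for s using pprt_neg[of "?h s"] by simp
  have "0 \<le> c * p ?h"
  proof -
    have "p ?h = \<gamma> *\<^sub>R 1 + p (\<lambda>s. - \<phi> s)"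
      using sup_functional_add_const[OF p Cuo_minus[OF \<phi>(1)], of "\<gamma> *\<^sub>R 1"] by (simp add: add.commute)
    then have "c * p ?h = \<gamma> *\<^sub>R c - c * - p (\<lambda>s. - \<phi> s)" by (simp add: distrib_left)
    also have "\<dots> \<ge> \<gamma> *\<^sub>R c - \<alpha> *\<^sub>R c" by (rule diff_left_mono[OF low])
    also have "\<gamma> *\<^sub>R c - \<alpha> *\<^sub>R c = (\<gamma> - \<alpha>) *\<^sub>R c" by (simp add: scaleR_diff_left)
    finally show ?thesis
      using scaleR_nonneg_nonneg[of "\<gamma> - \<alpha>" c] \<alpha>\<gamma>\<beta>(1) component_nonneg[OF c(1)] by (auto intro: order_trans)
  qed
  then have "c * p (\<lambda>s. nprt (?h s)) = 0"
    by (rule sup_functional_inf_zero[OF p c(1) h, of \<gamma>, rotated]) (simp add: \<phi>(2))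
  then have "c * p (\<lambda>s. - ?f s) = 0" by (simp add: f_eq)
  moreover have "c * p ?k = c * p (\<lambda>s. - ?f s)"
    by (rule sup_functional_component_cong[OF p c(1) k Cuo_minus[OF f]])
      (simp add: mult.assoc[symmetric] component_idem[OF c(1)])
  ultimately have ck: "c * p ?k = 0" by simp
  have c': "component (1 - c)" by (rule component_compl[OF c(1)])
  have ck0: "(1 - c) * ?k s = 0" for s
    using component_idem[OF c(1)] by (simp add: mult.assoc[symmetric] left_diff_distrib)
  have "(1 - c) * p ?k = (1 - c) * p (\<lambda>s. 0)"
    by (rule sup_functional_component_cong[OF p c' k Cuo_const]) (simp only: ck0 mult_zero_right)
  then have pk: "p ?k = 0" using ck by (simp add: sup_functional_const[OF p] left_diff_distrib)
  let ?r = "face p ?k"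
  have rle: "?r \<psi> \<le> p (\<lambda>s. \<psi> s + t *\<^sub>R ?k s)" if "\<psi> \<in> orth_functions" "0 \<le> t" for \<psi> t
    using face_le[OF p k that] by (simp only: pk scaleR_zero_right diff_zero)
  \<comment> \<open>On the face \<phi> is at most \<gamma> within \<open>c\<close>, whereas
    \<open>p \<phi>\<close> is at least \<beta> there.\<close>
  have "?r \<noteq> p"
  proof
    assume eq: "?r = p"
    have "p \<phi> \<le> p (\<lambda>s. \<phi> s + 1 *\<^sub>R ?k s)" using rle[OF \<phi>(1), of 1] by (simp only: eq zero_le_one)
    then have "c * p \<phi> \<le> c * p (\<lambda>s. \<phi> s + ?k s)" using component_nonneg[OF c(1)] by (simp add: mult_left_mono)
    also have "\<dots> \<le> c * p (\<lambda>s. \<gamma> *\<^sub>R 1)"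
    proof (rule sup_functional_component_mono[OF p c(1) Cuo_add[OF \<phi>(1) k] Cuo_const])
      fix s
      have "\<phi> s - \<gamma> *\<^sub>R 1 \<le> ?f s" by (simp add: pprt_def)
      then have "\<phi> s - ?f s \<le> \<gamma> *\<^sub>R 1" by (simp add: algebra_simps)
      from mult_left_mono[OF this component_nonneg[OF c(1)]]
      show "c * (\<phi> s + ?k s) \<le> c * (\<gamma> *\<^sub>R 1)"
        using component_idem[OF c(1)] by (simp add: distrib_left right_diff_distrib mult.assoc[symmetric])
    qed
    finally have "\<beta> *\<^sub>R c \<le> \<gamma> *\<^sub>R c" using high by (simp add: sup_functional_const[OF p])
    then show False using component_scaleR_le_cases[OF c(1)] \<alpha>\<gamma>\<beta>(2) c(2) by blast
  qed
  then have "\<exists>D\<in>C. \<not> q \<le> ?r D"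
    using min[OF sup_functional_face[OF p k] face_le_self[OF p k]] by blast
  then obtain D where D: "D \<in> C" "\<not> q \<le> ?r D" by blast
  have DV: "D \<in> orth_functions" using C(1) D(1) by blast
  \<comment> \<open>The face is an infimum over \<open>t\<close>, so a lower bound that fails for it
    fails at some finite \<open>t\<close>.\<close>
  have "\<exists>t\<ge>0. \<not> q \<le> p (\<lambda>s. D s + t *\<^sub>R ?k s)"
  proof (rule ccontr)
    assume "\<not> (\<exists>t\<ge>0. \<not> q \<le> p (\<lambda>s. D s + t *\<^sub>R ?k s))"
    then have "q \<le> ?r D" by (intro face_greatest[OF p k DV]) (simp only: pk scaleR_zero_right diff_zero, blast)
    then show False using D(2) by contradiction
  qed
  then obtain t where t: "0 \<le> t" "\<not> q \<le> p (\<lambda>s. D s + t *\<^sub>R ?k s)" by blast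
  let ?D = "\<lambda>s. D s + t *\<^sub>R ?k s"
  have DkV: "?D \<in> orth_functions" by (intro Cuo_add DV Cuo_scaleR k)
  have "\<not> q - p ?D \<le> 0" using t(2) by simp
  then obtain c' \<epsilon> where c2: "component c'" "c' \<noteq> 0" "0 < \<epsilon>" "\<epsilon> *\<^sub>R c' \<le> c' * (q - p ?D)"
    by (rule orth_not_nonpos_component)
  \<comment> \<open>The band of the violation lies below every component off which there is no
    violation. This is used for \<open>c\<close>, off which \<open>?k\<close> is 0, and for
    \<open>q\<close>, off which the constraint is trivial.\<close>
  have vanish: "c' * e = c'" if e: "component e" and le: "(1 - e) * (q - p ?D) \<le> 0" for e
  proof -
    have ce: "component (c' * (1 - e))" by (intro component_mult component_compl e c2)
    have "(1 - e) * (\<epsilon> *\<^sub>R c') \<le> (1 - e) * (c' * (q - p ?D))"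
      by (intro mult_left_mono c2 component_nonneg component_compl e)
    also have "\<dots> = c' * ((1 - e) * (q - p ?D))" by (simp only: mult_ac)
    also have "\<dots> \<le> c' * 0" by (rule mult_left_mono[OF le component_nonneg[OF c2(1)]])
    finally have "\<epsilon> *\<^sub>R (c' * (1 - e)) \<le> 0" by (simp add: mult.commute)
    then have "c' * (1 - e) = 0" by (rule scaleR_component_nonpos[OF ce c2(3)])
    then show ?thesis by (simp add: right_diff_distrib)
  qed
  have cc: "c' * c = c'"
  proof (rule vanish[OF c(1)])
    have "(1 - c) * p ?D = (1 - c) * p D"
      by (rule sup_functional_component_cong[OF p component_compl[OF c(1)] DkV DV])
        (simp only: distrib_left mult_scaleR_right ck0 scaleR_zero_right add_0_right)
    moreover have "(1 - c) * q \<le> (1 - c) * p D"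
      by (intro mult_left_mono C(2) D(1) component_nonneg component_compl c)
    ultimately show "(1 - c) * (q - p ?D) \<le> 0" by (simp add: right_diff_distrib)
  qed
  have cq: "c' * q = c'"
  proof (rule vanish[OF q])
    have qD: "(1 - q) * D s = 0" for s
      using orth_le_principal[of "D s" q] bspec[OF D01 D(1)] q by (simp add: left_diff_distrib)
    have "(1 - q) * p ?D = (1 - q) * p (\<lambda>s. t *\<^sub>R ?k s)"
      by (rule sup_functional_component_cong[OF p component_compl[OF q] DkV Cuo_scaleR[OF k]])
        (simp only: distrib_left qD add_0_left)
    also have "p (\<lambda>s. t *\<^sub>R ?k s) = 0" using sup_functional_scaleR[OF p k t(1)] pk by simp
    finally show "(1 - q) * (q - p ?D) \<le> 0"
      using component_idem[OF q] by (simp add: right_diff_distrib left_diff_distrib)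
  qed
  have "c' * p (\<lambda>s. D s - t *\<^sub>R ?f s) = c' * p ?D"
  proof (rule sup_functional_component_cong[OF p c2(1) Cuo_diff[OF DV Cuo_scaleR[OF f]] DkV])
    fix s
    have "c' * ?k s = (c' * c) * - ?f s" by (simp only: mult.assoc)
    then show "c' * (D s - t *\<^sub>R ?f s) = c' * ?D s"
      by (simp only: right_diff_distrib distrib_left mult_scaleR_right cc) simp
  qed
  also have "\<dots> \<le> (1 - \<epsilon>) *\<^sub>R c'"
  proof -
    have "c' * p ?D = c' * q - c' * (q - p ?D)" by (simp add: right_diff_distrib)
    also have "\<dots> \<le> c' - \<epsilon> *\<^sub>R c'" unfolding cq by (rule diff_left_mono[OF c2(4)])
    finally show ?thesis by (simp add: scaleR_diff_left)
  qed
  finally show ?thesis using that[OF D(1) c2(1,2) cc cq c2(3) t(1)] by blast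
qed

text \<open>Descends a grid of width \<delta>: either \<open>a\<close> stays above the next grid
  point on all of \<open>c\<close>, or the band is cut down to where it does not. At the bottom
  \<open>\<alpha> = 0\<close> works, since \<open>a\<close> is nonnegative.\<close>

lemma component_localize_value:
  fixes a :: "'e::dedekind_complete_vector_lattice orth"
  assumes a: "0 \<le> a" and \<delta>: "0 < \<delta>"
  shows "component c \<Longrightarrow> c \<noteq> 0 \<Longrightarrow> c * a \<le> (real n * \<delta>) *\<^sub>R c \<Longrightarrow>
    \<exists>c' \<alpha>. component c' \<and> c' \<noteq> 0 \<and> c' * c = c' \<and> 0 \<le> \<alpha> \<and> c' * a \<le> \<alpha> *\<^sub>R c' \<and> (\<alpha> - \<delta>) *\<^sub>R c' \<le> c' * a"
proof (induction n arbitrary: c)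
  case 0
  have "(0 - \<delta>) *\<^sub>R c \<le> 0" using \<delta> component_nonneg[OF 0(1)] by (simp add: scaleR_nonneg_nonneg)
  also have "0 \<le> c * a" by (rule orth_mult_nonneg[OF component_nonneg[OF 0(1)] a])
  finally show ?case using 0 component_idem[OF 0(1)] by (intro exI[of _ c] exI[of _ 0]) simp
next
  case (Suc n)
  obtain b where b: "component b" "b * a \<le> (real n * \<delta>) *\<^sub>R b" "(real n * \<delta>) *\<^sub>R (1 - b) \<le> (1 - b) * a"
    by (rule component_bounding)
  show ?case
  proof (cases "c * b = 0")
    case True
    then have c: "c * (1 - b) = c" by (simp add: right_diff_distrib)
    have "c * ((real n * \<delta>) *\<^sub>R (1 - b)) \<le> c * ((1 - b) * a)"
      by (rule mult_left_mono[OF b(3) component_nonneg[OF Suc.prems(1)]])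
    then have "(real n * \<delta>) *\<^sub>R c \<le> c * a" by (simp only: mult_scaleR_right mult.assoc[symmetric] c)
    then show ?thesis
      using Suc.prems component_idem[OF Suc.prems(1)] \<delta>
      by (intro exI[of _ c] exI[of _ "real (Suc n) * \<delta>"]) (simp add: algebra_simps)
  next
    case False
    have cb: "component (c * b)" by (rule component_mult[OF Suc.prems(1) b(1)])
    have "(c * b) * a \<le> (real n * \<delta>) *\<^sub>R (c * b)"
      using mult_left_mono[OF b(2) component_nonneg[OF Suc.prems(1)]] by (simp add: mult.assoc)
    from Suc.IH[OF cb False this] obtain c' \<alpha> where c': "component c'" "c' \<noteq> 0" "c' * (c * b) = c'" "0 \<le> \<alpha>"
      "c' * a \<le> \<alpha> *\<^sub>R c'" "(\<alpha> - \<delta>) *\<^sub>R c' \<le> c' * a" by blast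
    have "c' * c = c' * (c * b) * c" by (simp only: c'(3))
    also have "\<dots> = c' * ((c * c) * b)" by (simp only: mult_ac)
    also have "\<dots> = c'" by (simp only: component_idem[OF Suc.prems(1)] c'(3))
    finally show ?thesis using c' by blast
  qed
qed

text \<open>If \<open>x\<close> were bounded by a multiple of \<open>d\<close> on no nonzero part of
  \<open>c\<close>, all multiples of \<open>d\<close> would be below \<open>x\<close> on
  \<open>c\<close>, and \<open>d\<close> would vanish there.\<close>

lemma component_localize_bound:
  fixes x d :: "'e::dedekind_complete_vector_lattice"
  assumes d: "0 \<le> d" and c: "component c" "c \<noteq> 0" "c * principal_projection d = c"
  obtains c' K where "component c'" "c' \<noteq> 0" "c' * c = c'" "0 < K" "orth_app c' x \<le> K *\<^sub>R orth_app c' d"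
proof -
  have "\<exists>n b. component b \<and> orth_app b x \<le> real n *\<^sub>R orth_app b d \<and> c * b \<noteq> 0"
  proof (rule ccontr)
    assume none: "\<not> ?thesis"
    have "real n *\<^sub>R orth_app c d \<le> orth_app c x" for n :: nat
    proof -
      obtain b where b: "component b" "orth_app b (real n *\<^sub>R d - x) = pprt (real n *\<^sub>R d - x)"
        "orth_app (1 - b) (real n *\<^sub>R d - x) = nprt (real n *\<^sub>R d - x)" by (rule component_separating)
      have "0 \<le> orth_app b (real n *\<^sub>R d - x)" unfolding b(2) by simp
      then have "orth_app b x \<le> real n *\<^sub>R orth_app b d" by (simp add: orth_linear_simps)
      then have "c * b = 0" using none b(1) by blast
      then have cb: "c * (1 - b) = c" by (simp add: right_diff_distrib)
      have "orth_app (1 - b) (real n *\<^sub>R d - x) \<le> 0" unfolding b(3) by simp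
      from orth_app_mono[OF component_nonneg[OF c(1)] this]
      have "orth_app (c * (1 - b)) (real n *\<^sub>R d - x) \<le> 0" by (simp only: orth_app_mult orth_linear_simps)
      then show ?thesis unfolding cb by (simp add: orth_linear_simps)
    qed
    then have "orth_app c d \<le> 0" by (rule vl_archimedean)
    then have "orth_app c d = 0" using orth_app_nonneg[OF component_nonneg[OF c(1)] d] by (rule antisym)
    then have "principal_projection d * c = 0" by (rule orth_app_zero_principal[OF component_nonneg[OF c(1)] d])
    then show False using c(2,3) by (simp add: mult.commute)
  qed
  then obtain n b where b: "component b" "orth_app b x \<le> real n *\<^sub>R orth_app b d" "c * b \<noteq> 0" by blast
  have cb: "component (c * b)" by (rule component_mult[OF c(1) b(1)])
  have "orth_app (c * b) x \<le> real n *\<^sub>R orth_app (c * b) d"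
    using orth_app_mono[OF component_nonneg[OF c(1)] b(2)] by (simp add: orth_app_mult orth_linear_simps)
  \<comment> \<open>The increment makes the factor positive even for \<open>n = 0\<close>; it serves
    as a denominator later.\<close>
  also have "\<dots> \<le> (real n + 1) *\<^sub>R orth_app (c * b) d"
    by (intro scaleR_right_mono orth_app_nonneg component_nonneg cb d) simp
  finally have le: "orth_app (c * b) x \<le> (real n + 1) *\<^sub>R orth_app (c * b) d" .
  have "(c * b) * c = (c * c) * b" by (simp only: mult_ac)
  then have "(c * b) * c = c * b" by (simp only: component_idem[OF c(1)])
  then show ?thesis using that[OF cb b(3) _ _ le] by simp
qed

context bk_space begin

text \<open>The multipliers for functions with values in the Banach-Kantorovich space itself; for
  the image of the original family under the embedding they are the original multipliers.\<close>

definition convex_multipliers :: "('s::uniform_space \<Rightarrow> 'y) set \<Rightarrow> ('s \<Rightarrow> 'e orth) set"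
  where "convex_multipliers W = {\<phi> \<in> orth_functions. (\<forall>s. 0 \<le> \<phi> s \<and> \<phi> s \<le> 1) \<and>
    (\<forall>f\<in>W. \<forall>g\<in>W. \<exists>h\<in>W. \<forall>s. h s = act (\<phi> s) (f s) + act (1 - \<phi> s) (g s))}"

lemma convex_multipliers_compl:
  assumes "\<phi> \<in> convex_multipliers W" shows "(\<lambda>s. 1 - \<phi> s) \<in> convex_multipliers W"
  using assms unfolding convex_multipliers_def
  by (auto intro!: Cuo_diff Cuo_const simp: add.commute)

text \<open>Blending \<open>f\<close> and \<open>g\<close> by \<psi> and the result with
  \<open>g\<close> by \<phi> gives \<open>f\<close> the weight \<open>\<phi> * \<psi>\<close>. With
  complements and powers this makes \<open>(1 - \<phi>^m)^k\<close> a multiplier.\<close>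

lemma convex_multipliers_mult:
  assumes \<phi>: "\<phi> \<in> convex_multipliers W" and \<psi>: "\<psi> \<in> convex_multipliers W"
  shows "(\<lambda>s. \<phi> s * \<psi> s) \<in> convex_multipliers W"
  unfolding convex_multipliers_def
proof (intro CollectI conjI allI ballI)
  have *: "0 \<le> \<phi> s" "\<phi> s \<le> 1" "0 \<le> \<psi> s" "\<psi> s \<le> 1" for s using \<phi> \<psi> by (auto simp: convex_multipliers_def)
  show "(\<lambda>s. \<phi> s * \<psi> s) \<in> orth_functions" using \<phi> \<psi> by (intro Cuo_mult) (auto simp: convex_multipliers_def)
  show "0 \<le> \<phi> s * \<psi> s" for s by (intro orth_mult_nonneg *)
  show "\<phi> s * \<psi> s \<le> 1" for s using mult_mono[OF *(2) *(4) orth_one_nonneg *(3), of s s] by simp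
  fix f g assume fg: "f \<in> W" "g \<in> W"
  have "\<exists>h\<in>W. \<forall>s. h s = act (\<psi> s) (f s) + act (1 - \<psi> s) (g s)"
    using \<psi> fg unfolding convex_multipliers_def by blast
  then obtain h1 where h1: "h1 \<in> W" "\<And>s. h1 s = act (\<psi> s) (f s) + act (1 - \<psi> s) (g s)" by auto
  have "\<exists>h\<in>W. \<forall>s. h s = act (\<phi> s) (h1 s) + act (1 - \<phi> s) (g s)"
    using \<phi> h1(1) fg(2) unfolding convex_multipliers_def by blast
  then obtain h where h: "h \<in> W" "\<And>s. h s = act (\<phi> s) (h1 s) + act (1 - \<phi> s) (g s)" by auto
  have "h s = act (\<phi> s * \<psi> s) (f s) + act (1 - \<phi> s * \<psi> s) (g s)" for s
  proof -
    have "h s = act (\<phi> s * \<psi> s) (f s) + (act (\<phi> s * (1 - \<psi> s)) (g s) + act (1 - \<phi> s) (g s))"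
      by (simp only: h(2) h1(2) act_add_right act_mult add.assoc)
    also have "act (\<phi> s * (1 - \<psi> s)) (g s) + act (1 - \<phi> s) (g s) = act (\<phi> s * (1 - \<psi> s) + (1 - \<phi> s)) (g s)"
      by (rule act_add_left[symmetric])
    also have "\<phi> s * (1 - \<psi> s) + (1 - \<phi> s) = 1 - \<phi> s * \<psi> s" by (simp add: right_diff_distrib)
    finally show ?thesis .
  qed
  then show "\<exists>h\<in>W. \<forall>s. h s = act (\<phi> s * \<psi> s) (f s) + act (1 - \<phi> s * \<psi> s) (g s)" using h(1) by blast
qed

lemma convex_multipliers_power:
  assumes "\<phi> \<in> convex_multipliers W" shows "(\<lambda>s. \<phi> s ^ m) \<in> convex_multipliers W"
proof (induction m)
  case 0
  show ?case
    by (auto simp: convex_multipliers_def Cuo_const orth_one_nonneg act_one act_zero_left)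
qed (simp add: convex_multipliers_mult assms)

text \<open>\<open>- p (\<lambda>s. - \<phi> s)\<close> is the infimum of \<phi> over the closed set
  of \<open>p\<close>, so supremum and infimum coincide. Assuming a gap, the contradiction is
  prepared on a descending sequence of nonzero bands from \<open>c0\<close> to
  \<open>c4\<close>.\<close>

lemma multiplier_constant_on_minimal:
  fixes W :: "('s::{uniform_space, t2_space} \<Rightarrow> 'y) set" and p :: "('s, 'e) state"
  assumes d: "0 \<le> d" and W: "\<And>g. g \<in> W \<Longrightarrow> g \<in> Cuo N" and f: "f \<in> Cuo N"
    and p: "sup_functional p"
    and Q: "Q = (\<lambda>g s. truncated_quotient d (N (f s - g s)))"
    and QV: "\<And>g. g \<in> W \<Longrightarrow> Q g \<in> orth_functions"
    and pq: "\<And>g. g \<in> W \<Longrightarrow> principal_projection d \<le> p (Q g)"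
    and min: "\<And>r. sup_functional r \<Longrightarrow> (\<And>\<phi>. \<phi> \<in> orth_functions \<Longrightarrow> r \<phi> \<le> p \<phi>) \<Longrightarrow>
      (\<And>g. g \<in> W \<Longrightarrow> principal_projection d \<le> r (Q g)) \<Longrightarrow> r = p"
    and \<phi>M: "\<phi> \<in> convex_multipliers W"
  shows "p \<phi> + p (\<lambda>s. - \<phi> s) \<le> 0"
proof (rule ccontr)
  let ?q = "principal_projection d"
  have q: "component ?q" by (rule component_principal_projection[OF d])
  have \<phi>: "\<phi> \<in> orth_functions" "\<And>s. 0 \<le> \<phi> s" "\<And>s. \<phi> s \<le> 1" using \<phi>M by (auto simp: convex_multipliers_def)
  have Qd: "orth_app (Q g s) d = inf (N (f s - g s)) d" "0 \<le> Q g s" "Q g s \<le> ?q" for g s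
    unfolding Q using truncated_quotient[OF d lnorm_nonneg] by auto
  let ?C = "Q ` W"
  have C: "?C \<subseteq> orth_functions" "\<And>D. D \<in> ?C \<Longrightarrow> ?q \<le> p D" "\<forall>D\<in>?C. \<forall>s. 0 \<le> D s \<and> D s \<le> ?q"
    using QV pq Qd by auto
  have minC: "r = p" if "sup_functional r" "\<And>\<phi>. \<phi> \<in> orth_functions \<Longrightarrow> r \<phi> \<le> p \<phi>" "\<And>D. D \<in> ?C \<Longrightarrow> ?q \<le> r D" for r
    by (rule min[OF that(1,2)]) (use that(3) in auto)
  have restrict: "\<exists>g\<in>W. \<exists>c' \<epsilon> t. component c' \<and> c' \<noteq> 0 \<and> c' * c = c' \<and> c' * ?q = c' \<and> 0 < \<epsilon> \<and>
      c' * p (\<lambda>s. Q g s - t *\<^sub>R pprt (\<theta> s - \<gamma> *\<^sub>R 1)) \<le> (1 - \<epsilon>) *\<^sub>R c'"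
    if "\<theta> \<in> orth_functions" "\<And>s. 0 \<le> \<theta> s" "component c" "c \<noteq> 0" "\<alpha> < \<gamma>" "\<gamma> < \<beta>"
      "c * - p (\<lambda>s. - \<theta> s) \<le> \<alpha> *\<^sub>R c" "\<beta> *\<^sub>R c \<le> c * p \<theta>" for \<theta> c \<alpha> \<gamma> \<beta>
    by (rule minimal_functional_restrict[where p = p and C = ?C and q = ?q and \<phi> = \<theta> and c = c
        and \<alpha> = \<alpha> and \<gamma> = \<gamma> and \<beta> = \<beta>, OF p C q minC that]) auto
  assume "\<not> ?thesis"
  then obtain c0 \<epsilon>0 where c0: "component c0" "c0 \<noteq> 0" "0 < \<epsilon>0" "\<epsilon>0 *\<^sub>R c0 \<le> c0 * (p \<phi> + p (\<lambda>s. - \<phi> s))"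
    by (rule orth_not_nonpos_component)
  define a where "a = - p (\<lambda>s. - \<phi> s)"
  have "p (\<lambda>s. - \<phi> s) \<le> 0" by (rule sup_functional_le[OF p Cuo_minus[OF \<phi>(1)]]) (simp add: \<phi>)
  then have a0: "0 \<le> a" by (simp add: a_def)
  have p1: "p \<phi> \<le> 1" by (rule sup_functional_le[OF p \<phi>(1,3)])
  have a1: "a \<le> 1" unfolding a_def by (rule order_trans[OF sup_functional_minus_le[OF p \<phi>(1)] p1])
  \<comment> \<open>Half of the gap: when the infimum lies between
    \<open>\<alpha> - \<delta>\<close> and \<alpha> on a band, the supremum is at least
    \<open>\<alpha> + \<delta>\<close> there.\<close>
  define \<delta> where "\<delta> = \<epsilon>0 / 2"
  have \<delta>: "0 < \<delta>" using c0 by (simp add: \<delta>_def)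
  obtain n :: nat where n: "1 / \<delta> \<le> real n" using real_arch_simple by blast
  have "c0 * a \<le> c0 * 1" by (rule mult_left_mono[OF a1 component_nonneg[OF c0(1)]])
  also have "\<dots> \<le> (real n * \<delta>) *\<^sub>R c0"
    using scaleR_right_mono[of 1 "real n * \<delta>" c0] n \<delta> component_nonneg[OF c0(1)] by (simp add: field_simps)
  finally have "c0 * a \<le> (real n * \<delta>) *\<^sub>R c0" .
  from component_localize_value[OF a0 \<delta> c0(1,2) this]
  obtain c1 \<alpha> where c1: "component c1" "c1 \<noteq> 0" "c1 * c0 = c1" and \<alpha>: "0 \<le> \<alpha>" "c1 * a \<le> \<alpha> *\<^sub>R c1" "(\<alpha> - \<delta>) *\<^sub>R c1 \<le> c1 * a"
    by auto
  have \<beta>: "(\<alpha> + \<delta>) *\<^sub>R c1 \<le> c1 * p \<phi>"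
  proof -
    have "c1 * (\<epsilon>0 *\<^sub>R c0) \<le> c1 * (c0 * (p \<phi> + p (\<lambda>s. - \<phi> s)))" by (rule mult_left_mono[OF c0(4) component_nonneg[OF c1(1)]])
    then have "\<epsilon>0 *\<^sub>R c1 \<le> c1 * (p \<phi> + p (\<lambda>s. - \<phi> s))"
      by (simp only: mult_scaleR_right mult.assoc[symmetric] c1(3))
    then have 1: "\<epsilon>0 *\<^sub>R c1 \<le> c1 * p \<phi> - c1 * a" by (simp add: a_def distrib_left)
    have "(\<alpha> + \<delta>) *\<^sub>R c1 = \<epsilon>0 *\<^sub>R c1 + (\<alpha> - \<delta>) *\<^sub>R c1" by (simp add: scaleR_add_left[symmetric] \<delta>_def)
    also have "\<dots> \<le> (c1 * p \<phi> - c1 * a) + c1 * a" by (rule add_mono[OF 1 \<alpha>(3)])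
    finally show ?thesis by simp
  qed
  have \<beta>1: "\<alpha> + \<delta> \<le> 1"
  proof (rule ccontr)
    assume "\<not> \<alpha> + \<delta> \<le> 1"
    moreover have "(\<alpha> + \<delta>) *\<^sub>R c1 \<le> 1 *\<^sub>R c1"
      using order_trans[OF \<beta> mult_left_mono[OF p1 component_nonneg[OF c1(1)]]] by simp
    ultimately show False using component_scaleR_le_cases[OF c1(1), of "\<alpha> + \<delta>" 1] c1(2) by auto
  qed
  \<comment> \<open>Two distinct thresholds strictly inside the gap are needed, since powers of
    \<phi> separate only values that differ by a definite amount.\<close>
  define \<gamma>0 \<gamma>1 where "\<gamma>0 = \<alpha> + \<delta> / 3" and "\<gamma>1 = \<alpha> + 2 * \<delta> / 3"
  have \<gamma>: "\<alpha> < \<gamma>0" "0 < \<gamma>0" "\<gamma>0 < \<gamma>1" "\<gamma>1 < \<alpha> + \<delta>" "\<gamma>1 < 1" using \<alpha>(1) \<delta> \<beta>1 by (auto simp: \<gamma>0_def \<gamma>1_def)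
  have ex1: "\<exists>g1\<in>W. \<exists>c2 \<epsilon>1 t1. component c2 \<and> c2 \<noteq> 0 \<and> c2 * c1 = c2 \<and> c2 * ?q = c2 \<and> 0 < \<epsilon>1 \<and>
    c2 * p (\<lambda>s. Q g1 s - t1 *\<^sub>R pprt (\<phi> s - \<gamma>1 *\<^sub>R 1)) \<le> (1 - \<epsilon>1) *\<^sub>R c2"
    by (rule restrict[of \<phi> c1 \<alpha> \<gamma>1 "\<alpha> + \<delta>"]) (use \<gamma> \<alpha> \<beta> \<phi> c1 in \<open>auto simp: a_def\<close>)
  then obtain g1 c2 \<epsilon>1 t1 where g1: "g1 \<in> W" and c2: "component c2" "c2 \<noteq> 0" "c2 * c1 = c2" "c2 * ?q = c2" "0 < \<epsilon>1"
    and le1: "c2 * p (\<lambda>s. Q g1 s - t1 *\<^sub>R pprt (\<phi> s - \<gamma>1 *\<^sub>R 1)) \<le> (1 - \<epsilon>1) *\<^sub>R c2" by auto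
  have \<phi>': "(\<lambda>s. 1 - \<phi> s) \<in> orth_functions" by (intro Cuo_diff Cuo_const \<phi>)
  have pm: "p (\<lambda>s. 1 - \<phi> s) = 1 - a"
    using sup_functional_add_const[OF p Cuo_minus[OF \<phi>(1)], of 1] by (simp add: a_def add.commute)
  have pm': "p (\<lambda>s. - (1 - \<phi> s)) = p \<phi> - 1"
    using sup_functional_add_const[OF p \<phi>(1), of "- 1"] by simp
  have low2: "c2 * - p (\<lambda>s. - (1 - \<phi> s)) \<le> (1 - (\<alpha> + \<delta>)) *\<^sub>R c2"
  proof -
    have "c2 * ((\<alpha> + \<delta>) *\<^sub>R c1) \<le> c2 * (c1 * p \<phi>)" by (rule mult_left_mono[OF \<beta> component_nonneg[OF c2(1)]])
    then have "(\<alpha> + \<delta>) *\<^sub>R c2 \<le> c2 * p \<phi>" by (simp only: mult_scaleR_right mult.assoc[symmetric] c2(3))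
    then show ?thesis unfolding pm' by (simp add: right_diff_distrib scaleR_diff_left)
  qed
  have high2: "(1 - \<alpha>) *\<^sub>R c2 \<le> c2 * p (\<lambda>s. 1 - \<phi> s)"
  proof -
    have "c2 * (c1 * a) \<le> c2 * (\<alpha> *\<^sub>R c1)" by (rule mult_left_mono[OF \<alpha>(2) component_nonneg[OF c2(1)]])
    then have "c2 * a \<le> \<alpha> *\<^sub>R c2" by (simp only: mult_scaleR_right mult.assoc[symmetric] c2(3))
    then show ?thesis unfolding pm by (simp add: right_diff_distrib scaleR_diff_left)
  qed
  \<comment> \<open>Passing to \<open>1 - \<phi>\<close> exchanges supremum and infimum. The search
    starts from \<open>c2\<close>, so on \<open>c3\<close> both improvements hold.\<close>
  have ex2: "\<exists>g2\<in>W. \<exists>c3 \<epsilon>2 t2. component c3 \<and> c3 \<noteq> 0 \<and> c3 * c2 = c3 \<and> c3 * ?q = c3 \<and> 0 < \<epsilon>2 \<and>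
    c3 * p (\<lambda>s. Q g2 s - t2 *\<^sub>R pprt ((1 - \<phi> s) - (1 - \<gamma>0) *\<^sub>R 1)) \<le> (1 - \<epsilon>2) *\<^sub>R c3"
    by (rule restrict[OF \<phi>' _ c2(1,2) _ _ low2 high2]) (use \<gamma> \<phi>(3) in auto)
  then obtain g2 c3 \<epsilon>2 t2 where g2: "g2 \<in> W" and c3: "component c3" "c3 \<noteq> 0" "c3 * c2 = c3" "c3 * ?q = c3" "0 < \<epsilon>2"
    and le2': "c3 * p (\<lambda>s. Q g2 s - t2 *\<^sub>R pprt ((1 - \<phi> s) - (1 - \<gamma>0) *\<^sub>R 1)) \<le> (1 - \<epsilon>2) *\<^sub>R c3" by auto
  have eq2: "(\<lambda>s. (1 - \<phi> s) - (1 - \<gamma>0) *\<^sub>R 1) = (\<lambda>s. \<gamma>0 *\<^sub>R 1 - \<phi> s)" by (simp add: scaleR_diff_left algebra_simps)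
  have le2: "c3 * p (\<lambda>s. Q g2 s - t2 *\<^sub>R pprt (\<gamma>0 *\<^sub>R 1 - \<phi> s)) \<le> (1 - \<epsilon>2) *\<^sub>R c3"
    using le2' by (simp only: fun_cong[OF eq2])
  obtain e where e: "0 \<le> e" "\<And>s. N (f s) \<le> e" using Cuo_bounded[OF f] by auto
  obtain e1 where e1: "0 \<le> e1" "\<And>s. N (g1 s) \<le> e1" using Cuo_bounded[OF W[OF g1]] by auto
  obtain e2 where e2: "0 \<le> e2" "\<And>s. N (g2 s) \<le> e2" using Cuo_bounded[OF W[OF g2]] by auto
  let ?x = "e + e1 + e2"
  have x1: "N (f s - g1 s) \<le> ?x" and x2: "N (f s - g2 s) \<le> ?x" for s
  proof -
    have "N (f s - g1 s) \<le> e + e1" by (rule order_trans[OF lnorm_triangle_diff add_mono[OF e(2) e1(2)]])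
    also have "\<dots> \<le> ?x" using e2(1) by simp
    finally show "N (f s - g1 s) \<le> ?x" .
    have "N (f s - g2 s) \<le> e + e2" by (rule order_trans[OF lnorm_triangle_diff add_mono[OF e(2) e2(2)]])
    also have "\<dots> \<le> ?x" using e1(1) by simp
    finally show "N (f s - g2 s) \<le> ?x" .
  qed
  \<comment> \<open>Both distances become bounded by a real multiple of \<open>d\<close>, so the
    error caused by a small weight can be measured in units of \<open>d\<close>.\<close>
  obtain c4 K where c4: "component c4" "c4 \<noteq> 0" "c4 * c3 = c4" and K: "0 < K" "orth_app c4 ?x \<le> K *\<^sub>R orth_app c4 d"
    by (rule component_localize_bound[OF d c3(1,2,4), of ?x])
  have xK: "orth_app c4 (N (f s - g1 s)) \<le> K *\<^sub>R orth_app c4 d" "orth_app c4 (N (f s - g2 s)) \<le> K *\<^sub>R orth_app c4 d" for s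
    using order_trans[OF orth_app_mono[OF component_nonneg[OF c4(1)]] K(2)] x1 x2 by auto
  have c4q: "c4 * ?q = c4"
  proof -
    have "c4 * ?q = c4 * (c3 * ?q)" by (simp only: mult.assoc[symmetric] c4(3))
    then show ?thesis by (simp only: c3(4) c4(3))
  qed
  define \<epsilon> where "\<epsilon> = min \<epsilon>1 \<epsilon>2"
  have \<epsilon>: "0 < \<epsilon>" "\<epsilon> \<le> \<epsilon>1" "\<epsilon> \<le> \<epsilon>2" using c2(5) c3(5) by (auto simp: \<epsilon>_def)
  \<comment> \<open>The blend then costs \<open>\<eta> * K\<close>, which is half of the gain
    \<epsilon>.\<close>
  define \<eta> where "\<eta> = \<epsilon> / (2 * K)"
  have \<eta>: "0 < \<eta>" "\<eta> * K = \<epsilon> / 2" using \<epsilon> K by (simp_all add: \<eta>_def)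
  obtain m k :: nat where mk: "real k * \<gamma>0 ^ m \<le> \<eta>" "(1 - \<gamma>1 ^ m) ^ k \<le> \<eta>"
    by (rule threshold_powers[OF \<gamma>(2,3,5) \<eta>(1)])
  let ?\<psi> = "\<lambda>s. (1 - \<phi> s ^ m) ^ k"
  have \<psi>M: "?\<psi> \<in> convex_multipliers W"
    by (rule convex_multipliers_power[OF convex_multipliers_compl[OF convex_multipliers_power[OF \<phi>M]]])
  then have \<psi>01: "0 \<le> ?\<psi> s" "0 \<le> 1 - ?\<psi> s" for s by (auto simp: convex_multipliers_def)
  have "\<exists>g\<in>W. \<forall>s. g s = act (?\<psi> s) (g1 s) + act (1 - ?\<psi> s) (g2 s)"
    using \<psi>M g1 g2 unfolding convex_multipliers_def by blast
  then obtain g where g: "g \<in> W" "\<And>s. g s = act (?\<psi> s) (g1 s) + act (1 - ?\<psi> s) (g2 s)" by auto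
  have y: "N (f s - g s) \<le> orth_app (?\<psi> s) (N (f s - g1 s)) + orth_app (1 - ?\<psi> s) (N (f s - g2 s))" for s
  proof -
    have "act (?\<psi> s) (f s) + act (1 - ?\<psi> s) (f s) = f s"
      by (simp add: act_diff_left act_one)
    then have "f s - g s = act (?\<psi> s) (f s - g1 s) + act (1 - ?\<psi> s) (f s - g2 s)"
      unfolding act_diff_right g(2) by (simp add: algebra_simps)
    then have "N (f s - g s) \<le> N (act (?\<psi> s) (f s - g1 s)) + N (act (1 - ?\<psi> s) (f s - g2 s))"
      by (simp only: lnorm_triangle)
    then show ?thesis by (simp only: norm_act abs_of_nonneg[OF \<psi>01(1)] abs_of_nonneg[OF \<psi>01(2)])
  qed
  let ?u1 = "\<lambda>s. Q g1 s - t1 *\<^sub>R pprt (\<phi> s - \<gamma>1 *\<^sub>R 1)" and ?u2 = "\<lambda>s. Q g2 s - t2 *\<^sub>R pprt (\<gamma>0 *\<^sub>R 1 - \<phi> s)"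
  have u1: "?u1 \<in> orth_functions" by (intro Cuo_diff QV g1 Cuo_scaleR Cuo_pprt \<phi> Cuo_const)
  have u2: "?u2 \<in> orth_functions" by (intro Cuo_diff QV g2 Cuo_scaleR Cuo_pprt \<phi> Cuo_const)
  have su: "(\<lambda>s. sup (?u1 s) (?u2 s)) \<in> orth_functions" by (rule Cuo_sup[OF u1 u2])
  have "c4 * Q g s \<le> c4 * (sup (?u1 s) (?u2 s) + (\<eta> * K) *\<^sub>R 1)" for s
    by (rule blend_estimate[OF d c4(1) c4q \<phi>(2,3) lnorm_nonneg lnorm_nonneg xK refl y Qd(1) Qd(1) Qd(1) _ \<gamma>(3) _ _ _ mk])
      (use \<gamma> K \<eta> in auto)
  then have "c4 * p (Q g) \<le> c4 * p (\<lambda>s. sup (?u1 s) (?u2 s) + (\<eta> * K) *\<^sub>R 1)"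
    by (intro sup_functional_component_mono[OF p c4(1)] QV g(1) Cuo_add su Cuo_const)
  also have "\<dots> = sup (c4 * p ?u1) (c4 * p ?u2) + (\<epsilon> / 2) *\<^sub>R c4"
    unfolding sup_functional_add_const[OF p su] sup_functional_sup[OF p u1 u2]
    by (simp add: distrib_left component_sup[OF c4(1)] \<eta>(2))
  also have "\<dots> \<le> (1 - \<epsilon>) *\<^sub>R c4 + (\<epsilon> / 2) *\<^sub>R c4"
  proof (rule add_right_mono, rule sup_least)
    have c42: "c4 * c2 = c4"
    proof -
      have "c4 * c2 = c4 * (c3 * c2)" by (simp only: mult.assoc[symmetric] c4(3))
      then show ?thesis by (simp only: c3(3) c4(3))
    qed
    have "c4 * (c2 * p ?u1) \<le> c4 * ((1 - \<epsilon>1) *\<^sub>R c2)" by (rule mult_left_mono[OF le1 component_nonneg[OF c4(1)]])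
    then have "c4 * p ?u1 \<le> (1 - \<epsilon>1) *\<^sub>R c4" by (simp only: mult_scaleR_right mult.assoc[symmetric] c42)
    also have "\<dots> \<le> (1 - \<epsilon>) *\<^sub>R c4" using \<epsilon> by (intro scaleR_right_mono component_nonneg c4) simp
    finally show "c4 * p ?u1 \<le> (1 - \<epsilon>) *\<^sub>R c4" .
    have "c4 * (c3 * p ?u2) \<le> c4 * ((1 - \<epsilon>2) *\<^sub>R c3)" by (rule mult_left_mono[OF le2 component_nonneg[OF c4(1)]])
    then have "c4 * p ?u2 \<le> (1 - \<epsilon>2) *\<^sub>R c4" by (simp only: mult_scaleR_right mult.assoc[symmetric] c4(3))
    also have "\<dots> \<le> (1 - \<epsilon>) *\<^sub>R c4" using \<epsilon> by (intro scaleR_right_mono component_nonneg c4) simp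
    finally show "c4 * p ?u2 \<le> (1 - \<epsilon>) *\<^sub>R c4" .
  qed
  also have "\<dots> = (1 - \<epsilon> / 2) *\<^sub>R c4" by (simp add: scaleR_add_left[symmetric])
  finally have "c4 * p (Q g) \<le> (1 - \<epsilon> / 2) *\<^sub>R c4" .
  moreover have "1 *\<^sub>R c4 \<le> c4 * p (Q g)"
    using mult_left_mono[OF pq[OF g(1)] component_nonneg[OF c4(1)]] by (simp add: c4q)
  ultimately have "1 *\<^sub>R c4 \<le> (1 - \<epsilon> / 2) *\<^sub>R c4" by (rule order_trans[rotated])
  then have "c4 = 0" by (rule component_scaleR_le_cases[OF c4(1)]) (use \<epsilon> in simp)
  then show False using c4(2) by contradiction
qed

text \<open>The direction from values at states to functions. Infima are expressed through lower
  bounds: \<open>d\<close> is any positive element below all distances.\<close>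

lemma state_approximation_imp_approximation:
  fixes W :: "('s::{uniform_space, t2_space} \<Rightarrow> 'y) set"
  assumes cpt: "compact (UNIV :: 's set)" and W: "W \<subseteq> Cuo N" "W \<noteq> {}" and f: "f \<in> Cuo N"
    and sep: "separates_states (convex_multipliers W)"
    and approx: "\<And>\<sigma> z. \<sigma> \<in> extremal_states \<Longrightarrow>
      (\<And>g. g \<in> W \<Longrightarrow> z \<le> N (state_value N f \<sigma> - state_value N g \<sigma>)) \<Longrightarrow> z \<le> 0"
    and d: "0 \<le> d" "\<And>g. g \<in> W \<Longrightarrow> d \<le> Cuo_norm N (\<lambda>s. f s - g s)"
  shows "d = 0"
proof -
  let ?q = "principal_projection d"
  have q: "component ?q" by (rule component_principal_projection[OF d(1)])
  define Q where "Q = (\<lambda>g s. truncated_quotient d (N (f s - g s)))"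
  have WV: "g \<in> Cuo N" if "g \<in> W" for g using W that by blast
  have QV: "Q g \<in> orth_functions" if g: "g \<in> W" for g
    unfolding Q_def
  proof (rule truncated_quotient_Cuo[OF d(1) lnorm_nonneg])
    show "order_tendsto (\<lambda>p. (case p of (s, t) \<Rightarrow> N (f s - f t)) + (case p of (s, t) \<Rightarrow> N (g s - g t))) 0 uniformity"
      by (intro order_null_add Cuo_modulus f WV g)
    fix s t
    have "\<bar>N (f s - g s) - N (f t - g t)\<bar> \<le> N ((f s - g s) - (f t - g t))" by (rule lnorm_abs_diff)
    also have "(f s - g s) - (f t - g t) = (f s - f t) - (g s - g t)" by simp
    also have "N \<dots> \<le> N (f s - f t) + N (g s - g t)" by (rule lnorm_triangle_diff)
    finally show "\<bar>N (f s - g s) - N (f t - g t)\<bar> \<le>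
      (case (s, t) of (s, t) \<Rightarrow> N (f s - f t)) + (case (s, t) of (s, t) \<Rightarrow> N (g s - g t))" by simp
  qed
  have Qd: "orth_app (Q g s) d = inf (N (f s - g s)) d" "0 \<le> Q g s" "Q g s \<le> ?q" for g s
    unfolding Q_def using truncated_quotient[OF d(1) lnorm_nonneg] by auto
  let ?e = "\<lambda>\<phi>\<in>orth_functions. SUP s. \<phi> s"
  \<comment> \<open>The supremum over all of \<open>S\<close> meets the constraints: the quotients
    reach the projection because the norms reach \<open>d\<close>.\<close>
  have top: "?q \<le> ?e D" if D: "D \<in> Q ` W" for D
  proof -
    obtain g where g: "g \<in> W" "D = Q g" using D by blast
    let ?m = "SUP s. Q g s"
    have up: "Q g s \<le> ?m" for s by (rule cSUP_upper) (auto intro!: bdd_aboveI[of _ ?q] Qd)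
    have mq: "?m \<le> ?q" by (rule cSUP_least) (auto intro: Qd)
    have m0: "0 \<le> ?m" by (rule order_trans[OF Qd(2) up])
    obtain e where e: "\<And>s. N (f s) \<le> e" using Cuo_bounded[OF f] by blast
    obtain e' where e': "\<And>s. N (g s) \<le> e'" using Cuo_bounded[OF WV[OF g(1)]] by blast
    have bdd: "bdd_above (range (\<lambda>s. N (f s - g s)))"
      by (rule bdd_aboveI[of _ "e + e'"]) (auto intro: order_trans[OF lnorm_triangle_diff add_mono[OF e e']])
    have "inf (Cuo_norm N (\<lambda>s. f s - g s)) d \<le> orth_app ?m d"
    proof (rule vl_inf_Sup_le)
      show "inf (N (f s - g s)) d \<le> orth_app ?m d" for s
        unfolding Qd(1)[symmetric] by (rule orth_app_mono_left[OF up d(1)])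
      show "N (f s - g s) \<le> Cuo_norm N (\<lambda>s. f s - g s)" for s
        unfolding Cuo_norm_def by (rule cSUP_upper[OF _ bdd]) simp
      show "Cuo_norm N (\<lambda>s. f s - g s) \<le> z" if "\<And>s. N (f s - g s) \<le> z" for z
        unfolding Cuo_norm_def by (rule cSUP_least) (auto intro: that)
    qed
    then have "orth_app ?q d \<le> orth_app ?m d"
      using d(2)[OF g(1)] by (simp add: inf_absorb2 principal_projection_self[OF d(1)])
    then have "?q * ?q \<le> ?q * ?m" by (rule orth_le_principalI[OF d(1)])
    then have "?q \<le> ?m" by (simp add: component_idem[OF q] orth_le_principal[OF m0 mq q])
    then show ?thesis using QV[OF g(1)] g(2) by simp
  qed
  obtain p where p: "sup_functional p" "\<And>D. D \<in> Q ` W \<Longrightarrow> ?q \<le> p D"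
    and min: "\<And>r. sup_functional r \<Longrightarrow> (\<And>\<phi>. \<phi> \<in> orth_functions \<Longrightarrow> r \<phi> \<le> p \<phi>) \<Longrightarrow> (\<And>D. D \<in> Q ` W \<Longrightarrow> ?q \<le> r D) \<Longrightarrow> r = p"
    by (rule sup_functional_minimal[OF sup_functional_SUP _ top]) (use QV in auto)
  \<comment> \<open>The value of a state lies between infimum and supremum, which agree for
    multipliers.\<close>
  have const: "\<sigma> \<phi> = p \<phi>" if \<sigma>: "\<sigma> \<in> extremal_states" "\<And>\<phi>. \<phi> \<in> orth_functions \<Longrightarrow> \<sigma> \<phi> \<le> p \<phi>"
    and \<phi>: "\<phi> \<in> convex_multipliers W" for \<sigma> \<phi>
  proof -
    have eps: "\<sigma> \<in> eps_subdifferential" using \<sigma>(1) by (simp add: extremal_states_def)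
    have V: "\<phi> \<in> orth_functions" using \<phi> by (simp add: convex_multipliers_def)
    have minQ: "r = p" if r: "sup_functional r" "\<And>\<phi>. \<phi> \<in> orth_functions \<Longrightarrow> r \<phi> \<le> p \<phi>" "\<And>g. g \<in> W \<Longrightarrow> ?q \<le> r (Q g)" for r
      by (rule min[OF r(1,2)]) (use r(3) in auto)
    have "p \<phi> + p (\<lambda>s. - \<phi> s) \<le> 0"
      by (rule multiplier_constant_on_minimal[OF d(1) WV f p(1) Q_def QV p(2)[OF imageI] minQ \<phi>])
    moreover have "- \<sigma> \<phi> \<le> p (\<lambda>s. - \<phi> s)" using \<sigma>(2)[OF Cuo_minus[OF V]] state_minus[OF eps V] by simp
    ultimately have "p \<phi> + - \<sigma> \<phi> \<le> 0" by (meson add_left_mono order_trans)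
    then have "p \<phi> \<le> \<sigma> \<phi>" by simp
    then show ?thesis using \<sigma>(2)[OF V] by (simp add: antisym)
  qed
  have unique: "\<sigma> \<phi> = \<tau> \<phi>" if \<sigma>: "\<sigma> \<in> extremal_states" "\<And>\<phi>. \<phi> \<in> orth_functions \<Longrightarrow> \<sigma> \<phi> \<le> p \<phi>"
    and \<tau>: "\<tau> \<in> extremal_states" "\<And>\<phi>. \<phi> \<in> orth_functions \<Longrightarrow> \<tau> \<phi> \<le> p \<phi>" and \<phi>: "\<phi> \<in> orth_functions" for \<sigma> \<tau> \<phi>
  proof -
    have "band_projection (1 :: 'e orth)" by (simp add: band_projection_iff component_1)
    moreover have "\<forall>\<phi>\<in>convex_multipliers W. 1 * \<sigma> \<phi> = 1 * \<tau> \<phi>" using const[OF \<sigma>] const[OF \<tau>] by simp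
    ultimately have "1 * \<sigma> \<phi> = 1 * \<tau> \<phi>" using sep \<sigma>(1) \<tau>(1) \<phi> unfolding separates_states_def by blast
    then show ?thesis by simp
  qed
  obtain \<sigma> where \<sigma>: "\<sigma> \<in> extremal_states" "\<And>\<phi>. \<phi> \<in> orth_functions \<Longrightarrow> \<sigma> \<phi> \<le> p \<phi>"
    using extremal_state_below[OF p(1) Cuo_const] by metis
  have "d \<le> 0"
  proof (rule approx[OF \<sigma>(1)])
    fix g assume g: "g \<in> W"
    \<comment> \<open>A state that attains the supremum of \<open>Q g\<close> exists for each
      \<open>g\<close>; since all states below \<open>p\<close> coincide, \<sigma> attains it for
      every \<open>g\<close> at once.\<close>
    obtain \<tau> where \<tau>: "\<tau> \<in> extremal_states" "\<And>\<phi>. \<phi> \<in> orth_functions \<Longrightarrow> \<tau> \<phi> \<le> p \<phi>" "\<tau> (Q g) = p (Q g)"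
      using extremal_state_below[OF p(1) QV[OF g]] by metis
    have "?q \<le> \<sigma> (Q g)" using p(2)[of "Q g"] g unique[OF \<sigma> \<tau>(1,2) QV[OF g]] \<tau>(3) by simp
    from orth_app_mono_left[OF this d(1)]
    have "d \<le> orth_app (\<sigma> (Q g)) d" by (simp add: principal_projection_self[OF d(1)])
    also have "\<dots> \<le> N (state_value N f \<sigma> - state_value N g \<sigma>)"
      by (rule norm_state_value_diff_ge[OF cpt f WV[OF g] \<sigma>(1) QV[OF g] d(1)]) (simp add: Qd)
    finally show "d \<le> N (state_value N f \<sigma> - state_value N g \<sigma>)" .
  qed
  then show ?thesis using d(1) by (rule antisym)
qed

end

section \<open>Transfer along the embedding into the norm completion\<close>

theorem theorem3p8:
  fixes scX :: "'k::real_normed_field \<Rightarrow> 'x::ab_group_add \<Rightarrow> 'x"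
    and NX :: "'x \<Rightarrow> 'e::dedekind_complete_vector_lattice"
    and scY :: "'k \<Rightarrow> 'y::ab_group_add \<Rightarrow> 'y"
    and NY :: "'y \<Rightarrow> 'e"
    and \<iota> :: "'x \<Rightarrow> 'y"
    and W :: "('s::{uniform_space, t2_space} \<Rightarrow> 'x) set"
  assumes "compact (UNIV :: 's set)"
    and "lattice_normed_space scX NX"
    and "norm_completion scX NX scY NY \<iota>"
    and "W \<subseteq> Cuo NX" and "W \<noteq> {}"
    and "separates_states (multipliers NY \<iota> W)"
  shows "\<forall>f\<in>Cuo NX.
    (INF g\<in>W. Cuo_norm NX (\<lambda>s. f s - g s)) = 0 \<longleftrightarrow>
    (\<forall>\<sigma>\<in>extremal_states.
      (INF x\<in>{state_value NY (\<iota> \<circ> g) \<sigma> | g. g \<in> W}. NY (state_value NY (\<iota> \<circ> f) \<sigma> - x)) = 0)"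
proof
  fix f :: "'s \<Rightarrow> 'x" assume f: "f \<in> Cuo NX"
  interpret X: lattice_normed_space scX NX by (rule assms(2))
  have BK: "Banach_Kantorovich_space scY NY" using assms(3) by (simp add: norm_completion_def)
  interpret Y: bk_space scY NY
    using BK unfolding Banach_Kantorovich_space_def bk_space_def bk_space_axioms_def by blast
  have \<iota>: "Vector_Spaces.linear scX scY \<iota>" and iso: "NY (\<iota> x) = NX x" for x
    using assms(3) by (auto simp: norm_completion_def)
  have \<iota>diff: "\<iota> (x - y) = \<iota> x - \<iota> y" for x y
  proof -
    interpret L: Vector_Spaces.linear scX scY \<iota> by (rule \<iota>)
    show ?thesis by (rule L.diff)
  qed
  have isodiff: "NY (\<iota> x - \<iota> y) = NX (x - y)" for x y by (simp add: \<iota>diff[symmetric] iso)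
  have lift: "\<iota> \<circ> g \<in> Cuo NY" if "g \<in> Cuo NX" for g :: "'s \<Rightarrow> 'x"
    using that unfolding Y.Cuo_iff X.Cuo_iff by (simp add: iso isodiff)
  have nrm: "Cuo_norm NX (\<lambda>s. f s - g s) = Cuo_norm NY (\<lambda>s. (\<iota> \<circ> f) s - (\<iota> \<circ> g) s)" for g :: "'s \<Rightarrow> 'x"
    by (simp add: Cuo_norm_def isodiff)
  have bound: "0 \<le> Cuo_norm NX (\<lambda>s. f s - g s) \<and> (\<forall>s. NX (f s - g s) \<le> Cuo_norm NX (\<lambda>s. f s - g s))"
    if g: "g \<in> W" for g
  proof -
    have gC: "g \<in> Cuo NX" using g assms(4) by blast
    obtain e where e: "\<And>s. NX (f s) \<le> e" using X.Cuo_bounded[OF f] by blast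
    obtain e' where e': "\<And>s. NX (g s) \<le> e'" using X.Cuo_bounded[OF gC] by blast
    have bdd: "bdd_above (range (\<lambda>s. NX (f s - g s)))"
      by (rule bdd_aboveI[of _ "e + e'"]) (auto intro: order_trans[OF X.lnorm_triangle_diff add_mono[OF e e']])
    have up: "NX (f s - g s) \<le> Cuo_norm NX (\<lambda>s. f s - g s)" for s
      unfolding Cuo_norm_def by (rule cSUP_upper[OF _ bdd]) simp
    then show ?thesis using order_trans[OF X.lnorm_nonneg up] by blast
  qed
  \<comment> \<open>The module action is computed in the completion on both sides, so composing with
    the embedding changes nothing.\<close>
  have M: "Y.convex_multipliers ((\<lambda>g. \<iota> \<circ> g) ` W) = multipliers NY \<iota> W"
    unfolding Y.convex_multipliers_def multipliers_def by simp
  let ?n = "\<lambda>g. Cuo_norm NX (\<lambda>s. f s - g s)"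
  let ?v = "\<lambda>\<sigma> g. state_value NY (\<iota> \<circ> g) \<sigma>"
  let ?V = "\<lambda>\<sigma>. {?v \<sigma> g | g. g \<in> W}"
  have bddn: "bdd_below (?n ` W)" by (rule bdd_belowI2[of _ 0]) (use bound in blast)
  have bddv: "bdd_below ((\<lambda>x. NY (?v \<sigma> f - x)) ` ?V \<sigma>)" for \<sigma> by (rule bdd_belowI2[of _ 0]) (rule Y.lnorm_nonneg)
  have neV: "?V \<sigma> \<noteq> {}" for \<sigma> using assms(5) by blast
  show "(INF g\<in>W. ?n g) = 0 \<longleftrightarrow> (\<forall>\<sigma>\<in>extremal_states. (INF x\<in>?V \<sigma>. NY (?v \<sigma> f - x)) = 0)"
  proof
    assume inf: "(INF g\<in>W. ?n g) = 0"
    show "\<forall>\<sigma>\<in>extremal_states. (INF x\<in>?V \<sigma>. NY (?v \<sigma> f - x)) = 0"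
    proof
      fix \<sigma> :: "('s, 'e) state" assume \<sigma>: "\<sigma> \<in> extremal_states"
      let ?i = "INF x\<in>?V \<sigma>. NY (?v \<sigma> f - x)"
      have "?i \<le> (INF g\<in>W. ?n g)"
      proof (rule cINF_greatest[OF assms(5)])
        fix g assume g: "g \<in> W"
        have gC: "g \<in> Cuo NX" using g assms(4) by blast
        have "?i \<le> NY (?v \<sigma> f - ?v \<sigma> g)" by (rule cINF_lower[OF bddv]) (use g in blast)
        also have "\<dots> \<le> ?n g"
          by (rule Y.norm_state_value_diff_le[OF assms(1) lift[OF f] lift[OF gC] \<sigma>])
            (use bound[OF g] in \<open>simp add: isodiff\<close>)
        finally show "?i \<le> ?n g" .
      qed
      moreover have "0 \<le> ?i" by (rule cINF_greatest[OF neV Y.lnorm_nonneg])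
      ultimately show "?i = 0" using inf by (intro antisym) auto
    qed
  next
    assume inf: "\<forall>\<sigma>\<in>extremal_states. (INF x\<in>?V \<sigma>. NY (?v \<sigma> f - x)) = 0"
    let ?d = "INF g\<in>W. ?n g"
    show "?d = 0"
    proof (rule Y.state_approximation_imp_approximation[OF assms(1) _ _ lift[OF f], of "(\<lambda>g. \<iota> \<circ> g) ` W"])
      show "(\<lambda>g. \<iota> \<circ> g) ` W \<subseteq> Cuo NY" using lift assms(4) by blast
      show "(\<lambda>g. \<iota> \<circ> g) ` W \<noteq> {}" using assms(5) by simp
      show "separates_states (Y.convex_multipliers ((\<lambda>g. \<iota> \<circ> g) ` W))" unfolding M by (rule assms(6))
      show "0 \<le> ?d" by (rule cINF_greatest[OF assms(5)]) (use bound in blast)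
      show "?d \<le> Cuo_norm NY (\<lambda>s. (\<iota> \<circ> f) s - g s)" if "g \<in> (\<lambda>g. \<iota> \<circ> g) ` W" for g
      proof -
        have "\<exists>g'\<in>W. g = \<iota> \<circ> g'" using that by blast
        then obtain g' where g': "g' \<in> W" "g = \<iota> \<circ> g'" by (elim bexE)
        show ?thesis unfolding g'(2) nrm[symmetric] by (rule cINF_lower[OF bddn g'(1)])
      qed
      fix \<sigma> :: "('s, 'e) state" and z
      assume \<sigma>: "\<sigma> \<in> extremal_states"
        and z: "\<And>g. g \<in> (\<lambda>g. \<iota> \<circ> g) ` W \<Longrightarrow> z \<le> NY (state_value NY (\<iota> \<circ> f) \<sigma> - state_value NY g \<sigma>)"
      have "z \<le> (INF x\<in>?V \<sigma>. NY (?v \<sigma> f - x))" by (rule cINF_greatest[OF neV]) (use z in blast)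
      then show "z \<le> 0" using inf \<sigma> by simp
    qed
  qed
qed

end
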